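(* Let $n\geq 1$. The functors $\Phi:\mathcal A\to\mathrm{Rep}(\mathbf G)$ and $\Psi:\mathrm{Rep}(\mathbf G)\to\mathcal A$ give an equivalence of tensor categories $\mathcal A\cong\mathrm{Rep}(\mathbf G)$.
   Context: $\mathrm{Vec}$ is the category of finite dimensional complex vector spaces; a tensor category is a $\mathbf C$-linear symmetric monoidal category. **The category $\mathcal A$.** $\mathrm{Flag}_n$ is the category of finite dimensional complex vector spaces $V$ with a flag $0=V_0\subset V_1\subset\cdots\subset V_n=V$ (inclusions need not be strict), with linear maps $f$ satisfying $f(V_i)\subset W_i$ as morphisms. A functor $\mathrm{Flag}_n\to\mathrm{Vec}$ is polynomial if it is a subquotient of a finite direct sum of functors $F_a:\{V_i\}\mapsto V^{\otimes a}$, $a\ge0$. $\mathcal A$ is the category of polynomial functors with natural transformations, with tensor product defined on values. For $\underline a\in\mathbf N^n$ put $|\underline a|=a_1+\cdots+a_n$ and let $\mathbf C^{\underline a}$ be the flag $0\subset\mathbf C^{a_1}\subset\mathbf C^{a_1+a_2}\subset\cdots\subset\mathbf C^{|\underline a|}$; every object of $\mathrm{Flag}_n$ is isomorphic to a unique $\mathbf C^{\underline a}$. **The category $\mathrm{Rep}(\mathbf G)$.** Let $\mathbf{GL}=\bigcup_{i\ge1}\mathrm{GL}_i(\mathbf C)$, $\mathrm{End}(\mathbf C^\infty)=\bigcup_{i\ge1}\mathrm{End}(\mathbf C^i)$. Let $\mathbf V$ be a vector space of countably infinite dimension with a flag $0=\mathbf V_0\subset\cdots\subset\mathbf V_n=\mathbf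 V$ with infinite dimensional graded pieces; choose a basis $\{e_{i,j}\}_{1\le i\le n,\,j\ge1}$ of $\mathbf V$ with $\mathbf V_i$ spanned by the $e_{k,j}$, $k\le i$. $\mathbf G$ is the group of invertible $n\times n$ block upper triangular matrices (acting on $\mathbf V$) whose blocks are in $\mathrm{End}(\mathbf C^\infty)$ above the diagonal and in $\mathbf{GL}$ on the diagonal. A representation of $\mathbf G$ is polynomial if it is a subquotient of a finite direct sum of tensor powers of $\mathbf V$; $\mathrm{Rep}(\mathbf G)$ is the category of these, with tensor product over $\mathbf C$. Let $\mathrm{End}(\mathbf V)$ be the monoid of linear maps $f:\mathbf V\to\mathbf V$ with $f(\mathbf V_i)\subset\mathbf V_i$; it acts naturally on every polynomial representation of $\mathbf G$ (extending the action of $\mathbf G$), and maps in $\mathrm{Rep}(\mathbf G)$ are $\mathrm{End}(\mathbf V)$-equivariant. $\mathbf C^{\underline a}$ is identified with the span of the $e_{i,j}$ with $j\le a_i$. **Subgroups.** $H_{\underline a}\subset\mathbf G$ is the subgroup of block diagonal matrices whose $(i,i)$ block has the form $\begin{pmatrix}1&0\\0&*\end{pmatrix}$ with top left block the $a_i\times a_i$ identity. $G_{\underline a}\subset\mathbf G$ is the subgroup of matrices whose $(i,i)$ block has the form $\begin{pmatrix}*&0\\0&1\end{pmatrix}$ with top left block of size $a_i\times a_i$, and whose $(i,j)$ block for $i<j$ has the form $\begin{pmatrix}*&0\\0&0\end{pmatrix}$ with top left block of size $a_i\times a_j$; it is identified with the automorphism group of $\mathbf C^{\underline a}$ in $\mathrm{Flag}_n$,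 and it commutes with $H_{\underline a}$. **The functors.** $\Phi(F)=\varinjlim_j F(\mathbf C^{(j^n)})$, where $(j^n)=(j,\dots,j)$ and the transition maps are induced by the inclusions $\mathbf C^{(j^n)}\to\mathbf C^{((j+1)^n)}$ given by inclusion on each graded piece; $\mathbf G$ acts via the actions of $G_{(j^n)}$ on $F(\mathbf C^{(j^n)})$. $\Psi(V)(\mathbf C^{\underline a})=V^{H_{\underline a}}$; for a morphism $f:\mathbf C^{\underline a}\to\mathbf C^{\underline b}$ in $\mathrm{Flag}_n$, choose $g_f\in\mathrm{End}(\mathbf V)$ restricting to $f$ on $\mathbf C^{\underline a}$ and such that for every $h\in H_{\underline b}$ there is $h'\in H_{\underline a}$ with $h\circ g_f=g_f\circ h'$ on $\mathbf V$; then $\Psi(V)(f):V^{H_{\underline a}}\to V^{H_{\underline b}}$ is the action of $g_f$ on $V$. *)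

theory Defs
  imports Complex_Main "HOL-Algebra.Module"
begin

text \<open>
  All vector spaces occurring as objects have their carrier inside one type \<open>'u\<close>, which is
  arbitrary except that it contains the countably infinite dimensional space \<open>V\<close> of
  the main theorem. Hence \<open>'u\<close> contains a copy of every complex vector space of countable
  dimension, and constructions determined up to unique isomorphism by a universal property
  (tensor product, unit, sequential colimit) are realised in \<open>'u\<close> by \<open>SOME\<close>.
\<close>

section \<open>Complex vector spaces\<close>

definition CC :: "complex ring" where
  "CC = \<lparr>carrier = UNIV, monoid.mult = (*), one = 1, zero = 0, add = (+)\<rparr>"

lemma field_CC: "field CC"
proof -
  have "\<exists>y. x + y = 0 \<and> y + x = 0" for x :: complex
    by (rule exI[of _ "- x"]) simp
  moreover have "\<exists>y. x * y = 1 \<and> y * x = 1" if "x \<noteq> 0" for x :: complex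
    by (rule exI[of _ "inverse x"]) (simp add: that)
  ultimately show ?thesis
    by (unfold_locales) (auto simp: CC_def Units_def algebra_simps add_eq_0_iff)
qed

type_synonym 'a vs = "(complex, 'a) module"

definition lspan :: "'a vs \<Rightarrow> 'a set \<Rightarrow> 'a set" where
  "lspan V S = \<Inter> {W. submodule W CC V \<and> S \<subseteq> W}"

definition fin_dim :: "'a vs \<Rightarrow> bool" where
  "fin_dim V \<longleftrightarrow> (\<exists>S. finite S \<and> S \<subseteq> carrier V \<and> lspan V S = carrier V)"

definition linear_on :: "'a vs \<Rightarrow> 'b vs \<Rightarrow> ('a \<Rightarrow> 'b) \<Rightarrow> bool" where
  "linear_on V W f \<longleftrightarrow> f \<in> carrier V \<rightarrow> carrier W \<and>
     (\<forall>x\<in>carrier V. \<forall>y\<in>carrier V. f (x \<oplus>\<^bsub>V\<^esub> y) = f x \<oplus>\<^bsub>W\<^esub> f y) \<and>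
     (\<forall>c. \<forall>x\<in>carrier V. f (c \<odot>\<^bsub>V\<^esub> x) = c \<odot>\<^bsub>W\<^esub> f x)"

text \<open>Linear maps are extensional, so that equality of morphisms is equality in HOL.\<close>

definition lin :: "'a vs \<Rightarrow> 'b vs \<Rightarrow> ('a \<Rightarrow> 'b) set" where
  "lin V W = {f \<in> extensional (carrier V). linear_on V W f}"

definition lin_id :: "'a vs \<Rightarrow> 'a \<Rightarrow> 'a" where
  "lin_id V = (\<lambda>x\<in>carrier V. x)"

definition lin_space :: "'a vs \<Rightarrow> 'b vs \<Rightarrow> ('a \<Rightarrow> 'b) vs" where
  "lin_space V W = \<lparr>carrier = lin V W, monoid.mult = undefined, one = undefined,
     zero = (\<lambda>x\<in>carrier V. \<zero>\<^bsub>W\<^esub>),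
     add = (\<lambda>f g. \<lambda>x\<in>carrier V. f x \<oplus>\<^bsub>W\<^esub> g x),
     module.smult = (\<lambda>c f. \<lambda>x\<in>carrier V. c \<odot>\<^bsub>W\<^esub> f x)\<rparr>"

definition bilinear_on :: "'a vs \<Rightarrow> 'b vs \<Rightarrow> 'c vs \<Rightarrow> ('a \<Rightarrow> 'b \<Rightarrow> 'c) \<Rightarrow> bool" where
  "bilinear_on V W P b \<longleftrightarrow>
     (\<forall>v\<in>carrier V. linear_on W P (b v)) \<and>
     (\<forall>w\<in>carrier W. linear_on V P (\<lambda>v. b v w))"

definition dsum :: "nat \<Rightarrow> (nat \<Rightarrow> 'a vs) \<Rightarrow> (nat \<Rightarrow> 'a) vs" where
  "dsum k U = \<lparr>carrier = (\<Pi>\<^sub>E i\<in>{..<k}. carrier (U i)), monoid.mult = undefined, one = undefined,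
     zero = (\<lambda>i\<in>{..<k}. \<zero>\<^bsub>U i\<^esub>),
     add = (\<lambda>x y. \<lambda>i\<in>{..<k}. x i \<oplus>\<^bsub>U i\<^esub> y i),
     module.smult = (\<lambda>c x. \<lambda>i\<in>{..<k}. c \<odot>\<^bsub>U i\<^esub> x i)\<rparr>"

definition dsum_map :: "nat \<Rightarrow> (nat \<Rightarrow> 'a \<Rightarrow> 'b) \<Rightarrow> (nat \<Rightarrow> 'a) \<Rightarrow> nat \<Rightarrow> 'b" where
  "dsum_map k f x = (\<lambda>i\<in>{..<k}. f i (x i))"

subsection \<open>Tensor products\<close>

definition is_tensor :: "'a vs \<Rightarrow> 'a vs \<Rightarrow> 'a vs \<Rightarrow> ('a \<Rightarrow> 'a \<Rightarrow> 'a) \<Rightarrow> bool" where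
  "is_tensor V W T b \<longleftrightarrow> module CC T \<and> bilinear_on V W T b \<and>
     (\<forall>(P::'a vs) \<beta>. module CC P \<and> bilinear_on V W P \<beta> \<longrightarrow>
        (\<exists>!h. h \<in> lin T P \<and> (\<forall>v\<in>carrier V. \<forall>w\<in>carrier W. h (b v w) = \<beta> v w)))"

definition tensor_choice :: "'a vs \<Rightarrow> 'a vs \<Rightarrow> 'a vs \<times> ('a \<Rightarrow> 'a \<Rightarrow> 'a)" where
  "tensor_choice V W = (SOME Tb. is_tensor V W (fst Tb) (snd Tb))"

definition tensor :: "'a vs \<Rightarrow> 'a vs \<Rightarrow> 'a vs" where
  "tensor V W = fst (tensor_choice V W)"

definition pure :: "'a vs \<Rightarrow> 'a vs \<Rightarrow> 'a \<Rightarrow> 'a \<Rightarrow> 'a" where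
  "pure V W = snd (tensor_choice V W)"

text \<open>The tensor unit: a copy in \<open>'a\<close> of the line \<open>\<complex>\<close>, with \<open>unit_vec\<close> the image of \<open>1\<close>.\<close>

definition unit_choice :: "'a vs \<times> 'a" where
  "unit_choice = (SOME Ku. module CC (fst Ku) \<and> snd Ku \<in> carrier (fst Ku) \<and>
     (\<forall>x\<in>carrier (fst Ku). \<exists>!c. x = c \<odot>\<^bsub>fst Ku\<^esub> snd Ku))"

definition unit_sp :: "'a vs" where
  "unit_sp = fst unit_choice"

definition unit_vec :: "'a" where
  "unit_vec = snd unit_choice"

definition tensor_map ::
  "'a vs \<Rightarrow> 'a vs \<Rightarrow> 'a vs \<Rightarrow> 'a vs \<Rightarrow> ('a \<Rightarrow> 'a) \<Rightarrow> ('a \<Rightarrow> 'a) \<Rightarrow> 'a \<Rightarrow> 'a" where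
  "tensor_map V V' W W' f g = (THE h. h \<in> lin (tensor V W) (tensor V' W') \<and>
     (\<forall>v\<in>carrier V. \<forall>w\<in>carrier W. h (pure V W v w) = pure V' W' (f v) (g w)))"

definition tensor_assoc :: "'a vs \<Rightarrow> 'a vs \<Rightarrow> 'a vs \<Rightarrow> 'a \<Rightarrow> 'a" where
  "tensor_assoc U V W = (THE h. h \<in> lin (tensor (tensor U V) W) (tensor U (tensor V W)) \<and>
     (\<forall>u\<in>carrier U. \<forall>v\<in>carrier V. \<forall>w\<in>carrier W.
        h (pure (tensor U V) W (pure U V u v) w) = pure U (tensor V W) u (pure V W v w)))"

definition tensor_lunit :: "'a vs \<Rightarrow> 'a \<Rightarrow> 'a" where
  "tensor_lunit V = (THE h. h \<in> lin (tensor unit_sp V) V \<and>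
     (\<forall>v\<in>carrier V. h (pure unit_sp V unit_vec v) = v))"

definition tensor_runit :: "'a vs \<Rightarrow> 'a \<Rightarrow> 'a" where
  "tensor_runit V = (THE h. h \<in> lin (tensor V unit_sp) V \<and>
     (\<forall>v\<in>carrier V. h (pure V unit_sp v unit_vec) = v))"

definition tensor_swap :: "'a vs \<Rightarrow> 'a vs \<Rightarrow> 'a \<Rightarrow> 'a" where
  "tensor_swap V W = (THE h. h \<in> lin (tensor V W) (tensor W V) \<and>
     (\<forall>v\<in>carrier V. \<forall>w\<in>carrier W. h (pure V W v w) = pure W V w v))"

primrec tpow :: "'a vs \<Rightarrow> nat \<Rightarrow> 'a vs" where
  "tpow V 0 = unit_sp"
| "tpow V (Suc a) = tensor (tpow V a) V"

primrec tpow_map :: "'a vs \<Rightarrow> 'a vs \<Rightarrow> nat \<Rightarrow> ('a \<Rightarrow> 'a) \<Rightarrow> 'a \<Rightarrow> 'a" where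
  "tpow_map V W 0 f = lin_id unit_sp"
| "tpow_map V W (Suc a) f = tensor_map (tpow V a) (tpow W a) V W (tpow_map V W a f) f"

subsection \<open>Sequential colimits\<close>

definition is_cocone ::
  "(nat \<Rightarrow> 'a vs) \<Rightarrow> (nat \<Rightarrow> 'a \<Rightarrow> 'a) \<Rightarrow> 'a vs \<Rightarrow> (nat \<Rightarrow> 'a \<Rightarrow> 'a) \<Rightarrow> bool" where
  "is_cocone X t P m \<longleftrightarrow> module CC P \<and>
     (\<forall>j. m j \<in> lin (X j) P \<and> (\<forall>x\<in>carrier (X j). m (Suc j) (t j x) = m j x))"

definition is_colim ::
  "(nat \<Rightarrow> 'a vs) \<Rightarrow> (nat \<Rightarrow> 'a \<Rightarrow> 'a) \<Rightarrow> 'a vs \<Rightarrow> (nat \<Rightarrow> 'a \<Rightarrow> 'a) \<Rightarrow> bool" where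
  "is_colim X t L l \<longleftrightarrow> is_cocone X t L l \<and>
     (\<forall>(P::'a vs) m. is_cocone X t P m \<longrightarrow>
        (\<exists>!h. h \<in> lin L P \<and> (\<forall>j. \<forall>x\<in>carrier (X j). h (l j x) = m j x)))"

definition colim_choice ::
  "(nat \<Rightarrow> 'a vs) \<Rightarrow> (nat \<Rightarrow> 'a \<Rightarrow> 'a) \<Rightarrow> 'a vs \<times> (nat \<Rightarrow> 'a \<Rightarrow> 'a)" where
  "colim_choice X t = (SOME Ll. is_colim X t (fst Ll) (snd Ll))"

section \<open>Categories, tensor categories and their equivalences\<close>

text \<open>Morphisms do not carry their source and target; the identities, the composition and the
  action of functors on morphisms therefore take the objects as arguments. In particular
  \<open>Cmp C X Y Z g f\<close> is the composite of \<open>f : X \<rightarrow> Y\<close> and \<open>g : Y \<rightarrow> Z\<close>.\<close>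

record ('o, 'm) category =
  Ob :: "'o set"
  Hom :: "'o \<Rightarrow> 'o \<Rightarrow> 'm set"
  Idn :: "'o \<Rightarrow> 'm"
  Cmp :: "'o \<Rightarrow> 'o \<Rightarrow> 'o \<Rightarrow> 'm \<Rightarrow> 'm \<Rightarrow> 'm"

locale category =
  fixes C :: "('o, 'm, 'z) category_scheme"
  assumes Idn_in: "X \<in> Ob C \<Longrightarrow> Idn C X \<in> Hom C X X"
    and Cmp_in: "\<lbrakk>X \<in> Ob C; Y \<in> Ob C; Z \<in> Ob C; f \<in> Hom C X Y; g \<in> Hom C Y Z\<rbrakk>
      \<Longrightarrow> Cmp C X Y Z g f \<in> Hom C X Z"
    and Idn_left: "\<lbrakk>X \<in> Ob C; Y \<in> Ob C; f \<in> Hom C X Y\<rbrakk> \<Longrightarrow> Cmp C X Y Y (Idn C Y) f = f"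
    and Idn_right: "\<lbrakk>X \<in> Ob C; Y \<in> Ob C; f \<in> Hom C X Y\<rbrakk> \<Longrightarrow> Cmp C X X Y f (Idn C X) = f"
    and Cmp_assoc: "\<lbrakk>W \<in> Ob C; X \<in> Ob C; Y \<in> Ob C; Z \<in> Ob C;
        f \<in> Hom C W X; g \<in> Hom C X Y; h \<in> Hom C Y Z\<rbrakk>
      \<Longrightarrow> Cmp C W X Z (Cmp C X Y Z h g) f = Cmp C W Y Z h (Cmp C W X Y g f)"

definition is_inverse ::
  "('o, 'm, 'z) category_scheme \<Rightarrow> 'o \<Rightarrow> 'o \<Rightarrow> 'm \<Rightarrow> 'm \<Rightarrow> bool" where
  "is_inverse C X Y f g \<longleftrightarrow> f \<in> Hom C X Y \<and> g \<in> Hom C Y X \<and>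
     Cmp C X Y X g f = Idn C X \<and> Cmp C Y X Y f g = Idn C Y"

definition is_iso :: "('o, 'm, 'z) category_scheme \<Rightarrow> 'o \<Rightarrow> 'o \<Rightarrow> 'm \<Rightarrow> bool" where
  "is_iso C X Y f \<longleftrightarrow> (\<exists>g. is_inverse C X Y f g)"

definition the_inverse :: "('o, 'm, 'z) category_scheme \<Rightarrow> 'o \<Rightarrow> 'o \<Rightarrow> 'm \<Rightarrow> 'm" where
  "the_inverse C X Y f = (THE g. is_inverse C X Y f g)"

record ('o, 'm, 'p, 'k) cfunctor =
  FOb :: "'o \<Rightarrow> 'p"
  FMap :: "'o \<Rightarrow> 'o \<Rightarrow> 'm \<Rightarrow> 'k"

locale cat_functor = C: category C + D: category D
  for C :: "('o, 'm, 'x) category_scheme" and D :: "('p, 'k, 'y) category_scheme" +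
  fixes F :: "('o, 'm, 'p, 'k) cfunctor"
  assumes FOb_in: "X \<in> Ob C \<Longrightarrow> FOb F X \<in> Ob D"
    and FMap_in: "\<lbrakk>X \<in> Ob C; Y \<in> Ob C; f \<in> Hom C X Y\<rbrakk>
      \<Longrightarrow> FMap F X Y f \<in> Hom D (FOb F X) (FOb F Y)"
    and FMap_Idn: "X \<in> Ob C \<Longrightarrow> FMap F X X (Idn C X) = Idn D (FOb F X)"
    and FMap_Cmp: "\<lbrakk>X \<in> Ob C; Y \<in> Ob C; Z \<in> Ob C; f \<in> Hom C X Y; g \<in> Hom C Y Z\<rbrakk>
      \<Longrightarrow> FMap F X Z (Cmp C X Y Z g f)
          = Cmp D (FOb F X) (FOb F Y) (FOb F Z) (FMap F Y Z g) (FMap F X Y f)"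

definition id_functor :: "('o, 'm, 'o, 'm) cfunctor" where
  "id_functor = \<lparr>FOb = (\<lambda>X. X), FMap = (\<lambda>X Y f. f)\<rparr>"

definition comp_functor ::
  "('p, 'k, 'q, 'l) cfunctor \<Rightarrow> ('o, 'm, 'p, 'k) cfunctor \<Rightarrow> ('o, 'm, 'q, 'l) cfunctor" where
  "comp_functor G F = \<lparr>FOb = (\<lambda>X. FOb G (FOb F X)),
     FMap = (\<lambda>X Y f. FMap G (FOb F X) (FOb F Y) (FMap F X Y f))\<rparr>"

text \<open>\<open>HomSp C X Y\<close> is \<open>Hom C X Y\<close> with its vector space structure;
  \<open>Tmor C X X' Y Y' f g : X \<star> Y \<rightarrow> X' \<star> Y'\<close> is the tensor product of \<open>f : X \<rightarrow> X'\<close> and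
  \<open>g : Y \<rightarrow> Y'\<close>; \<open>Asc\<close>, \<open>Lun\<close>, \<open>Run\<close>, \<open>Swp\<close> are the associativity, left and right unit and
  commutativity constraints.\<close>

record ('o, 'm) tensor_cat = "('o, 'm) category" +
  HomSp :: "'o \<Rightarrow> 'o \<Rightarrow> 'm vs"
  Unt :: "'o" (\<open>\<^bold>I\<index>\<close>)
  Tob :: "'o \<Rightarrow> 'o \<Rightarrow> 'o" (infixl \<open>\<star>\<index>\<close> 70)
  Tmor :: "'o \<Rightarrow> 'o \<Rightarrow> 'o \<Rightarrow> 'o \<Rightarrow> 'm \<Rightarrow> 'm \<Rightarrow> 'm"
  Asc :: "'o \<Rightarrow> 'o \<Rightarrow> 'o \<Rightarrow> 'm"
  Lun :: "'o \<Rightarrow> 'm"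
  Run :: "'o \<Rightarrow> 'm"
  Swp :: "'o \<Rightarrow> 'o \<Rightarrow> 'm"

locale linear_category = category C
  for C :: "('o, 'm, 'z) tensor_cat_scheme" +
  assumes carrier_HomSp: "\<lbrakk>X \<in> Ob C; Y \<in> Ob C\<rbrakk> \<Longrightarrow> carrier (HomSp C X Y) = Hom C X Y"
    and HomSp_vs: "\<lbrakk>X \<in> Ob C; Y \<in> Ob C\<rbrakk> \<Longrightarrow> module CC (HomSp C X Y)"
    and Cmp_bilinear: "\<lbrakk>X \<in> Ob C; Y \<in> Ob C; Z \<in> Ob C\<rbrakk>
      \<Longrightarrow> bilinear_on (HomSp C Y Z) (HomSp C X Y) (HomSp C X Z) (Cmp C X Y Z)"

locale symmetric_monoidal_category = category C
  for C :: "('o, 'm, 'z) tensor_cat_scheme" (structure) +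
  assumes Unt_in: "\<^bold>I \<in> Ob C"
    and Tob_in: "\<lbrakk>X \<in> Ob C; Y \<in> Ob C\<rbrakk> \<Longrightarrow> X \<star> Y \<in> Ob C"
    and Tmor_in: "\<lbrakk>X \<in> Ob C; X' \<in> Ob C; Y \<in> Ob C; Y' \<in> Ob C; f \<in> Hom C X X'; g \<in> Hom C Y Y'\<rbrakk>
      \<Longrightarrow> Tmor C X X' Y Y' f g \<in> Hom C (X \<star> Y) (X' \<star> Y')"
    and Tmor_Idn: "\<lbrakk>X \<in> Ob C; Y \<in> Ob C\<rbrakk>
      \<Longrightarrow> Tmor C X X Y Y (Idn C X) (Idn C Y) = Idn C (X \<star> Y)"
    and Tmor_Cmp: "\<lbrakk>X \<in> Ob C; X' \<in> Ob C; X'' \<in> Ob C; Y \<in> Ob C; Y' \<in> Ob C; Y'' \<in> Ob C;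
        f \<in> Hom C X X'; f' \<in> Hom C X' X''; g \<in> Hom C Y Y'; g' \<in> Hom C Y' Y''\<rbrakk>
      \<Longrightarrow> Tmor C X X'' Y Y'' (Cmp C X X' X'' f' f) (Cmp C Y Y' Y'' g' g)
          = Cmp C (X \<star> Y) (X' \<star> Y') (X'' \<star> Y'') (Tmor C X' X'' Y' Y'' f' g') (Tmor C X X' Y Y' f g)"
    and Asc_iso: "\<lbrakk>X \<in> Ob C; Y \<in> Ob C; Z \<in> Ob C\<rbrakk>
      \<Longrightarrow> is_iso C (X \<star> Y \<star> Z) (X \<star> (Y \<star> Z)) (Asc C X Y Z)"
    and Asc_natural: "\<lbrakk>X \<in> Ob C; X' \<in> Ob C; Y \<in> Ob C; Y' \<in> Ob C; Z \<in> Ob C; Z' \<in> Ob C;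
        f \<in> Hom C X X'; g \<in> Hom C Y Y'; h \<in> Hom C Z Z'\<rbrakk>
      \<Longrightarrow> Cmp C (X \<star> Y \<star> Z) (X' \<star> Y' \<star> Z') (X' \<star> (Y' \<star> Z'))
            (Asc C X' Y' Z') (Tmor C (X \<star> Y) (X' \<star> Y') Z Z' (Tmor C X X' Y Y' f g) h)
          = Cmp C (X \<star> Y \<star> Z) (X \<star> (Y \<star> Z)) (X' \<star> (Y' \<star> Z'))
            (Tmor C X X' (Y \<star> Z) (Y' \<star> Z') f (Tmor C Y Y' Z Z' g h)) (Asc C X Y Z)"
    and Lun_iso: "X \<in> Ob C \<Longrightarrow> is_iso C (\<^bold>I \<star> X) X (Lun C X)"
    and Lun_natural: "\<lbrakk>X \<in> Ob C; Y \<in> Ob C; f \<in> Hom C X Y\<rbrakk>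
      \<Longrightarrow> Cmp C (\<^bold>I \<star> X) (\<^bold>I \<star> Y) Y (Lun C Y) (Tmor C \<^bold>I \<^bold>I X Y (Idn C \<^bold>I) f)
          = Cmp C (\<^bold>I \<star> X) X Y f (Lun C X)"
    and Run_iso: "X \<in> Ob C \<Longrightarrow> is_iso C (X \<star> \<^bold>I) X (Run C X)"
    and Run_natural: "\<lbrakk>X \<in> Ob C; Y \<in> Ob C; f \<in> Hom C X Y\<rbrakk>
      \<Longrightarrow> Cmp C (X \<star> \<^bold>I) (Y \<star> \<^bold>I) Y (Run C Y) (Tmor C X Y \<^bold>I \<^bold>I f (Idn C \<^bold>I))
          = Cmp C (X \<star> \<^bold>I) X Y f (Run C X)"
    and Swp_in: "\<lbrakk>X \<in> Ob C; Y \<in> Ob C\<rbrakk> \<Longrightarrow> Swp C X Y \<in> Hom C (X \<star> Y) (Y \<star> X)"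
    and Swp_natural: "\<lbrakk>X \<in> Ob C; X' \<in> Ob C; Y \<in> Ob C; Y' \<in> Ob C;
        f \<in> Hom C X X'; g \<in> Hom C Y Y'\<rbrakk>
      \<Longrightarrow> Cmp C (X \<star> Y) (X' \<star> Y') (Y' \<star> X') (Swp C X' Y') (Tmor C X X' Y Y' f g)
          = Cmp C (X \<star> Y) (Y \<star> X) (Y' \<star> X') (Tmor C Y Y' X X' g f) (Swp C X Y)"
    and pentagon: "\<lbrakk>W \<in> Ob C; X \<in> Ob C; Y \<in> Ob C; Z \<in> Ob C\<rbrakk>
      \<Longrightarrow> Cmp C (W \<star> X \<star> Y \<star> Z) (W \<star> X \<star> (Y \<star> Z)) (W \<star> (X \<star> (Y \<star> Z)))
            (Asc C W X (Y \<star> Z)) (Asc C (W \<star> X) Y Z)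
          = Cmp C (W \<star> X \<star> Y \<star> Z) (W \<star> (X \<star> Y \<star> Z)) (W \<star> (X \<star> (Y \<star> Z)))
            (Tmor C W W (X \<star> Y \<star> Z) (X \<star> (Y \<star> Z)) (Idn C W) (Asc C X Y Z))
            (Cmp C (W \<star> X \<star> Y \<star> Z) (W \<star> (X \<star> Y) \<star> Z) (W \<star> (X \<star> Y \<star> Z))
              (Asc C W (X \<star> Y) Z)
              (Tmor C (W \<star> X \<star> Y) (W \<star> (X \<star> Y)) Z Z (Asc C W X Y) (Idn C Z)))"
    and triangle: "\<lbrakk>X \<in> Ob C; Y \<in> Ob C\<rbrakk>
      \<Longrightarrow> Cmp C (X \<star> \<^bold>I \<star> Y) (X \<star> (\<^bold>I \<star> Y)) (X \<star> Y)
            (Tmor C X X (\<^bold>I \<star> Y) Y (Idn C X) (Lun C Y)) (Asc C X \<^bold>I Y)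
          = Tmor C (X \<star> \<^bold>I) X Y Y (Run C X) (Idn C Y)"
    and hexagon: "\<lbrakk>X \<in> Ob C; Y \<in> Ob C; Z \<in> Ob C\<rbrakk>
      \<Longrightarrow> Cmp C (X \<star> Y \<star> Z) (Y \<star> Z \<star> X) (Y \<star> (Z \<star> X))
            (Asc C Y Z X)
            (Cmp C (X \<star> Y \<star> Z) (X \<star> (Y \<star> Z)) (Y \<star> Z \<star> X) (Swp C X (Y \<star> Z)) (Asc C X Y Z))
          = Cmp C (X \<star> Y \<star> Z) (Y \<star> (X \<star> Z)) (Y \<star> (Z \<star> X))
            (Tmor C Y Y (X \<star> Z) (Z \<star> X) (Idn C Y) (Swp C X Z))
            (Cmp C (X \<star> Y \<star> Z) (Y \<star> X \<star> Z) (Y \<star> (X \<star> Z))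
              (Asc C Y X Z)
              (Tmor C (X \<star> Y) (Y \<star> X) Z Z (Swp C X Y) (Idn C Z)))"
    and Swp_Swp: "\<lbrakk>X \<in> Ob C; Y \<in> Ob C\<rbrakk>
      \<Longrightarrow> Cmp C (X \<star> Y) (Y \<star> X) (X \<star> Y) (Swp C Y X) (Swp C X Y) = Idn C (X \<star> Y)"

locale tensor_category = linear_category C + symmetric_monoidal_category C
  for C :: "('o, 'm, 'z) tensor_cat_scheme" (structure) +
  assumes Tmor_bilinear: "\<lbrakk>X \<in> Ob C; X' \<in> Ob C; Y \<in> Ob C; Y' \<in> Ob C\<rbrakk>
    \<Longrightarrow> bilinear_on (HomSp C X X') (HomSp C Y Y') (HomSp C (X \<star> Y) (X' \<star> Y')) (Tmor C X X' Y Y')"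

text \<open>A tensor functor is a \<open>\<complex>\<close>-linear strong symmetric monoidal functor; the structure maps are
  \<open>\<mu> X Y : F X \<star> F Y \<rightarrow> F (X \<star> Y)\<close> and \<open>\<iota> : \<^bold>I \<rightarrow> F \<^bold>I\<close>.\<close>

locale tensor_functor = cat_functor C D F + C: tensor_category C + D: tensor_category D
  for C :: "('o, 'm, 'x) tensor_cat_scheme" (structure)
    and D :: "('p, 'k, 'y) tensor_cat_scheme" (structure)
    and F :: "('o, 'm, 'p, 'k) cfunctor" +
  fixes \<mu> :: "'o \<Rightarrow> 'o \<Rightarrow> 'k" and \<iota> :: 'k
  assumes FMap_linear: "\<lbrakk>X \<in> Ob C; Y \<in> Ob C\<rbrakk>
      \<Longrightarrow> linear_on (HomSp C X Y) (HomSp D (FOb F X) (FOb F Y)) (FMap F X Y)"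
    and mu_iso: "\<lbrakk>X \<in> Ob C; Y \<in> Ob C\<rbrakk>
      \<Longrightarrow> is_iso D (FOb F X \<star>\<^bsub>D\<^esub> FOb F Y) (FOb F (X \<star> Y)) (\<mu> X Y)"
    and iota_iso: "is_iso D \<^bold>I\<^bsub>D\<^esub> (FOb F \<^bold>I) \<iota>"
    and mu_natural: "\<lbrakk>X \<in> Ob C; X' \<in> Ob C; Y \<in> Ob C; Y' \<in> Ob C;
        f \<in> Hom C X X'; g \<in> Hom C Y Y'\<rbrakk>
      \<Longrightarrow> Cmp D (FOb F X \<star>\<^bsub>D\<^esub> FOb F Y) (FOb F X' \<star>\<^bsub>D\<^esub> FOb F Y') (FOb F (X' \<star> Y'))
            (\<mu> X' Y')
            (Tmor D (FOb F X) (FOb F X') (FOb F Y) (FOb F Y') (FMap F X X' f) (FMap F Y Y' g))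
          = Cmp D (FOb F X \<star>\<^bsub>D\<^esub> FOb F Y) (FOb F (X \<star> Y)) (FOb F (X' \<star> Y'))
            (FMap F (X \<star> Y) (X' \<star> Y') (Tmor C X X' Y Y' f g)) (\<mu> X Y)"
    and mu_assoc: "\<lbrakk>X \<in> Ob C; Y \<in> Ob C; Z \<in> Ob C\<rbrakk>
      \<Longrightarrow> Cmp D (FOb F X \<star>\<^bsub>D\<^esub> FOb F Y \<star>\<^bsub>D\<^esub> FOb F Z) (FOb F (X \<star> Y \<star> Z)) (FOb F (X \<star> (Y \<star> Z)))
            (FMap F (X \<star> Y \<star> Z) (X \<star> (Y \<star> Z)) (Asc C X Y Z))
            (Cmp D (FOb F X \<star>\<^bsub>D\<^esub> FOb F Y \<star>\<^bsub>D\<^esub> FOb F Z) (FOb F (X \<star> Y) \<star>\<^bsub>D\<^esub> FOb F Z)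
              (FOb F (X \<star> Y \<star> Z))
              (\<mu> (X \<star> Y) Z)
              (Tmor D (FOb F X \<star>\<^bsub>D\<^esub> FOb F Y) (FOb F (X \<star> Y)) (FOb F Z) (FOb F Z)
                (\<mu> X Y) (Idn D (FOb F Z))))
          = Cmp D (FOb F X \<star>\<^bsub>D\<^esub> FOb F Y \<star>\<^bsub>D\<^esub> FOb F Z) (FOb F X \<star>\<^bsub>D\<^esub> FOb F (Y \<star> Z))
            (FOb F (X \<star> (Y \<star> Z)))
            (\<mu> X (Y \<star> Z))
            (Cmp D (FOb F X \<star>\<^bsub>D\<^esub> FOb F Y \<star>\<^bsub>D\<^esub> FOb F Z) (FOb F X \<star>\<^bsub>D\<^esub> (FOb F Y \<star>\<^bsub>D\<^esub> FOb F Z))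
              (FOb F X \<star>\<^bsub>D\<^esub> FOb F (Y \<star> Z))
              (Tmor D (FOb F X) (FOb F X) (FOb F Y \<star>\<^bsub>D\<^esub> FOb F Z) (FOb F (Y \<star> Z))
                (Idn D (FOb F X)) (\<mu> Y Z))
              (Asc D (FOb F X) (FOb F Y) (FOb F Z)))"
    and mu_left_unit: "X \<in> Ob C
      \<Longrightarrow> Cmp D (\<^bold>I\<^bsub>D\<^esub> \<star>\<^bsub>D\<^esub> FOb F X) (FOb F (\<^bold>I \<star> X)) (FOb F X)
            (FMap F (\<^bold>I \<star> X) X (Lun C X))
            (Cmp D (\<^bold>I\<^bsub>D\<^esub> \<star>\<^bsub>D\<^esub> FOb F X) (FOb F \<^bold>I \<star>\<^bsub>D\<^esub> FOb F X) (FOb F (\<^bold>I \<star> X))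
              (\<mu> \<^bold>I X) (Tmor D \<^bold>I\<^bsub>D\<^esub> (FOb F \<^bold>I) (FOb F X) (FOb F X) \<iota> (Idn D (FOb F X))))
          = Lun D (FOb F X)"
    and mu_right_unit: "X \<in> Ob C
      \<Longrightarrow> Cmp D (FOb F X \<star>\<^bsub>D\<^esub> \<^bold>I\<^bsub>D\<^esub>) (FOb F (X \<star> \<^bold>I)) (FOb F X)
            (FMap F (X \<star> \<^bold>I) X (Run C X))
            (Cmp D (FOb F X \<star>\<^bsub>D\<^esub> \<^bold>I\<^bsub>D\<^esub>) (FOb F X \<star>\<^bsub>D\<^esub> FOb F \<^bold>I) (FOb F (X \<star> \<^bold>I))
              (\<mu> X \<^bold>I) (Tmor D (FOb F X) (FOb F X) \<^bold>I\<^bsub>D\<^esub> (FOb F \<^bold>I) (Idn D (FOb F X)) \<iota>))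
          = Run D (FOb F X)"
    and mu_swap: "\<lbrakk>X \<in> Ob C; Y \<in> Ob C\<rbrakk>
      \<Longrightarrow> Cmp D (FOb F X \<star>\<^bsub>D\<^esub> FOb F Y) (FOb F (X \<star> Y)) (FOb F (Y \<star> X))
            (FMap F (X \<star> Y) (Y \<star> X) (Swp C X Y)) (\<mu> X Y)
          = Cmp D (FOb F X \<star>\<^bsub>D\<^esub> FOb F Y) (FOb F Y \<star>\<^bsub>D\<^esub> FOb F X) (FOb F (Y \<star> X))
            (\<mu> Y X) (Swp D (FOb F X) (FOb F Y))"

text \<open>Structure maps of the composite of two tensor functors (\<open>F\<close> from \<open>C\<close>, then \<open>G\<close> to \<open>E\<close>).\<close>

definition comp_mu ::
  "('o, 'm, 'x) tensor_cat_scheme \<Rightarrow> ('q, 'l, 'y) tensor_cat_scheme \<Rightarrow>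
   ('p, 'k, 'q, 'l) cfunctor \<Rightarrow> ('p \<Rightarrow> 'p \<Rightarrow> 'l) \<Rightarrow>
   ('p, 'k, 'w) tensor_cat_scheme \<Rightarrow>
   ('o, 'm, 'p, 'k) cfunctor \<Rightarrow> ('o \<Rightarrow> 'o \<Rightarrow> 'k) \<Rightarrow> 'o \<Rightarrow> 'o \<Rightarrow> 'l" where
  "comp_mu C E G \<mu>G D F \<mu>F X Y =
     Cmp E (FOb G (FOb F X) \<star>\<^bsub>E\<^esub> FOb G (FOb F Y)) (FOb G (FOb F X \<star>\<^bsub>D\<^esub> FOb F Y))
       (FOb G (FOb F (X \<star>\<^bsub>C\<^esub> Y)))
       (FMap G (FOb F X \<star>\<^bsub>D\<^esub> FOb F Y) (FOb F (X \<star>\<^bsub>C\<^esub> Y)) (\<mu>F X Y))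
       (\<mu>G (FOb F X) (FOb F Y))"

definition comp_iota ::
  "('o, 'm, 'x) tensor_cat_scheme \<Rightarrow> ('q, 'l, 'y) tensor_cat_scheme \<Rightarrow>
   ('p, 'k, 'q, 'l) cfunctor \<Rightarrow> 'l \<Rightarrow>
   ('p, 'k, 'w) tensor_cat_scheme \<Rightarrow>
   ('o, 'm, 'p, 'k) cfunctor \<Rightarrow> 'k \<Rightarrow> 'l" where
  "comp_iota C E G \<iota>G D F \<iota>F =
     Cmp E \<^bold>I\<^bsub>E\<^esub> (FOb G \<^bold>I\<^bsub>D\<^esub>) (FOb G (FOb F \<^bold>I\<^bsub>C\<^esub>)) (FMap G \<^bold>I\<^bsub>D\<^esub> (FOb F \<^bold>I\<^bsub>C\<^esub>) \<iota>F) \<iota>G"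

definition monoidal_nat_iso ::
  "('o, 'm, 'x) tensor_cat_scheme \<Rightarrow> ('p, 'k, 'y) tensor_cat_scheme \<Rightarrow>
   ('o, 'm, 'p, 'k) cfunctor \<Rightarrow> ('o \<Rightarrow> 'o \<Rightarrow> 'k) \<Rightarrow> 'k \<Rightarrow>
   ('o, 'm, 'p, 'k) cfunctor \<Rightarrow> ('o \<Rightarrow> 'o \<Rightarrow> 'k) \<Rightarrow> 'k \<Rightarrow> ('o \<Rightarrow> 'k) \<Rightarrow> bool" where
  "monoidal_nat_iso C D F \<mu>F \<iota>F G \<mu>G \<iota>G \<eta> \<longleftrightarrow>
     (\<forall>X\<in>Ob C. is_iso D (FOb F X) (FOb G X) (\<eta> X)) \<and>
     (\<forall>X\<in>Ob C. \<forall>Y\<in>Ob C. \<forall>f\<in>Hom C X Y.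
        Cmp D (FOb F X) (FOb F Y) (FOb G Y) (\<eta> Y) (FMap F X Y f)
        = Cmp D (FOb F X) (FOb G X) (FOb G Y) (FMap G X Y f) (\<eta> X)) \<and>
     (\<forall>X\<in>Ob C. \<forall>Y\<in>Ob C.
        Cmp D (FOb F X \<star>\<^bsub>D\<^esub> FOb F Y) (FOb F (X \<star>\<^bsub>C\<^esub> Y)) (FOb G (X \<star>\<^bsub>C\<^esub> Y))
          (\<eta> (X \<star>\<^bsub>C\<^esub> Y)) (\<mu>F X Y)
        = Cmp D (FOb F X \<star>\<^bsub>D\<^esub> FOb F Y) (FOb G X \<star>\<^bsub>D\<^esub> FOb G Y) (FOb G (X \<star>\<^bsub>C\<^esub> Y))
          (\<mu>G X Y) (Tmor D (FOb F X) (FOb G X) (FOb F Y) (FOb G Y) (\<eta> X) (\<eta> Y))) \<and>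
     Cmp D \<^bold>I\<^bsub>D\<^esub> (FOb F \<^bold>I\<^bsub>C\<^esub>) (FOb G \<^bold>I\<^bsub>C\<^esub>) (\<eta> \<^bold>I\<^bsub>C\<^esub>) \<iota>F = \<iota>G"

definition tensor_equivalence ::
  "('o, 'm, 'x) tensor_cat_scheme \<Rightarrow> ('p, 'k, 'y) tensor_cat_scheme \<Rightarrow>
   ('o, 'm, 'p, 'k) cfunctor \<Rightarrow> ('p, 'k, 'o, 'm) cfunctor \<Rightarrow> bool" where
  "tensor_equivalence C D F G \<longleftrightarrow>
     tensor_category C \<and> tensor_category D \<and>
     (\<exists>\<mu>F \<iota>F \<mu>G \<iota>G \<eta> \<epsilon>.
        tensor_functor C D F \<mu>F \<iota>F \<and> tensor_functor D C G \<mu>G \<iota>G \<and>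
        monoidal_nat_iso C C
          id_functor (\<lambda>X Y. Idn C (X \<star>\<^bsub>C\<^esub> Y)) (Idn C \<^bold>I\<^bsub>C\<^esub>)
          (comp_functor G F) (comp_mu C C G \<mu>G D F \<mu>F) (comp_iota C C G \<iota>G D F \<iota>F) \<eta> \<and>
        monoidal_nat_iso D D
          (comp_functor F G) (comp_mu D D F \<mu>F C G \<mu>G) (comp_iota D D F \<iota>F C G \<iota>G)
          id_functor (\<lambda>X Y. Idn D (X \<star>\<^bsub>D\<^esub> Y)) (Idn D \<^bold>I\<^bsub>D\<^esub>) \<epsilon>)"

section \<open>Flags and polynomial functors\<close>

definition Vect :: "('u vs, 'u \<Rightarrow> 'u) category" where
  "Vect = \<lparr>Ob = {V. module CC V \<and> fin_dim V}, Hom = lin, Idn = lin_id,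
     Cmp = (\<lambda>U V W g f. compose (carrier U) g f)\<rparr>"

text \<open>A flagged vector space; only the members \<open>0, \<dots>, n\<close> of the second component matter.\<close>

type_synonym 'u flag = "'u vs \<times> (nat \<Rightarrow> 'u set)"

definition is_flag :: "nat \<Rightarrow> 'u flag \<Rightarrow> bool" where
  "is_flag n X \<longleftrightarrow> module CC (fst X) \<and> (\<forall>i\<le>n. submodule (snd X i) CC (fst X)) \<and>
     snd X 0 = {\<zero>\<^bsub>fst X\<^esub>} \<and> (\<forall>i<n. snd X i \<subseteq> snd X (Suc i)) \<and> snd X n = carrier (fst X)"

definition flag_lin :: "nat \<Rightarrow> 'u flag \<Rightarrow> 'u flag \<Rightarrow> ('u \<Rightarrow> 'u) set" where
  "flag_lin n X Y = {f \<in> lin (fst X) (fst Y). \<forall>i\<le>n. f ` snd X i \<subseteq> snd Y i}"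

definition Flag :: "nat \<Rightarrow> ('u flag, 'u \<Rightarrow> 'u) category" where
  "Flag n = \<lparr>Ob = {X. is_flag n X \<and> fin_dim (fst X)}, Hom = flag_lin n,
     Idn = (\<lambda>X. lin_id (fst X)), Cmp = (\<lambda>X Y Z g f. compose (carrier (fst X)) g f)\<rparr>"

type_synonym 'u flagfun = "('u flag, 'u \<Rightarrow> 'u, 'u vs, 'u \<Rightarrow> 'u) cfunctor"

text \<open>A subquotient of the functor \<open>X \<mapsto> \<Oplus>i<k. X\<^bsup>\<otimes> a i\<^esup>\<close> is a functor \<open>F\<close> with a natural
  surjection \<open>p\<close> onto it from a subfunctor \<open>S\<close>.\<close>

definition polynomial_functor :: "nat \<Rightarrow> 'u flagfun \<Rightarrow> bool" where
  "polynomial_functor n F \<longleftrightarrow> cat_functor (Flag n) Vect F \<and>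
     (\<exists>k a S p.
        (\<forall>X\<in>Ob (Flag n).
           submodule (S X) CC (dsum k (\<lambda>i. tpow (fst X) (a i))) \<and>
           linear_on ((dsum k (\<lambda>i. tpow (fst X) (a i)))\<lparr>carrier := S X\<rparr>) (FOb F X) (p X) \<and>
           p X ` S X = carrier (FOb F X)) \<and>
        (\<forall>X\<in>Ob (Flag n). \<forall>Y\<in>Ob (Flag n). \<forall>f\<in>Hom (Flag n) X Y. \<forall>x\<in>S X.
           dsum_map k (\<lambda>i. tpow_map (fst X) (fst Y) (a i) f) x \<in> S Y \<and>
           p Y (dsum_map k (\<lambda>i. tpow_map (fst X) (fst Y) (a i) f) x) = FMap F X Y f (p X x)))"

definition nat_trans :: "nat \<Rightarrow> 'u flagfun \<Rightarrow> 'u flagfun \<Rightarrow> ('u flag \<Rightarrow> 'u \<Rightarrow> 'u) set" where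
  "nat_trans n F G = {\<eta> \<in> extensional (Ob (Flag n)).
     (\<forall>X\<in>Ob (Flag n). \<eta> X \<in> Hom Vect (FOb F X) (FOb G X)) \<and>
     (\<forall>X\<in>Ob (Flag n). \<forall>Y\<in>Ob (Flag n). \<forall>f\<in>Hom (Flag n) X Y.
        Cmp Vect (FOb F X) (FOb F Y) (FOb G Y) (\<eta> Y) (FMap F X Y f)
        = Cmp Vect (FOb F X) (FOb G X) (FOb G Y) (FMap G X Y f) (\<eta> X))}"

definition nat_trans_space ::
  "nat \<Rightarrow> 'u flagfun \<Rightarrow> 'u flagfun \<Rightarrow> ('u flag \<Rightarrow> 'u \<Rightarrow> 'u) vs" where
  "nat_trans_space n F G = \<lparr>carrier = nat_trans n F G, monoid.mult = undefined, one = undefined,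
     zero = (\<lambda>X\<in>Ob (Flag n). \<zero>\<^bsub>lin_space (FOb F X) (FOb G X)\<^esub>),
     add = (\<lambda>\<eta> \<theta>. \<lambda>X\<in>Ob (Flag n). \<eta> X \<oplus>\<^bsub>lin_space (FOb F X) (FOb G X)\<^esub> \<theta> X),
     module.smult = (\<lambda>c \<eta>. \<lambda>X\<in>Ob (Flag n). c \<odot>\<^bsub>lin_space (FOb F X) (FOb G X)\<^esub> \<eta> X)\<rparr>"

definition CatA :: "nat \<Rightarrow> ('u flagfun, 'u flag \<Rightarrow> 'u \<Rightarrow> 'u) tensor_cat" where
  "CatA n = \<lparr>Ob = {F. polynomial_functor n F}, Hom = nat_trans n,
     Idn = (\<lambda>F. \<lambda>X\<in>Ob (Flag n). lin_id (FOb F X)),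
     Cmp = (\<lambda>F G H \<theta> \<eta>. \<lambda>X\<in>Ob (Flag n). compose (carrier (FOb F X)) (\<theta> X) (\<eta> X)),
     HomSp = nat_trans_space n,
     Unt = \<lparr>FOb = (\<lambda>X. unit_sp), FMap = (\<lambda>X Y f. lin_id unit_sp)\<rparr>,
     Tob = (\<lambda>F G. \<lparr>FOb = (\<lambda>X. tensor (FOb F X) (FOb G X)),
       FMap = (\<lambda>X Y f. tensor_map (FOb F X) (FOb F Y) (FOb G X) (FOb G Y)
                         (FMap F X Y f) (FMap G X Y f))\<rparr>),
     Tmor = (\<lambda>F F' G G' \<eta> \<theta>. \<lambda>X\<in>Ob (Flag n).
       tensor_map (FOb F X) (FOb F' X) (FOb G X) (FOb G' X) (\<eta> X) (\<theta> X)),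
     Asc = (\<lambda>F G H. \<lambda>X\<in>Ob (Flag n). tensor_assoc (FOb F X) (FOb G X) (FOb H X)),
     Lun = (\<lambda>F. \<lambda>X\<in>Ob (Flag n). tensor_lunit (FOb F X)),
     Run = (\<lambda>F. \<lambda>X\<in>Ob (Flag n). tensor_runit (FOb F X)),
     Swp = (\<lambda>F G. \<lambda>X\<in>Ob (Flag n). tensor_swap (FOb F X) (FOb G X))\<rparr>"

section \<open>The group and its polynomial representations\<close>

text \<open>\<open>e i j\<close>, for \<open>1 \<le> i \<le> n\<close> and \<open>1 \<le> j\<close>, is the basis of \<open>V\<close>; the flag on \<open>V\<close> is \<open>big_flag\<close>.\<close>

definition expansion ::
  "nat \<Rightarrow> 'u vs \<Rightarrow> (nat \<Rightarrow> nat \<Rightarrow> 'u) \<Rightarrow> 'u \<Rightarrow> (nat \<times> nat \<Rightarrow> complex) \<Rightarrow> bool" where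
  "expansion n V e v c \<longleftrightarrow> finite {x. c x \<noteq> 0} \<and> {x. c x \<noteq> 0} \<subseteq> {1..n} \<times> {1..} \<and>
     v = (\<Oplus>\<^bsub>V\<^esub>x\<in>{x. c x \<noteq> 0}. c x \<odot>\<^bsub>V\<^esub> e (fst x) (snd x))"

definition flag_basis :: "nat \<Rightarrow> 'u vs \<Rightarrow> (nat \<Rightarrow> nat \<Rightarrow> 'u) \<Rightarrow> bool" where
  "flag_basis n V e \<longleftrightarrow> module CC V \<and> (\<forall>i\<in>{1..n}. \<forall>j\<ge>1. e i j \<in> carrier V) \<and>
     (\<forall>v\<in>carrier V. \<exists>!c. expansion n V e v c)"

definition coord ::
  "nat \<Rightarrow> 'u vs \<Rightarrow> (nat \<Rightarrow> nat \<Rightarrow> 'u) \<Rightarrow> 'u \<Rightarrow> nat \<times> nat \<Rightarrow> complex" where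
  "coord n V e v = (THE c. expansion n V e v c)"

definition big_flag :: "'u vs \<Rightarrow> (nat \<Rightarrow> nat \<Rightarrow> 'u) \<Rightarrow> 'u flag" where
  "big_flag V e = (V, \<lambda>i. lspan V {e k j | k j. 1 \<le> k \<and> k \<le> i \<and> 1 \<le> j})"

definition EndV :: "nat \<Rightarrow> 'u vs \<Rightarrow> (nat \<Rightarrow> nat \<Rightarrow> 'u) \<Rightarrow> ('u \<Rightarrow> 'u) set" where
  "EndV n V e = flag_lin n (big_flag V e) (big_flag V e)"

text \<open>\<open>block n V e g i k\<close> is the \<open>(i,k)\<close> block of the matrix of \<open>g\<close>; rows and columns of a block
  are numbered from \<open>1\<close>.\<close>

definition block ::
  "nat \<Rightarrow> 'u vs \<Rightarrow> (nat \<Rightarrow> nat \<Rightarrow> 'u) \<Rightarrow> ('u \<Rightarrow> 'u) \<Rightarrow> nat \<Rightarrow> nat \<Rightarrow> nat \<Rightarrow> nat \<Rightarrow> complex" where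
  "block n V e g i k p q = coord n V e (g (e k q)) (i, p)"

definition in_End_inf :: "(nat \<Rightarrow> nat \<Rightarrow> complex) \<Rightarrow> bool" where
  "in_End_inf A \<longleftrightarrow> (\<exists>N. \<forall>p\<ge>1. \<forall>q\<ge>1. p > N \<or> q > N \<longrightarrow> A p q = 0)"

definition in_GL_inf :: "(nat \<Rightarrow> nat \<Rightarrow> complex) \<Rightarrow> bool" where
  "in_GL_inf A \<longleftrightarrow> (\<exists>N. (\<forall>p\<ge>1. \<forall>q\<ge>1. p > N \<or> q > N \<longrightarrow> A p q = (if p = q then 1 else 0)) \<and>
     (\<exists>B. \<forall>p\<in>{1..N}. \<forall>q\<in>{1..N}.
        (\<Sum>r=1..N. A p r * B r q) = (if p = q then 1 else 0) \<and>
        (\<Sum>r=1..N. B p r * A r q) = (if p = q then 1 else 0)))"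

definition GG :: "nat \<Rightarrow> 'u vs \<Rightarrow> (nat \<Rightarrow> nat \<Rightarrow> 'u) \<Rightarrow> ('u \<Rightarrow> 'u) monoid" where
  "GG n V e = \<lparr>carrier = {g \<in> lin V V. bij_betw g (carrier V) (carrier V) \<and>
       (\<forall>i\<in>{1..n}. \<forall>k\<in>{1..n}.
          (k < i \<longrightarrow> (\<forall>p\<ge>1. \<forall>q\<ge>1. block n V e g i k p q = 0)) \<and>
          (i < k \<longrightarrow> in_End_inf (block n V e g i k)) \<and>
          (i = k \<longrightarrow> in_GL_inf (block n V e g i k)))},
     monoid.mult = compose (carrier V), one = lin_id V\<rparr>"

definition HH :: "nat \<Rightarrow> 'u vs \<Rightarrow> (nat \<Rightarrow> nat \<Rightarrow> 'u) \<Rightarrow> (nat \<Rightarrow> nat) \<Rightarrow> ('u \<Rightarrow> 'u) set" where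
  "HH n V e a = {g \<in> carrier (GG n V e). \<forall>i\<in>{1..n}. \<forall>k\<in>{1..n}. \<forall>p\<ge>1. \<forall>q\<ge>1.
     (i \<noteq> k \<longrightarrow> block n V e g i k p q = 0) \<and>
     (i = k \<and> (p \<le> a i \<or> q \<le> a i) \<longrightarrow> block n V e g i k p q = (if p = q then 1 else 0))}"

definition GG_sub :: "nat \<Rightarrow> 'u vs \<Rightarrow> (nat \<Rightarrow> nat \<Rightarrow> 'u) \<Rightarrow> (nat \<Rightarrow> nat) \<Rightarrow> ('u \<Rightarrow> 'u) set" where
  "GG_sub n V e a = {g \<in> carrier (GG n V e). \<forall>i\<in>{1..n}. \<forall>k\<in>{1..n}. \<forall>p\<ge>1. \<forall>q\<ge>1.
     (i = k \<and> (p > a i \<or> q > a i) \<longrightarrow> block n V e g i k p q = (if p = q then 1 else 0)) \<and>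
     (i < k \<and> (p > a i \<or> q > a k) \<longrightarrow> block n V e g i k p q = 0)}"

type_synonym 'u rep = "'u vs \<times> (('u \<Rightarrow> 'u) \<Rightarrow> 'u \<Rightarrow> 'u)"

definition is_rep :: "('u \<Rightarrow> 'u) monoid \<Rightarrow> 'u rep \<Rightarrow> bool" where
  "is_rep G R \<longleftrightarrow> module CC (fst R) \<and>
     (\<forall>g\<in>carrier G. snd R g \<in> lin (fst R) (fst R)) \<and>
     snd R \<one>\<^bsub>G\<^esub> = lin_id (fst R) \<and>
     (\<forall>g\<in>carrier G. \<forall>h\<in>carrier G.
        snd R (g \<otimes>\<^bsub>G\<^esub> h) = compose (carrier (fst R)) (snd R g) (snd R h))"

text \<open>\<open>presentation n V e R k a S p\<close>: \<open>p\<close> is a \<open>G\<close>-equivariant surjection onto \<open>R\<close> from the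
  subrepresentation \<open>S\<close> of \<open>\<Oplus>i<k. V\<^bsup>\<otimes> a i\<^esup>\<close>.\<close>

definition presentation ::
  "nat \<Rightarrow> 'u vs \<Rightarrow> (nat \<Rightarrow> nat \<Rightarrow> 'u) \<Rightarrow> 'u rep \<Rightarrow>
   nat \<Rightarrow> (nat \<Rightarrow> nat) \<Rightarrow> (nat \<Rightarrow> 'u) set \<Rightarrow> ((nat \<Rightarrow> 'u) \<Rightarrow> 'u) \<Rightarrow> bool" where
  "presentation n V e R k a S p \<longleftrightarrow>
     submodule S CC (dsum k (\<lambda>i. tpow V (a i))) \<and>
     linear_on ((dsum k (\<lambda>i. tpow V (a i)))\<lparr>carrier := S\<rparr>) (fst R) p \<and>
     p ` S = carrier (fst R) \<and>
     (\<forall>g\<in>carrier (GG n V e). \<forall>x\<in>S.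
        dsum_map k (\<lambda>i. tpow_map V V (a i) g) x \<in> S \<and>
        p (dsum_map k (\<lambda>i. tpow_map V V (a i) g) x) = snd R g (p x))"

definition polynomial_rep :: "nat \<Rightarrow> 'u vs \<Rightarrow> (nat \<Rightarrow> nat \<Rightarrow> 'u) \<Rightarrow> 'u rep \<Rightarrow> bool" where
  "polynomial_rep n V e R \<longleftrightarrow> is_rep (GG n V e) R \<and> (\<exists>k a S p. presentation n V e R k a S p)"

text \<open>The action of \<open>End(V)\<close> on a polynomial representation is induced by its action on tensor
  powers of \<open>V\<close>; it does not depend on the presentation nor on the preimage of \<open>m\<close>.\<close>

definition end_act ::
  "nat \<Rightarrow> 'u vs \<Rightarrow> (nat \<Rightarrow> nat \<Rightarrow> 'u) \<Rightarrow> 'u rep \<Rightarrow> ('u \<Rightarrow> 'u) \<Rightarrow> 'u \<Rightarrow> 'u" where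
  "end_act n V e R f m = (THE m'. \<exists>k a S p. presentation n V e R k a S p \<and>
     (\<exists>x\<in>S. p x = m \<and> m' = p (dsum_map k (\<lambda>i. tpow_map V V (a i) f) x)))"

definition equivariant :: "('u \<Rightarrow> 'u) monoid \<Rightarrow> 'u rep \<Rightarrow> 'u rep \<Rightarrow> ('u \<Rightarrow> 'u) set" where
  "equivariant G R R' = {\<theta> \<in> lin (fst R) (fst R').
     \<forall>g\<in>carrier G. \<forall>m\<in>carrier (fst R). \<theta> (snd R g m) = snd R' g (\<theta> m)}"

definition RepG ::
  "nat \<Rightarrow> 'u vs \<Rightarrow> (nat \<Rightarrow> nat \<Rightarrow> 'u) \<Rightarrow> ('u rep, 'u \<Rightarrow> 'u) tensor_cat" where
  "RepG n V e = \<lparr>Ob = {R. polynomial_rep n V e R}, Hom = equivariant (GG n V e),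
     Idn = (\<lambda>R. lin_id (fst R)),
     Cmp = (\<lambda>R R' R'' g f. compose (carrier (fst R)) g f),
     HomSp = (\<lambda>R R'. (lin_space (fst R) (fst R'))\<lparr>carrier := equivariant (GG n V e) R R'\<rparr>),
     Unt = (unit_sp, \<lambda>g. lin_id unit_sp),
     Tob = (\<lambda>R Q. (tensor (fst R) (fst Q),
       \<lambda>g. tensor_map (fst R) (fst R) (fst Q) (fst Q) (snd R g) (snd Q g))),
     Tmor = (\<lambda>R R' Q Q' f g. tensor_map (fst R) (fst R') (fst Q) (fst Q') f g),
     Asc = (\<lambda>R Q P. tensor_assoc (fst R) (fst Q) (fst P)),
     Lun = (\<lambda>R. tensor_lunit (fst R)),
     Run = (\<lambda>R. tensor_runit (fst R)),
     Swp = (\<lambda>R Q. tensor_swap (fst R) (fst Q))\<rparr>"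

section \<open>The functors\<close>

text \<open>The flag \<open>\<complex>\<^sup>a\<close> inside \<open>V\<close>, for \<open>a = (a 1, \<dots>, a n)\<close>.\<close>

definition std_flag :: "nat \<Rightarrow> 'u vs \<Rightarrow> (nat \<Rightarrow> nat \<Rightarrow> 'u) \<Rightarrow> (nat \<Rightarrow> nat) \<Rightarrow> 'u flag" where
  "std_flag n V e a =
     (V\<lparr>carrier := lspan V {e k j | k j. 1 \<le> k \<and> k \<le> n \<and> 1 \<le> j \<and> j \<le> a k}\<rparr>,
      \<lambda>i. lspan V {e k j | k j. 1 \<le> k \<and> k \<le> i \<and> 1 \<le> j \<and> j \<le> a k})"

subsection \<open>From functors to representations\<close>

definition diag_flag :: "nat \<Rightarrow> 'u vs \<Rightarrow> (nat \<Rightarrow> nat \<Rightarrow> 'u) \<Rightarrow> nat \<Rightarrow> 'u flag" where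
  "diag_flag n V e j = std_flag n V e (\<lambda>i\<in>{1..n}. j)"

definition Phi_colim ::
  "nat \<Rightarrow> 'u vs \<Rightarrow> (nat \<Rightarrow> nat \<Rightarrow> 'u) \<Rightarrow> 'u flagfun \<Rightarrow> 'u vs \<times> (nat \<Rightarrow> 'u \<Rightarrow> 'u)" where
  "Phi_colim n V e F = colim_choice
     (\<lambda>j. FOb F (diag_flag n V e j))
     (\<lambda>j. FMap F (diag_flag n V e j) (diag_flag n V e (Suc j)) (lin_id (fst (diag_flag n V e j))))"

definition Phi_act ::
  "nat \<Rightarrow> 'u vs \<Rightarrow> (nat \<Rightarrow> nat \<Rightarrow> 'u) \<Rightarrow> 'u flagfun \<Rightarrow> ('u \<Rightarrow> 'u) \<Rightarrow> 'u \<Rightarrow> 'u" where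
  "Phi_act n V e F g = (THE h.
     h \<in> lin (fst (Phi_colim n V e F)) (fst (Phi_colim n V e F)) \<and>
     (\<forall>j. g \<in> GG_sub n V e (\<lambda>i\<in>{1..n}. j) \<longrightarrow>
        (\<forall>x\<in>carrier (FOb F (diag_flag n V e j)).
           h (snd (Phi_colim n V e F) j x) =
           snd (Phi_colim n V e F) j
             (FMap F (diag_flag n V e j) (diag_flag n V e j)
               (restrict g (carrier (fst (diag_flag n V e j)))) x))))"

definition Phi_map ::
  "nat \<Rightarrow> 'u vs \<Rightarrow> (nat \<Rightarrow> nat \<Rightarrow> 'u) \<Rightarrow> 'u flagfun \<Rightarrow> 'u flagfun \<Rightarrow>
   ('u flag \<Rightarrow> 'u \<Rightarrow> 'u) \<Rightarrow> 'u \<Rightarrow> 'u" where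
  "Phi_map n V e F G \<eta> = (THE h.
     h \<in> lin (fst (Phi_colim n V e F)) (fst (Phi_colim n V e G)) \<and>
     (\<forall>j. \<forall>x\<in>carrier (FOb F (diag_flag n V e j)).
        h (snd (Phi_colim n V e F) j x) = snd (Phi_colim n V e G) j (\<eta> (diag_flag n V e j) x)))"

definition Phi ::
  "nat \<Rightarrow> 'u vs \<Rightarrow> (nat \<Rightarrow> nat \<Rightarrow> 'u) \<Rightarrow>
   ('u flagfun, 'u flag \<Rightarrow> 'u \<Rightarrow> 'u, 'u rep, 'u \<Rightarrow> 'u) cfunctor" where
  "Phi n V e = \<lparr>FOb = (\<lambda>F. (fst (Phi_colim n V e F), Phi_act n V e F)), FMap = Phi_map n V e\<rparr>"

subsection \<open>From representations to functors\<close>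

definition invariants ::
  "nat \<Rightarrow> 'u vs \<Rightarrow> (nat \<Rightarrow> nat \<Rightarrow> 'u) \<Rightarrow> 'u rep \<Rightarrow> (nat \<Rightarrow> nat) \<Rightarrow> 'u vs" where
  "invariants n V e R a =
     (fst R)\<lparr>carrier := {m \<in> carrier (fst R). \<forall>h\<in>HH n V e a. snd R h m = m}\<rparr>"

definition is_lift ::
  "nat \<Rightarrow> 'u vs \<Rightarrow> (nat \<Rightarrow> nat \<Rightarrow> 'u) \<Rightarrow> (nat \<Rightarrow> nat) \<Rightarrow> (nat \<Rightarrow> nat) \<Rightarrow>
   ('u \<Rightarrow> 'u) \<Rightarrow> ('u \<Rightarrow> 'u) \<Rightarrow> bool" where
  "is_lift n V e a b f g \<longleftrightarrow> g \<in> EndV n V e \<and>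
     (\<forall>x\<in>carrier (fst (std_flag n V e a)). g x = f x) \<and>
     (\<forall>h\<in>HH n V e b. \<exists>h'\<in>HH n V e a. \<forall>v\<in>carrier V. h (g v) = g (h' v))"

definition Psi_std ::
  "nat \<Rightarrow> 'u vs \<Rightarrow> (nat \<Rightarrow> nat \<Rightarrow> 'u) \<Rightarrow> 'u rep \<Rightarrow> (nat \<Rightarrow> nat) \<Rightarrow> (nat \<Rightarrow> nat) \<Rightarrow>
   ('u \<Rightarrow> 'u) \<Rightarrow> 'u \<Rightarrow> 'u" where
  "Psi_std n V e R a b f =
     (\<lambda>m\<in>carrier (invariants n V e R a). end_act n V e R (SOME g. is_lift n V e a b f g) m)"

text \<open>The values on the flags \<open>\<complex>\<^sup>a\<close> are extended to all of \<open>Flag n\<close> along a choice of isomorphisms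
  with the flags \<open>\<complex>\<^sup>a\<close>, which is the identity on each \<open>\<complex>\<^sup>a\<close> itself.\<close>

definition flag_type :: "nat \<Rightarrow> 'u vs \<Rightarrow> (nat \<Rightarrow> nat \<Rightarrow> 'u) \<Rightarrow> 'u flag \<Rightarrow> nat \<Rightarrow> nat" where
  "flag_type n V e X = (THE a. a \<in> {1..n} \<rightarrow>\<^sub>E UNIV \<and>
     (\<exists>\<phi>. is_iso (Flag n) X (std_flag n V e a) \<phi>))"

definition std_iso :: "nat \<Rightarrow> 'u vs \<Rightarrow> (nat \<Rightarrow> nat \<Rightarrow> 'u) \<Rightarrow> 'u flag \<Rightarrow> 'u \<Rightarrow> 'u" where
  "std_iso n V e X =
     (if X = std_flag n V e (flag_type n V e X) then Idn (Flag n) X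
      else SOME \<phi>. is_iso (Flag n) X (std_flag n V e (flag_type n V e X)) \<phi>)"

text \<open>\<open>transport n V e X Y f\<close> is \<open>\<phi>\<^sub>Y \<circ> f \<circ> \<phi>\<^sub>X\<^sup>-\<^sup>1\<close> for the chosen isomorphisms \<open>\<phi>\<^sub>X\<close>.\<close>

definition transport ::
  "nat \<Rightarrow> 'u vs \<Rightarrow> (nat \<Rightarrow> nat \<Rightarrow> 'u) \<Rightarrow> 'u flag \<Rightarrow> 'u flag \<Rightarrow> ('u \<Rightarrow> 'u) \<Rightarrow> 'u \<Rightarrow> 'u" where
  "transport n V e X Y f =
     (let A = std_flag n V e (flag_type n V e X); B = std_flag n V e (flag_type n V e Y)
      in Cmp (Flag n) A Y B (std_iso n V e Y)
           (Cmp (Flag n) A X Y f (the_inverse (Flag n) X A (std_iso n V e X))))"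

definition Psi_ob :: "nat \<Rightarrow> 'u vs \<Rightarrow> (nat \<Rightarrow> nat \<Rightarrow> 'u) \<Rightarrow> 'u rep \<Rightarrow> 'u flagfun" where
  "Psi_ob n V e R = \<lparr>FOb = (\<lambda>X. invariants n V e R (flag_type n V e X)),
     FMap = (\<lambda>X Y f. Psi_std n V e R (flag_type n V e X) (flag_type n V e Y)
                        (transport n V e X Y f))\<rparr>"

definition Psi ::
  "nat \<Rightarrow> 'u vs \<Rightarrow> (nat \<Rightarrow> nat \<Rightarrow> 'u) \<Rightarrow>
   ('u rep, 'u \<Rightarrow> 'u, 'u flagfun, 'u flag \<Rightarrow> 'u \<Rightarrow> 'u) cfunctor" where
  "Psi n V e = \<lparr>FOb = Psi_ob n V e,
     FMap = (\<lambda>R R' \<theta>. \<lambda>X\<in>Ob (Flag n).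
       restrict \<theta> (carrier (invariants n V e R (flag_type n V e X))))\<rparr>"

end

theory Submission
 imports Defs
begin

text \<open>
 Both functors are evaluations of one and the same structure, and the proof consists in making this
 precise. Every finite dimensional flag \<open>X\<close> is a retract of the infinite dimensional flag on \<open>V\<close>: there are
 flag maps \<open>emb X\<close> from \<open>X\<close> to \<open>V\<close> and \<open>ret X\<close> back with \<open>ret X \<circ> emb X = id\<close>, and \<open>emb X \<circ> ret X\<close> is the
 coordinate projection \<open>\<pi>\<^sub>a\<close> of \<open>V\<close> onto \<open>\<complex>\<^sup>a\<close>, where \<open>a\<close> is the type of \<open>X\<close>. If a functor on flags also had a
 value at \<open>V\<close>, its value at \<open>X\<close> would therefore be the image of an idempotent acting on that value.

 \<^item> The colimit \<open>\<Phi> F\<close> is such a value at \<open>V\<close>: flag maps \<open>X \<rightarrow> V\<close> and \<open>V \<rightarrow> X\<close> induce maps \<open>F X \<rightarrow> \<Phi> F\<close> and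
  \<open>\<Phi> F \<rightarrow> F X\<close> (\<open>inF\<close>, \<open>outF\<close>), and every flag endomorphism of \<open>V\<close> acts on \<open>\<Phi> F\<close> (\<open>actF\<close>), functorially.
 \<^item> A polynomial representation \<open>R\<close> has an action of \<open>End V\<close> as well. It is well defined because the group is dense:
  a given endomorphism is, on a given finite set of vectors, the value at \<open>0\<close> of a curve \<open>A + t B\<close> that lies in
  the group for \<open>t \<noteq> 0\<close>. Its action on tensor powers is polynomial in \<open>t\<close>, so it is a fixed linear
  combination of actions of group elements (\<open>act_eq\<close>), and all equivariant maps commute with it. By the same argument the
  invariants of \<open>H\<^sub>a\<close> are the fixed points of \<open>\<pi>\<^sub>a\<close> (\<open>invariants_eq\<close>). Hence \<open>\<Psi> R\<close> sends \<open>f : X \<rightarrow> Y\<close> to the action of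
  \<open>emb Y \<circ> f \<circ> ret X\<close> (\<open>Psi_FMap\<close>).

 With these descriptions the unit is \<open>inF F X (emb X)\<close>, inverse to \<open>outF F X (ret X)\<close>, and the counit sends the class
 of an invariant vector to that vector; it is onto because every vector is fixed by some \<open>\<pi>\<^sub>a\<close>.
 The structure map of \<open>\<Phi>\<close> is the inverse of \<open>\<Phi>(F \<otimes> H) \<rightarrow> \<Phi> F \<otimes> \<Phi> H\<close>; that of \<open>\<Psi>\<close> is induced by the inclusions of the
 invariants. All coherence conditions are identities between linear maps out of tensor products, which are compared on pure
 tensors; since both categories have faithful families of tensor-preserving functors to vector spaces, this is done
 once and for all for categories with such fibre functors (\<open>fibred_tensor\<close>).

 Two points need work beyond this. Tensor products and colimits must be shown to exist inside the given type
 (\<open>universal_object\<close>), and \<open>\<Phi> F\<close>, \<open>\<Psi> R\<close> and tensor products must again be subquotients of sums of tensor powers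
 (\<open>Phi_presentation\<close>, \<open>Psi_poly\<close>, \<open>pres_tensor\<close>).
\<close>

text \<open>Most formulas below involve several spaces at once; a compact notation keeps them readable.\<close>

abbreviation vadd :: "'a => 'a vs => 'a => 'a" (\<open>(_ +[_] _)\<close> [65, 0, 66] 65) where
  "x +[M] y == add M x y"

abbreviation vscale :: "complex => 'a vs => 'a => 'a" (\<open>(_ *[_] _)\<close> [70, 0, 71] 70) where
  "c *[M] x == module.smult M c x"

abbreviation vzero :: "'a vs => 'a" (\<open>0[_]\<close>) where
  "0[M] == ring.zero M"

abbreviation subsp :: "'a vs => 'a set => 'a vs" (\<open>_<|_|>\<close> [900, 0] 900) where
  "M<|W|> == M(|carrier := W|)"

abbreviation cmp where
  "cmp M g f == compose (carrier M) g f"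

abbreviation car where
  "car M == carrier M"

section \<open>Complex vector spaces\<close>

lemma CC_simps [simp]:
 "car CC = UNIV" "monoid.mult CC = (*)" "one CC = 1" "zero CC = 0" "add CC = (+)"
 by (simp_all add: CC_def)

abbreviation vsp :: "'a vs => bool" where
 "vsp M == module CC M"

lemma vs_abelian: "vsp M ==> abelian_group M"
 by (simp add: module_def)

lemma vs_add [simp]: "vsp M ==> x:car M ==> y:car M ==> x +[M] y:car M"
 by (meson abelian_groupE(1) vs_abelian)

lemma vs_zero [simp]: "vsp M ==> 0[M]:car M"
 by (meson abelian_groupE(2) vs_abelian)

lemma vs_smult [simp]: "vsp M ==> x:car M ==> c *[M] x:car M"
 using module.smult_closed[of CC M c x] by simp

lemma vs_add_assoc: "vsp M ==> x:car M ==> y:car M ==> z:car M ==>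
  x +[M] y +[M] z = x +[M] (y +[M] z)"
 by (meson abelian_groupE(3) vs_abelian)

lemma vs_add_commute: "vsp M ==> x:car M ==> y:car M ==> x +[M] y = y +[M] x"
 by (meson abelian_groupE(4) vs_abelian)

lemma vs_add_left_commute: "vsp M ==> x:car M ==> y:car M ==> z:car M ==>
  x +[M] (y +[M] z) = y +[M] (x +[M] z)"
 by (metis vs_add_assoc vs_add_commute)

lemmas vs_ac = vs_add_assoc vs_add_commute vs_add_left_commute

lemma vs_add_zero [simp]:
 "vsp M ==> x:car M ==> 0[M] +[M] x = x"
 "vsp M ==> x:car M ==> x +[M] 0[M] = x"
 by (meson abelian_groupE(5) vs_abelian, metis abelian_groupE(5) vs_abelian vs_add_commute vs_zero)

lemma vs_smult_ladd: "vsp M ==> x:car M ==> (a + b) *[M] x = a *[M] x +[M] b *[M] x"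
 using module.smult_l_distr[of CC M a b x] by simp

lemma vs_smult_radd: "vsp M ==> x:car M ==> y:car M ==>
  a *[M] (x +[M] y) = a *[M] x +[M] a *[M] y"
 using module.smult_r_distr[of CC M a x y] by simp

lemma vs_smult_smult: "vsp M ==> x:car M ==> a *[M] (b *[M] x) = (a * b) *[M] x"
 using module.smult_assoc1[of CC M a b x] by simp

lemma vs_smult_one [simp]: "vsp M ==> x:car M ==> 1 *[M] x = x"
 using module.smult_one[of CC M x] by simp

lemma vs_smult_zero [simp]: "vsp M ==> x:car M ==> 0 *[M] x = 0[M]"
 using module.smult_l_null[of CC M x] by simp

lemma vs_smult_vzero [simp]: "vsp M ==> c *[M] 0[M] = 0[M]"
 using module.smult_r_null[of CC M c] by simp

lemma vs_add_neg [simp]: "vsp M ==> x:car M ==> x +[M] (-1) *[M] x = 0[M]"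
 "vsp M ==> x:car M ==> (-1) *[M] x +[M] x = 0[M]"
 using vs_smult_ladd[of M x 1 "-1"] vs_smult_ladd[of M x "-1" 1] by simp_all

lemma vs_a_inv: "vsp M ==> x:car M ==> \<ominus>\<^bsub>M\<^esub> x = (-1) *[M] x"
 by (metis abelian_group.minus_equality vs_abelian vs_add_neg(2) vs_smult)

lemma vs_add_cancel: "vsp M ==> x:car M ==> y:car M ==> z:car M ==>
  x +[M] y = x +[M] z \<longleftrightarrow> y = z"
 by (metis vs_add_assoc vs_add_neg(2) vs_add_zero(1) vs_smult)

lemma vs_eq_iff_diff: "vsp M ==> x:car M ==> y:car M ==>
  x +[M] (-1) *[M] y = 0[M] \<longleftrightarrow> x = y"
 by (metis vs_add_cancel vs_add_commute vs_add_neg(1) vs_smult)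

lemma vs_smult_cancel: "vsp M ==> x:car M ==> c *[M] x = 0[M] ==> c = 0 | x = 0[M]"
 by (metis left_inverse vs_smult_one vs_smult_smult vs_smult_vzero)

lemma vsI:
 assumes "!!x y. x:car M ==> y:car M ==> x +[M] y:car M"
  and "0[M]:car M"
  and sc: "!!c x. x:car M ==> c *[M] x:car M"
  and "!!x y z. x:car M ==> y:car M ==> z:car M ==>
   x +[M] y +[M] z = x +[M] (y +[M] z)"
  and "!!x y. x:car M ==> y:car M ==> x +[M] y = y +[M] x"
  and z: "!!x. x:car M ==> 0[M] +[M] x = x"
  and n: "!!x. x:car M ==> 0 *[M] x = 0[M]"
  and l: "!!a b x. x:car M ==> (a + b) *[M] x = a *[M] x +[M] b *[M] x"
  and "!!a x y. x:car M ==> y:car M ==>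
   a *[M] (x +[M] y) = a *[M] x +[M] a *[M] y"
  and "!!a b x. x:car M ==> (a * b) *[M] x = a *[M] (b *[M] x)"
  and o: "!!x. x:car M ==> 1 *[M] x = x"
 shows "vsp M"
proof (rule moduleI)
 show "cring CC"
  using field_CC by (simp add: field_def domain_def)
 have neg: "(-1) *[M] x +[M] x = 0[M]" if "x:car M" for x
  using l[OF that, of "-1" 1] n[OF that] o[OF that] by simp
 show "abelian_group M"
 proof (rule abelian_groupI)
  show "EX y:car M. y +[M] x = 0[M]" if "x:car M" for x
   using sc neg that by blast
 qed (fact assms)+
qed (simp, fact assms)+

subsection \<open>Subspaces\<close>

lemma submodule_iff:
 assumes "vsp M"
 shows "submodule W CC M \<longleftrightarrow> W <= car M & 0[M]:W \<and>
  (ALL x:W. ALL y:W. x +[M] y:W) & (ALL c. ALL x:W. c *[M] x:W)"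
proof
 assume L: "submodule W CC M"
 from module.submoduleE[OF assms L] have
  "W <= car M" "W ~= {}" "!!a b. b:W ==> a *[M] b:W" "!!a b. a:W ==> b:W ==> a +[M] b:W"
  by auto
 thus "W <= car M & 0[M]:W \<and>
  (ALL x:W. ALL y:W. x +[M] y:W) & (ALL c. ALL x:W. c *[M] x:W)"
  by (metis all_not_in_conv assms subsetD vs_smult_zero)
next
 assume R: "W <= car M & 0[M]:W \<and>
  (ALL x:W. ALL y:W. x +[M] y:W) & (ALL c. ALL x:W. c *[M] x:W)"
 show "submodule W CC M"
 proof (rule module.submoduleI[OF assms])
  show "\<ominus>\<^bsub>M\<^esub> a:W" if "a:W" for a
   using that R by (metis assms subsetD vs_a_inv)
 qed (use R in auto)
qed

lemma submoduleI:
 assumes "vsp M" "W <= car M" "0[M]:W"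
  "!!x y. x:W ==> y:W ==> x +[M] y:W" "!!c x. x:W ==> c *[M] x:W"
 shows "submodule W CC M"
 using assms by (simp add: submodule_iff)

lemma submoduleD:
 assumes "vsp M" "submodule W CC M"
 shows "W <= car M" "0[M]:W"
  "!!x y. x:W ==> y:W ==> x +[M] y:W" "!!c x. x:W ==> c *[M] x:W"
  "!!x. x:W ==> x:car M"
 using assms by (auto simp add: submodule_iff)

lemma submodule_vspace:
 assumes "vsp M" "submodule W CC M"
 shows "vsp (M<|W|>)"
proof -
 note D = submoduleD[OF assms]
 show ?thesis
  by (rule vsI) (simp_all add: assms(1) D vs_ac vs_smult_ladd vs_smult_radd vs_smult_smult)
qed

lemma submodule_carrier [simp]: "vsp M ==> submodule (car M) CC M"
 by (simp add: submodule_iff)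

lemma submodule_singleton_zero [simp]: "vsp M ==> submodule {0[M]} CC M"
 by (simp add: submodule_iff)

lemma submodule_trans:
 assumes "vsp M" "submodule W CC M" "submodule U CC (M<|W|>)"
 shows "submodule U CC M"
 using assms submodule_vspace[OF assms(1,2)] by (auto simp add: submodule_iff)

lemma submodule_restrict:
 assumes "vsp M" "submodule W CC M" "submodule U CC M" "U <= W"
 shows "submodule U CC (M<|W|>)"
 using assms submodule_vspace[OF assms(1,2)] by (auto simp add: submodule_iff)

lemma submodule_lspan:
 assumes "vsp M" "S <= car M" shows "submodule (lspan M S) CC M"
 using assms by (auto simp: submodule_iff lspan_def)

lemma lspan_incl: "S <= lspan M S"
 by (auto simp: lspan_def)

lemma lspan_least: "submodule W CC M ==> S <= W ==> lspan M S <= W"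
 by (auto simp: lspan_def)

lemma lspan_sub: "vsp M ==> S <= car M ==> lspan M S <= car M"
 by (simp add: lspan_least)

lemma lspan_mono: "S <= T ==> lspan M S <= lspan M T"
 by (auto simp: lspan_def)

lemma lspan_restrict:
 assumes "vsp M" "submodule W CC M" "S <= W"
 shows "lspan (M<|W|>) S = lspan M S"
proof -
 have SM: "S <= car M"
  using assms submoduleD(1) by blast
 have v: "vsp (M<|W|>)"
  by (simp add: assms submodule_vspace)
 show ?thesis
 proof (rule antisym; rule lspan_least)
  show "submodule (lspan M S) CC (M<|W|>)"
   by (simp add: assms SM submodule_lspan submodule_restrict lspan_least)
  show "submodule (lspan (M<|W|>) S) CC M"
   by (rule submodule_trans[OF assms(1,2) submodule_lspan[OF v]]) (simp add: assms)
 qed (simp_all add: lspan_incl)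
qed

subsection \<open>Linear maps\<close>

lemma linear_onI:
 assumes "!!x. x:car V ==> f x:car W"
  "!!x y. x:car V ==> y:car V ==> f (x +[V] y) = f x +[W] f y"
  "!!c x. x:car V ==> f (c *[V] x) = c *[W] f x"
 shows "linear_on V W f"
 using assms by (auto simp: linear_on_def)

lemma linear_onD:
 assumes "linear_on V W f"
 shows "!!x. x:car V ==> f x:car W"
  "!!x y. x:car V ==> y:car V ==> f (x +[V] y) = f x +[W] f y"
  "!!c x. x:car V ==> f (c *[V] x) = c *[W] f x"
 using assms by (auto simp: linear_on_def)

lemma linear_on_zero:
 assumes "vsp V" "vsp W" "linear_on V W f"
 shows "f 0[V] = 0[W]"
 using linear_onD(3)[OF assms(3), of "0[V]" 0] linear_onD(1)[OF assms(3)] assms by simp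

lemma linear_on_cong: "(!!x. x:car V ==> f x = g x) ==> vsp V ==> linear_on V W f \<longleftrightarrow> linear_on V W g"
 by (auto simp: linear_on_def Pi_def)

lemma linear_on_restrict_iff [simp]:
 "vsp V ==> linear_on V W (restrict f (car V)) \<longleftrightarrow> linear_on V W f"
 by (rule linear_on_cong) auto

lemma lin_comp: "linear_on U V f ==> linear_on V W g ==> linear_on U W (%x. g (f x))"
 by (auto simp: linear_on_def Pi_def)

lemma linear_on_ident: "linear_on V V (%x. x)"
 by (simp add: linear_on_def)

lemma linear_on_sub: "vsp V ==> submodule S CC V ==> linear_on V W f ==> linear_on (V<|S|>) W f"
 by (rule linear_onI) (simp_all add: linear_onD submoduleD(5)[of V S])

lemma linI: "vsp V ==> linear_on V W f ==> restrict f (car V):lin V W"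
 by (simp add: lin_def)

lemma linD: "f:lin V W ==> linear_on V W f"
 by (simp add: lin_def)

lemma lin_closed: "f:lin V W ==> x:car V ==> f x:car W"
 by (auto simp: lin_def linear_on_def)

lemma lin_add: "f:lin V W ==> x:car V ==> y:car V ==> f (x +[V] y) = f x +[W] f y"
 by (auto simp: lin_def linear_on_def)

lemma lin_smult: "f:lin V W ==> x:car V ==> f (c *[V] x) = c *[W] f x"
 by (auto simp: lin_def linear_on_def)

lemma lin_zero: "vsp V ==> vsp W ==> f:lin V W ==> f 0[V] = 0[W]"
 by (simp add: linD linear_on_zero)

lemma lin_eqI: "f:lin V W ==> g:lin V W' ==> (!!x. x:car V ==> f x = g x) ==> f = g"
 by (auto simp: lin_def intro: extensionalityI)

lemma lin_id_in [simp]: "vsp V ==> lin_id V:lin V V"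
 by (auto simp: lin_id_def lin_def linear_on_def)

lemma lin_id_apply [simp]: "x:car V ==> lin_id V x = x"
 by (simp add: lin_id_def)

lemma lin_compose: "vsp U ==> f:lin U V ==> g:lin V W ==> cmp U g f:lin U W"
 using lin_comp[of U V f W g] by (simp add: lin_def compose_def)

lemma compose_apply [simp]: "x:A ==> compose A g f x = g (f x)"
 by (simp add: compose_def)

lemma lin_id_sub: "vsp M ==> submodule W CC M ==> lin_id (M<|W|>):lin (M<|W|>) M"
 by (auto simp: lin_id_def lin_def linear_on_def submodule_iff)

lemma lin_restrict_sub: "vsp M ==> submodule W CC M ==> f:lin M N ==>
  restrict f W:lin (M<|W|>) N"
 by (auto simp: lin_def linear_on_def submodule_iff Pi_def subset_iff)

lemma lin_corestrict: "f:lin M N ==> (!!x. x:car M ==> f x:W) ==> f:lin M (N<|W|>)"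
 by (auto simp: lin_def linear_on_def)

lemma lin_cowiden: "f:lin M (N<|W|>) ==> W <= car N ==> f:lin M N"
 by (auto simp: lin_def linear_on_def)

lemma submodule_preimage:
 assumes "vsp V" "vsp W" "linear_on V W f" "submodule U CC W"
 shows "submodule {x:car V. f x:U} CC V"
 using assms linear_on_zero[OF assms(1-3)]
 by (intro submoduleI) (auto simp: linear_on_def submodule_iff)

lemma submodule_eqset:
 assumes "vsp V" "vsp W" "linear_on V W f" "linear_on V W g"
 shows "submodule {x:car V. f x = g x} CC V"
 using assms linear_on_zero[OF assms(1-3)] linear_on_zero[OF assms(1,2,4)]
 by (intro submoduleI) (auto simp: linear_on_def)

lemma submodule_image:
 assumes "vsp V" "vsp W" "linear_on V W f" "submodule U CC V"
 shows "submodule (f ` U) CC W"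
proof (rule submoduleI)
 note D = linear_onD[OF assms(3)] submoduleD[OF assms(1,4)]
 show "0[W]:f ` U"
  using linear_on_zero[OF assms(1-3)] D(5) by (metis imageI)
 show "x +[W] y:f ` U" if "x:f ` U" "y:f ` U" for x y
 proof -
  obtain a b where "a:U" "b:U" "x = f a" "y = f b"
   using \<open>x:f ` U\<close> \<open>y:f ` U\<close> by auto
  thus ?thesis
   using D(6)[of a b] by (auto simp: D(2,8) intro!: image_eqI[of _ _ "a +[V] b"])
 qed
 show "c *[W] x:f ` U" if "x:f ` U" for c x
 proof -
  obtain a where "a:U" "x = f a"
   using \<open>x:f ` U\<close> by auto
  thus ?thesis
   using D(7)[of a c] by (auto simp: D(3,8) intro!: image_eqI[of _ _ "c *[V] a"])
 qed
 show "f ` U <= car W"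
  using D by auto
qed (use assms in auto)

lemma lspan_induct_linear:
 assumes "vsp V" "vsp W" "linear_on V W f" "linear_on V W g"
  "S <= car V" "!!x. x:S ==> f x = g x" "x:lspan V S"
 shows "f x = g x"
 using lspan_least[OF submodule_eqset[OF assms(1-4)], of S] assms(5-7) by blast

lemma image_lspan:
 assumes "vsp V" "vsp W" "linear_on V W f" "S <= car V"
 shows "f ` lspan V S = lspan W (f ` S)"
proof
 have fS: "f ` S <= car W"
  using assms(4) linear_onD(1)[OF assms(3)] by blast
 have "lspan V S <= {x:car V. f x:lspan W (f ` S)}"
 proof (rule lspan_least)
  show "submodule {x:car V. f x:lspan W (f ` S)} CC V"
   by (rule submodule_preimage[OF assms(1-3) submodule_lspan[OF assms(2) fS]])
  show "S <= {x:car V. f x:lspan W (f ` S)}"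
   using assms(4) lspan_incl[of "f ` S" W] by blast
 qed
 thus "f ` lspan V S <= lspan W (f ` S)"
  by blast
 show "lspan W (f ` S) <= f ` lspan V S"
  by (rule lspan_least[OF submodule_image[OF assms(1-3) submodule_lspan[OF assms(1,4)]]])
   (rule image_mono[OF lspan_incl])
qed

lemma fin_dim_image:
 assumes "vsp V" "vsp W" "linear_on V W f" "f ` car V = car W" "fin_dim V"
 shows "fin_dim W"
proof -
 obtain S where S: "finite S" "S <= car V" "lspan V S = car V"
  using assms(5) by (auto simp: fin_dim_def)
 hence "lspan W (f ` S) = car W"
  using image_lspan[OF assms(1-3) S(2)] assms(4) by simp
 thus ?thesis
  using S assms(4) unfolding fin_dim_def by (intro exI[of _ "f ` S"]) (auto intro!: linear_onD(1)[OF assms(3)])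
qed

lemma lin_inverse:
 assumes "vsp V" "vsp W" "f:lin V W" "bij_betw f (car V) (car W)"
 shows "restrict (inv_into (car V) f) (car W):lin W V"
proof -
 let ?g = "inv_into (car V) f"
 have g: "?g y:car V" "f (?g y) = y" if "y:car W" for y
  using that assms(4) by (auto simp: bij_betw_def inv_into_into f_inv_into_f)
 have i: "x = y" if "x:car V" "y:car V" "f x = f y" for x y
  using that assms(4) by (auto simp: bij_betw_def inj_on_def)
 have "linear_on W V ?g"
 proof (rule linear_onI)
  show "?g (x +[W] y) = ?g x +[V] ?g y" if xy: "x:car W" "y:car W" for x y
  proof (rule i)
   show "f (?g (x +[W] y)) = f (?g x +[V] ?g y)"
    using xy by (simp add: g assms(2) lin_add[OF assms(3)])
  qed (simp_all add: xy g assms(1,2))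
  show "?g (c *[W] x) = c *[V] ?g x" if x: "x:car W" for c x
  proof (rule i)
   show "f (?g (c *[W] x)) = f (c *[V] ?g x)"
    using x by (simp add: g assms(2) lin_smult[OF assms(3)])
  qed (simp_all add: x g assms(1,2))
 qed (rule g)
 thus ?thesis
  using assms(2) by (simp add: linI)
qed

lemma lin_inj_iff:
 assumes "vsp V" "vsp W" "linear_on V W f" "!!x. x:car V ==> f x = 0[W] ==> x = 0[V]"
 shows "inj_on f (car V)"
proof (rule inj_onI)
 fix x y assume xy: "x:car V" "y:car V" "f x = f y"
 hence "f (x +[V] (-1) *[V] y) = 0[W]"
  using assms linear_onD[OF assms(3)] by (simp add: vs_eq_iff_diff)
 thus "x = y"
  using assms(4)[of "x +[V] (-1) *[V] y"] vs_eq_iff_diff[OF assms(1) xy(1,2)] assms(1) xy by simp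
qed

subsection \<open>Spaces of linear maps\<close>

lemma lin_space_simps [simp]:
 "car (lin_space V W) = lin V W"
 "0[lin_space V W] = (\<lambda>x\<in>car V. 0[W])"
 "f +[lin_space V W] g = (\<lambda>x\<in>car V. f x +[W] g x)"
 "c *[lin_space V W] f = (\<lambda>x\<in>car V. c *[W] f x)"
 by (simp_all add: lin_space_def)

lemma lin_space_closed:
 assumes "vsp V" "vsp W"
 shows "(\<lambda>x\<in>car V. 0[W]):lin V W"
  "f:lin V W ==> g:lin V W ==> (\<lambda>x\<in>car V. f x +[W] g x):lin V W"
  "f:lin V W ==> (\<lambda>x\<in>car V. c *[W] f x):lin V W"
 using assms
 by (auto simp: lin_def linear_on_def Pi_def vs_ac vs_smult_radd vs_smult_smult mult.commute)

lemma lin_space_vspace: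
 assumes "vsp V" "vsp W"
 shows "vsp (lin_space V W)"
proof -
 have e: "(\<lambda>x\<in>car V. f x) = f" if "f:lin V W" for f
  using that by (simp add: lin_def extensional_restrict)
 note c = lin_closed[of _ V W]
 show ?thesis
 proof (rule vsI, goal_cases)
  case (4 x y z)
  thus ?case by (auto intro!: restrict_ext simp: vs_add_assoc assms c)
 next
  case (5 x y)
  thus ?case by (auto intro!: restrict_ext simp: vs_add_commute assms c)
 next
  case (6 f)
  hence "(\<lambda>x\<in>car V. 0[W] +[W] f x) = (\<lambda>x\<in>car V. f x)"
   by (intro restrict_ext) (simp add: assms c)
  with 6 e show ?case by (simp cong: restrict_cong)
 next
  case (7 f)
  thus ?case by (auto intro!: restrict_ext simp: assms c)
 next
  case (8 a b x)
  thus ?case by (auto intro!: restrict_ext simp: vs_smult_ladd assms c)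
 next
  case (9 a x y)
  thus ?case by (auto intro!: restrict_ext simp: vs_smult_radd assms c)
 next
  case (10 a b x)
  thus ?case by (auto intro!: restrict_ext simp: vs_smult_smult assms c)
 next
  case (11 f)
  hence "(\<lambda>x\<in>car V. 1 *[W] f x) = (\<lambda>x\<in>car V. f x)"
   by (intro restrict_ext) (simp add: assms c)
  with 11 e show ?case by simp
 qed (simp_all add: lin_space_closed[OF assms])
qed

lemma bilinear_onI:
 assumes "!!v w. v:car V ==> w:car W ==> b v w:car P"
  "!!v v' w. v:car V ==> v':car V ==> w:car W ==> b (v +[V] v') w = b v w +[P] b v' w"
  "!!v w w'. v:car V ==> w:car W ==> w':car W ==> b v (w +[W] w') = b v w +[P] b v w'"
  "!!c v w. v:car V ==> w:car W ==> b (c *[V] v) w = c *[P] b v w"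
  "!!c v w. v:car V ==> w:car W ==> b v (c *[W] w) = c *[P] b v w"
 shows "bilinear_on V W P b"
 using assms by (auto simp: bilinear_on_def linear_on_def)

lemma bilinear_onD:
 assumes "bilinear_on V W P b"
 shows "!!v w. v:car V ==> w:car W ==> b v w:car P"
  "!!v v' w. v:car V ==> v':car V ==> w:car W ==> b (v +[V] v') w = b v w +[P] b v' w"
  "!!v w w'. v:car V ==> w:car W ==> w':car W ==> b v (w +[W] w') = b v w +[P] b v w'"
  "!!c v w. v:car V ==> w:car W ==> b (c *[V] v) w = c *[P] b v w"
  "!!c v w. v:car V ==> w:car W ==> b v (c *[W] w) = c *[P] b v w"
 using assms by (auto simp: bilinear_on_def linear_on_def)

section \<open>Extension of linear maps\<close>

text \<open>A maximal partial extension, in the sense of Zorn's lemma, is defined everywhere. Applied to the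
 identity of a subspace this gives a linear retraction onto it.\<close>

lemma linear_extension:
 assumes V: "vsp V" and W: "vsp W" and S: "submodule S CC V"
  and p: "linear_on (V<|S|>) W p"
 shows "EX q. linear_on V W q & (ALL x:S. q x = p x)"
proof -
 note SD = submoduleD[OF V S] and pD = linear_onD[OF p, simplified]
 define A where "A = {G. G <= car V \<times> car W & (ALL x:S. (x, p x):G) \<and>
  (ALL x y x' y'. (x, y):G --> (x', y'):G --> (x +[V] x', y +[W] y'):G) \<and>
  (ALL c x y. (x, y):G --> (c *[V] x, c *[W] y):G) \<and>
  (ALL y. (0[V], y):G --> y = 0[W])}"
 have p0: "p 0[V] = 0[W]"
  using linear_on_zero[OF submodule_vspace[OF V S] W p] by simp
 have G0: "{(x, p x) | x. x:S}:A"
  unfolding A_def using p0 by (auto simp: SD pD)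
 have "EX M:A. ALL X:A. M <= X --> X = M"
 proof (rule subset_Zorn_nonempty)
  show "A ~= {}"
   using G0 by blast
  fix C assume C: "C ~= {}" "subset.chain A C"
  have sub: "X:A" if "X:C" for X
   using that C(2) by (auto simp: subset.chain_def)
  have tot: "X <= Y | Y <= X" if "X:C" "Y:C" for X Y
   using that C(2) by (auto simp: subset.chain_def)
  have "\<Union>C <= car V \<times> car W"
   using sub unfolding A_def by blast
  moreover have "(x, p x):\<Union>C" if "x:S" for x
  proof -
   obtain X where "X:C" using C(1) by blast
   thus ?thesis using sub[of X] that unfolding A_def by blast
  qed
  moreover have "(x +[V] x', y +[W] y'):\<Union>C" if xy: "(x, y):\<Union>C" "(x', y'):\<Union>C" for x y x' y'
  proof -
   obtain X Y where "X:C" "Y:C" "(x, y):X" "(x', y'):Y"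
    using xy by blast
   then obtain Z where Z: "Z:C" "(x, y):Z" "(x', y'):Z"
    using tot[of X Y] by blast
   thus ?thesis using sub[OF Z(1)] unfolding A_def by blast
  qed
  moreover have "(c *[V] x, c *[W] y):\<Union>C" if "(x, y):\<Union>C" for c x y
   using that sub unfolding A_def by blast
  moreover have "y = 0[W]" if "(0[V], y):\<Union>C" for y
   using that sub unfolding A_def by blast
  ultimately show "\<Union>C:A"
   unfolding A_def by simp
 qed
 then obtain M where MA: "M:A" and M_max: "!!X. X:A ==> M <= X ==> X = M"
  by blast
 have Msub: "!!x y. (x, y):M ==> x:car V & y:car W"
  and Mp: "!!x. x:S ==> (x, p x):M"
  and Madd: "!!x y x' y'. (x, y):M ==> (x', y'):M ==> (x +[V] x', y +[W] y'):M"
  and Msm: "!!c x y. (x, y):M ==> (c *[V] x, c *[W] y):M"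
  and M0: "!!y. (0[V], y):M ==> y = 0[W]"
  using MA unfolding A_def by auto
 have Mun: "y = y'" if "(x, y):M" "(x, y'):M" for x y y'
 proof -
  have "(x +[V] (-1) *[V] x, y +[W] (-1) *[W] y'):M"
   by (intro Madd Msm that)
  thus ?thesis
   using Msub[OF that(1)] Msub[OF that(2)] M0[of "y +[W] (-1) *[W] y'"] V W by (simp add: vs_eq_iff_diff)
 qed
 have total: "EX y. (v, y):M" if v: "v:car V" for v
 proof (rule ccontr)
  assume nv: "\<nexists>y. (v, y):M"
  define M' where "M' = {(x +[V] c *[V] v, y) | x y c. (x, y):M}"
  have MM': "M <= M'"
  proof
   fix z assume z: "z:M"
   obtain x y where xy: "z = (x, y)" by force
   hence "z = (x +[V] 0 *[V] v, y)"
    using Msub[of x y] z v V by simp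
   moreover have "(x, y):M"
    using z xy by simp
   ultimately show "z:M'"
    unfolding M'_def by (intro CollectI exI[of _ x] exI[of _ y] exI[of _ 0]) simp
  qed
  have "M':A"
   unfolding A_def
  proof (intro CollectI conjI allI impI ballI)
   show "M' <= car V \<times> car W"
    using Msub v V by (auto simp: M'_def)
   show "(x, p x):M'" if "x:S" for x
    using Mp[OF that] MM' by blast
  next
   fix x y x' y' assume "(x, y):M'" "(x', y'):M'"
   then obtain a c a' c' where *: "x = a +[V] c *[V] v" "(a, y):M"
    "x' = a' +[V] c' *[V] v" "(a', y'):M"
    by (auto simp: M'_def)
   have "x +[V] x' = (a +[V] a') +[V] (c + c') *[V] v"
    using Msub[OF *(2)] Msub[OF *(4)] v V by (simp add: * vs_smult_ladd vs_ac)
   thus "(x +[V] x', y +[W] y'):M'"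
    using Madd[OF *(2,4)] unfolding M'_def by blast
  next
   fix b x y assume "(x, y):M'"
   then obtain a c where *: "x = a +[V] c *[V] v" "(a, y):M"
    by (auto simp: M'_def)
   have "b *[V] x = b *[V] a +[V] (b * c) *[V] v"
    using Msub[OF *(2)] v V by (simp add: * vs_smult_radd vs_smult_smult)
   thus "(b *[V] x, b *[W] y):M'"
    using Msm[OF *(2)] unfolding M'_def by blast
  next
   fix y assume "(0[V], y):M'"
   then obtain a c where *: "0[V] = a +[V] c *[V] v" "(a, y):M"
    by (auto simp: M'_def)
   note a = Msub[OF *(2)]
   show "y = 0[W]"
   proof (cases "c = 0")
    case True
    thus ?thesis using * a v V M0 by simp
   next
    case False
    have "a = (- 1) *[V] (c *[V] v)"
    proof -
    have "c *[V] v +[V] a = c *[V] v +[V] (- 1) *[V] (c *[V] v)"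
    using *(1) a v V vs_add_commute[of V a "c *[V] v"] by simp
    thus ?thesis
    using a v V by (subst (asm) vs_add_cancel) simp_all
    qed
    hence "(- (1 / c)) *[V] a = v"
    using False v V by (simp add: vs_smult_smult)
    thus ?thesis
    using Msm[OF *(2), of "- (1 / c)"] nv by simp
   qed
  qed
  hence "M' = M"
   using M_max MM' by blast
  moreover have "(v, 0[W]):M'"
  proof -
   have "(0[V] +[V] 1 *[V] v, 0[W]):M'"
    using Mp[OF SD(2)] p0 unfolding M'_def by force
   thus ?thesis using v V by simp
  qed
  ultimately show False using nv by blast
 qed
 define q where "q x = (THE y. (x, y):M)" for x
 have q: "q x = y" if "(x, y):M" for x y
  unfolding q_def using that Mun by blast
 have qM: "(x, q x):M" if "x:car V" for x
  using total[OF that] q by auto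
 have "linear_on V W q"
 proof (rule linear_onI)
  show "q x:car W" if "x:car V" for x
   using Msub[OF qM[OF that]] by simp
  show "q (x +[V] y) = q x +[W] q y" if "x:car V" "y:car V" for x y
   by (rule q[OF Madd[OF qM[OF that(1)] qM[OF that(2)]]])
  show "q (c *[V] x) = c *[W] q x" if "x:car V" for c x
   by (rule q[OF Msm[OF qM[OF that]]])
 qed
 thus ?thesis
  using q Mp by blast
qed

section \<open>Universal objects\<close>

lemma inj_lists:
 fixes p :: "'u \<times> 'u => 'u"
 assumes p: "inj p" and inf: "infinite (UNIV :: 'u set)"
 shows "EX f :: 'u list => 'u. inj f"
proof -
 obtain \<nu> :: "nat => 'u" where \<nu>: "inj \<nu>"
  using infinite_countable_subset[OF inf] by blast
 define g where "g = rec_list (\<nu> 0) (%x xs r. p (x, r))"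
 have g: "g [] = \<nu> 0" "!!x xs. g (x # xs) = p (x, g xs)"
  by (simp_all add: g_def)
 have eq: "xs = ys" if "length xs = length ys" "g xs = g ys" for xs ys
  using that by (induction xs ys rule: list_induct2) (auto simp: g dest: injD[OF p])
 have "inj (%xs. p (\<nu> (length xs), g xs))"
 proof (rule injI)
  fix xs ys assume "p (\<nu> (length xs), g xs) = p (\<nu> (length ys), g ys)"
  hence "\<nu> (length xs) = \<nu> (length ys)" "g xs = g ys"
   using injD[OF p] by blast+
  thus "xs = ys"
   using injD[OF \<nu>] eq by blast
 qed
 thus ?thesis by blast
qed

locale vs_universe =
 fixes L :: "'u vs" and l :: 'u
 assumes L_vspace: "vsp L" and l_in: "l:car L" and l_nonzero: "l ~= 0[L]"
begin

lemma inj_scalar: "inj (%c. c *[L] l)"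
proof (rule injI)
 fix a b assume ab: "a *[L] l = b *[L] l"
 have "(a - b) *[L] l = 0[L]"
  using vs_smult_ladd[OF L_vspace l_in, of a "- b"] vs_smult_ladd[OF L_vspace l_in, of b "- b"] ab
   L_vspace l_in by simp
 thus "a = b"
  using vs_smult_cancel[OF L_vspace l_in, of "a - b"] l_nonzero by simp
qed

lemma infinite_universe: "infinite (UNIV :: 'u set)"
 using inj_scalar infinite_UNIV_char_0 finite_imageD[of "%c. c *[L] l" UNIV]
 by (metis finite_subset top_greatest)

lemma inj_pair: "EX p :: 'u \<times> 'u => 'u. inj p"
proof -
 have "(card_of ((UNIV :: 'u set) \<times> (UNIV :: 'u set)), card_of (UNIV :: 'u set)):ordIso"
  by (rule card_of_Times_same_infinite[OF infinite_universe])
 then obtain f :: "'u \<times> 'u => 'u" where "bij_betw f (UNIV \<times> UNIV) UNIV"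
  using card_of_ordIso by blast
 thus ?thesis
  by (auto simp: bij_betw_def)
qed

text \<open>An infinite set is equinumerous with the set of its finite lists.\<close>

lemma inj_combinations:
 assumes "inj (j :: 'g => 'u)"
 shows "EX f :: (complex \<times> 'g) list => 'u. inj f"
proof -
 obtain p :: "'u \<times> 'u => 'u" where p: "inj p"
  using inj_pair by blast
 obtain f :: "'u list => 'u" where f: "inj f"
  using inj_lists[OF p infinite_universe] by blast
 have i: "inj (%(c, g). p (c *[L] l, j g))"
  by (auto intro!: injI dest!: injD[OF p] injD[OF assms] injD[OF inj_scalar])
 show ?thesis
  using inj_compose[OF f] i by (metis inj_mapI)
qed

text \<open>Elements of the object generated by \<open>Gens\<close> are formal linear combinations, two of them
 being identified when every test object gives them the same value. There are no more combinations than
 elements of \<open>'u\<close>, because \<open>'u\<close> contains a line and is infinite; so the quotient can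
 be realised inside \<open>'u\<close>. The last clause says that tests separate points, whence the uniqueness
 of the induced maps.\<close>

lemma universal_object:
 fixes K :: "'u vs => ('g => 'u) => bool" and Gens :: "'g set" and j :: "'g => 'u"
 assumes j: "inj j"
  and tests: "ALL P m. K P m --> vsp P & (ALL g:Gens. m g:car P)"
 shows "EX (T :: 'u vs) ta. vsp T & (ALL g:Gens. ta g:car T) \<and>
  (ALL P m. K P m --> (EX! h. h:lin T P & (ALL g:Gens. h (ta g) = m g))) \<and>
  (ALL x:car T. ALL y:car T.
   (ALL P m h. K P m --> h:lin T P --> (ALL g:Gens. h (ta g) = m g) --> h x = h y) --> x = y)"
proof -
 have K: "!!P m. K P m ==> vsp P" "!!P m g. K P m ==> g:Gens ==> m g:car P"
  using tests by auto
 obtain enc :: "(complex \<times> 'g) list => 'u" where enc: "inj enc"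
  using inj_combinations[OF j] by blast
 define dec where "dec = inv_into UNIV enc"
 have dec_enc [simp]: "dec (enc xs) = xs" for xs
  by (simp add: dec_def enc)
 define ev :: "('u vs) => ('g => 'u) => (complex \<times> 'g) list => 'u" where
  "ev P m xs = foldr (%cg acc. fst cg *[P] m (snd cg) +[P] acc) xs 0[P]" for P :: "'u vs" and m xs
 have ev_simps [simp]: "ev P m [] = 0[P]" "ev P m (cg # xs) = fst cg *[P] m (snd cg) +[P] ev P m xs"
  for P m cg xs by (simp_all add: ev_def)
 define valid where "valid = {xs :: (complex \<times> 'g) list. ALL cg:set xs. snd cg:Gens}"
 have valid_simps [simp]: "[]:valid" "cg # xs:valid \<longleftrightarrow> snd cg:Gens & xs:valid"
  "xs @ ys:valid \<longleftrightarrow> xs:valid & ys:valid" for cg xs ys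
  by (auto simp: valid_def)
 define sc where "sc c xs = map (%cg. (c * fst cg, snd cg)) xs" for c and xs :: "(complex \<times> 'g) list"
 have sc_valid [simp]: "xs:valid ==> sc c xs:valid" for c xs
  by (auto simp: valid_def sc_def)
 have ev_in [simp]: "ev P m xs:car P" if "vsp P" "!!g. g:Gens ==> m g:car P" "xs:valid" for P m xs
  using that(3) by (induction xs) (use that in auto)
 have ev_append: "ev P m (xs @ ys) = ev P m xs +[P] ev P m ys"
  if "vsp P" "!!g. g:Gens ==> m g:car P" "xs:valid" "ys:valid" for P m xs ys
  using that(3) by (induction xs) (use that(1,2,4) in "simp_all add: vs_add_assoc")
 have ev_sc: "ev P m (sc c xs) = c *[P] ev P m xs"
  if "vsp P" "!!g. g:Gens ==> m g:car P" "xs:valid" for P m xs c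
  using that(3) by (induction xs) (use that(1,2) in "simp_all add: sc_def vs_smult_radd vs_smult_smult")
 define rel where "rel xs ys \<longleftrightarrow> (ALL P m. K P m --> ev P m xs = ev P m ys)" for xs ys
 define nf where "nf xs = enc (SOME ys. ys:valid & rel xs ys)" for xs
 have F1: "dec (nf xs):valid & rel xs (dec (nf xs))" if "xs:valid" for xs
 proof -
  have "xs:valid & rel xs xs" using that by (simp add: rel_def)
  from someI[of "%ys. ys:valid & rel xs ys", OF this] show ?thesis
   by (simp add: nf_def)
 qed
 have nf_eq: "nf xs = nf ys" if "rel xs ys" for xs ys
 proof -
  have "rel xs = rel ys" using that unfolding rel_def by (intro ext) auto
  thus ?thesis by (simp add: nf_def)
 qed
 define T :: "'u vs" where "T = (|carrier = nf ` valid, monoid.mult = undefined, one = undefined,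
   zero = nf [], add = (%x y. nf (dec x @ dec y)), module.smult = (%c x. nf (sc c (dec x)))|)"
 have T_simps: "car T = nf ` valid" "0[T] = nf []" "x +[T] y = nf (dec x @ dec y)"
  "c *[T] x = nf (sc c (dec x))" for x y c
  by (simp_all add: T_def)
 define E where "E P m x = ev P m (dec x)" for P m x
 have dv: "dec x:valid" if "x:car T" for x
  using that F1 by (auto simp: T_simps)
 have E_nf: "E P m (nf xs) = ev P m xs" if "K P m" "xs:valid" for P m xs
  using F1[OF that(2)] that(1) by (simp add: E_def rel_def)
 have sep: "x = y" if xy: "x:car T" "y:car T" and e: "!!P m. K P m ==> E P m x = E P m y" for x y
 proof -
  obtain xs ys where *: "xs:valid" "x = nf xs" "ys:valid" "y = nf ys"
   using xy by (auto simp: T_simps)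
  have "rel xs ys"
   unfolding rel_def
  proof (intro allI impI)
   fix P m assume k: "K P m"
   show "ev P m xs = ev P m ys"
    using e[OF k] E_nf[OF k *(1)] E_nf[OF k *(3)] * by simp
  qed
  thus ?thesis using nf_eq * by simp
 qed
 have T_closed: "0[T]:car T" "!!x y. x:car T ==> y:car T ==> x +[T] y:car T"
  "!!c x. x:car T ==> c *[T] x:car T"
  using dv by (auto simp: T_simps)
 have E_in: "E P m x:car P" if "K P m" "x:car T" for P m x
  unfolding E_def by (rule ev_in) (use K that dv in auto)
 have E_zero: "E P m 0[T] = 0[P]" if "K P m" for P m
  using E_nf[OF that, of "[]"] by (simp add: T_simps)
 have E_add: "E P m (x +[T] y) = E P m x +[P] E P m y" if "K P m" "x:car T" "y:car T" for P m x y
  using E_nf[OF that(1), of "dec x @ dec y"] ev_append[OF K(1)[OF that(1)] K(2)[OF that(1)] dv[OF that(2)] dv[OF that(3)]]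
   dv that(2,3) by (simp add: T_simps E_def)
 have E_sc: "E P m (c *[T] x) = c *[P] E P m x" if "K P m" "x:car T" for P m x c
  using E_nf[OF that(1), of "sc c (dec x)"] ev_sc[OF K(1)[OF that(1)] K(2)[OF that(1)] dv[OF that(2)]]
   dv that(2) by (simp add: T_simps E_def)
 note Es = E_in E_zero E_add E_sc T_closed
 have T: "vsp T"
  by (rule vsI; (rule sep)?)
   (simp_all add: Es K(1) vs_add_assoc vs_smult_ladd vs_smult_radd vs_smult_smult, (simp add: vs_add_commute K(1) Es)?)
 define ta where "ta g = nf [(1, g)]" for g
 have ta_in: "ta g:car T" if "g:Gens" for g
  using that by (simp add: ta_def T_simps)
 have E_ta: "E P m (ta g) = m g" if "K P m" "g:Gens" for P m g
  using E_nf[OF that(1), of "[(1, g)]"] that K by (simp add: ta_def)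
 have E_lin: "restrict (E P m) (car T):lin T P" if "K P m" for P m
  by (intro linI T linear_onI) (use Es that in auto)
 have gen: "h x = ev P (%g. h (ta g)) (dec x)" if h: "h:lin T P" and P: "vsp P" and x: "x:car T" for h P x
 proof -
  have "h (ev T ta xs) = ev P (%g. h (ta g)) xs" if "xs:valid" for xs
   using that
  proof (induction xs)
   case Nil
   thus ?case using lin_zero[OF T P h] by simp
  next
   case (Cons a xs)
   thus ?case
    using ta_in T by (simp add: lin_add[OF h] lin_smult[OF h])
  qed
  moreover have "ev T ta (dec x) = x"
  proof (rule sep)
   fix Q m assume k: "K Q m"
   have "E Q m (ev T ta xs) = ev Q m xs" if "xs:valid" for xs
    using that
   proof (induction xs)
    case Nil
    thus ?case using E_zero[OF k] by simp
   next
    case (Cons a xs)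
    thus ?case
    using ta_in T by (simp add: E_add[OF k] E_sc[OF k] E_ta[OF k])
   qed
   thus "E Q m (ev T ta (dec x)) = E Q m x"
    using dv[OF x] by (simp add: E_def)
  qed (use x T ta_in dv in auto)
  ultimately show ?thesis using dv[OF x] by metis
 qed
 have ev_cong: "ev P m xs = ev P m' xs" if "xs:valid" "!!g. g:Gens ==> m g = m' g" for P m m' xs
  using that(1) by (induction xs) (use that(2) in auto)
 have uniq: "h = restrict (E P m) (car T)" if k: "K P m" and h: "h:lin T P" and hm: "ALL g:Gens. h (ta g) = m g" for P m h
 proof (rule lin_eqI[OF h E_lin[OF k]])
  fix x assume x: "x:car T"
  show "h x = restrict (E P m) (car T) x"
   using gen[OF h K(1)[OF k] x] ev_cong[OF dv[OF x], of "%g. h (ta g)" m P] hm x by (simp add: E_def)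
 qed
 show ?thesis
 proof (rule exI[of _ T], rule exI[of _ ta], intro conjI allI impI ballI)
  fix P m assume k: "K P m"
  show "EX! h. h:lin T P & (ALL g:Gens. h (ta g) = m g)"
  proof (rule ex1I[of _ "restrict (E P m) (car T)"])
   show "restrict (E P m) (car T):lin T P & (ALL g:Gens. restrict (E P m) (car T) (ta g) = m g)"
    using E_lin[OF k] E_ta[OF k] ta_in by simp
   show "h = restrict (E P m) (car T)" if "h:lin T P & (ALL g:Gens. h (ta g) = m g)" for h
    using that uniq[OF k] by blast
  qed
 next
  fix x y assume xy: "x:car T" "y:car T"
   and e: "ALL P m h. K P m --> h:lin T P --> (ALL g:Gens. h (ta g) = m g) --> h x = h y"
  show "x = y"
  proof (rule sep[OF xy])
   fix P m assume k: "K P m"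
   have "ALL g:Gens. restrict (E P m) (car T) (ta g) = m g"
    using E_ta[OF k] ta_in by simp
   hence "restrict (E P m) (car T) x = restrict (E P m) (car T) y"
    using e E_lin[OF k] k by blast
   thus "E P m x = E P m y" using xy by simp
  qed
 qed (use T ta_in in auto)
qed

end

section \<open>Tensor products\<close>

lemma lin_bijI:
 assumes "f:lin V W" "g:lin W V" "!!x. x:car V ==> g (f x) = x"
  "!!y. y:car W ==> f (g y) = y"
 shows "bij_betw f (car V) (car W)"
 by (rule bij_betw_byWitness[where f' = g])
  (use assms in "auto intro: lin_closed[OF assms(1)] lin_closed[OF assms(2)]")

context vs_universe
begin

lemma tensor_exists:
 fixes V W :: "'u vs"
 assumes V: "vsp V" and W: "vsp W"
 shows "EX T b. is_tensor V W T b"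
proof -
 obtain p :: "'u \<times> 'u => 'u" where p: "inj p"
  using inj_pair by blast
 define K where "K P m \<longleftrightarrow> vsp P & bilinear_on V W P (%v w. m (v, w))" for P :: "'u vs" and m
 let ?G = "car V \<times> car W"
 have K: "ALL P m. K P m --> vsp P & (ALL g:?G. m g:car P)"
  unfolding K_def using bilinear_onD(1)[of V W _ "%v w. _ (v, w)"] by auto
 from universal_object[OF p K]
 obtain T :: "'u vs" and ta where T: "vsp T" and ta: "ALL g:?G. ta g:car T"
  and ex: "ALL P m. K P m --> (EX! h. h:lin T P & (ALL g:?G. h (ta g) = m g))"
  and sep: "ALL x:car T. ALL y:car T.
   (ALL P m h. K P m --> h:lin T P --> (ALL g:?G. h (ta g) = m g) --> h x = h y) --> x = y"
  by blast
 have ta': "ta (v, w):car T" if "v:car V" "w:car W" for v w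
  using ta that by blast
 have test: "x = y" if xy: "x:car T" "y:car T"
  and t: "!!(P :: 'u vs) m h. vsp P ==>
   (!!v v' w. v:car V ==> v':car V ==> w:car W ==> m (v +[V] v', w) = m (v, w) +[P] m (v', w)) ==>
   (!!v w w'. v:car V ==> w:car W ==> w':car W ==> m (v, w +[W] w') = m (v, w) +[P] m (v, w')) ==>
   (!!c v w. v:car V ==> w:car W ==> m (c *[V] v, w) = c *[P] m (v, w)) ==>
   (!!c v w. v:car V ==> w:car W ==> m (v, c *[W] w) = c *[P] m (v, w)) ==>
   h:lin T P ==> (!!v w. v:car V ==> w:car W ==> h (ta (v, w)) = m (v, w)) ==> h x = h y" for x y
 proof (rule sep[rule_format, OF xy])
  fix P :: "'u vs" and m h
  assume k: "K P m" and h: "h:lin T P" "!!g. g:?G ==> h (ta g) = m g"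
  have b: "bilinear_on V W P (%v w. m (v, w))" and P: "vsp P"
   using k by (simp_all add: K_def)
  show "h x = h y"
   by (rule t[OF P bilinear_onD(2)[OF b] bilinear_onD(3)[OF b] bilinear_onD(4)[OF b] bilinear_onD(5)[OF b] h(1)])
    (use h(2) in auto)
 qed
 have "bilinear_on V W T (%v w. ta (v, w))"
 proof (rule bilinear_onI)
  show "ta (v +[V] v', w) = ta (v, w) +[T] ta (v', w)"
   if "v:car V" "v':car V" "w:car W" for v v' w
   by (rule test) (use that V W T ta' in "simp_all add: lin_add")
  show "ta (v, w +[W] w') = ta (v, w) +[T] ta (v, w')"
   if "v:car V" "w:car W" "w':car W" for v w w'
   by (rule test) (use that V W T ta' in "simp_all add: lin_add")
  show "ta (c *[V] v, w) = c *[T] ta (v, w)"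
   if "v:car V" "w:car W" for c v w
   by (rule test) (use that V W T ta' in "simp_all add: lin_smult")
  show "ta (v, c *[W] w) = c *[T] ta (v, w)"
   if "v:car V" "w:car W" for c v w
   by (rule test) (use that V W T ta' in "simp_all add: lin_smult")
 qed (rule ta')
 moreover have "EX! h. h:lin T P & (ALL v:car V. ALL w:car W. h (ta (v, w)) = \<beta> v w)"
  if "vsp P" "bilinear_on V W P \<beta>" for P :: "'u vs" and \<beta>
 proof -
  have "EX! h. h:lin T P & (ALL g:?G. h (ta g) = (%(v, w). \<beta> v w) g)"
   by (rule ex[rule_format]) (use that in "simp add: K_def")
  thus ?thesis by simp
 qed
 ultimately show ?thesis
  unfolding is_tensor_def using T by (intro exI[of _ T] exI[of _ "%v w. ta (v, w)"]) blast
qed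

lemma is_tensor_tensor:
 fixes V W :: "'u vs"
 assumes "vsp V" "vsp W"
 shows "is_tensor V W (tensor V W) (pure V W)"
proof -
 have "EX Tb. is_tensor V W (fst Tb) (snd Tb)"
  using tensor_exists[OF assms] by auto
 thus ?thesis
  unfolding tensor_def pure_def tensor_choice_def by (rule someI_ex)
qed

lemma tensor_vspace [simp]: "vsp V ==> vsp W ==> vsp (tensor V W)" for V W :: "'u vs"
 using is_tensor_tensor[of V W] by (simp add: is_tensor_def)

lemma pure_bilinear: "vsp V ==> vsp W ==> bilinear_on V W (tensor V W) (pure V W)" for V W :: "'u vs"
 using is_tensor_tensor[of V W] by (simp add: is_tensor_def)

lemma pure_in [simp]: "vsp V ==> vsp W ==> v:car V ==> w:car W ==>
  pure V W v w:car (tensor V W)" for V W :: "'u vs"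
 using pure_bilinear[of V W] by (simp add: bilinear_onD)

lemma pure_add1: "vsp V ==> vsp W ==> v:car V ==> v':car V ==> w:car W ==>
  pure V W (v +[V] v') w = pure V W v w +[tensor V W] pure V W v' w" for V W :: "'u vs"
 using pure_bilinear[of V W] by (simp add: bilinear_onD)

lemma pure_add2: "vsp V ==> vsp W ==> v:car V ==> w:car W ==> w':car W ==>
  pure V W v (w +[W] w') = pure V W v w +[tensor V W] pure V W v w'" for V W :: "'u vs"
 using pure_bilinear[of V W] by (simp add: bilinear_onD)

lemma pure_smult1: "vsp V ==> vsp W ==> v:car V ==> w:car W ==>
  pure V W (c *[V] v) w = c *[tensor V W] pure V W v w" for V W :: "'u vs"
 using pure_bilinear[of V W] by (simp add: bilinear_onD)

lemma pure_smult2: "vsp V ==> vsp W ==> v:car V ==> w:car W ==>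
  pure V W v (c *[W] w) = c *[tensor V W] pure V W v w" for V W :: "'u vs"
 using pure_bilinear[of V W] by (simp add: bilinear_onD)

lemmas pure_linear = pure_add1 pure_add2 pure_smult1 pure_smult2

lemma tensor_lift_ex1:
 fixes V W P :: "'u vs"
 assumes "vsp V" "vsp W" "vsp P" "bilinear_on V W P \<beta>"
 shows "EX! h. h:lin (tensor V W) P & (ALL v:car V. ALL w:car W. h (pure V W v w) = \<beta> v w)"
 using is_tensor_tensor[OF assms(1,2)] assms(3,4) by (simp add: is_tensor_def)

definition tensor_lift :: "'u vs => 'u vs => 'u vs => ('u => 'u => 'u) => 'u => 'u" where
 "tensor_lift V W P \<beta> = (THE h. h:lin (tensor V W) P \<and>
   (ALL v:car V. ALL w:car W. h (pure V W v w) = \<beta> v w))"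

lemma
 assumes "vsp V" "vsp W" "vsp P" "bilinear_on V W P \<beta>"
 shows tensor_lift_in: "tensor_lift V W P \<beta>:lin (tensor V W) P"
  and tensor_lift_pure: "v:car V ==> w:car W ==> tensor_lift V W P \<beta> (pure V W v w) = \<beta> v w"
 using theI'[OF tensor_lift_ex1[OF assms]] by (simp_all add: tensor_lift_def)

text \<open>A subspace containing the pure tensors receives a lift of the universal bilinear map; composed with
 the inclusion this lift is the identity, whence the subspace is everything.\<close>

lemma tensor_generated:
 fixes V W :: "'u vs"
 assumes V: "vsp V" and W: "vsp W" and U: "submodule U CC (tensor V W)"
  and p: "!!v w. v:car V ==> w:car W ==> pure V W v w:U"
 shows "car (tensor V W) <= U"
proof
 fix x assume x: "x:car (tensor V W)"
 let ?U = "(tensor V W)<|U|>"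
 have T: "vsp (tensor V W)"
  using V W by simp
 have vU: "vsp ?U"
  by (rule submodule_vspace[OF T U])
 have b: "bilinear_on V W ?U (pure V W)"
  by (rule bilinear_onI) (simp_all add: p pure_linear V W)
 let ?h = "tensor_lift V W ?U (pure V W)"
 have h: "?h:lin (tensor V W) ?U"
  by (rule tensor_lift_in[OF V W vU b])
 hence h': "?h:lin (tensor V W) (tensor V W)"
  by (rule lin_cowiden) (simp add: submoduleD(1)[OF T U])
 have "?h = lin_id (tensor V W)"
  by (rule ex1E[OF tensor_lift_ex1[OF V W T pure_bilinear[OF V W]]])
   (use h' V W tensor_lift_pure[OF V W vU b] in "metis lin_id_apply lin_id_in T pure_in")
 thus "x:U"
  using lin_closed[OF h x] x by simp
qed

text \<open>Pure tensors generate, so linear maps out of a tensor product are compared on them; with its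
 variants for iterated products this is how every coherence condition is verified.\<close>

lemma tensor_eq:
 fixes V W :: "'u vs" and P :: "'c vs"
 assumes "vsp V" "vsp W" "vsp P" "linear_on (tensor V W) P f" "linear_on (tensor V W) P g"
  "!!v w. v:car V ==> w:car W ==> f (pure V W v w) = g (pure V W v w)"
  "x:car (tensor V W)"
 shows "f x = g x"
 using tensor_generated[OF assms(1,2) submodule_eqset[OF tensor_vspace[OF assms(1,2)] assms(3-5)]]
  assms by auto

lemma linear_on_pure1: "vsp V ==> vsp W ==> w:car W ==>
  linear_on V (tensor V W) (%v. pure V W v w)" for V W :: "'u vs"
 by (rule linear_onI) (simp_all add: pure_linear)

lemma linear_on_pure2: "vsp V ==> vsp W ==> v:car V ==>
  linear_on W (tensor V W) (%w. pure V W v w)" for V W :: "'u vs"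
 by (rule linear_onI) (simp_all add: pure_linear)

lemma tensor_eq_left:
 fixes U V W :: "'u vs" and P :: "'c vs"
 assumes U: "vsp U" and V: "vsp V" and W: "vsp W" and P: "vsp P"
  and f: "linear_on (tensor (tensor U V) W) P f" and g: "linear_on (tensor (tensor U V) W) P g"
  and e: "!!u v w. u:car U ==> v:car V ==> w:car W ==>
   f (pure (tensor U V) W (pure U V u v) w) = g (pure (tensor U V) W (pure U V u v) w)"
  and x: "x:car (tensor (tensor U V) W)"
 shows "f x = g x"
proof (rule tensor_eq[OF tensor_vspace[OF U V] W P f g _ x])
 fix t w assume t: "t:car (tensor U V)" and w: "w:car W"
 note l = linear_on_pure1[OF tensor_vspace[OF U V] W w]
 show "f (pure (tensor U V) W t w) = g (pure (tensor U V) W t w)"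
  by (rule tensor_eq[OF U V P lin_comp[OF l f] lin_comp[OF l g] _ t]) (rule e[OF _ _ w])
qed

lemma tensor_eq_right:
 fixes U V W :: "'u vs" and P :: "'c vs"
 assumes U: "vsp U" and V: "vsp V" and W: "vsp W" and P: "vsp P"
  and f: "linear_on (tensor U (tensor V W)) P f" and g: "linear_on (tensor U (tensor V W)) P g"
  and e: "!!u v w. u:car U ==> v:car V ==> w:car W ==>
   f (pure U (tensor V W) u (pure V W v w)) = g (pure U (tensor V W) u (pure V W v w))"
  and x: "x:car (tensor U (tensor V W))"
 shows "f x = g x"
proof (rule tensor_eq[OF U tensor_vspace[OF V W] P f g _ x])
 fix u t assume t: "t:car (tensor V W)" and u: "u:car U"
 note l = linear_on_pure2[OF U tensor_vspace[OF V W] u]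
 show "f (pure U (tensor V W) u t) = g (pure U (tensor V W) u t)"
  by (rule tensor_eq[OF V W P lin_comp[OF l f] lin_comp[OF l g] _ t]) (rule e[OF u])
qed

lemma tensor_eq4:
 fixes U V W Z :: "'u vs" and P :: "'c vs"
 assumes U: "vsp U" and V: "vsp V" and W: "vsp W" and Z: "vsp Z" and P: "vsp P"
  and f: "linear_on (tensor (tensor (tensor U V) W) Z) P f" and g: "linear_on (tensor (tensor (tensor U V) W) Z) P g"
  and e: "!!u v w z. u:car U ==> v:car V ==> w:car W ==> z:car Z ==>
   f (pure (tensor (tensor U V) W) Z (pure (tensor U V) W (pure U V u v) w) z) =
   g (pure (tensor (tensor U V) W) Z (pure (tensor U V) W (pure U V u v) w) z)"
  and x: "x:car (tensor (tensor (tensor U V) W) Z)"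
 shows "f x = g x"
proof (rule tensor_eq_left[OF tensor_vspace[OF U V] W Z P f g _ x])
 fix t w z assume t: "t:car (tensor U V)" and w: "w:car W" and z: "z:car Z"
 note UV = tensor_vspace[OF U V]
 note l = lin_comp[OF linear_on_pure1[OF UV W w] linear_on_pure1[OF tensor_vspace[OF UV W] Z z]]
 show "f (pure (tensor (tensor U V) W) Z (pure (tensor U V) W t w) z) =
   g (pure (tensor (tensor U V) W) Z (pure (tensor U V) W t w) z)"
  by (rule tensor_eq[OF U V P lin_comp[OF l f] lin_comp[OF l g] _ t]) (rule e[OF _ _ w z])
qed

subsection \<open>Functoriality\<close>

lemma
 fixes V V' W W' :: "'u vs"
 assumes V: "vsp V" and V': "vsp V'" and W: "vsp W" and W': "vsp W'"
  and f: "f:lin V V'" and g: "g:lin W W'"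
 shows tensor_map_in [simp]: "tensor_map V V' W W' f g:lin (tensor V W) (tensor V' W')"
  and tensor_map_pure [simp]: "v:car V ==> w:car W ==>
   tensor_map V V' W W' f g (pure V W v w) = pure V' W' (f v) (g w)"
proof -
 have b: "bilinear_on V W (tensor V' W') (%v w. pure V' W' (f v) (g w))"
  by (rule bilinear_onI)
   (simp_all add: pure_linear V' W' lin_closed[OF f] lin_closed[OF g] lin_add[OF f] lin_add[OF g] lin_smult[OF f] lin_smult[OF g])
 note th = theI'[OF tensor_lift_ex1[OF V W tensor_vspace[OF V' W'] b], folded tensor_map_def]
 show "tensor_map V V' W W' f g:lin (tensor V W) (tensor V' W')"
  using th by blast
 show "tensor_map V V' W W' f g (pure V W v w) = pure V' W' (f v) (g w)"
  if "v:car V" "w:car W"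
  using th that by blast
qed

lemma tensor_map_unique:
 fixes V V' W W' :: "'u vs"
 assumes "vsp V" "vsp V'" "vsp W" "vsp W'" "f:lin V V'" "g:lin W W'"
  "h:lin (tensor V W) (tensor V' W')"
  "!!v w. v:car V ==> w:car W ==> h (pure V W v w) = pure V' W' (f v) (g w)"
 shows "h = tensor_map V V' W W' f g"
 by (rule lin_eqI[OF assms(7) tensor_map_in[OF assms(1-6)]],
   rule tensor_eq[OF assms(1,3) tensor_vspace[OF assms(2,4)] linD[OF assms(7)] linD[OF tensor_map_in[OF assms(1-6)]]])
  (simp_all add: assms)

lemma tensor_map_id:
 fixes V W :: "'u vs"
 assumes "vsp V" "vsp W"
 shows "tensor_map V V W W (lin_id V) (lin_id W) = lin_id (tensor V W)"
 by (rule tensor_map_unique[symmetric]) (simp_all add: assms)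

lemma tensor_map_compose:
 fixes V V' V'' W W' W'' :: "'u vs"
 assumes "vsp V" "vsp V'" "vsp V''" "vsp W" "vsp W'" "vsp W''"
  and f: "f:lin V V'" "f':lin V' V''" and g: "g:lin W W'" "g':lin W' W''"
 shows "tensor_map V V'' W W'' (cmp V f' f) (cmp W g' g) =
  cmp (tensor V W) (tensor_map V' V'' W' W'' f' g') (tensor_map V V' W W' f g)"
proof (rule tensor_map_unique[symmetric])
 show "cmp (tensor V W) (tensor_map V' V'' W' W'' f' g') (tensor_map V V' W W' f g)
  :lin (tensor V W) (tensor V'' W'')"
  by (rule lin_compose[of _ _ "tensor V' W'"]) (simp_all add: assms)
qed (use assms in "simp_all add: lin_compose[of V _ V'] lin_compose[of W _ W'] lin_closed[OF f(1)] lin_closed[OF g(1)]")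

lemma tensor_map_compose_apply:
 fixes V V' V'' W W' W'' :: "'u vs"
 assumes "vsp V" "vsp V'" "vsp V''" "vsp W" "vsp W'" "vsp W''"
  and f: "f:lin V V'" "f':lin V' V''" and g: "g:lin W W'" "g':lin W' W''"
  and x: "x:car (tensor V W)"
 shows "tensor_map V' V'' W' W'' f' g' (tensor_map V V' W W' f g x) =
  tensor_map V V'' W W'' (cmp V f' f) (cmp W g' g) x"
 using x by (simp add: tensor_map_compose[OF assms(1-10)])

lemma tensor_map_bilinear:
 fixes X X' Y Y' :: "'u vs"
 assumes X: "vsp X" "vsp X'" and Y: "vsp Y" "vsp Y'"
 shows "bilinear_on (lin_space X X') (lin_space Y Y') (lin_space (tensor X Y) (tensor X' Y')) (tensor_map X X' Y Y')"
proof -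
 let ?T = "tensor X Y" and ?T' = "tensor X' Y'"
 have T: "vsp ?T" "vsp ?T'" by (simp_all add: assms)
 note m = tensor_map_in[OF X Y]
 note cl = lin_space_closed[OF T] lin_space_closed[OF X] lin_space_closed[OF Y] m
 note ev = tensor_map_pure[OF X Y] pure_linear[OF X(2) Y(2)] lin_closed[of _ X X'] lin_closed[of _ Y Y']
 show ?thesis
  by (rule bilinear_onI; (simp only: lin_space_simps)?;
    ((rule tensor_map_unique[OF X Y, symmetric])?; simp add: cl ev X Y pure_linear))
qed

lemma fin_dim_tensor:
 fixes V W :: "'u vs"
 assumes V: "vsp V" and W: "vsp W" and fV: "fin_dim V" and fW: "fin_dim W"
 shows "fin_dim (tensor V W)"
proof -
 obtain A where A: "finite A" "A <= car V" "lspan V A = car V"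
  using fV by (auto simp: fin_dim_def)
 obtain B where B: "finite B" "B <= car W" "lspan W B = car W"
  using fW by (auto simp: fin_dim_def)
 let ?T = "tensor V W"
 let ?S = "(%(a, b). pure V W a b) ` (A \<times> B)"
 have T: "vsp ?T" using V W by simp
 have S: "?S <= car ?T"
  using A(2) B(2) V W by (auto simp: subset_iff)
 note sp = submodule_lspan[OF T S]
 have 1: "pure V W a w:lspan ?T ?S" if a: "a:A" and w: "w:car W" for a w
 proof -
  have aV: "a:car V" using a A by blast
  have "lspan W B <= {w:car W. pure V W a w:lspan ?T ?S}"
   by (rule lspan_least[OF submodule_preimage[OF W T linear_on_pure2[OF V W aV] sp]])
    (use B a lspan_incl[of ?S ?T] in auto)
  thus ?thesis using w B by auto
 qed
 have 2: "pure V W v w:lspan ?T ?S" if v: "v:car V" and w: "w:car W" for v w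
 proof -
  have "lspan V A <= {v:car V. pure V W v w:lspan ?T ?S}"
   by (rule lspan_least[OF submodule_preimage[OF V T linear_on_pure1[OF V W w] sp]])
    (use A w 1 in auto)
  thus ?thesis using v A by auto
 qed
 have "car ?T <= lspan ?T ?S"
  by (rule tensor_generated[OF V W sp 2])
 hence "lspan ?T ?S = car ?T"
  using lspan_sub[OF T S] by blast
 thus ?thesis
  unfolding fin_dim_def using A(1) B(1) S by (intro exI[of _ ?S]) simp
qed

subsection \<open>The constraints\<close>

lemma tensor_swap_ex1:
 fixes V W :: "'u vs"
 assumes V: "vsp V" and W: "vsp W"
 shows "EX! h. h:lin (tensor V W) (tensor W V) \<and>
   (ALL v:car V. ALL w:car W. h (pure V W v w) = pure W V w v)"
 by (rule tensor_lift_ex1[OF V W tensor_vspace[OF W V]], rule bilinear_onI) (simp_all add: pure_linear V W)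

lemma tensor_swap_in [simp]: "vsp V ==> vsp W ==> tensor_swap V W:lin (tensor V W) (tensor W V)"
 for V W :: "'u vs"
 using theI'[OF tensor_swap_ex1[of V W]] by (simp add: tensor_swap_def)

lemma tensor_swap_pure [simp]: "vsp V ==> vsp W ==> v:car V ==> w:car W ==>
  tensor_swap V W (pure V W v w) = pure W V w v" for V W :: "'u vs"
 using theI'[OF tensor_swap_ex1[of V W]] by (simp add: tensor_swap_def)

lemma trilinear_lift:
 fixes U V W P :: "'u vs"
 assumes U: "vsp U" and V: "vsp V" and W: "vsp W" and P: "vsp P"
  and b: "!!w. w:car W ==> bilinear_on U V P (%u v. \<beta> u v w)"
  and l: "!!u v. u:car U ==> v:car V ==> linear_on W P (\<beta> u v)"
 shows "EX h. h:lin (tensor (tensor U V) W) P & (ALL u:car U. ALL v:car V. ALL w:car W.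
   h (pure (tensor U V) W (pure U V u v) w) = \<beta> u v w)"
proof -
 let ?T = "tensor U V"
 have T: "vsp ?T" using U V by simp
 define G where "G w = tensor_lift U V P (%u v. \<beta> u v w)" for w
 have G_in: "G w:lin ?T P" if "w:car W" for w
  unfolding G_def by (rule tensor_lift_in[OF U V P b[OF that]])
 have G_pure: "G w (pure U V u v) = \<beta> u v w" if "u:car U" "v:car V" "w:car W" for u v w
  unfolding G_def by (rule tensor_lift_pure[OF U V P b[OF that(3)] that(1,2)])
 have G_add: "G (w +[W] w') t = G w t +[P] G w' t" if w: "w:car W" "w':car W" and t: "t:car ?T" for w w' t
 proof (rule tensor_eq[OF U V P linD[OF G_in] _ _ t])
  show "linear_on ?T P (%t. G w t +[P] G w' t)"
   by (rule linear_onI) (use P T in "simp_all add: lin_closed[OF G_in] w lin_add[OF G_in] lin_smult[OF G_in] vs_smult_radd vs_ac")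
  show "G (w +[W] w') (pure U V u v) = G w (pure U V u v) +[P] G w' (pure U V u v)"
   if "u:car U" "v:car V" for u v
   using that w W by (simp add: G_pure linear_onD(2)[OF l])
 qed (use w W in simp)
 have G_smult: "G (c *[W] w) t = c *[P] G w t" if w: "w:car W" and t: "t:car ?T" for c w t
 proof (rule tensor_eq[OF U V P linD[OF G_in] _ _ t])
  show "linear_on ?T P (%t. c *[P] G w t)"
   by (rule linear_onI) (use P T in "simp_all add: lin_closed[OF G_in] w lin_add[OF G_in] lin_smult[OF G_in] vs_smult_radd vs_smult_smult mult.commute")
  show "G (c *[W] w) (pure U V u v) = c *[P] G w (pure U V u v)"
   if "u:car U" "v:car V" for u v
   using that w W by (simp add: G_pure linear_onD(3)[OF l])
 qed (use w W in simp)
 have B: "bilinear_on ?T W P (%t w. G w t)"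
  by (rule bilinear_onI) (simp_all add: lin_closed[OF G_in] lin_add[OF G_in] lin_smult[OF G_in] G_add G_smult)
 show ?thesis
  by (rule exI[of _ "tensor_lift ?T W P (%t w. G w t)"])
   (use U V in "simp add: tensor_lift_in[OF T W P B] tensor_lift_pure[OF T W P B] G_pure")
qed

lemma tensor_assoc_ex1:
 fixes U V W :: "'u vs"
 assumes U: "vsp U" and V: "vsp V" and W: "vsp W"
 shows "EX! h. h:lin (tensor (tensor U V) W) (tensor U (tensor V W)) \<and>
   (ALL u:car U. ALL v:car V. ALL w:car W.
    h (pure (tensor U V) W (pure U V u v) w) = pure U (tensor V W) u (pure V W v w))"
proof (rule ex_ex1I)
 let ?P = "tensor U (tensor V W)"
 have P: "vsp ?P" by (simp add: assms)
 show "EX h. h:lin (tensor (tensor U V) W) ?P \<and>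
   (ALL u:car U. ALL v:car V. ALL w:car W.
    h (pure (tensor U V) W (pure U V u v) w) = pure U (tensor V W) u (pure V W v w))"
  by (rule trilinear_lift[OF U V W P])
   (auto intro!: bilinear_onI linear_onI simp: pure_linear U V W)
 fix h h'
 assume h: "h:lin (tensor (tensor U V) W) ?P \<and>
   (ALL u:car U. ALL v:car V. ALL w:car W.
    h (pure (tensor U V) W (pure U V u v) w) = pure U (tensor V W) u (pure V W v w))"
  and h': "h':lin (tensor (tensor U V) W) ?P \<and>
   (ALL u:car U. ALL v:car V. ALL w:car W.
    h' (pure (tensor U V) W (pure U V u v) w) = pure U (tensor V W) u (pure V W v w))"
 note hl = conjunct1[OF h] conjunct1[OF h']
 show "h = h'"
  by (rule lin_eqI[OF hl], rule tensor_eq_left[OF U V W P linD[OF hl(1)] linD[OF hl(2)]]) (use h h' in simp_all)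
qed

lemma tensor_assoc_in [simp]: "vsp U ==> vsp V ==> vsp W ==>
  tensor_assoc U V W:lin (tensor (tensor U V) W) (tensor U (tensor V W))" for U V W :: "'u vs"
 using theI'[OF tensor_assoc_ex1[of U V W]] by (simp add: tensor_assoc_def)

lemma tensor_assoc_pure [simp]: "vsp U ==> vsp V ==> vsp W ==>
  u:car U ==> v:car V ==> w:car W ==>
  tensor_assoc U V W (pure (tensor U V) W (pure U V u v) w) = pure U (tensor V W) u (pure V W v w)" for U V W :: "'u vs"
 using theI'[OF tensor_assoc_ex1[of U V W]] by (simp add: tensor_assoc_def)

lemma unit_choice_spec:
 "vsp (unit_sp :: 'u vs) & (unit_vec :: 'u):car unit_sp \<and>
   (ALL x:car (unit_sp :: 'u vs). EX! c. x = c *[unit_sp] unit_vec)"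
proof -
 let ?R = "range (%c. c *[L] l)"
 let ?K = "L<|?R|>"
 have "submodule ?R CC L"
 proof (rule submoduleI[OF L_vspace])
  show "0[L]:?R"
   using vs_smult_zero[OF L_vspace l_in] by (metis rangeI)
  show "x +[L] y:?R" if "x:?R" "y:?R" for x y
   using that vs_smult_ladd[OF L_vspace l_in] by (auto simp: image_iff) metis
  show "c *[L] x:?R" if "x:?R" for c x
   using that by (auto simp: vs_smult_smult[OF L_vspace l_in])
 qed (use L_vspace l_in in auto)
 hence "vsp ?K"
  by (rule submodule_vspace[OF L_vspace])
 moreover have "l:?R"
  using vs_smult_one[OF L_vspace l_in] by (metis rangeI)
 ultimately have "EX Ku :: 'u vs \<times> 'u. module CC (fst Ku) & snd Ku:car (fst Ku) \<and>
   (ALL x:car (fst Ku). EX! c. x = c *[fst Ku] snd Ku)"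
  using injD[OF inj_scalar] by (intro exI[of _ "(?K, l)"]) auto
 thus ?thesis
  unfolding unit_sp_def unit_vec_def unit_choice_def by (rule someI_ex)
qed

lemma unit_vspace [simp]: "vsp (unit_sp :: 'u vs)"
 and unit_vec_in [simp]: "(unit_vec :: 'u):car unit_sp"
 using unit_choice_spec by blast+

definition unit_coeff :: "'u => complex" where
 "unit_coeff x = (THE c. x = c *[unit_sp] unit_vec)"

lemma unit_coeff: "x:car (unit_sp :: 'u vs) ==> unit_coeff x *[unit_sp] unit_vec = x"
 using theI'[of "%c. x = c *[unit_sp] unit_vec"] unit_choice_spec unfolding unit_coeff_def by metis

lemma unit_coeff_smult [simp]: "unit_coeff (c *[unit_sp] unit_vec) = c"
 using unit_choice_spec unit_coeff[of "c *[unit_sp] unit_vec"] vs_smult[OF unit_vspace unit_vec_in] by metis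

lemma unit_coeff_vec [simp]: "unit_coeff unit_vec = 1"
 using unit_coeff_smult[of 1] by simp

lemma unit_coeff_add: "x:car (unit_sp :: 'u vs) ==> y:car unit_sp ==>
  unit_coeff (x +[unit_sp] y) = unit_coeff x + unit_coeff y"
 using unit_coeff_smult[of "unit_coeff x + unit_coeff y"] by (simp add: vs_smult_ladd unit_coeff)

lemma unit_coeff_mult: "x:car (unit_sp :: 'u vs) ==>
  unit_coeff (c *[unit_sp] x) = c * unit_coeff x"
 using unit_coeff_smult[of "c * unit_coeff x"] by (simp add: vs_smult_smult[symmetric] unit_coeff)

lemma unit_eq:
 fixes P :: "'c vs"
 assumes "linear_on (unit_sp :: 'u vs) P f" "linear_on unit_sp P g" "f unit_vec = g unit_vec" "x:car unit_sp"
 shows "f x = g x"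
 using linear_onD(3)[OF assms(1), of unit_vec "unit_coeff x"] linear_onD(3)[OF assms(2), of unit_vec "unit_coeff x"]
  assms(3,4) by (simp add: unit_coeff)

lemma tensor_lunit_ex1:
 fixes V :: "'u vs"
 assumes V: "vsp V"
 shows "EX! h. h:lin (tensor unit_sp V) V & (ALL v:car V. h (pure unit_sp V unit_vec v) = v)"
proof (rule ex_ex1I)
 have b: "bilinear_on unit_sp V V (%x v. unit_coeff x *[V] v)"
  by (rule bilinear_onI)
   (simp_all add: V unit_coeff_add unit_coeff_mult vs_smult_ladd vs_smult_radd vs_smult_smult mult.commute)
 show "EX h. h:lin (tensor unit_sp V) V & (ALL v:car V. h (pure unit_sp V unit_vec v) = v)"
  by (rule exI[of _ "tensor_lift unit_sp V V (%x v. unit_coeff x *[V] v)"])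
   (simp add: tensor_lift_in[OF _ _ _ b] tensor_lift_pure[OF _ _ _ b] V)
 fix h h' assume h: "h:lin (tensor unit_sp V) V & (ALL v:car V. h (pure unit_sp V unit_vec v) = v)"
  and h': "h':lin (tensor unit_sp V) V & (ALL v:car V. h' (pure unit_sp V unit_vec v) = v)"
 note hl = conjunct1[OF h] conjunct1[OF h']
 show "h = h'"
 proof (rule lin_eqI[OF hl], rule tensor_eq[OF unit_vspace V V linD[OF hl(1)] linD[OF hl(2)]])
  fix x v assume x: "x:car (unit_sp :: 'u vs)" and v: "v:car V"
  note l = linear_on_pure1[OF unit_vspace V v]
  show "h (pure unit_sp V x v) = h' (pure unit_sp V x v)"
   by (rule unit_eq[OF lin_comp[OF l linD[OF hl(1)]] lin_comp[OF l linD[OF hl(2)]] _ x])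
    (use h h' v in simp)
 qed
qed

lemma tensor_lunit_in [simp]: "vsp V ==> tensor_lunit V:lin (tensor unit_sp V) V" for V :: "'u vs"
 using theI'[OF tensor_lunit_ex1[of V]] by (simp add: tensor_lunit_def)

lemma tensor_lunit_pure [simp]: "vsp V ==> v:car V ==>
  tensor_lunit V (pure unit_sp V unit_vec v) = v" for V :: "'u vs"
 using theI'[OF tensor_lunit_ex1[of V]] by (simp add: tensor_lunit_def)

lemma tensor_runit_ex1:
 fixes V :: "'u vs"
 assumes V: "vsp V"
 shows "EX! h. h:lin (tensor V unit_sp) V & (ALL v:car V. h (pure V unit_sp v unit_vec) = v)"
proof (rule ex_ex1I)
 have b: "bilinear_on V unit_sp V (%v x. unit_coeff x *[V] v)"
  by (rule bilinear_onI)
   (simp_all add: V unit_coeff_add unit_coeff_mult vs_smult_ladd vs_smult_radd vs_smult_smult mult.commute)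
 show "EX h. h:lin (tensor V unit_sp) V & (ALL v:car V. h (pure V unit_sp v unit_vec) = v)"
  by (rule exI[of _ "tensor_lift V unit_sp V (%v x. unit_coeff x *[V] v)"])
   (simp add: tensor_lift_in[OF _ _ _ b] tensor_lift_pure[OF _ _ _ b] V)
 fix h h' assume h: "h:lin (tensor V unit_sp) V & (ALL v:car V. h (pure V unit_sp v unit_vec) = v)"
  and h': "h':lin (tensor V unit_sp) V & (ALL v:car V. h' (pure V unit_sp v unit_vec) = v)"
 note hl = conjunct1[OF h] conjunct1[OF h']
 show "h = h'"
 proof (rule lin_eqI[OF hl], rule tensor_eq[OF V unit_vspace V linD[OF hl(1)] linD[OF hl(2)]])
  fix x v assume x: "x:car (unit_sp :: 'u vs)" and v: "v:car V"
  note l = linear_on_pure2[OF V unit_vspace v]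
  show "h (pure V unit_sp v x) = h' (pure V unit_sp v x)"
   by (rule unit_eq[OF lin_comp[OF l linD[OF hl(1)]] lin_comp[OF l linD[OF hl(2)]] _ x])
    (use h h' v in simp)
 qed
qed

lemma tensor_runit_in [simp]: "vsp V ==> tensor_runit V:lin (tensor V unit_sp) V" for V :: "'u vs"
 using theI'[OF tensor_runit_ex1[of V]] by (simp add: tensor_runit_def)

lemma tensor_runit_pure [simp]: "vsp V ==> v:car V ==>
  tensor_runit V (pure V unit_sp v unit_vec) = v" for V :: "'u vs"
 using theI'[OF tensor_runit_ex1[of V]] by (simp add: tensor_runit_def)

lemma tensor_unit_eq_left:
 fixes V :: "'u vs" and P :: "'c vs"
 assumes V: "vsp V" and P: "vsp P"
  and f: "linear_on (tensor unit_sp V) P f" and g: "linear_on (tensor unit_sp V) P g"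
  and e: "!!v. v:car V ==> f (pure unit_sp V unit_vec v) = g (pure unit_sp V unit_vec v)"
  and x: "x:car (tensor unit_sp V)"
 shows "f x = g x"
proof (rule tensor_eq[OF unit_vspace V P f g _ x])
 fix a v assume a: "a:car (unit_sp :: 'u vs)" and v: "v:car V"
 note l = linear_on_pure1[OF unit_vspace V v]
 show "f (pure unit_sp V a v) = g (pure unit_sp V a v)"
  by (rule unit_eq[OF lin_comp[OF l f] lin_comp[OF l g] e[OF v] a])
qed

lemma tensor_unit_eq_right:
 fixes V :: "'u vs" and P :: "'c vs"
 assumes V: "vsp V" and P: "vsp P"
  and f: "linear_on (tensor V unit_sp) P f" and g: "linear_on (tensor V unit_sp) P g"
  and e: "!!v. v:car V ==> f (pure V unit_sp v unit_vec) = g (pure V unit_sp v unit_vec)"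
  and x: "x:car (tensor V unit_sp)"
 shows "f x = g x"
proof (rule tensor_eq[OF V unit_vspace P f g _ x])
 fix a v assume a: "a:car (unit_sp :: 'u vs)" and v: "v:car V"
 note l = linear_on_pure2[OF V unit_vspace v]
 show "f (pure V unit_sp v a) = g (pure V unit_sp v a)"
  by (rule unit_eq[OF lin_comp[OF l f] lin_comp[OF l g] e[OF v] a])
qed

lemma tensor_lunit_bij:
 fixes V :: "'u vs"
 assumes V: "vsp V"
 shows "bij_betw (tensor_lunit V) (car (tensor unit_sp V)) (car V)"
proof (rule lin_bijI)
 let ?g = "\<lambda>v\<in>car V. pure unit_sp V unit_vec v"
 show g: "?g:lin V (tensor unit_sp V)"
  by (rule linI[OF V linear_on_pure2]) (simp_all add: V)
 show "?g (tensor_lunit V x) = x" if x: "x:car (tensor unit_sp V)" for x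
  by (rule tensor_unit_eq_left[OF V _ lin_comp[OF linD[OF tensor_lunit_in] linD[OF g]] linear_on_ident _ x])
   (simp_all add: V)
qed (simp_all add: V)

lemma tensor_runit_bij:
 fixes V :: "'u vs"
 assumes V: "vsp V"
 shows "bij_betw (tensor_runit V) (car (tensor V unit_sp)) (car V)"
proof (rule lin_bijI)
 let ?g = "\<lambda>v\<in>car V. pure V unit_sp v unit_vec"
 show g: "?g:lin V (tensor V unit_sp)"
  by (rule linI[OF V linear_on_pure1]) (simp_all add: V)
 show "?g (tensor_runit V x) = x" if x: "x:car (tensor V unit_sp)" for x
  by (rule tensor_unit_eq_right[OF V _ lin_comp[OF linD[OF tensor_runit_in] linD[OF g]] linear_on_ident _ x])
   (simp_all add: V)
qed (simp_all add: V)

text \<open>The inverse of the associator is a composite of associators and swaps.\<close>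

definition tensor_unassoc :: "'u vs => 'u vs => 'u vs => 'u => 'u" where
 "tensor_unassoc U V W = (\<lambda>x\<in>car (tensor U (tensor V W)).
   tensor_swap W (tensor U V) (tensor_assoc W U V (tensor_swap V (tensor W U)
    (tensor_assoc V W U (tensor_swap U (tensor V W) x)))))"

lemma tensor_unassoc_in [simp]:
 fixes U V W :: "'u vs"
 assumes "vsp U" "vsp V" "vsp W"
 shows "tensor_unassoc U V W:lin (tensor U (tensor V W)) (tensor (tensor U V) W)"
proof -
 note UV = tensor_vspace[OF assms(1,2)] and VW = tensor_vspace[OF assms(2,3)] and WU = tensor_vspace[OF assms(3,1)]
 note c1 = lin_comp[OF linD[OF tensor_swap_in[OF assms(1) VW]] linD[OF tensor_assoc_in[OF assms(2,3,1)]]]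
 note c2 = lin_comp[OF c1 linD[OF tensor_swap_in[OF assms(2) WU]]]
 note c3 = lin_comp[OF c2 linD[OF tensor_assoc_in[OF assms(3,1,2)]]]
 note c4 = lin_comp[OF c3 linD[OF tensor_swap_in[OF assms(3) UV]]]
 show ?thesis
  unfolding tensor_unassoc_def by (rule linI[OF tensor_vspace[OF assms(1) VW] c4])
qed

lemma tensor_unassoc_pure [simp]: "vsp U ==> vsp V ==> vsp W ==>
  u:car U ==> v:car V ==> w:car W ==>
  tensor_unassoc U V W (pure U (tensor V W) u (pure V W v w)) = pure (tensor U V) W (pure U V u v) w" for U V W :: "'u vs"
 by (simp add: tensor_unassoc_def)

lemma tensor_unassoc_assoc:
 fixes U V W :: "'u vs"
 assumes "vsp U" "vsp V" "vsp W" and x: "x:car (tensor (tensor U V) W)"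
 shows "tensor_unassoc U V W (tensor_assoc U V W x) = x"
 by (rule tensor_eq_left[OF assms(1-3) _ lin_comp[OF linD[OF tensor_assoc_in] linD[OF tensor_unassoc_in]] linear_on_ident _ x])
  (simp_all add: assms)

lemma tensor_assoc_unassoc:
 fixes U V W :: "'u vs"
 assumes "vsp U" "vsp V" "vsp W" and x: "x:car (tensor U (tensor V W))"
 shows "tensor_assoc U V W (tensor_unassoc U V W x) = x"
 by (rule tensor_eq_right[OF assms(1-3) _ lin_comp[OF linD[OF tensor_unassoc_in] linD[OF tensor_assoc_in]] linear_on_ident _ x])
  (simp_all add: assms)

lemma tensor_assoc_bij:
 fixes U V W :: "'u vs"
 assumes "vsp U" "vsp V" "vsp W"
 shows "bij_betw (tensor_assoc U V W) (car (tensor (tensor U V) W)) (car (tensor U (tensor V W)))"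
 by (rule lin_bijI[of _ _ _ "tensor_unassoc U V W"]) (simp_all add: assms tensor_unassoc_assoc tensor_assoc_unassoc)

end

section \<open>Sequential colimits\<close>

context vs_universe
begin

lemma colim_exists:
 fixes X :: "nat => 'u vs"
 assumes X: "!!j. vsp (X j)" and t: "!!j. t j:lin (X j) (X (Suc j))"
 shows "EX L l. is_colim X t L l"
proof -
 obtain p :: "'u \<times> 'u => 'u" where p: "inj p"
  using inj_pair by blast
 obtain \<nu> :: "nat => 'u" where \<nu>: "inj \<nu>"
  using infinite_countable_subset[OF infinite_universe] by blast
 have q: "inj (%(j, x). p (\<nu> j, x))"
  by (auto intro!: injI dest!: injD[OF p] injD[OF \<nu>])
 define K where "K P m \<longleftrightarrow> vsp P & (ALL j. linear_on (X j) P (%x. m (j, x)) \<and>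
  (ALL x:car (X j). m (Suc j, t j x) = m (j, x)))" for P :: "'u vs" and m
 define G where "G = {(j, x). x:car (X j)}"
 have K: "ALL P m. K P m --> vsp P & (ALL g:G. m g:car P)"
  unfolding K_def G_def by (auto simp: linear_on_def)
 from universal_object[OF q K]
 obtain T :: "'u vs" and ta where T: "vsp T" and ta: "ALL g:G. ta g:car T"
  and ex: "ALL P m. K P m --> (EX! h. h:lin T P & (ALL g:G. h (ta g) = m g))"
  and sep: "ALL x:car T. ALL y:car T.
   (ALL P m h. K P m --> h:lin T P --> (ALL g:G. h (ta g) = m g) --> h x = h y) --> x = y"
  by blast
 have ta': "ta (j, x):car T" if "x:car (X j)" for j x
  using ta that by (simp add: G_def)
 have test: "x = y" if xy: "x:car T" "y:car T"
  and s: "!!(P :: 'u vs) m h. vsp P ==>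
   (!!j x y. x:car (X j) ==> y:car (X j) ==> m (j, x +[X j] y) = m (j, x) +[P] m (j, y)) ==>
   (!!j c x. x:car (X j) ==> m (j, c *[X j] x) = c *[P] m (j, x)) ==>
   (!!j x. x:car (X j) ==> m (Suc j, t j x) = m (j, x)) ==>
   h:lin T P ==> (!!j x. x:car (X j) ==> h (ta (j, x)) = m (j, x)) ==> h x = h y" for x y
 proof (rule sep[rule_format, OF xy])
  fix P :: "'u vs" and m h
  assume k: "K P m" and h: "h:lin T P" "!!g. g:G ==> h (ta g) = m g"
  have b: "linear_on (X j) P (%x. m (j, x))" and P: "vsp P" for j
   using k by (simp_all add: K_def)
  show "h x = h y"
  proof (rule s[OF P linear_onD(2)[OF b] linear_onD(3)[OF b] _ h(1)])
   show "m (Suc j, t j x) = m (j, x)" if "x:car (X j)" for j x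
    using k that by (simp add: K_def)
   show "h (ta (j, x)) = m (j, x)" if "x:car (X j)" for j x
    using h(2)[of "(j, x)"] that by (simp add: G_def)
  qed
 qed
 define l where "l j = (\<lambda>x\<in>car (X j). ta (j, x))" for j
 have "l j:lin (X j) T" for j
  unfolding l_def
 proof (rule linI[OF X], rule linear_onI)
  show "ta (j, x +[X j] y) = ta (j, x) +[T] ta (j, y)" if "x:car (X j)" "y:car (X j)" for x y
   by (rule test) (use that X T ta' in "simp_all add: lin_add")
  show "ta (j, c *[X j] x) = c *[T] ta (j, x)" if "x:car (X j)" for c x
   by (rule test) (use that X T ta' in "simp_all add: lin_smult")
 qed (rule ta')
 moreover have "l (Suc j) (t j x) = l j x" if x: "x:car (X j)" for j x
 proof -
  have "ta (Suc j, t j x) = ta (j, x)"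
   by (rule test) (use x X T ta' in "simp_all add: lin_closed[OF t]")
  thus ?thesis using x by (simp add: l_def lin_closed[OF t])
 qed
 ultimately have "is_cocone X t T l"
  using T by (simp add: is_cocone_def)
 moreover have "EX! h. h:lin T P & (ALL j. ALL x:car (X j). h (l j x) = m j x)"
  if m: "is_cocone X t P m" for P :: "'u vs" and m
 proof -
  have "K P (%(j, x). m j x)"
   using m by (simp add: K_def is_cocone_def lin_def)
  hence "EX! h. h:lin T P & (ALL g:G. h (ta g) = (%(j, x). m j x) g)"
   using ex by blast
  thus ?thesis by (simp add: G_def l_def split_paired_all Ball_def)
 qed
 ultimately show ?thesis
  unfolding is_colim_def by blast
qed

lemma is_colim_choice:
 fixes X :: "nat => 'u vs"
 assumes "!!j. vsp (X j)" "!!j. t j:lin (X j) (X (Suc j))"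
 shows "is_colim X t (fst (colim_choice X t)) (snd (colim_choice X t))"
proof -
 have "EX Ll. is_colim X t (fst Ll) (snd Ll)"
  using colim_exists[of X t] assms by auto
 thus ?thesis
  unfolding colim_choice_def by (rule someI_ex)
qed

end

lemma is_colimD:
 assumes "is_colim X t L l"
 shows "vsp L" "!!j. l j:lin (X j) L" "!!j x. x:car (X j) ==> l (Suc j) (t j x) = l j x"
  "!!P m. is_cocone X t P m ==> EX! h. h:lin L P & (ALL j. ALL x:car (X j). h (l j x) = m j x)"
 using assms by (auto simp: is_colim_def is_cocone_def)

lemma colim_later:
 assumes c: "is_colim X t L l" and t: "!!j. t j:lin (X j) (X (Suc j))"
  and jk: "j <= k" and x: "x:car (X j)"
 shows "EX x':car (X k). l k x' = l j x"
 using jk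
proof (induction k rule: dec_induct)
 case base
 thus ?case using x by blast
next
 case (step k)
 then obtain x' where "x':car (X k)" "l k x' = l j x" by blast
 thus ?case
  using is_colimD(3)[OF c, of x' k] lin_closed[OF t, of x' k] by metis
qed

text \<open>Like the tensor product, a colimit contains nothing but the images of the maps that define it.\<close>

lemma colim_elem:
 assumes c: "is_colim X t L l" and X: "!!j. vsp (X j)" and t: "!!j. t j:lin (X j) (X (Suc j))"
  and z: "z:car L"
 shows "EX j>=j0. EX x:car (X j). z = l j x"
proof -
 note L = is_colimD[OF c]
 let ?U = "\<Union>j. l j ` car (X j)"
 have U: "submodule ?U CC L"
 proof (rule submoduleI[OF L(1)])
  show "?U <= car L"
   using lin_closed[OF L(2)] by blast
  show "0[L]:?U"
   using lin_zero[OF X L(1) L(2), of 0] vs_zero[OF X, of 0] by (metis UNIV_I UN_I imageI)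
  show "c *[L] u:?U" if u: "u:?U" for c u
  proof -
   obtain j x where "x:car (X j)" "u = l j x" using u by blast
   hence "c *[L] u = l j (c *[X j] x)" "c *[X j] x:car (X j)"
    using lin_smult[OF L(2)] X by auto
   thus ?thesis by blast
  qed
  show "u +[L] v:?U" if u: "u:?U" and v: "v:?U" for u v
  proof -
   obtain i x j y where "x:car (X i)" "u = l i x" "y:car (X j)" "v = l j y"
    using u v by blast
   then obtain x' y' where "x':car (X (max i j))" "u = l (max i j) x'"
    "y':car (X (max i j))" "v = l (max i j) y'"
    using colim_later[OF c t, of i "max i j" x] colim_later[OF c t, of j "max i j" y] by auto
   hence "u +[L] v = l (max i j) (x' +[X (max i j)] y')"
    "x' +[X (max i j)] y':car (X (max i j))"
    using lin_add[OF L(2)] X by auto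
   thus ?thesis by blast
  qed
 qed
 let ?LU = "L<|?U|>"
 have vU: "vsp ?LU"
  by (rule submodule_vspace[OF L(1) U])
 have "is_cocone X t ?LU l"
  unfolding is_cocone_def using vU L(3) by (auto intro!: lin_corestrict[OF L(2)])
 then obtain h where h: "h:lin L ?LU" "!!j x. x:car (X j) ==> h (l j x) = l j x"
  using L(4) by blast
 have h': "h:lin L L"
  by (rule lin_cowiden[OF h(1)]) (simp add: submoduleD(1)[OF L(1) U])
 have "EX! h. h:lin L L & (ALL j. ALL x:car (X j). h (l j x) = l j x)"
  by (rule L(4)) (use c in "simp add: is_colim_def")
 moreover have "lin_id L:lin L L & (ALL j. ALL x:car (X j). lin_id L (l j x) = l j x)"
  using L(1) lin_closed[OF L(2)] by simp
 ultimately have "h = lin_id L"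
  using h' h(2) by blast
 hence "z:?U"
  using lin_closed[OF h(1) z] z by simp
 then obtain i x where x: "x:car (X i)" "z = l i x" by blast
 have "i <= max i j0" "j0 <= max i j0" by simp_all
 thus ?thesis
  using colim_later[OF c t, of i "max i j0" x] x by metis
qed

section \<open>Finite direct sums\<close>

lemma dsum_simps [simp]:
 "car (dsum k U) = (\<Pi>\<^sub>E i\<in>{..<k}. car (U i))"
 "0[dsum k U] = (\<lambda>i\<in>{..<k}. 0[U i])"
 "x +[dsum k U] y = (\<lambda>i\<in>{..<k}. x i +[U i] y i)"
 "c *[dsum k U] x = (\<lambda>i\<in>{..<k}. c *[U i] x i)"
 by (simp_all add: dsum_def)

lemma dsum_in: "x:car (dsum k U) ==> i < k ==> x i:car (U i)"
 by (auto simp: PiE_iff)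

lemma dsum_eqI: "x:car (dsum k U) ==> y:car (dsum k U') ==> (!!i. i < k ==> x i = y i) ==> x = y"
 by (rule extensionalityI[of _ "{..<k}"]) (auto simp: PiE_def)

lemma dsum_vspace:
 assumes U: "!!i. i < k ==> vsp (U i)"
 shows "vsp (dsum k U)"
proof -
 have e: "(\<lambda>i\<in>{..<k}. x i) = x" if "x:car (dsum k U)" for x
  using that by (auto simp: PiE_def extensional_restrict)
 show ?thesis
 proof (rule vsI, goal_cases)
  case (4 x y z)
  thus ?case by (auto intro!: restrict_ext simp: vs_add_assoc U PiE_iff)
 next
  case (5 x y)
  thus ?case by (auto intro!: restrict_ext simp: vs_add_commute U PiE_iff)
 next
  case (6 x)
  hence "(\<lambda>i\<in>{..<k}. 0[U i] +[U i] x i) = (\<lambda>i\<in>{..<k}. x i)"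
   by (intro restrict_ext) (auto simp: U PiE_iff)
  thus ?case using e[OF 6] by (simp cong: restrict_cong)
 next
  case (7 x)
  thus ?case by (auto intro!: restrict_ext simp: U PiE_iff)
 next
  case (8 a b x)
  thus ?case by (auto intro!: restrict_ext simp: vs_smult_ladd U PiE_iff)
 next
  case (9 a x y)
  thus ?case by (auto intro!: restrict_ext simp: vs_smult_radd U PiE_iff)
 next
  case (10 a b x)
  thus ?case by (auto intro!: restrict_ext simp: vs_smult_smult U PiE_iff)
 next
  case (11 x)
  hence "(\<lambda>i\<in>{..<k}. 1 *[U i] x i) = (\<lambda>i\<in>{..<k}. x i)"
   by (intro restrict_ext) (auto simp: U PiE_iff)
  thus ?case using e[OF 11] by simp
 qed (use U in "auto simp: PiE_iff")
qed

definition dinj :: "nat => (nat => 'a vs) => nat => 'a => nat => 'a" where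
 "dinj k U i x = (\<lambda>j\<in>{..<k}. if j = i then x else 0[U j])"

lemma dinj_apply [simp]: "j < k ==> dinj k U i x j = (if j = i then x else 0[U j])"
 by (simp add: dinj_def)

lemma dinj_in: "(!!i. i < k ==> vsp (U i)) ==> (i < k ==> x:car (U i)) ==> dinj k U i x:car (dsum k U)"
 by (auto simp: dinj_def)

lemma linear_on_dinj:
 assumes U: "!!i. i < k ==> vsp (U i)" and i: "i < k"
 shows "linear_on (U i) (dsum k U) (dinj k U i)"
proof (rule linear_onI)
 show "dinj k U i x:car (dsum k U)" if "x:car (U i)" for x
  by (rule dinj_in[OF U]) (use that in auto)
 show "dinj k U i (x +[U i] y) = dinj k U i x +[dsum k U] dinj k U i y" if "x:car (U i)" "y:car (U i)" for x y
  unfolding dsum_simps dinj_def[of _ _ _ "x +[U i] y"] by (rule restrict_ext) (use that U in auto)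
 show "dinj k U i (c *[U i] x) = c *[dsum k U] dinj k U i x" if "x:car (U i)" for c x
  unfolding dsum_simps dinj_def[of _ _ _ "c *[U i] x"] by (rule restrict_ext) (use that U in auto)
qed

lemma dsum_generated:
 assumes U: "!!i. i < k ==> vsp (U i)" and W: "submodule W CC (dsum k U)"
  and inj: "!!i x. i < k ==> x:car (U i) ==> dinj k U i x:W"
 shows "car (dsum k U) <= W"
proof
 fix y assume y: "y:car (dsum k U)"
 have dv: "vsp (dsum k U)"
  by (rule dsum_vspace[OF U])
 note WD = submoduleD[OF dv W]
 have "m <= k ==> (\<lambda>i\<in>{..<k}. if i < m then y i else 0[U i]):W" for m
 proof (induction m)
  case 0
  have "(\<lambda>i\<in>{..<k}. if i < 0 then y i else 0[U i]) = 0[dsum k U]"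
   by simp
  thus ?case using WD(2) by (simp add: restrict_def)
 next
  case (Suc m)
  hence ym: "y m:car (U m)" and m: "m < k"
   using dsum_in[OF y, of m] by auto
  have IH: "(\<lambda>i\<in>{..<k}. if i < m then y i else 0[U i]):W"
   by (rule Suc.IH) (use m in simp)
  have "(\<lambda>i\<in>{..<k}. if i < Suc m then y i else 0[U i]) =
    (\<lambda>i\<in>{..<k}. if i < m then y i else 0[U i]) +[dsum k U] dinj k U m (y m)"
   unfolding dsum_simps by (rule restrict_ext) (use dsum_in[OF y] U in "auto simp: less_Suc_eq")
  thus ?case
   using WD(3)[OF IH inj[OF m ym]] by (simp only:)
 qed
 from this[of k] have "(\<lambda>i\<in>{..<k}. if i < k then y i else 0[U i]):W"
  by simp
 moreover have "(\<lambda>i\<in>{..<k}. if i < k then y i else 0[U i]) = y"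
  by (rule ext) (use y in "auto simp: PiE_iff extensional_def")
 ultimately show "y:W" by simp
qed

lemma dsum_eq:
 assumes U: "!!i. i < k ==> vsp (U i)" and P: "vsp P"
  and f: "linear_on (dsum k U) P f" and g: "linear_on (dsum k U) P g"
  and e: "!!i x. i < k ==> x:car (U i) ==> f (dinj k U i x) = g (dinj k U i x)"
  and y: "y:car (dsum k U)"
 shows "f y = g y"
proof -
 have "car (dsum k U) <= {x:car (dsum k U). f x = g x}"
  by (rule dsum_generated[OF U submodule_eqset[OF dsum_vspace[OF U] P f g]])
   (auto simp del: dsum_simps intro!: dinj_in U e)
 thus ?thesis using y by blast
qed

primrec dsum_lift :: "'b vs => (nat => 'a => 'b) => nat => (nat => 'a) => 'b" where
 "dsum_lift P g 0 y = 0[P]"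
| "dsum_lift P g (Suc m) y = dsum_lift P g m y +[P] g m (y m)"

lemma linear_on_dsum_lift:
 assumes U: "!!i. i < k ==> vsp (U i)" and P: "vsp P"
  and g: "!!i. i < k ==> linear_on (U i) P (g i)"
 shows "linear_on (dsum k U) P (dsum_lift P g k)"
proof -
 have "m <= k ==> linear_on (dsum k U) P (dsum_lift P g m)" for m
 proof (induction m)
  case 0
  thus ?case by (simp add: linear_on_def P)
 next
  case (Suc m)
  hence IH: "linear_on (dsum k U) P (dsum_lift P g m)" and m: "m < k" by auto
  note D = linear_onD[OF IH] linear_onD[OF g[OF m]]
  show ?case
  proof (rule linear_onI)
   fix x y c assume x: "x:car (dsum k U)"
   note xm = dsum_in[OF x m]
   show "dsum_lift P g (Suc m) x:car P"
    using P D(1)[OF x] D(4)[OF xm] by simp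
   show "dsum_lift P g (Suc m) (c *[dsum k U] x) = c *[P] dsum_lift P g (Suc m) x"
    using P D(1)[OF x] D(4)[OF xm] D(3)[OF x, of c] D(6)[OF xm, of c] m by (simp add: vs_smult_radd)
   assume y: "y:car (dsum k U)"
   note ym = dsum_in[OF y m]
   show "dsum_lift P g (Suc m) (x +[dsum k U] y) = dsum_lift P g (Suc m) x +[P] dsum_lift P g (Suc m) y"
    using P D(1)[OF x] D(4)[OF xm] D(1)[OF y] D(4)[OF ym] D(2)[OF x y] D(5)[OF xm ym] m by (simp add: vs_ac)
  qed
 qed
 thus ?thesis by simp
qed

lemma dsum_lift_dinj:
 assumes U: "!!i. i < k ==> vsp (U i)" and P: "vsp P"
  and g: "!!i. i < k ==> linear_on (U i) P (g i)" and i: "i < k" and x: "x:car (U i)"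
 shows "dsum_lift P g k (dinj k U i x) = g i x"
proof -
 have g0: "g m 0[U m] = 0[P]" if "m < k" for m
  by (rule linear_on_zero[OF U[OF that] P g[OF that]])
 have gx: "g i x:car P"
  by (rule linear_onD(1)[OF g[OF i] x])
 have "m <= k ==> dsum_lift P g m (dinj k U i x) = (if i < m then g i x else 0[P])" for m
  by (induction m) (use gx g0 P in "auto simp: less_Suc_eq")
 thus ?thesis using i by simp
qed

lemma dsum_map_in:
 assumes U: "!!i. i < k ==> vsp (U i)" and f: "!!i. i < k ==> f i:lin (U i) (W i)"
 shows "linear_on (dsum k U) (dsum k W) (dsum_map k f)"
proof (rule linear_onI)
 show "dsum_map k f x:car (dsum k W)" if "x:car (dsum k U)" for x
  using that lin_closed[OF f] by (auto simp: dsum_map_def PiE_iff)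
 show "dsum_map k f (x +[dsum k U] y) = dsum_map k f x +[dsum k W] dsum_map k f y"
  if "x:car (dsum k U)" "y:car (dsum k U)" for x y
  unfolding dsum_simps dsum_map_def
  by (rule restrict_ext) (use dsum_in[OF that(1)] dsum_in[OF that(2)] lin_add[OF f] in auto)
 show "dsum_map k f (c *[dsum k U] x) = c *[dsum k W] dsum_map k f x"
  if "x:car (dsum k U)" for x c
  unfolding dsum_simps dsum_map_def
  by (rule restrict_ext) (use dsum_in[OF that(1)] lin_smult[OF f] in auto)
qed

lemma fin_dim_dsum:
 assumes U: "!!i. i < k ==> vsp (U i)" and f: "!!i. i < k ==> fin_dim (U i)"
 shows "fin_dim (dsum k U)"
proof -
 have "ALL i<k. EX S. finite S & S <= car (U i) & lspan (U i) S = car (U i)"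
  using f by (auto simp: fin_dim_def)
 then obtain S where S: "!!i. i < k ==> finite (S i) & S i <= car (U i) & lspan (U i) (S i) = car (U i)"
  by metis
 let ?S = "\<Union>i\<in>{..<k}. dinj k U i ` S i"
 note D = dsum_vspace[OF U]
 have sub: "?S <= car (dsum k U)"
  using S by (auto simp del: dsum_simps intro!: dinj_in U)
 have sp: "submodule (lspan (dsum k U) ?S) CC (dsum k U)"
  by (rule submodule_lspan[OF D sub])
 have "car (dsum k U) <= lspan (dsum k U) ?S"
 proof (rule dsum_generated[OF U sp])
  fix i x assume i: "i < k" and x: "x:car (U i)"
  have "lspan (U i) (S i) <= {x:car (U i). dinj k U i x:lspan (dsum k U) ?S}"
   by (rule lspan_least[OF submodule_preimage[OF U[OF i] D linear_on_dinj[OF U i] sp]])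
    (use S[OF i] i lspan_incl[of ?S "dsum k U"] in auto)
  thus "dinj k U i x:lspan (dsum k U) ?S"
   using S[OF i] x by auto
 qed
 hence "lspan (dsum k U) ?S = car (dsum k U)"
  using lspan_sub[OF D sub] by blast
 thus ?thesis
  unfolding fin_dim_def using S sub by (intro exI[of _ ?S]) auto
qed

section \<open>Tensor powers\<close>

abbreviation tsum :: "'u vs => nat => (nat => nat) => (nat => 'u) vs" where
 "tsum M k a == dsum k (%i. tpow M (a i))"

abbreviation tmap :: "'u vs => 'u vs => nat => (nat => nat) => ('u => 'u) => (nat => 'u) => nat => 'u" where
 "tmap M N k a f == dsum_map k (%i. tpow_map M N (a i) f)"

context vs_universe
begin

lemma fin_dim_unit: "fin_dim (unit_sp :: 'u vs)"
proof -
 have "car (unit_sp :: 'u vs) <= lspan unit_sp {unit_vec}"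
 proof
  fix x assume "x:car (unit_sp :: 'u vs)"
  hence "x = unit_coeff x *[unit_sp] unit_vec" by (simp add: unit_coeff)
  thus "x:lspan unit_sp {unit_vec}"
   using submoduleD(4)[OF unit_vspace submodule_lspan[OF unit_vspace]] lspan_incl[of "{unit_vec}" unit_sp]
   by (metis empty_subsetI insert_subset unit_vec_in)
 qed
 hence "lspan unit_sp {unit_vec} = car (unit_sp :: 'u vs)"
  using lspan_sub[OF unit_vspace, of "{unit_vec}"] by auto
 thus ?thesis
  unfolding fin_dim_def by (intro exI[of _ "{unit_vec}"]) simp
qed

lemma tpow_vspace [simp]: "vsp M ==> vsp (tpow M a)" for M :: "'u vs"
 by (induction a) simp_all

lemma fin_dim_tpow: "vsp M ==> fin_dim M ==> fin_dim (tpow M a)" for M :: "'u vs"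
 by (induction a) (simp_all add: fin_dim_unit fin_dim_tensor)

lemma tpow_map_in [simp]: "vsp M ==> vsp N ==> f:lin M N ==>
  tpow_map M N a f:lin (tpow M a) (tpow N a)" for M N :: "'u vs"
 by (induction a) simp_all

lemma tpow_map_id: "vsp M ==> tpow_map M M a (lin_id M) = lin_id (tpow M a)" for M :: "'u vs"
 by (induction a) (simp_all add: tensor_map_id)

lemma tpow_map_compose:
 fixes M N P :: "'u vs"
 assumes "vsp M" "vsp N" "vsp P" "f:lin M N" "g:lin N P"
 shows "tpow_map M P a (cmp M g f) = cmp (tpow M a) (tpow_map N P a g) (tpow_map M N a f)"
proof (induction a)
 case 0
 show ?case by (auto simp: compose_def lin_id_def)
next
 case (Suc a)
 thus ?case
  using tensor_map_compose[of "tpow M a" "tpow N a" "tpow P a" M N P "tpow_map M N a f" "tpow_map N P a g" f g] assms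
  by simp
qed

lemma tsum_vspace [simp]: "vsp M ==> vsp (tsum M k a)" for M :: "'u vs"
 by (rule dsum_vspace) simp

lemma linear_on_tsum_map: "vsp M ==> vsp N ==> f:lin M N ==>
  linear_on (tsum M k a) (tsum N k a) (tmap M N k a f)" for M N :: "'u vs"
 by (rule dsum_map_in) simp_all

lemma tsum_map_closed: "vsp M ==> vsp N ==> f:lin M N ==> y:car (tsum M k a) ==>
  tmap M N k a f y:car (tsum N k a)" for M N :: "'u vs"
 by (rule linear_onD(1)[OF linear_on_tsum_map])

lemma tsum_map_id: "vsp M ==> y:car (tsum M k a) ==> tmap M M k a (lin_id M) y = y" for M :: "'u vs"
 by (rule dsum_eqI[of _ k _ _ "%i. tpow M (a i)"]) (auto simp: tpow_map_id dsum_map_def PiE_iff)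

lemma tsum_map_compose:
 fixes M N P :: "'u vs"
 assumes "vsp M" "vsp N" "vsp P" "f:lin M N" "g:lin N P" and y: "y:car (tsum M k a)"
 shows "tmap M P k a (cmp M g f) y = tmap N P k a g (tmap M N k a f y)"
 unfolding dsum_map_def
 by (rule restrict_ext) (use y in "auto simp: tpow_map_compose[OF assms(1-5)] PiE_iff")

lemma fin_dim_tsum: "vsp M ==> fin_dim M ==> fin_dim (tsum M k a)" for M :: "'u vs"
 by (rule fin_dim_dsum) (simp_all add: fin_dim_tpow)

end

section \<open>Extrapolation of polynomial families\<close>

inductive_set polyfun :: "'a vs => nat => (complex => 'a) set" for M :: "'a vs" and d :: nat where
 mono: "c:car M ==> k <= d ==> (%s. s ^ k *[M] c):polyfun M d"
| add: "p:polyfun M d ==> q:polyfun M d ==> (%s. p s +[M] q s):polyfun M d"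

text \<open>Richardson extrapolation: the value at \<open>0\<close> of a polynomial of degree at most \<open>d\<close> is a fixed linear
 combination of its values at \<open>1, 2, \<dots>, 2\<^sup>d\<close>.\<close>

primrec extrapolate :: "'a vs => nat => (complex => 'a) => 'a" where
 "extrapolate M 0 p = p 1"
| "extrapolate M (Suc d) p = (2 ^ Suc d / (2 ^ Suc d - 1)) *[M] extrapolate M d p +[M]
   (- 1 / (2 ^ Suc d - 1)) *[M] extrapolate M d (%s. p (2 * s))"

lemma extrapolate_cong: "(!!s. s ~= 0 ==> p s = q s) ==> extrapolate M d p = extrapolate M d q"
proof (induction d arbitrary: p q)
 case (Suc d)
 have "extrapolate M d p = extrapolate M d q"
  "extrapolate M d (%s. p (2 * s)) = extrapolate M d (%s. q (2 * s))"
  by (rule Suc.IH; use Suc.prems in simp)+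
 thus ?case by simp
qed simp

lemma extrapolate_closed:
 assumes "vsp M" "submodule W CC M"
 shows "(!!s. s ~= 0 ==> p s:W) ==> extrapolate M d p:W"
proof (induction d arbitrary: p)
 case (Suc d)
 have "extrapolate M d p:W" "extrapolate M d (%s. p (2 * s)):W"
  by (rule Suc.IH; use Suc.prems in simp)+
 thus ?case using submoduleD[OF assms] by simp
qed simp

lemma extrapolate_in: "vsp M ==> (!!s. s ~= 0 ==> p s:car M) ==> extrapolate M d p:car M"
 by (rule extrapolate_closed) auto

lemma extrapolate_linear:
 assumes M: "vsp M" and W: "submodule W CC M" and f: "linear_on (M<|W|>) N f"
 shows "(!!s. s ~= 0 ==> p s:W) ==> f (extrapolate M d p) = extrapolate N d (%s. f (p s))"
proof (induction d arbitrary: p)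
 case (Suc d)
 note D = submoduleD[OF M W] and L = linear_onD[OF f, simplified]
 have "extrapolate M d p:W" "extrapolate M d (%s. p (2 * s)):W"
  by (rule extrapolate_closed[OF M W]; use Suc.prems in simp)+
 moreover have "f (extrapolate M d p) = extrapolate N d (%s. f (p s))"
  "f (extrapolate M d (%s. p (2 * s))) = extrapolate N d (%s. f (p (2 * s)))"
  by (rule Suc.IH; use Suc.prems in simp)+
 ultimately show ?case
  by (simp add: L D)
qed simp

lemma extrapolate_add:
 assumes M: "vsp M"
 shows "(!!s. s ~= 0 ==> p s:car M) ==> (!!s. s ~= 0 ==> q s:car M) ==>
  extrapolate M d (%s. p s +[M] q s) = extrapolate M d p +[M] extrapolate M d q"
proof (induction d arbitrary: p q)
 case (Suc d)
 have "extrapolate M d p:car M" "extrapolate M d (%s. p (2 * s)):car M"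
  "extrapolate M d q:car M" "extrapolate M d (%s. q (2 * s)):car M"
  by (rule extrapolate_in[OF M]; use Suc.prems in simp)+
 moreover have "extrapolate M d (%s. p s +[M] q s) = extrapolate M d p +[M] extrapolate M d q"
  "extrapolate M d (%s. p (2 * s) +[M] q (2 * s)) = extrapolate M d (%s. p (2 * s)) +[M] extrapolate M d (%s. q (2 * s))"
  by (rule Suc.IH; use Suc.prems in simp)+
 ultimately show ?case
  using M by (simp add: vs_smult_radd vs_ac)
qed simp

lemma two_power_neq: "(2::complex) ^ Suc d - 1 ~= 0"
proof
 assume "(2::complex) ^ Suc d - 1 = 0"
 hence "of_nat (2 ^ Suc d) = (of_nat 1 :: complex)" by simp
 hence "(2::nat) ^ Suc d = 1" by (simp only: of_nat_eq_iff)
 thus False by simp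
qed

lemma extrapolate_const:
 assumes M: "vsp M" and c: "c:car M"
 shows "extrapolate M d (%s. c) = c"
proof (induction d)
 case (Suc d)
 have "2 ^ Suc d / (2 ^ Suc d - 1) + - 1 / (2 ^ Suc d - 1) = (1 :: complex)"
  using two_power_neq[of d] by (simp add: add_divide_distrib[symmetric] diff_divide_distrib[symmetric] del: power_Suc)
 thus ?case
  using Suc M c by (simp add: vs_smult_ladd[symmetric] del: power_Suc)
qed simp

text \<open>Extrapolation is linear, so its effect on a power of \<open>s\<close> is a scalar; passing from level \<open>d\<close> to \<open>d + 1\<close> multiplies
 this scalar by a multiple of \<open>2 ^ Suc d - 2 ^ k\<close>, which vanishes for \<open>k = Suc d\<close>.\<close>

lemma extrapolate_power:
 assumes M: "vsp M" and c: "c:car M"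
 shows "EX b. ALL r. extrapolate M d (%s. (r * s) ^ k *[M] c) = (r ^ k * b) *[M] c & (0 < k & k <= d --> b = 0)"
proof (induction d)
 case 0
 thus ?case by (intro exI[of _ 1]) auto
next
 case (Suc d)
 then obtain b where b: "!!r. extrapolate M d (%s. (r * s) ^ k *[M] c) = (r ^ k * b) *[M] c"
  and b0: "0 < k ==> k <= d ==> b = 0" by blast
 let ?b = "(2 ^ Suc d / (2 ^ Suc d - 1)) * b + (- 1 / (2 ^ Suc d - 1)) * (2 ^ k * b)"
 have "extrapolate M (Suc d) (%s. (r * s) ^ k *[M] c) = (r ^ k * ?b) *[M] c" for r
 proof -
  have "extrapolate M d (%s. (r * (2 * s)) ^ k *[M] c) = ((r * 2) ^ k * b) *[M] c"
   using b[of "r * 2"] by (simp add: mult.assoc)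
  hence "extrapolate M (Suc d) (%s. (r * s) ^ k *[M] c) =
   ((2 ^ Suc d / (2 ^ Suc d - 1)) * (r ^ k * b) + (- 1 / (2 ^ Suc d - 1)) * ((r * 2) ^ k * b)) *[M] c"
   unfolding extrapolate.simps b[of r] by (simp only: vs_smult_smult[OF M c] vs_smult_ladd[OF M c])
  also have "(2 ^ Suc d / (2 ^ Suc d - 1)) * (r ^ k * b) + (- 1 / (2 ^ Suc d - 1)) * ((r * 2) ^ k * b) = r ^ k * ?b"
   by (simp add: power_mult_distrib algebra_simps del: power_Suc)
  finally show ?thesis .
 qed
 moreover have "?b = 0" if "0 < k" "k <= Suc d"
 proof (cases "k = Suc d")
  case True
  thus ?thesis by (simp del: power_Suc)
 next
  case False
  thus ?thesis using b0 that by simp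
 qed
 ultimately show ?case by blast
qed

lemma polyfun_in: "vsp M ==> p:polyfun M d ==> p s:car M"
 by (erule polyfun.induct) simp_all

lemma extrapolate_polyfun:
 assumes M: "vsp M" and p: "p:polyfun M d" and dd: "d <= d'"
 shows "extrapolate M d' p = p 0"
 using p
proof induction
 case (mono c k)
 show ?case
 proof (cases "k = 0")
  case True
  thus ?thesis using extrapolate_const[OF M mono(1)] M mono(1) by simp
 next
  case False
  obtain b where b: "ALL r. extrapolate M d' (%s. (r * s) ^ k *[M] c) = (r ^ k * b) *[M] c"
   "0 < k & k <= d' --> b = 0"
   using extrapolate_power[OF M mono(1), of d' k] by blast
  thus ?thesis
   using b(1)[rule_format, of 1] False mono dd M by (simp add: zero_power)
 qed
next
 case (add p q)
 thus ?case
  using extrapolate_add[OF M, of p q d'] polyfun_in[OF M] by simp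
qed

lemma polyfun_linear:
 assumes M: "vsp M" and f: "linear_on M N f" and p: "p:polyfun M d"
 shows "(%s. f (p s)):polyfun N d"
 using p
proof induction
 case (mono c k)
 thus ?case
  using polyfun.mono[of "f c" N k d] linear_onD[OF f] by simp
next
 case (add p q)
 thus ?case
  using polyfun.add[OF add.IH] linear_onD(2)[OF f] polyfun_in[OF M] by simp
qed

lemma polyfun_const: "vsp M ==> c:car M ==> (%s. c):polyfun M d"
 using polyfun.mono[of c M 0 d] by simp

context vs_universe
begin

lemma polyfun_pure:
 fixes M N :: "'u vs"
 assumes M: "vsp M" and N: "vsp N" and b: "b:car N" and c: "c:car N" and p: "p:polyfun M d"
 shows "(%s. pure M N (p s) (b +[N] s *[N] c)):polyfun (tensor M N) (Suc d)"
 using p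
proof induction
 case (mono m k)
 have "(%s. s ^ k *[tensor M N] pure M N m b +[tensor M N] s ^ Suc k *[tensor M N] pure M N m c):polyfun (tensor M N) (Suc d)"
  by (intro polyfun.add polyfun.mono) (use mono M N b c in auto)
 thus ?case
  using mono M N b c by (simp add: pure_linear vs_smult_radd vs_smult_smult)
next
 case (add p q)
 thus ?case
  using polyfun.add[OF add.IH] polyfun_in[OF M] M N b c by (simp add: pure_add1)
qed

text \<open>Tensor powers of an affine family \<open>A + s B\<close> depend polynomially on \<open>s\<close>, of
 degree the exponent.\<close>

lemma polyfun_tpow:
 fixes V W :: "'u vs"
 assumes V: "vsp V" and W: "vsp W" and A: "A:lin V W" and B: "B:lin V W"
  and g: "!!s. g s:lin V W" "!!s v. v:car V ==> g s v = A v +[W] s *[W] B v"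
  and y: "y:car (tpow V a)"
 shows "(%s. tpow_map V W a (g s) y):polyfun (tpow W a) a"
 using y
proof (induction a arbitrary: y)
 case 0
 thus ?case using polyfun_const[of unit_sp y 0] by simp
next
 case (Suc a)
 let ?T = "tpow V (Suc a)" and ?T' = "tpow W (Suc a)"
 have T: "vsp ?T" "vsp ?T'" using V W by simp_all
 note h = tpow_map_in[OF V W g(1), of "Suc a"]
 have "submodule {y:car ?T. (%s. tpow_map V W (Suc a) (g s) y):polyfun ?T' (Suc a)} CC ?T"
 proof (rule submoduleI[OF T(1)])
  show "0[?T]:{y:car ?T. (%s. tpow_map V W (Suc a) (g s) y):polyfun ?T' (Suc a)}"
   using lin_zero[OF T h] T polyfun_const[OF T(2) vs_zero[OF T(2)]] by (simp del: tpow.simps tpow_map.simps)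
  show "x +[?T] y:{y:car ?T. (%s. tpow_map V W (Suc a) (g s) y):polyfun ?T' (Suc a)}"
   if "x:{y:car ?T. (%s. tpow_map V W (Suc a) (g s) y):polyfun ?T' (Suc a)}"
    "y:{y:car ?T. (%s. tpow_map V W (Suc a) (g s) y):polyfun ?T' (Suc a)}" for x y
   using that lin_add[OF h] T polyfun.add[of _ ?T' "Suc a"] by (simp del: tpow.simps tpow_map.simps)
  show "c *[?T] x:{y:car ?T. (%s. tpow_map V W (Suc a) (g s) y):polyfun ?T' (Suc a)}"
   if x: "x:{y:car ?T. (%s. tpow_map V W (Suc a) (g s) y):polyfun ?T' (Suc a)}" for c x
  proof -
   have "linear_on ?T' ?T' (%x. c *[?T'] x)"
    by (rule linear_onI) (use T in "simp_all add: vs_smult_radd vs_smult_smult mult.commute del: tpow.simps")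
   from polyfun_linear[OF T(2) this] show ?thesis
    using x lin_smult[OF h] T by (simp del: tpow.simps tpow_map.simps)
  qed
 qed auto
 hence "submodule {y:car ?T. (%s. tpow_map V W (Suc a) (g s) y):polyfun ?T' (Suc a)} CC (tensor (tpow V a) V)"
  by simp
 hence "car (tensor (tpow V a) V) <= {y:car ?T. (%s. tpow_map V W (Suc a) (g s) y):polyfun ?T' (Suc a)}"
 proof (rule tensor_generated[OF tpow_vspace[OF V] V])
  fix u v assume uv: "u:car (tpow V a)" "v:car V"
  have "(%s. pure (tpow W a) W (tpow_map V W a (g s) u) (A v +[W] s *[W] B v)):polyfun ?T' (Suc a)"
   unfolding tpow.simps by (rule polyfun_pure) (use Suc.IH[OF uv(1)] W lin_closed[OF A uv(2)] lin_closed[OF B uv(2)] in simp_all)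
  thus "pure (tpow V a) V u v:{y:car ?T. (%s. tpow_map V W (Suc a) (g s) y):polyfun ?T' (Suc a)}"
   using uv V W g by simp
 qed
 thus ?case using Suc.prems by auto
qed

lemma extrapolate_dsum:
 assumes U: "!!i. i < k ==> vsp (U i)" and p: "!!s. p s:car (dsum k U)" and i: "i < k"
 shows "extrapolate (dsum k U) d p i = extrapolate (U i) d (%s. p s i)"
proof -
 have D: "vsp (dsum k U)" by (rule dsum_vspace[OF U])
 have "linear_on ((dsum k U)<|car (dsum k U)|>) (U i) (%y. y i)"
  by (rule linear_onI) (use i in "auto simp: PiE_iff")
 from extrapolate_linear[OF D submodule_carrier[OF D] this, of p d] p show ?thesis by simp
qed

text \<open>The maps \<open>tmap (A + s B)\<close>, \<open>s \<noteq> 0\<close>, determine \<open>tmap A\<close>, since they depend polynomially on \<open>s\<close>.\<close>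

lemma extrapolate_tsum:
 fixes V W :: "'u vs"
 assumes V: "vsp V" and W: "vsp W" and A: "A:lin V W" and B: "B:lin V W"
  and g: "!!s. g s:lin V W" "!!s v. v:car V ==> g s v = A v +[W] s *[W] B v"
  and y: "y:car (tsum V k a)" and d: "!!i. i < k ==> a i <= d"
 shows "extrapolate (tsum W k a) d (%s. tmap V W k a (g s) y) = tmap V W k a A y"
proof (rule dsum_eqI)
 have cl: "tmap V W k a (g s) y:car (tsum W k a)" for s
  by (rule tsum_map_closed[OF V W g(1) y])
 show "extrapolate (tsum W k a) d (%s. tmap V W k a (g s) y):car (tsum W k a)"
  by (rule extrapolate_in[OF tsum_vspace[OF W] cl])
 show "tmap V W k a A y:car (tsum W k a)"
  by (rule tsum_map_closed[OF V W A y])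
 fix i assume i: "i < k"
 have yi: "y i:car (tpow V (a i))" using dsum_in[OF y i] .
 have g0: "g 0 = A"
  by (rule lin_eqI[OF g(1) A]) (simp add: g W lin_closed[OF A] lin_closed[OF B])
 have "extrapolate (tsum W k a) d (%s. tmap V W k a (g s) y) i = extrapolate (tpow W (a i)) d (%s. tmap V W k a (g s) y i)"
  by (rule extrapolate_dsum) (use cl i W in auto)
 also have "... = extrapolate (tpow W (a i)) d (%s. tpow_map V W (a i) (g s) (y i))"
  using i by (simp add: dsum_map_def)
 also have "... = tpow_map V W (a i) (g 0) (y i)"
  by (rule extrapolate_polyfun[OF _ polyfun_tpow[OF V W A B g yi] d[OF i]]) (use W in simp)
 finally show "extrapolate (tsum W k a) d (%s. tmap V W k a (g s) y) i = tmap V W k a A y i"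
  using i g0 by (simp add: dsum_map_def)
qed

section \<open>Tensor products of subquotients of tensor powers\<close>

lemma tensor_map_bij:
 fixes V V' W W' :: "'u vs"
 assumes vs: "vsp V" "vsp V'" "vsp W" "vsp W'" and f: "f:lin V V'" and g: "g:lin W W'"
  and bf: "bij_betw f (car V) (car V')" and bg: "bij_betw g (car W) (car W')"
 shows "bij_betw (tensor_map V V' W W' f g) (car (tensor V W)) (car (tensor V' W'))"
proof -
 define f' where "f' = restrict (inv_into (car V) f) (car V')"
 define g' where "g' = restrict (inv_into (car W) g) (car W')"
 have f': "f':lin V' V" "!!x. x:car V ==> f' (f x) = x" "!!x. x:car V' ==> f (f' x) = x"
  unfolding f'_def using lin_inverse[OF vs(1,2) f bf] bf lin_closed[OF f]
  by (auto simp: bij_betw_def f_inv_into_f)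
 have g': "g':lin W' W" "!!x. x:car W ==> g' (g x) = x" "!!x. x:car W' ==> g (g' x) = x"
  unfolding g'_def using lin_inverse[OF vs(3,4) g bg] bg lin_closed[OF g]
  by (auto simp: bij_betw_def f_inv_into_f)
 have c: "cmp V f' f = lin_id V" "cmp V' f f' = lin_id V'"
  "cmp W g' g = lin_id W" "cmp W' g g' = lin_id W'"
  by (rule lin_eqI[OF lin_compose lin_id_in]; (rule vs f f' g g')?; simp add: f' g')+
 show ?thesis
  by (rule lin_bijI[of _ _ _ "tensor_map V' V W' W f' g'"])
   (simp_all add: vs f g f'(1) g'(1) tensor_map_compose_apply[OF vs(1,2,1,3,4,3) f f'(1) g g'(1)]
    tensor_map_compose_apply[OF vs(2,1,2,4,3,4) f'(1) f g'(1) g] c tensor_map_id)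
qed

primrec tpow_merge :: "'u vs => nat => nat => 'u => 'u" where
 "tpow_merge M a 0 = tensor_runit (tpow M a)"
| "tpow_merge M a (Suc b) = cmp (tensor (tpow M a) (tpow M (Suc b)))
   (tensor_map (tensor (tpow M a) (tpow M b)) (tpow M (a + b)) M M (tpow_merge M a b) (lin_id M))
   (tensor_unassoc (tpow M a) (tpow M b) M)"

lemma tpow_merge_in [simp]:
 fixes M :: "'u vs"
 assumes "vsp M" shows "tpow_merge M a b:lin (tensor (tpow M a) (tpow M b)) (tpow M (a + b))"
proof (induction b)
 case (Suc b)
 have "cmp (tensor (tpow M a) (tensor (tpow M b) M))
   (tensor_map (tensor (tpow M a) (tpow M b)) (tpow M (a + b)) M M (tpow_merge M a b) (lin_id M))
   (tensor_unassoc (tpow M a) (tpow M b) M):lin (tensor (tpow M a) (tensor (tpow M b) M)) (tensor (tpow M (a + b)) M)"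
  by (rule lin_compose[OF _ tensor_unassoc_in tensor_map_in]) (use assms Suc in simp_all)
 thus ?case by simp
qed (use assms in simp)

text \<open>Concatenation of tensors is the iterated associator.\<close>

lemma tpow_merge_bij:
 fixes M :: "'u vs"
 assumes M: "vsp M"
 shows "bij_betw (tpow_merge M a b) (car (tensor (tpow M a) (tpow M b))) (car (tpow M (a + b)))"
proof (induction b)
 case 0
 thus ?case using M by (simp add: tensor_runit_bij)
next
 case (Suc b)
 let ?A = "tpow M a" and ?B = "tpow M b"
 have A: "vsp ?A" and B: "vsp ?B" using M by simp_all
 have id: "bij_betw (lin_id M) (car M) (car M)"
  by (rule lin_bijI[of _ _ _ "lin_id M"]) (use M in simp_all)
 have "bij_betw (tensor_unassoc ?A ?B M) (car (tensor ?A (tensor ?B M))) (car (tensor (tensor ?A ?B) M))"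
  by (rule lin_bijI[of _ _ _ "tensor_assoc ?A ?B M"]) (use A B M in "simp_all add: tensor_unassoc_assoc tensor_assoc_unassoc")
 moreover have "bij_betw (tensor_map (tensor ?A ?B) (tpow M (a + b)) M M (tpow_merge M a b) (lin_id M))
  (car (tensor (tensor ?A ?B) M)) (car (tensor (tpow M (a + b)) M))"
  by (rule tensor_map_bij) (use A B M Suc id in simp_all)
 ultimately show ?case
  by (simp add: bij_betw_compose)
qed

lemma tpow_merge_natural:
 fixes M N :: "'u vs"
 assumes M: "vsp M" and N: "vsp N" and f: "f:lin M N" and t: "t:car (tensor (tpow M a) (tpow M b))"
 shows "tpow_map M N (a + b) f (tpow_merge M a b t) =
  tpow_merge N a b (tensor_map (tpow M a) (tpow N a) (tpow M b) (tpow N b) (tpow_map M N a f) (tpow_map M N b f) t)"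
 using t
proof (induction b arbitrary: t)
 case 0
 note m = tpow_map_in[OF M N f, of a]
 note c1 = lin_comp[OF linD[OF tensor_runit_in] linD[OF m]]
 note c2 = lin_comp[OF linD[OF tensor_map_in[OF _ _ _ _ m lin_id_in]] linD[OF tensor_runit_in]]
 show ?case
  unfolding tpow_merge.simps add_0_right tpow.simps(1) tpow_map.simps(1)
  by (rule tensor_unit_eq_right[OF tpow_vspace[OF M] tpow_vspace[OF N] c1 c2])
   (use 0 M N m lin_closed[OF m] in simp_all)
next
 case (Suc b)
 let ?A = "tpow M a" and ?B = "tpow M b" and ?A' = "tpow N a" and ?B' = "tpow N b"
 have A: "vsp ?A" "vsp ?A'" and B: "vsp ?B" "vsp ?B'" using M N by simp_all
 note ma = tpow_map_in[OF M N f, of a] and mb = tpow_map_in[OF M N f, of b]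
  and mab = tpow_map_in[OF M N f, of "a + Suc b"] and mb' = tpow_map_in[OF M N f, of "Suc b"]
 note c1 = lin_comp[OF linD[OF tpow_merge_in[OF M]] linD[OF mab]]
 note c2 = lin_comp[OF linD[OF tensor_map_in[OF _ _ _ _ ma mb']] linD[OF tpow_merge_in[OF N]]]
 note c1' = c1[unfolded tpow.simps(2)]
 note c2' = c2[unfolded tpow.simps(2)]
 show ?case
 proof (rule tensor_eq_right[OF A(1) B(1) M _ c1' c2', simplified tpow.simps(2)[symmetric]])
  show "vsp (tpow N (a + Suc b))" using N by simp
  show "t:car (tensor ?A (tpow M (Suc b)))" by (rule Suc.prems)
  fix u v m assume uvm: "u:car ?A" "v:car ?B" "m:car M"
  have uv: "pure ?A ?B u v:car (tensor ?A ?B)" using uvm A B by simp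
  note mg = lin_closed[OF tpow_merge_in[OF M] uv] lin_closed[OF ma uvm(1)] lin_closed[OF mb uvm(2)] lin_closed[OF f uvm(3)]
  have IH: "tpow_map M N (a + b) f (tpow_merge M a b (pure ?A ?B u v)) =
   tpow_merge N a b (pure ?A' ?B' (tpow_map M N a f u) (tpow_map M N b f v))"
   using Suc.IH[OF uv] uvm A B ma mb by simp
  show "tpow_map M N (a + Suc b) f (tpow_merge M a (Suc b) (pure ?A (tpow M (Suc b)) u (pure ?B M v m))) =
   tpow_merge N a (Suc b) (tensor_map ?A ?A' (tpow M (Suc b)) (tpow N (Suc b)) (tpow_map M N a f) (tpow_map M N (Suc b) f)
    (pure ?A (tpow M (Suc b)) u (pure ?B M v m)))"
   using uvm A B M N f mg uv IH by (simp add: ma mb)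
 qed (use M N in simp_all)
qed

definition pres :: "'u vs => nat => (nat => nat) => (nat => 'u) set => ((nat => 'u) => 'u) => 'u vs => bool" where
 "pres M k a S p A \<longleftrightarrow> submodule S CC (tsum M k a) & linear_on ((tsum M k a)<|S|>) A p \<and>
   p ` S = car A"

definition tprod_exp :: "(nat => nat) => nat => (nat => nat) => nat => nat" where
 "tprod_exp a k' a' x = a (x div k') + a' (x mod k')"

definition tprod :: "'u vs => nat => (nat => nat) => nat => (nat => nat) => (nat => 'u) => (nat => 'u) => nat => 'u" where
 "tprod M k a k' a' s s' = (\<lambda>x\<in>{..<k * k'}. tpow_merge M (a (x div k')) (a' (x mod k'))
   (pure (tpow M (a (x div k'))) (tpow M (a' (x mod k'))) (s (x div k')) (s' (x mod k'))))"

definition tprod_span :: "'u vs => nat => (nat => nat) => (nat => 'u) set => nat => (nat => nat) => (nat => 'u) set => (nat => 'u) set" where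
 "tprod_span M k a S k' a' S' = lspan (tsum M (k * k') (tprod_exp a k' a')) {tprod M k a k' a' s s' | s s'. s:S & s':S'}"

lemma div_mod_less: "x < k * k' ==> x div k' < k & x mod k' < k'" for x k k' :: nat
 by (metis less_mult_imp_div_less mod_less_divisor mult_0_right neq0_conv not_less_zero)

lemma tprod_in:
 fixes M :: "'u vs"
 assumes M: "vsp M" and s: "s:car (tsum M k a)" and s': "s':car (tsum M k' a')"
 shows "tprod M k a k' a' s s':car (tsum M (k * k') (tprod_exp a k' a'))"
 unfolding tprod_def tprod_exp_def dsum_simps
proof (rule restrict_PiE_iff[THEN iffD2], intro ballI)
 fix x assume "x:{..<k * k'}"
 hence x: "x div k' < k" "x mod k' < k'" using div_mod_less by auto
 show "tpow_merge M (a (x div k')) (a' (x mod k'))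
   (pure (tpow M (a (x div k'))) (tpow M (a' (x mod k'))) (s (x div k')) (s' (x mod k')))
  :car (tpow M (a (x div k') + a' (x mod k')))"
  by (rule lin_closed[OF tpow_merge_in[OF M]]) (use dsum_in[OF s x(1)] dsum_in[OF s' x(2)] M in simp)
qed

lemma tprod_linear1:
 fixes M :: "'u vs"
 assumes M: "vsp M" and s': "s':car (tsum M k' a')"
 shows "linear_on (tsum M k a) (tsum M (k * k') (tprod_exp a k' a')) (%s. tprod M k a k' a' s s')"
proof (rule linear_onI)
 fix s t c assume s: "s:car (tsum M k a)"
 show "tprod M k a k' a' s s':car (tsum M (k * k') (tprod_exp a k' a'))"
  by (rule tprod_in[OF M s s'])
 note S = tpow_vspace[OF M] lin_add[OF tpow_merge_in[OF M]] lin_smult[OF tpow_merge_in[OF M]] div_mod_less dsum_in[OF s] dsum_in[OF s']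
 show "tprod M k a k' a' (c *[tsum M k a] s) s' = c *[tsum M (k * k') (tprod_exp a k' a')] tprod M k a k' a' s s'"
  unfolding tprod_def tprod_exp_def dsum_simps by (rule restrict_ext) (simp add: S pure_linear)
 assume t: "t:car (tsum M k a)"
 show "tprod M k a k' a' (s +[tsum M k a] t) s' =
  tprod M k a k' a' s s' +[tsum M (k * k') (tprod_exp a k' a')] tprod M k a k' a' t s'"
  unfolding tprod_def tprod_exp_def dsum_simps by (rule restrict_ext) (simp add: S dsum_in[OF t] pure_linear)
qed

lemma tprod_linear2:
 fixes M :: "'u vs"
 assumes M: "vsp M" and s': "s':car (tsum M k a)"
 shows "linear_on (tsum M k' a') (tsum M (k * k') (tprod_exp a k' a')) (%s. tprod M k a k' a' s' s)"
proof (rule linear_onI)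
 fix s t c assume s: "s:car (tsum M k' a')"
 show "tprod M k a k' a' s' s:car (tsum M (k * k') (tprod_exp a k' a'))"
  by (rule tprod_in[OF M s' s])
 note S = tpow_vspace[OF M] lin_add[OF tpow_merge_in[OF M]] lin_smult[OF tpow_merge_in[OF M]] div_mod_less dsum_in[OF s] dsum_in[OF s']
 show "tprod M k a k' a' s' (c *[tsum M k' a'] s) = c *[tsum M (k * k') (tprod_exp a k' a')] tprod M k a k' a' s' s"
  unfolding tprod_def tprod_exp_def dsum_simps by (rule restrict_ext) (simp add: S pure_linear)
 assume t: "t:car (tsum M k' a')"
 show "tprod M k a k' a' s' (s +[tsum M k' a'] t) =
  tprod M k a k' a' s' s +[tsum M (k * k') (tprod_exp a k' a')] tprod M k a k' a' s' t"
  unfolding tprod_def tprod_exp_def dsum_simps by (rule restrict_ext) (simp add: S dsum_in[OF t] pure_linear)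
qed

lemma tprod_natural:
 fixes M N :: "'u vs"
 assumes M: "vsp M" and N: "vsp N" and f: "f:lin M N"
  and s: "s:car (tsum M k a)" and s': "s':car (tsum M k' a')"
 shows "tmap M N (k * k') (tprod_exp a k' a') f (tprod M k a k' a' s s') =
  tprod N k a k' a' (tmap M N k a f s) (tmap M N k' a' f s')"
 unfolding dsum_map_def tprod_def tprod_exp_def
proof (rule restrict_ext)
 fix x assume x0: "x:{..<k * k'}"
 hence x: "x div k' < k" "x mod k' < k'" using div_mod_less by auto
 thus "tpow_map M N (a (x div k') + a' (x mod k')) f
   ((\<lambda>x\<in>{..<k * k'}. tpow_merge M (a (x div k')) (a' (x mod k'))
    (pure (tpow M (a (x div k'))) (tpow M (a' (x mod k'))) (s (x div k')) (s' (x mod k')))) x) =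
  tpow_merge N (a (x div k')) (a' (x mod k'))
   (pure (tpow N (a (x div k'))) (tpow N (a' (x mod k'))) ((\<lambda>i\<in>{..<k}. tpow_map M N (a i) f (s i)) (x div k'))
    ((\<lambda>i\<in>{..<k'}. tpow_map M N (a' i) f (s' i)) (x mod k')))"
  using x0 M N f dsum_in[OF s x(1)] dsum_in[OF s' x(2)] by (simp add: tpow_merge_natural)
qed

lemma tprod_dinj:
 fixes M :: "'u vs"
 assumes M: "vsp M" and i: "i < k" and j: "j < k'" and x: "x:car (tpow M (a i))" and x': "x':car (tpow M (a' j))"
 shows "tprod M k a k' a' (dinj k (%i. tpow M (a i)) i x) (dinj k' (%i. tpow M (a' i)) j x') =
  dinj (k * k') (%x. tpow M (tprod_exp a k' a' x)) (i * k' + j) (tpow_merge M (a i) (a' j) (pure (tpow M (a i)) (tpow M (a' j)) x x'))"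
 unfolding tprod_def dinj_def[of "k * k'"]
proof (rule restrict_ext)
 fix y assume "y:{..<k * k'}"
 hence y: "y div k' < k" "y mod k' < k'" using div_mod_less by auto
 have T: "vsp (tpow M b)" for b using M by simp
 have z1: "pure (tpow M b) (tpow M b') 0[tpow M b] w = 0[tensor (tpow M b) (tpow M b')]" if "w:car (tpow M b')" for b b' w
  by (rule linear_on_zero[OF T _ linear_on_pure1[OF T T that]]) (use M in simp)
 have z2: "pure (tpow M b) (tpow M b') w 0[tpow M b'] = 0[tensor (tpow M b) (tpow M b')]" if "w:car (tpow M b)" for b b' w
  by (rule linear_on_zero[OF T _ linear_on_pure2[OF T T that]]) (use M in simp)
 have z3: "tpow_merge M b b' 0[tensor (tpow M b) (tpow M b')] = 0[tpow M (b + b')]" for b b'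
  by (rule lin_zero[OF _ _ tpow_merge_in[OF M]]) (use M in simp_all)
 have yy: "y = i * k' + j \<longleftrightarrow> y div k' = i & y mod k' = j"
  using j div_mult_mod_eq[of y k'] by auto
 show "tpow_merge M (a (y div k')) (a' (y mod k'))
   (pure (tpow M (a (y div k'))) (tpow M (a' (y mod k'))) (dinj k (%i. tpow M (a i)) i x (y div k')) (dinj k' (%i. tpow M (a' i)) j x' (y mod k'))) =
  (if y = i * k' + j then tpow_merge M (a i) (a' j) (pure (tpow M (a i)) (tpow M (a' j)) x x') else 0[tpow M (tprod_exp a k' a' y)])"
  unfolding yy using y x x' T by (auto simp: tprod_exp_def z1 z2 z3)
qed

text \<open>The product of two sums of tensor powers is the sum, over pairs of summands, of the concatenated
 powers; the pair of indices is coded by quotient and remainder.\<close>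

lemma tprod_lift:
 fixes M A A' :: "'u vs"
 assumes M: "vsp M" and A: "vsp A" and A': "vsp A'"
  and q: "linear_on (tsum M k a) A q" and q': "linear_on (tsum M k' a') A' q'"
 shows "EX P. linear_on (tsum M (k * k') (tprod_exp a k' a')) (tensor A A') P \<and>
  (ALL s:car (tsum M k a). ALL s':car (tsum M k' a'). P (tprod M k a k' a' s s') = pure A A' (q s) (q' s'))"
proof -
 have T: "vsp (tpow M b)" for b using M by simp
 have AA: "vsp (tensor A A')" using A A' by simp
 define r where "r i = (\<lambda>x\<in>car (tpow M (a i)). q (dinj k (%i. tpow M (a i)) i x))" for i
 define r' where "r' i = (\<lambda>x\<in>car (tpow M (a' i)). q' (dinj k' (%i. tpow M (a' i)) i x))" for i
 have r: "r i:lin (tpow M (a i)) A" if "i < k" for i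
  unfolding r_def by (rule linI[OF T lin_comp[OF linear_on_dinj[of k "%i. tpow M (a i)", OF T that] q]])
 have r': "r' i:lin (tpow M (a' i)) A'" if "i < k'" for i
  unfolding r'_def by (rule linI[OF T lin_comp[OF linear_on_dinj[of k' "%i. tpow M (a' i)", OF T that] q']])
 define m where "m b b' = restrict (inv_into (car (tensor (tpow M b) (tpow M b'))) (tpow_merge M b b')) (car (tpow M (b + b')))" for b b'
 have m: "m b b':lin (tpow M (b + b')) (tensor (tpow M b) (tpow M b'))" for b b'
  unfolding m_def by (rule lin_inverse) (use M tpow_merge_bij[OF M] in simp_all)
 have mm: "m b b' (tpow_merge M b b' t) = t" if "t:car (tensor (tpow M b) (tpow M b'))" for b b' t
  unfolding m_def using tpow_merge_bij[OF M, of b b'] lin_closed[OF tpow_merge_in[OF M] that] that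
  by (auto simp: bij_betw_def)
 define g where "g x t = tensor_map (tpow M (a (x div k'))) A (tpow M (a' (x mod k'))) A' (r (x div k')) (r' (x mod k'))
   (m (a (x div k')) (a' (x mod k')) t)" for x t
 have g: "linear_on (tpow M (tprod_exp a k' a' x)) (tensor A A') (g x)" if "x < k * k'" for x
  unfolding g_def tprod_exp_def
  using lin_comp[OF linD[OF m] linD[OF tensor_map_in[OF T A T A' r r']]] div_mod_less[OF that] by blast
 define P where "P = dsum_lift (tensor A A') g (k * k')"
 have P: "linear_on (tsum M (k * k') (tprod_exp a k' a')) (tensor A A') P"
  unfolding P_def by (rule linear_on_dsum_lift[OF T AA g])
 have base: "P (tprod M k a k' a' (dinj k (%i. tpow M (a i)) i x) (dinj k' (%i. tpow M (a' i)) j x')) =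
  pure A A' (q (dinj k (%i. tpow M (a i)) i x)) (q' (dinj k' (%i. tpow M (a' i)) j x'))"
  if i: "i < k" and j: "j < k'" and x: "x:car (tpow M (a i))" and x': "x':car (tpow M (a' j))" for i j x x'
 proof -
  have ij: "i * k' + j < k * k'"
  proof -
   have "i * k' + j < i * k' + k'" using j by simp
   also have "... = Suc i * k'" by simp
   also have "... <= k * k'" using i by (intro mult_le_mono1) simp
   finally show ?thesis .
  qed
  have dm: "(i * k' + j) div k' = i" "(i * k' + j) mod k' = j" using j by auto
  have pin: "pure (tpow M (a i)) (tpow M (a' j)) x x':car (tensor (tpow M (a i)) (tpow M (a' j)))"
   using x x' T by simp
  have "P (dinj (k * k') (%x. tpow M (tprod_exp a k' a' x)) (i * k' + j) (tpow_merge M (a i) (a' j) (pure (tpow M (a i)) (tpow M (a' j)) x x'))) =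
   g (i * k' + j) (tpow_merge M (a i) (a' j) (pure (tpow M (a i)) (tpow M (a' j)) x x'))"
   unfolding P_def
   by (rule dsum_lift_dinj[where U = "%x. tpow M (tprod_exp a k' a' x)", OF T AA g ij])
    (use lin_closed[OF tpow_merge_in[OF M] pin] j in "simp_all add: tprod_exp_def dm")
  also have "... = pure A A' (r i x) (r' j x')"
   using T A A' r[OF i] r'[OF j] x x' j by (simp add: g_def dm mm[OF pin])
  finally show ?thesis
   using tprod_dinj[where a = a and a' = a', OF M i j x x'] x x' by (simp add: r_def r'_def)
 qed
 have "P (tprod M k a k' a' s s') = pure A A' (q s) (q' s')"
  if s: "s:car (tsum M k a)" and s': "s':car (tsum M k' a')" for s s'
 proof (rule dsum_eq[of k "%i. tpow M (a i)", OF T AA lin_comp[OF tprod_linear1[OF M s'] P]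
    lin_comp[OF q linear_on_pure1[OF A A' linear_onD(1)[OF q' s']]] _ s])
  fix i x assume i: "i < k" and x: "x:car (tpow M (a i))"
  let ?d = "dinj k (%i. tpow M (a i)) i x"
  have d: "?d:car (tsum M k a)" by (rule dinj_in) (use T x in auto)
  show "P (tprod M k a k' a' ?d s') = pure A A' (q ?d) (q' s')"
   by (rule dsum_eq[of k' "%i. tpow M (a' i)", OF T AA lin_comp[OF tprod_linear2[OF M d] P]
    lin_comp[OF q' linear_on_pure2[OF A A' linear_onD(1)[OF q d]]] base[OF i _ x] s'])
 qed
 thus ?thesis using P by blast
qed

lemma tprod_sub:
 fixes M :: "'u vs"
 assumes M: "vsp M" and S: "submodule S CC (tsum M k a)" and S': "submodule S' CC (tsum M k' a')"
 shows "{tprod M k a k' a' s s' | s s'. s:S & s':S'} <= car (tsum M (k * k') (tprod_exp a k' a'))"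
 using tprod_in[OF M] submoduleD(5)[OF tsum_vspace[OF M] S] submoduleD(5)[OF tsum_vspace[OF M] S'] by blast

text \<open>Over a field the tensor product of two subquotients is again a subquotient: extend the two presenting
 maps to the ambient spaces, tensor the extensions, and restrict to the span of the products.\<close>

lemma pres_tensor:
 fixes M A A' :: "'u vs"
 assumes M: "vsp M" and A: "vsp A" and A': "vsp A'"
  and p: "pres M k a S p A" and p': "pres M k' a' S' p' A'"
 shows "EX P. pres M (k * k') (tprod_exp a k' a') (tprod_span M k a S k' a' S') P (tensor A A') \<and>
  linear_on (tsum M (k * k') (tprod_exp a k' a')) (tensor A A') P \<and>
  (ALL s:S. ALL s':S'. P (tprod M k a k' a' s s') = pure A A' (p s) (p' s'))"
proof -
 let ?T = "tsum M (k * k') (tprod_exp a k' a')"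
 have S: "submodule S CC (tsum M k a)" and S': "submodule S' CC (tsum M k' a')"
  and pl: "linear_on ((tsum M k a)<|S|>) A p" "linear_on ((tsum M k' a')<|S'|>) A' p'"
  and sj: "p ` S = car A" "p' ` S' = car A'"
  using p p' by (simp_all add: pres_def)
 obtain q where q: "linear_on (tsum M k a) A q" "ALL s:S. q s = p s"
  using linear_extension[OF tsum_vspace[OF M] A S pl(1)] by blast
 obtain q' where q': "linear_on (tsum M k' a') A' q'" "ALL s:S'. q' s = p' s"
  using linear_extension[OF tsum_vspace[OF M] A' S' pl(2)] by blast
 obtain P where P: "linear_on ?T (tensor A A') P"
  "ALL s:car (tsum M k a). ALL s':car (tsum M k' a'). P (tprod M k a k' a' s s') = pure A A' (q s) (q' s')"
  using tprod_lift[OF M A A' q(1) q'(1)] by blast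
 have T: "vsp ?T" and AA: "vsp (tensor A A')" using M A A' by simp_all
 have Ps: "P (tprod M k a k' a' s s') = pure A A' (p s) (p' s')" if "s:S" "s':S'" for s s'
  using P(2) q(2) q'(2) that submoduleD(5)[OF tsum_vspace[OF M] S] submoduleD(5)[OF tsum_vspace[OF M] S'] by metis
 note sub = tprod_sub[OF M S S']
 have SS: "submodule (tprod_span M k a S k' a' S') CC ?T"
  unfolding tprod_span_def by (rule submodule_lspan[OF T sub])
 have lin: "linear_on (?T<|tprod_span M k a S k' a' S'|>) (tensor A A') P"
  by (rule linear_on_sub[OF T SS P(1)])
 have "P ` tprod_span M k a S k' a' S' = car (tensor A A')"
 proof
  show "P ` tprod_span M k a S k' a' S' <= car (tensor A A')"
   using linear_onD(1)[OF lin] by auto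
  show "car (tensor A A') <= P ` tprod_span M k a S k' a' S'"
  proof (rule tensor_generated[OF A A' submodule_image[OF T AA P(1) SS]])
   fix x y assume "x:car A" "y:car A'"
   then obtain s s' where ss: "s:S" "x = p s" "s':S'" "y = p' s'" using sj by (metis imageE)
   hence "tprod M k a k' a' s s':tprod_span M k a S k' a' S'"
    unfolding tprod_span_def by (intro subsetD[OF lspan_incl]) blast
   thus "pure A A' x y:P ` tprod_span M k a S k' a' S'"
    using Ps[OF ss(1,3)] ss by (intro image_eqI[of _ _ "tprod M k a k' a' s s'"]) simp_all
  qed
 qed
 with SS lin have "pres M (k * k') (tprod_exp a k' a') (tprod_span M k a S k' a' S') P (tensor A A')"
  unfolding pres_def by (intro conjI)
 with P(1) Ps show ?thesis
  by (intro exI[of _ P] conjI ballI)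
qed

lemma pres_tensor_natural:
 fixes M N A A' B B' :: "'u vs"
 assumes M: "vsp M" and N: "vsp N" and f: "f:lin M N"
  and A: "vsp A" "vsp A'" and B: "vsp B" "vsp B'"
  and ph: "ph:lin A B" and ph': "ph':lin A' B'"
  and p: "pres M k a S p A" and p': "pres M k' a' S' p' A'"
  and r: "pres N k a T r B" and r': "pres N k' a' T' r' B'"
  and c: "!!s. s:S ==> tmap M N k a f s:T & r (tmap M N k a f s) = ph (p s)"
  and c': "!!s. s:S' ==> tmap M N k' a' f s:T' & r' (tmap M N k' a' f s) = ph' (p' s)"
  and P: "linear_on (tsum M (k * k') (tprod_exp a k' a')) (tensor A A') P"
   "ALL s:S. ALL s':S'. P (tprod M k a k' a' s s') = pure A A' (p s) (p' s')"
  and Q: "linear_on (tsum N (k * k') (tprod_exp a k' a')) (tensor B B') Q"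
   "ALL s:T. ALL s':T'. Q (tprod N k a k' a' s s') = pure B B' (r s) (r' s')"
  and y: "y:tprod_span M k a S k' a' S'"
 shows "tmap M N (k * k') (tprod_exp a k' a') f y:tprod_span N k a T k' a' T' \<and>
  Q (tmap M N (k * k') (tprod_exp a k' a') f y) = tensor_map A B A' B' ph ph' (P y)"
proof -
 let ?X = "tsum M (k * k') (tprod_exp a k' a')" and ?Y = "tsum N (k * k') (tprod_exp a k' a')"
 let ?f = "tmap M N (k * k') (tprod_exp a k' a') f"
 have X: "vsp ?X" and Y: "vsp ?Y" and BB: "vsp (tensor B B')" using M N B by simp_all
 have S: "submodule S CC (tsum M k a)" and S': "submodule S' CC (tsum M k' a')"
  and T: "submodule T CC (tsum N k a)" and T': "submodule T' CC (tsum N k' a')"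
  using p p' r r' by (simp_all add: pres_def)
 have pin: "p s:car A" if "s:S" for s using p that by (auto simp: pres_def)
 have pin': "p' s:car A'" if "s:S'" for s using p' that by (auto simp: pres_def)
 note sin = submoduleD(5)[OF tsum_vspace[OF M] S] and sin' = submoduleD(5)[OF tsum_vspace[OF M] S']
 let ?G = "{tprod M k a k' a' s s' | s s'. s:S & s':S'}"
 have G: "?G <= car ?X" by (rule tprod_sub[OF M S S'])
 note fl = linear_on_tsum_map[OF M N f, of "k * k'" "tprod_exp a k' a'"]
 have gen: "?f x:tprod_span N k a T k' a' T' & Q (?f x) = tensor_map A B A' B' ph ph' (P x)" if x: "x:?G" for x
 proof -
  obtain s s' where ss: "s:S" "s':S'" "x = tprod M k a k' a' s s'" using x by blast
  have fx: "?f x = tprod N k a k' a' (tmap M N k a f s) (tmap M N k' a' f s')"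
   using tprod_natural[OF M N f sin[OF ss(1)] sin'[OF ss(2)]] ss(3) by simp
  have "?f x:tprod_span N k a T k' a' T'"
   unfolding fx tprod_span_def by (rule subsetD[OF lspan_incl]) (use c[OF ss(1)] c'[OF ss(2)] in blast)
  moreover have "Q (?f x) = tensor_map A B A' B' ph ph' (P x)"
   using fx Q(2) P(2) c[OF ss(1)] c'[OF ss(2)] ss A B ph ph' pin pin' by simp
  ultimately show ?thesis ..
 qed
 have sp: "submodule (tprod_span N k a T k' a' T') CC ?Y"
  unfolding tprod_span_def by (rule submodule_lspan[OF Y tprod_sub[OF N T T']])
 have y': "y:lspan ?X ?G" using y by (simp add: tprod_span_def)
 have "lspan ?X ?G <= {x:car ?X. ?f x:tprod_span N k a T k' a' T'}"
  by (rule lspan_least[OF submodule_preimage[OF X Y fl sp]]) (use G gen in blast)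
 moreover have "Q (?f y) = tensor_map A B A' B' ph ph' (P y)"
  by (rule lspan_induct_linear[OF X BB lin_comp[OF fl Q(1)]
    lin_comp[OF P(1) linD[OF tensor_map_in[OF A(1) B(1) A(2) B(2) ph ph']]] G _ y'])
   (use gen in blast)
 ultimately show ?thesis using y' by blast
qed

end

section \<open>The space with a flagged basis\<close>

lemma vs_abelian_monoid: "vsp M ==> abelian_monoid M"
 by (simp add: vs_abelian abelian_group.axioms(1))

lemma finsum_submodule:
 assumes M: "vsp M" and U: "submodule U CC M" and "finite A" "!!x. x:A ==> f x:U"
 shows "finsum M f A:U"
proof -
 interpret abelian_monoid M by (rule vs_abelian_monoid[OF M])
 note D = submoduleD[OF M U]
 show ?thesis
  using assms(3,4) by (induction A) (auto simp: D Pi_def)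
qed

locale flagged_space =
 fixes n :: nat and V :: "'u vs" and e :: "nat => nat => 'u"
 assumes n_pos: "n >= 1" and basis: "flag_basis n V e"
begin

abbreviation cd :: "'u => nat \<times> nat => complex" where
 "cd v == coord n V e v"

definition bas :: "nat \<times> nat => 'u" where
 "bas x = e (fst x) (snd x)"

definition ix :: "(nat \<times> nat) set" where
 "ix = {1..n} \<times> {1..}"

definition supp :: "'u => (nat \<times> nat) set" where
 "supp v = {x. cd v x ~= 0}"

lemma V_vs [simp]: "vsp V"
 using basis by (simp add: flag_basis_def)

lemma bas_in [simp]: "x:ix ==> bas x:car V"
 using basis by (auto simp: flag_basis_def ix_def bas_def)

lemma expansion_coord: "v:car V ==> expansion n V e v (cd v)"
 using basis unfolding flag_basis_def coord_def by (metis theI')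

lemma coord_unique: "v:car V ==> expansion n V e v c ==> cd v = c"
 using basis expansion_coord[of v] unfolding flag_basis_def by metis

lemma finite_supp [simp]: "v:car V ==> finite (supp v)"
 and supp_ix: "v:car V ==> supp v <= ix"
 using expansion_coord[of v] by (auto simp: expansion_def supp_def ix_def)

definition lc :: "(nat \<times> nat => complex) => (nat \<times> nat) set => 'u" where
 "lc c A = (\<Oplus>\<^bsub>V\<^esub>x\<in>A. c x *[V] bas x)"

lemma lc_in: "finite A ==> A <= ix ==> lc c A:car V"
 unfolding lc_def by (rule finsum_submodule[OF V_vs submodule_carrier[OF V_vs]]) (simp_all add: subset_iff split_paired_all)

lemma finsum_support:
 assumes W: "vsp W" and A: "finite A" "A <= ix" "!!x. c x ~= 0 ==> x:A"
  and h: "!!x. x:ix ==> h x:car W"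
 shows "(\<Oplus>\<^bsub>W\<^esub>x\<in>A. c x *[W] h x) = (\<Oplus>\<^bsub>W\<^esub>x\<in>{x. c x ~= 0}. c x *[W] h x)"
proof -
 interpret abelian_monoid W by (rule vs_abelian_monoid[OF W])
 have hA: "h x:car W" if "x:A" for x using that A(2) h by blast
 show ?thesis
  by (rule add.finprod_mono_neutral_cong_right[OF A(1)]) (use A(3) hA W in "auto simp: Pi_def")
qed

lemma coord_lc:
 assumes A: "finite A" "A <= ix"
 shows "cd (lc c A) = (%x. if x:A then c x else 0)"
proof (rule coord_unique[OF lc_in[OF A]])
 let ?c = "%x. if x:A then c x else 0"
 have "lc c A = lc ?c A"
  unfolding lc_def
  by (rule abelian_monoid.finsum_cong'[OF vs_abelian_monoid[OF V_vs]]) (use A in auto)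
 also have "... = (\<Oplus>\<^bsub>V\<^esub>x\<in>{x. ?c x ~= 0}. ?c x *[V] bas x)"
  unfolding lc_def by (rule finsum_support[OF V_vs A]) (auto split: if_splits)
 finally show "expansion n V e (lc c A) ?c"
  using A by (auto simp: expansion_def ix_def bas_def intro: finite_subset[of _ A])
qed

lemma lc_coord:
 assumes v: "v:car V" and A: "finite A" "A <= ix" "supp v <= A"
 shows "lc (cd v) A = v"
proof -
 have "lc (cd v) A = (\<Oplus>\<^bsub>V\<^esub>x\<in>{x. cd v x ~= 0}. cd v x *[V] bas x)"
  unfolding lc_def by (rule finsum_support[OF V_vs A(1,2)]) (use A(3) in "auto simp: supp_def")
 also have "... = v" using expansion_coord[OF v] by (simp add: expansion_def bas_def)
 finally show ?thesis .
qed

lemma coord_outside: "v:car V ==> x \<notin> A ==> supp v <= A ==> cd v x = 0"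
 by (auto simp: supp_def)

lemma coord_add:
 assumes v: "v:car V" and w: "w:car V"
 shows "cd (v +[V] w) x = cd v x + cd w x"
proof -
 let ?A = "supp v Un supp w"
 have A: "finite ?A" "?A <= ix" using v w supp_ix by auto
 have "lc (%x. cd v x + cd w x) ?A = lc (cd v) ?A +[V] lc (cd w) ?A"
 proof -
  interpret abelian_monoid V by (rule vs_abelian_monoid[OF V_vs])
  have b: "bas x:car V" if "x:?A" for x using that A(2) by (intro bas_in) blast
  have "lc (%x. cd v x + cd w x) ?A = (\<Oplus>\<^bsub>V\<^esub>x\<in>?A. cd v x *[V] bas x +[V] cd w x *[V] bas x)"
   unfolding lc_def by (rule finsum_cong') (use b in "auto simp: vs_smult_ladd")
  also have "... = lc (cd v) ?A +[V] lc (cd w) ?A"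
   unfolding lc_def by (rule finsum_addf) (use b in auto)
  finally show ?thesis .
 qed
 also have "... = v +[V] w"
  using lc_coord[OF v A] lc_coord[OF w A] by simp
 finally have "cd (v +[V] w) x = (if x:?A then cd v x + cd w x else 0)"
  using coord_lc[OF A, of "%x. cd v x + cd w x"] by simp
 thus ?thesis by (auto simp: supp_def)
qed

lemma coord_smult:
 assumes v: "v:car V"
 shows "cd (c *[V] v) x = c * cd v x"
proof -
 let ?A = "supp v"
 have A: "finite ?A" "?A <= ix" using v supp_ix by auto
 have "lc (%x. c * cd v x) ?A = c *[V] lc (cd v) ?A"
 proof -
  interpret abelian_monoid V by (rule vs_abelian_monoid[OF V_vs])
  have b: "bas x:car V" if "x:?A" for x using that A(2) by (intro bas_in) blast
  have "lc (%x. c * cd v x) ?A = (\<Oplus>\<^bsub>V\<^esub>x\<in>?A. c *[V] (cd v x *[V] bas x))"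
   unfolding lc_def by (rule finsum_cong') (use b in "auto simp: vs_smult_smult")
  also have "... = c *[V] lc (cd v) ?A"
   unfolding lc_def by (rule module.finsum_smult_ldistr[OF V_vs A(1), symmetric]) (use b in auto)
  finally show ?thesis .
 qed
 also have "... = c *[V] v"
  using lc_coord[OF v A] by simp
 finally have "cd (c *[V] v) x = (if x:?A then c * cd v x else 0)"
  using coord_lc[OF A, of "%x. c * cd v x"] by simp
 thus ?thesis by (auto simp: supp_def)
qed

lemma coord_zero: "cd 0[V] x = 0"
 using coord_smult[of "0[V]" 0 x] by simp

lemma coord_bas: "y:ix ==> cd (bas y) x = (if x = y then 1 else 0)"
proof -
 assume y: "y:ix"
 interpret abelian_monoid V by (rule vs_abelian_monoid[OF V_vs])
 have "lc (%_. 1) {y} = bas y"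
  unfolding lc_def using y by (simp add: Pi_def)
 thus ?thesis using fun_cong[OF coord_lc[of "{y}" "%_. 1"], of x] y by simp
qed

lemma coord_eqI:
 assumes v: "v:car V" and w: "w:car V" and "!!x. x:ix ==> cd v x = cd w x"
 shows "v = w"
proof -
 have eq: "cd v = cd w"
 proof
  fix x
  show "cd v x = cd w x"
   using assms(3) coord_outside[OF v _ supp_ix[OF v], of x] coord_outside[OF w _ supp_ix[OF w], of x]
   by (cases "x:ix") simp_all
 qed
 have "v = lc (cd v) (supp v)"
  using lc_coord[OF v finite_supp[OF v] supp_ix[OF v]] by simp
 also have "... = lc (cd w) (supp w)"
  by (simp add: supp_def eq)
 also have "... = w"
  using lc_coord[OF w finite_supp[OF w] supp_ix[OF w]] by simp
 finally show ?thesis .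
qed

lemma V_generated:
 assumes U: "submodule U CC V" and b: "!!x. x:supp v ==> bas x:U" and v: "v:car V"
 shows "v:U"
proof -
 have "lc (cd v) (supp v):U"
  unfolding lc_def by (rule finsum_submodule[OF V_vs U]) (use v b submoduleD[OF V_vs U] in auto)
 thus ?thesis using lc_coord[OF v _ supp_ix[OF v]] v by simp
qed

lemma V_eq:
 fixes P :: "'c vs"
 assumes P: "vsp P" and f: "linear_on V P f" and g: "linear_on V P g"
  and b: "!!x. x:ix ==> f (bas x) = g (bas x)" and v: "v:car V"
 shows "f v = g v"
proof -
 have "v:{x:car V. f x = g x}"
  by (rule V_generated[OF submodule_eqset[OF V_vs P f g] _ v]) (use b supp_ix[OF v] in auto)
 thus ?thesis by simp
qed

definition extend :: "'c vs => (nat \<times> nat => 'c) => 'u => 'c" where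
 "extend W h = (\<lambda>v\<in>car V. \<Oplus>\<^bsub>W\<^esub>x\<in>supp v. cd v x *[W] h x)"

lemma extend_sum:
 assumes W: "vsp W" and h: "!!x. x:ix ==> h x:car W" and v: "v:car V"
  and A: "finite A" "A <= ix" "supp v <= A"
 shows "extend W h v = (\<Oplus>\<^bsub>W\<^esub>x\<in>A. cd v x *[W] h x)"
proof -
 have "(\<Oplus>\<^bsub>W\<^esub>x\<in>A. cd v x *[W] h x) = (\<Oplus>\<^bsub>W\<^esub>x\<in>{x. cd v x ~= 0}. cd v x *[W] h x)"
  by (rule finsum_support[OF W A(1,2) _ h]) (use A(3) in "auto simp: supp_def")
 thus ?thesis using v by (simp add: extend_def supp_def)
qed

lemma extend_in:
 assumes W: "vsp W" and h: "!!x. x:ix ==> h x:car W"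
 shows "extend W h:lin V W"
proof -
 interpret abelian_monoid W by (rule vs_abelian_monoid[OF W])
 have "linear_on V W (extend W h)"
 proof (rule linear_onI)
  fix v w c assume v: "v:car V"
  have hv: "h x:car W" if "x:supp v" for x using that supp_ix[OF v] h by blast
  show "extend W h v:car W"
   using v hv W by (simp add: extend_def Pi_def)
  have cv: "c *[V] v:car V" using v by simp
  have "extend W h (c *[V] v) = (\<Oplus>\<^bsub>W\<^esub>x\<in>supp v. cd (c *[V] v) x *[W] h x)"
   by (rule extend_sum[OF W h cv]) (use v supp_ix[OF v] finite_supp[OF v] in "auto simp: supp_def coord_smult")
  also have "... = (\<Oplus>\<^bsub>W\<^esub>x\<in>supp v. c *[W] (cd v x *[W] h x))"
   by (rule finsum_cong') (use hv W v in "auto simp: coord_smult vs_smult_smult")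
  also have "... = c *[W] extend W h v"
   using module.finsum_smult_ldistr[OF W, of "supp v" c "%x. cd v x *[W] h x"] hv W v by (simp add: extend_def Pi_def)
  finally show "extend W h (c *[V] v) = c *[W] extend W h v" .
  assume w: "w:car V"
  let ?A = "supp v Un supp w"
  have A: "finite ?A" "?A <= ix" using v w supp_ix by auto
  have hA: "h x:car W" if "x:?A" for x using that A(2) h by blast
  have vw: "v +[V] w:car V" using v w by simp
  have "extend W h (v +[V] w) = (\<Oplus>\<^bsub>W\<^esub>x\<in>?A. cd (v +[V] w) x *[W] h x)"
   by (rule extend_sum[OF W h vw A]) (auto simp: supp_def coord_add v w)
  also have "... = (\<Oplus>\<^bsub>W\<^esub>x\<in>?A. cd v x *[W] h x +[W] cd w x *[W] h x)"
   by (rule finsum_cong') (use hA W v w in "auto simp: coord_add vs_smult_ladd")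
  also have "... = (\<Oplus>\<^bsub>W\<^esub>x\<in>?A. cd v x *[W] h x) +[W] (\<Oplus>\<^bsub>W\<^esub>x\<in>?A. cd w x *[W] h x)"
   by (rule finsum_addf) (use hA W in auto)
  also have "... = extend W h v +[W] extend W h w"
   using extend_sum[OF W h v A] extend_sum[OF W h w A] by simp
  finally show "extend W h (v +[V] w) = extend W h v +[W] extend W h w" .
 qed
 thus ?thesis by (simp add: lin_def extend_def)
qed

lemma extend_bas:
 assumes W: "vsp W" and h: "!!x. x:ix ==> h x:car W" and y: "y:ix"
 shows "extend W h (bas y) = h y"
proof -
 interpret abelian_monoid W by (rule vs_abelian_monoid[OF W])
 have "extend W h (bas y) = (\<Oplus>\<^bsub>W\<^esub>x\<in>{y}. cd (bas y) x *[W] h x)"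
  by (rule extend_sum[OF W h bas_in[OF y]]) (use y in "auto simp: supp_def coord_bas split: if_splits")
 also have "... = h y"
  using y h[OF y] W by (simp add: coord_bas Pi_def)
 finally show ?thesis .
qed

text \<open>For functionals with values in the scalars, which do not form a vector space inside the given type.\<close>

lemma functional_expand:
 fixes g :: "'u => complex"
 assumes add: "!!v w. v:car V ==> w:car V ==> g (v +[V] w) = g v + g w"
  and sm: "!!c v. v:car V ==> g (c *[V] v) = c * g v"
  and v: "v:car V" and A: "finite A" "A <= ix" "supp v <= A"
 shows "g v = (\<Sum>x\<in>A. cd v x * g (bas x))"
proof -
 interpret abelian_monoid V by (rule vs_abelian_monoid[OF V_vs])
 have "g (lc c B) = (\<Sum>x\<in>B. c x * g (bas x))" if "finite B" "B <= ix" for B c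
  using that
 proof (induction B)
  case empty
  thus ?case using sm[of "0[V]" 0] by (simp add: lc_def)
 next
  case (insert x F)
  hence "lc c (insert x F) = c x *[V] bas x +[V] lc c F"
   unfolding lc_def by (subst finsum_insert) auto
  thus ?case
   using insert lc_in[of F c] by (simp add: add sm)
 qed
 from this[OF A(1,2), of "cd v"] show ?thesis using lc_coord[OF v A] by simp
qed

lemma supp_zero: "supp 0[V] = {}"
 by (simp add: supp_def coord_zero)

lemma supp_add: "v:car V ==> w:car V ==> supp (v +[V] w) <= supp v Un supp w"
 unfolding supp_def by (rule subsetI, simp only: mem_Collect_eq Un_iff coord_add) auto

lemma supp_smult: "v:car V ==> supp (c *[V] v) <= supp v"
 by (auto simp: supp_def coord_smult)

lemma supp_bas: "x:ix ==> supp (bas x) = {x}"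
 by (auto simp: supp_def coord_bas)

lemma submodule_supp: "submodule {v:car V. supp v <= J} CC V"
proof (rule submoduleI[OF V_vs])
 show "x +[V] y:{v:car V. supp v <= J}"
  if "x:{v:car V. supp v <= J}" "y:{v:car V. supp v <= J}" for x y
  using that supp_add[of x y] by (simp add: subset_iff) blast
 show "c *[V] x:{v:car V. supp v <= J}" if "x:{v:car V. supp v <= J}" for c x
  using that supp_smult[of x c] by (simp add: subset_iff)
qed (simp_all add: supp_zero)

subsection \<open>Coordinate subspaces and projections\<close>

lemma lspan_bas:
 assumes J: "J <= ix"
 shows "lspan V (bas ` J) = {v:car V. supp v <= J}"
proof
 show "lspan V (bas ` J) <= {v:car V. supp v <= J}"
  by (rule lspan_least[OF submodule_supp]) (use J in "auto simp: subset_iff supp_bas")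
 have bJ: "bas ` J <= car V" using J by auto
 show "{v:car V. supp v <= J} <= lspan V (bas ` J)"
 proof
  fix v assume v: "v:{v:car V. supp v <= J}"
  show "v:lspan V (bas ` J)"
   by (rule V_generated[OF submodule_lspan[OF V_vs bJ]]) (use v lspan_incl[of "bas ` J" V] in auto)
 qed
qed

definition sub :: "(nat \<times> nat) set => 'u set" where
 "sub J = {v:car V. supp v <= J}"

lemma sub_in: "v:sub J ==> v:car V"
 by (simp add: sub_def)

lemma submodule_sub [simp]: "submodule (sub J) CC V"
 unfolding sub_def by (rule submodule_supp)

lemma bas_sub: "x:ix ==> bas x:sub J \<longleftrightarrow> x:J"
 by (simp add: sub_def supp_bas)

lemma sub_mono: "J <= J' ==> sub J <= sub J'"
 by (auto simp: sub_def)

lemma map_sub: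
 assumes f: "linear_on V W f" and W: "vsp W" and U: "submodule U CC W"
  and b: "!!x. x:J ==> x:ix ==> f (bas x):U" and v: "v:sub J"
 shows "f v:U"
proof -
 have "v:{x:car V. f x:U}"
  by (rule V_generated[OF submodule_preimage[OF V_vs W f U]]) (use v b supp_ix[of v] in "auto simp: sub_def subset_iff")
 thus ?thesis by simp
qed

definition proj :: "(nat \<times> nat) set => 'u => 'u" where
 "proj J = extend V (%x. if x:J then bas x else 0[V])"

lemma proj_in [simp]: "proj J:lin V V"
 unfolding proj_def by (rule extend_in) auto

lemma proj_bas: "x:ix ==> proj J (bas x) = (if x:J then bas x else 0[V])"
 unfolding proj_def by (subst extend_bas) auto

lemma proj_closed [simp]: "v:car V ==> proj J v:car V"
 by (rule lin_closed[OF proj_in])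

lemma proj_sub: "v:car V ==> proj J v:sub J"
 by (rule map_sub[OF linD[OF proj_in] V_vs submodule_sub, of UNIV])
  (auto simp: proj_bas bas_sub submoduleD(2)[OF V_vs submodule_sub] sub_def[of UNIV])

lemma proj_id:
 assumes "v:sub J" shows "proj J v = v"
proof -
 have "v:{v:car V. proj J v = v}"
  by (rule V_generated[OF submodule_eqset[OF V_vs V_vs linD[OF proj_in] linear_on_ident]])
   (use assms supp_ix[of v] in "auto simp: sub_def proj_bas subset_iff")
 thus ?thesis by simp
qed

lemma proj_proj:
 assumes v: "v:car V" shows "proj J (proj K v) = proj (J Int K) v"
 by (rule V_eq[OF V_vs lin_comp[OF linD[OF proj_in] linD[OF proj_in]] linD[OF proj_in] _ v])
  (auto simp: proj_bas lin_zero[OF V_vs V_vs proj_in])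

end

sublocale flagged_space \<subseteq> vs_universe V "e 1 1"
proof (rule vs_universe.intro)
 have "(1, 1):ix" using n_pos by (simp add: ix_def)
 thus "e 1 1:car V" "e 1 1 ~= 0[V]"
  using bas_in[of "(1, 1)", unfolded bas_def] coord_bas[of "(1, 1)" "(1, 1)", unfolded bas_def] coord_zero[of "(1, 1)"] by auto
qed (rule V_vs)

section \<open>Flags\<close>

abbreviation Fl :: "nat => 'u flag set" where
 "Fl n == Ob (Flag n)"

abbreviation pfn where "pfn n F == polynomial_functor n F"

abbreviation NT where "NT n == nat_trans n"

abbreviation FL where "FL n X Y == flag_lin n X Y"

lemma Flag_simps [simp]:
 "X:Fl n \<longleftrightarrow> is_flag n X & fin_dim (fst X)" "Hom (Flag n) = FL n"
 "Idn (Flag n) X = lin_id (fst X)" "Cmp (Flag n) X Y Z g f = cmp (fst X) g f"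
 by (simp_all add: Flag_def)

lemma flag_linI: "f:lin (fst X) (fst Y) ==> (!!i x. i <= n ==> x:snd X i ==> f x:snd Y i) ==> f:FL n X Y"
 by (auto simp: flag_lin_def)

lemma flag_linD: "f:FL n X Y ==> f:lin (fst X) (fst Y)"
 "f:FL n X Y ==> i <= n ==> x:snd X i ==> f x:snd Y i"
 by (auto simp: flag_lin_def)

lemma is_flagD:
 assumes "is_flag n X"
 shows "vsp (fst X)" "!!i. i <= n ==> submodule (snd X i) CC (fst X)" "snd X 0 = {0[fst X]}"
  "snd X n = car (fst X)" "!!i x. i <= n ==> x:snd X i ==> x:car (fst X)"
proof -
 show v: "vsp (fst X)" and s: "!!i. i <= n ==> submodule (snd X i) CC (fst X)"
  and "snd X 0 = {0[fst X]}" "snd X n = car (fst X)"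
  using assms by (simp_all add: is_flag_def)
 show "!!i x. i <= n ==> x:snd X i ==> x:car (fst X)"
  using submoduleD(5)[OF v s] by blast
qed

lemma is_flag_mono: "is_flag n X ==> i <= j ==> j <= n ==> snd X i <= snd X j"
proof -
 assume X: "is_flag n X" and ij: "i <= j"
 show "j <= n ==> snd X i <= snd X j"
  using ij
 proof (induction j rule: dec_induct)
  case (step m)
  have "snd X m <= snd X (Suc m)" using X step.prems by (simp add: is_flag_def)
  thus ?case using step by simp
 qed simp
qed

lemma flag_lin_compose:
 assumes "is_flag n X" "f:FL n X Y" "g:FL n Y Z"
 shows "cmp (fst X) g f:FL n X Z"
 by (rule flag_linI)
  (use assms is_flagD[OF assms(1)] flag_linD[OF assms(2)] flag_linD[OF assms(3)] in "auto intro!: lin_compose")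

lemma flag_lin_id: "is_flag n X ==> lin_id (fst X):FL n X X"
 by (rule flag_linI) (use is_flagD[of n X] in auto)

lemma compose_lin_id_left: "f:lin V W ==> cmp V (lin_id W) f = f"
 by (rule ext) (auto simp: compose_def lin_id_def lin_def linear_on_def extensional_def)

lemma compose_lin_id_right: "f:lin V W ==> cmp V f (lin_id V) = f"
 by (rule ext) (auto simp: compose_def lin_id_def lin_def linear_on_def extensional_def)

lemma compose_lin_assoc: "f:lin U V ==> cmp U (cmp V h g) f = cmp U h (cmp U g f)"
 by (rule ext) (auto simp: compose_def lin_def linear_on_def)

lemma category_Flag: "category (Flag n)"
proof
 fix W X Y Z :: "'a flag" and f g h
 show "Idn (Flag n) X:Hom (Flag n) X X" if "X:Fl n"
  using that flag_lin_id[of n X] by simp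
 show "Cmp (Flag n) X Y Z g f:Hom (Flag n) X Z"
  if "X:Fl n" "f:Hom (Flag n) X Y" "g:Hom (Flag n) Y Z"
  using that flag_lin_compose[of n X f Y g Z] by simp
 show "Cmp (Flag n) X Y Y (Idn (Flag n) Y) f = f" if "X:Fl n" "Y:Fl n" "f:Hom (Flag n) X Y"
  using that flag_linD(1)[of f n X Y] by (simp add: compose_lin_id_left)
 show "Cmp (Flag n) X X Y f (Idn (Flag n) X) = f" if "X:Fl n" "Y:Fl n" "f:Hom (Flag n) X Y"
  using that flag_linD(1)[of f n X Y] by (simp add: compose_lin_id_right)
 show "Cmp (Flag n) W X Z (Cmp (Flag n) X Y Z h g) f = Cmp (Flag n) W Y Z h (Cmp (Flag n) W X Y g f)"
  if "f:Hom (Flag n) W X"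
  using that flag_linD(1)[of f n W X] by (simp add: compose_lin_assoc)
qed

lemma is_inverse_unique:
 assumes "category C" "X:Ob C" "Y:Ob C" "is_inverse C X Y f g" "is_inverse C X Y f g'"
 shows "g = g'"
proof -
 interpret category C by fact
 note i = assms(4,5)[unfolded is_inverse_def]
 have "g = Cmp C Y X X (Idn C X) g"
  using Idn_left assms(2,3) i by simp
 also have "... = Cmp C Y X X (Cmp C X Y X g' f) g"
  using i by simp
 also have "... = Cmp C Y Y X g' (Cmp C Y X Y f g)"
  using Cmp_assoc[of Y X Y X g f g'] assms(2,3) i by simp
 also have "... = g'"
  using Idn_right[of Y X g'] assms(2,3) i by simp
 finally show ?thesis .
qed

lemma the_inverse:
 assumes "category C" "X:Ob C" "Y:Ob C" "is_iso C X Y f"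
 shows "is_inverse C X Y f (the_inverse C X Y f)"
 using assms is_inverse_unique[OF assms(1-3)] unfolding is_iso_def the_inverse_def
 by (metis theI)

lemma fin_dim_submodule:
 assumes X: "vsp X" and W: "submodule W CC X" and f: "fin_dim X"
 shows "fin_dim (X<|W|>)"
proof -
 note vW = submodule_vspace[OF X W]
 obtain r where r: "linear_on X (X<|W|>) r" "ALL x:W. r x = x"
  using linear_extension[OF X vW W linear_on_ident] by blast
 have "r ` car X = car (X<|W|>)"
  using linear_onD(1)[OF r(1)] r(2) submoduleD(5)[OF X W] by (force simp: image_iff)
 thus ?thesis
  by (rule fin_dim_image[OF X vW r(1) _ f])
qed

definition adapted :: "nat => 'u flag => (nat \<times> 'u) set => bool" where
 "adapted n X T \<longleftrightarrow> finite T & (ALL k x. (k, x):T --> 1 <= k & k <= n & x:snd X k) \<and>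
   (ALL i<=n. snd X i <= lspan (fst X) {x. EX k<=i. (k, x):T})"

lemma adapted_exists:
 assumes X: "is_flag n X" "fin_dim (fst X)"
 shows "EX T. adapted n X T"
proof -
 note F = is_flagD[OF X(1)]
 have "ALL i<=n. EX S. finite S & S <= snd X i & lspan (fst X) S = snd X i"
 proof (intro allI impI)
  fix i assume i: "i <= n"
  obtain S where "finite S" "S <= snd X i" "lspan ((fst X)<|snd X i|>) S = snd X i"
   using fin_dim_submodule[OF F(1) F(2)[OF i] X(2)] by (auto simp: fin_dim_def)
  thus "EX S. finite S & S <= snd X i & lspan (fst X) S = snd X i"
   using lspan_restrict[OF F(1) F(2)[OF i], of S] by auto
 qed
 then obtain S where S: "!!i. i <= n ==> finite (S i) & S i <= snd X i & lspan (fst X) (S i) = snd X i"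
  by metis
 have "adapted n X (SIGMA i:{1..n}. S i)"
  unfolding adapted_def
 proof (intro conjI allI impI)
  show "finite (SIGMA i:{1..n}. S i)" using S by auto
  fix i assume i: "i <= n"
  show "snd X i <= lspan (fst X) {x. EX k<=i. (k, x):(SIGMA i:{1..n}. S i)}"
  proof (cases "i = 0")
   case True
   have "submodule (lspan (fst X) {x. EX k<=i. (k, x):(SIGMA i:{1..n}. S i)}) CC (fst X)"
    by (rule submodule_lspan[OF F(1)]) (use True in auto)
   thus ?thesis using True F(1,3) submoduleD(2) by fastforce
  next
   case False
   hence "S i <= {x. EX k<=i. (k, x):(SIGMA i:{1..n}. S i)}" using i by auto
   thus ?thesis using lspan_mono S[OF i] by blast
  qed
 qed (use S in auto)
 thus ?thesis by blast
qed

context flagged_space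
begin

definition ixa :: "(nat => nat) => (nat \<times> nat) set" where
 "ixa a = {(k, j). 1 <= k & k <= n & 1 <= j & j <= a k}"

definition lev :: "nat => (nat \<times> nat) set" where
 "lev i = {x. fst x <= i}"

lemma ixa_ix: "ixa a <= ix"
 by (auto simp: ixa_def ix_def)

lemma finite_ixa [simp]: "finite (ixa a)"
proof -
 have "ixa a <= (SIGMA k:{1..n}. {1..a k})"
  by (auto simp: ixa_def)
 thus ?thesis
  by (rule finite_subset) simp
qed

lemma std_flag_eq:
 "fst (std_flag n V e a) = V<|sub (ixa a)|>"
 "i <= n ==> snd (std_flag n V e a) i = sub (ixa a Int lev i)"
proof -
 have 1: "{e k j | k j. 1 <= k & k <= n & 1 <= j & j <= a k} = bas ` ixa a"
  by (force simp: ixa_def bas_def image_iff)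
 show "fst (std_flag n V e a) = V<|sub (ixa a)|>"
  unfolding std_flag_def 1 sub_def lspan_bas[OF ixa_ix] by simp
 assume "i <= n"
 hence 2: "{e k j | k j. 1 <= k & k <= i & 1 <= j & j <= a k} = bas ` (ixa a Int lev i)"
  by (force simp: ixa_def bas_def image_iff lev_def)
 have J: "ixa a Int lev i <= ix" using ixa_ix by blast
 have "snd (std_flag n V e a) i = lspan V {e k j | k j. 1 <= k & k <= i & 1 <= j & j <= a k}"
  by (simp add: std_flag_def)
 also have "... = sub (ixa a Int lev i)"
  unfolding 2 lspan_bas[OF J] sub_def ..
 finally show "snd (std_flag n V e a) i = sub (ixa a Int lev i)" .
qed

lemma big_flag_eq:
 "fst (big_flag V e) = V"
 "i <= n ==> snd (big_flag V e) i = sub (lev i)"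
proof -
 assume "i <= n"
 hence 2: "{e k j | k j. 1 <= k & k <= i & 1 <= j} = bas ` (ix Int lev i)"
  by (force simp: ix_def bas_def image_iff lev_def)
 have J: "ix Int lev i <= ix" by blast
 have "snd (big_flag V e) i = lspan V {e k j | k j. 1 <= k & k <= i & 1 <= j}"
  by (simp add: big_flag_def)
 also have "... = {v:car V. supp v <= ix Int lev i}"
  unfolding 2 lspan_bas[OF J] ..
 also have "... = sub (lev i)"
  using supp_ix by (auto simp: sub_def)
 finally show "snd (big_flag V e) i = sub (lev i)" .
qed (simp add: big_flag_def)

lemma sub_empty: "sub {} = {0[V]}"
 using coord_eqI[of _ "0[V]"] by (auto simp: sub_def supp_zero supp_def coord_zero)

lemma sub_all: "sub ix = car V"
 using supp_ix by (auto simp: sub_def)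

lemma sub_ix: "sub (J Int ix) = sub J"
 using supp_ix by (auto simp: sub_def)

lemma is_flag_big: "is_flag n (big_flag V e)"
proof -
 have "lev 0 Int ix = {}" "lev n Int ix = ix"
  by (auto simp: lev_def ix_def)
 hence "sub (lev 0) = {0[V]}" "sub (lev n) = car V"
  using sub_ix[of "lev 0"] sub_ix[of "lev n"] sub_empty sub_all by simp_all
 moreover have "sub (lev i) <= sub (lev (Suc i))" for i
  by (rule sub_mono) (auto simp: lev_def)
 ultimately show ?thesis
  unfolding is_flag_def by (auto simp: big_flag_eq)
qed

lemma std_vspace [simp]: "vsp (V<|sub J|>)"
 by (rule submodule_vspace) simp_all

lemma is_flag_std: "is_flag n (std_flag n V e a)"
proof -
 have "lev 0 Int ixa a = {}" "ixa a Int lev n = ixa a"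
  by (auto simp: lev_def ixa_def)
 hence "sub (ixa a Int lev 0) = {0[V]}" "sub (ixa a Int lev n) = sub (ixa a)"
  using sub_empty by (simp_all add: Int_commute)
 moreover have "sub (ixa a Int lev i) <= sub (ixa a Int lev (Suc i))" for i
  by (rule sub_mono) (auto simp: lev_def)
 moreover have "submodule (sub (ixa a Int lev i)) CC (V<|sub (ixa a)|>)" for i
  by (rule submodule_restrict) (auto intro!: sub_mono)
 ultimately show ?thesis
  unfolding is_flag_def by (auto simp: std_flag_eq)
qed

lemma fin_dim_std: "fin_dim (fst (std_flag n V e a))"
proof -
 have s: "bas ` ixa a <= sub (ixa a)"
  using ixa_ix bas_sub by blast
 have "lspan (V<|sub (ixa a)|>) (bas ` ixa a) = lspan V (bas ` ixa a)"
  by (rule lspan_restrict[OF V_vs submodule_sub s])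
 also have "... = sub (ixa a)"
  by (simp add: lspan_bas[OF ixa_ix] sub_def)
 finally show ?thesis
  unfolding std_flag_eq fin_dim_def using s by (intro exI[of _ "bas ` ixa a"]) simp
qed

lemma std_Ob [simp]: "std_flag n V e a:Fl n"
 by (simp add: is_flag_std fin_dim_std)

text \<open>For mutually inverse flag maps, the diagonal blocks are mutually inverse as well, and
 \<open>tr (M N) = tr (N M)\<close> compares their sizes.\<close>

lemma std_iso_block:
 assumes ph: "ph:FL n (std_flag n V e a) (std_flag n V e b)"
  and ps: "ps:FL n (std_flag n V e b) (std_flag n V e a)"
  and inv: "!!v. v:sub (ixa a) ==> ps (ph v) = v"
  and k: "1 <= k" "k <= n" and p: "1 <= p" "p <= a k"
 shows "(\<Sum>q=1..b k. cd (ph (bas (k, p))) (k, q) * cd (ps (bas (k, q))) (k, p')) = (if p = p' then 1 else 0)"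
proof -
 have kp: "(k, p):ixa a" using k p by (simp add: ixa_def)
 hence kp': "(k, p):ix" using ixa_ix by blast
 define v where "v = ph (bas (k, p))"
 have "bas (k, p):snd (std_flag n V e a) k"
  using kp kp' k(2) by (simp add: std_flag_eq bas_sub lev_def)
 hence "v:snd (std_flag n V e b) k"
  unfolding v_def by (rule flag_linD(2)[OF ph k(2)])
 hence v: "v:sub (ixa b Int lev k)" using k(2) by (simp add: std_flag_eq)
 hence vV: "v:car V" and vs: "supp v <= ixa b Int lev k" by (auto simp: sub_def)
 have psl: "ps:lin (V<|sub (ixa b)|>) (V<|sub (ixa a)|>)"
  using flag_linD(1)[OF ps] by (simp add: std_flag_eq)
 define g where "g w = cd (ps (proj (ixa b) w)) (k, p')" for w
 have psV: "ps (proj (ixa b) w):car V" if "w:car V" for w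
  using lin_closed[OF psl, of "proj (ixa b) w"] proj_sub[OF that] sub_in by simp
 have "g v = (\<Sum>x\<in>ixa b. cd v x * g (bas x))"
 proof (rule functional_expand[OF _ _ vV finite_ixa ixa_ix])
  show "g (u +[V] w) = g u + g w" if "u:car V" "w:car V" for u w
   using lin_add[OF psl, of "proj (ixa b) u" "proj (ixa b) w"] that proj_sub psV
   by (simp add: g_def lin_add[OF proj_in] coord_add)
  show "g (c *[V] w) = c * g w" if "w:car V" for c w
   using lin_smult[OF psl, of "proj (ixa b) w" c] that proj_sub psV
   by (simp add: g_def lin_smult[OF proj_in] coord_smult)
 qed (use vs in blast)
 also have "... = (\<Sum>x\<in>{k} \<times> {1..b k}. cd v x * g (bas x))"
 proof (rule sum.mono_neutral_right)
  show "{k} \<times> {1..b k} <= ixa b" using k by (auto simp: ixa_def)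
  show "ALL x:ixa b - {k} \<times> {1..b k}. cd v x * g (bas x) = 0"
  proof
   fix x assume x: "x:ixa b - {k} \<times> {1..b k}"
   hence xb: "x:ixa b" and xk: "fst x ~= k" and xn: "fst x <= n" by (auto simp: ixa_def)
   have xi: "x:ix" using xb ixa_ix by blast
   show "cd v x * g (bas x) = 0"
   proof (cases "fst x <= k")
    case False
    hence "x \<notin> supp v" using vs by (auto simp: lev_def)
    thus ?thesis by (simp add: supp_def)
   next
    case True
    have "bas x:snd (std_flag n V e b) (fst x)"
    using xb xi xn by (simp add: std_flag_eq bas_sub lev_def)
    hence "ps (bas x):sub (ixa a Int lev (fst x))"
    using flag_linD(2)[OF ps xn] xn by (simp add: std_flag_eq)
    hence "(k, p') \<notin> supp (ps (bas x))" using True xk by (auto simp: sub_def lev_def)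
    hence "g (bas x) = 0"
    using xb xi by (simp add: g_def proj_bas supp_def)
    thus ?thesis by simp
   qed
  qed
 qed simp
 also have "... = (\<Sum>q=1..b k. cd v (k, q) * cd (ps (bas (k, q))) (k, p'))"
 proof -
  have "(\<Sum>x\<in>{k} \<times> {1..b k}. cd v x * g (bas x)) = (\<Sum>q=1..b k. cd v (k, q) * g (bas (k, q)))"
  proof -
   have eq: "{k} \<times> {1..b k} = Pair k ` {1..b k}" by auto
   show ?thesis unfolding eq by (subst sum.reindex) (auto simp: inj_on_def)
  qed
  also have "... = (\<Sum>q=1..b k. cd v (k, q) * cd (ps (bas (k, q))) (k, p'))"
  proof (rule sum.cong[OF refl])
   fix q assume "q:{1..b k}"
   hence "(k, q):ixa b" using k by (simp add: ixa_def)
   thus "cd v (k, q) * g (bas (k, q)) = cd v (k, q) * cd (ps (bas (k, q))) (k, p')"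
    using ixa_ix by (auto simp: g_def proj_bas subset_iff)
  qed
  finally show ?thesis .
 qed
 finally have "g v = (\<Sum>q=1..b k. cd v (k, q) * cd (ps (bas (k, q))) (k, p'))" .
 moreover have "g v = (if p = p' then 1 else 0)"
 proof -
  have "v:sub (ixa b)" using v sub_mono[of "ixa b Int lev k" "ixa b"] by blast
  hence "g v = cd (ps v) (k, p')" by (simp add: g_def proj_id)
  also have "ps v = bas (k, p)"
   unfolding v_def by (rule inv) (use kp kp' bas_sub in simp)
  finally show ?thesis using kp' by (auto simp: coord_bas)
 qed
 ultimately show ?thesis by (simp add: v_def)
qed

lemma std_iso_type:
 assumes ph: "ph:FL n (std_flag n V e a) (std_flag n V e b)"
  and ps: "ps:FL n (std_flag n V e b) (std_flag n V e a)"
  and inv: "!!v. v:sub (ixa a) ==> ps (ph v) = v" "!!v. v:sub (ixa b) ==> ph (ps v) = v"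
  and k: "1 <= k" "k <= n"
 shows "a k = b k"
proof -
 let ?M = "%p q. cd (ph (bas (k, p))) (k, q)" and ?N = "%q p. cd (ps (bas (k, q))) (k, p)"
 have "of_nat (a k) = (\<Sum>p=1..a k. \<Sum>q=1..b k. ?M p q * ?N q p)"
  using std_iso_block[OF ph ps inv(1) k] by simp
 also have "... = (\<Sum>q=1..b k. \<Sum>p=1..a k. ?N q p * ?M p q)"
  by (subst sum.swap) (simp add: mult.commute)
 also have "... = of_nat (b k)"
  using std_iso_block[OF ps ph inv(2) k] by simp
 finally show ?thesis by (simp only: of_nat_eq_iff)
qed

text \<open>A spanning family of least size among those adapted to the flag is a basis: in a relation, a member
 of highest level is a combination of others of at most that level and could be left out.\<close>

lemma std_iso_exists:
 assumes X: "is_flag n X" "fin_dim (fst X)"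
 shows "EX a:{1..n} \<rightarrow>\<^sub>E UNIV. EX ph. is_iso (Flag n) X (std_flag n V e a) ph"
proof -
 note F = is_flagD[OF X(1)]
 obtain T where T: "adapted n X T" and Tmin: "!!T'. adapted n X T' ==> card T <= card T'"
  using adapted_exists[OF X] ex_has_least_nat[of "adapted n X" _ card] by metis
 have Tfin: "finite T" and Tin: "!!k x. (k, x):T ==> 1 <= k & k <= n & x:snd X k"
  and Tspan: "!!i. i <= n ==> snd X i <= lspan (fst X) {x. EX k<=i. (k, x):T}"
  using T by (auto simp: adapted_def)
 have TX: "x:car (fst X)" if "(k, x):T" for k x
  using Tin[OF that] F(5) by blast
 define a where "a = (\<lambda>k\<in>{1..n}. card {x. (k, x):T})"
 have fin: "finite {x. (k, x):T}" for k
  using finite_imageI[OF Tfin, of snd] by (rule finite_subset[rotated]) force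
 have "ALL k. EX h. bij_betw h {1..card {x. (k, x):T}} {x. (k, x):T}"
  using ex_bij_betw_nat_finite_1[OF fin] by blast
 then obtain h where h: "!!k. bij_betw (h k) {1..card {x. (k, x):T}} {x. (k, x):T}"
  by metis
 have ak: "a k = card {x. (k, x):T}" if "1 <= k" "k <= n" for k
  using that by (simp add: a_def)
 have hT: "(k, h k j):T" if "(k, j):ixa a" for k j
  using bij_betw_apply[OF h[of k], of j] that ak[of k] by (simp add: ixa_def)
 have hinj: "j = j'" if "(k, j):ixa a" "(k, j'):ixa a" "h k j = h k j'" for k j j'
  by (rule inj_onD[OF bij_betw_imp_inj_on[OF h[of k]] that(3)]) (use that ak[of k] in "simp_all add: ixa_def")
 have hsurj: "EX j. (k, j):ixa a & h k j = x" if "(k, x):T" for k x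
 proof -
  have "x:h k ` {1..card {x. (k, x):T}}" using h[of k] that by (simp add: bij_betw_def)
  thus ?thesis using Tin[OF that] ak[of k] by (auto simp: ixa_def)
 qed
 define hh where "hh y = (if y:ixa a then h (fst y) (snd y) else 0[fst X])" for y
 have hh_in: "hh y:car (fst X)" for y
  using hT[of "fst y" "snd y"] TX F(1) by (auto simp: hh_def)
 define ps where "ps = extend (fst X) hh"
 have ps: "ps:lin V (fst X)" and ps_bas: "!!y. y:ix ==> ps (bas y) = hh y"
  unfolding ps_def by (rule extend_in[OF F(1) hh_in], rule extend_bas[OF F(1) hh_in])
 have img: "ps ` sub (ixa a Int lev i) = lspan (fst X) {x. EX k<=i. (k, x):T}" for i
 proof -
  have J: "ixa a Int lev i <= ix" using ixa_ix by blast
  have "ps ` sub (ixa a Int lev i) = ps ` lspan V (bas ` (ixa a Int lev i))"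
   by (simp add: lspan_bas[OF J] sub_def)
  also have "... = lspan (fst X) (ps ` bas ` (ixa a Int lev i))"
   by (rule image_lspan[OF V_vs F(1) linD[OF ps]]) (use J in auto)
  also have "ps ` bas ` (ixa a Int lev i) = {x. EX k<=i. (k, x):T}"
  proof (intro subset_antisym subsetI)
   fix x assume "x:ps ` bas ` (ixa a Int lev i)"
   then obtain k j where "(k, j):ixa a" "k <= i" "x = h k j"
    using ps_bas J by (auto simp: hh_def lev_def subset_iff)
   thus "x:{x. EX k<=i. (k, x):T}" using hT by blast
  next
   fix x assume "x:{x. EX k<=i. (k, x):T}"
   then obtain k where k: "k <= i" "(k, x):T" by blast
   then obtain j where j: "(k, j):ixa a" "h k j = x" using hsurj by blast
   hence "ps (bas (k, j)) = x" using ps_bas[of "(k, j)"] ixa_ix by (auto simp: hh_def)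
   thus "x:ps ` bas ` (ixa a Int lev i)"
    using j k by (auto simp: lev_def intro!: image_eqI[of x ps "bas (k, j)"])
  qed
  finally show ?thesis .
 qed
 have img': "ps ` sub (ixa a Int lev i) = snd X i" if i: "i <= n" for i
 proof
  have "{x. EX k<=i. (k, x):T} <= snd X i"
   using Tin is_flag_mono[OF X(1) _ i] by blast
  thus "ps ` sub (ixa a Int lev i) <= snd X i"
   unfolding img using lspan_least[OF F(2)[OF i]] by blast
  show "snd X i <= ps ` sub (ixa a Int lev i)"
   unfolding img by (rule Tspan[OF i])
 qed
 have ker: "v = 0[V]" if v: "v:sub (ixa a)" and v0: "ps v = 0[fst X]" for v
 proof (rule ccontr)
  assume "v ~= 0[V]"
  have vV: "v:car V" and vs: "supp v <= ixa a" using v by (auto simp: sub_def)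
  have "supp v ~= {}"
   using \<open>v ~= 0[V]\<close> coord_eqI[OF vV, of "0[V]"] by (auto simp: supp_def coord_zero)
  hence fne: "finite (fst ` supp v)" "fst ` supp v ~= {}" using vV by auto
  define k where "k = Max (fst ` supp v)"
  have kmax: "fst y <= k" if "y:supp v" for y
   unfolding k_def using fne that by simp
  obtain j where j: "(k, j):supp v"
   using Max_in[OF fne] by (auto simp: k_def)
  hence kj: "(k, j):ixa a" and kji: "(k, j):ix" using vs ixa_ix by blast+
  define c where "c = cd v (k, j)"
  have c: "c ~= 0" using j by (simp add: c_def supp_def)
  define w where "w = (- (1 / c)) *[V] v +[V] bas (k, j)"
  have bV: "bas (k, j):car V" using kji by simp
  have wV: "w:car V" unfolding w_def using vV bV by simp
  have w_cd: "cd w y = (- (1 / c)) * cd v y + (if y = (k, j) then 1 else 0)" for y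
   unfolding w_def using vV bV kji by (simp add: coord_add coord_smult coord_bas)
  let ?J = "ixa a Int lev k - {(k, j)}"
  have wJ: "w:sub ?J"
  proof -
   have "y:?J" if y: "cd w y ~= 0" for y
   proof -
    have "y ~= (k, j)" using y c by (auto simp: w_cd c_def)
    moreover have "y:supp v" using y \<open>y ~= (k, j)\<close> by (simp add: w_cd supp_def)
    ultimately show ?thesis using vs kmax by (auto simp: lev_def)
   qed
   thus ?thesis using wV by (auto simp: sub_def supp_def)
  qed
  define x where "x = h k j"
  have psw: "ps w = x"
  proof -
   have "ps w = (- (1 / c)) *[fst X] ps v +[fst X] ps (bas (k, j))"
    unfolding w_def using vV bV by (simp add: lin_add[OF ps] lin_smult[OF ps])
   thus ?thesis
    using v0 F(1) ps_bas[OF kji] kj hh_in[of "(k, j)"] by (simp add: hh_def x_def)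
  qed
  let ?T' = "T - {(k, x)}"
  have xspan: "x:lspan (fst X) {x. EX k'<=k. (k', x):?T'}"
  proof -
   have sub': "{x. EX k'<=k. (k', x):?T'} <= car (fst X)" using TX by blast
   have "ps w:lspan (fst X) {x. EX k'<=k. (k', x):?T'}"
   proof (rule map_sub[OF linD[OF ps] F(1) submodule_lspan[OF F(1) sub'] _ wJ])
    fix y assume y: "y:?J" "y:ix"
    obtain k' j' where kj': "y = (k', j')" by force
    have "(k', h k' j'):T" "(k', h k' j') ~= (k, x)" "k' <= k"
    using y hT[of k' j'] hinj[of k j' j] kj by (auto simp: kj' x_def lev_def)
    hence m: "h k' j':{x. EX k'<=k. (k', x):?T'}" by blast
    have "ps (bas y) = h k' j'" using y ps_bas[OF y(2)] by (simp add: hh_def kj')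
    thus "ps (bas y):lspan (fst X) {x. EX k'<=k. (k', x):?T'}"
    using subsetD[OF lspan_incl m] by simp
   qed
   thus ?thesis by (simp add: psw)
  qed
  have "adapted n X ?T'"
   unfolding adapted_def
  proof (intro conjI allI impI)
   show "finite ?T'" using Tfin by simp
   fix i assume i: "i <= n"
   let ?S = "{x. EX k'<=i. (k', x):?T'}"
   have S: "?S <= car (fst X)" using TX by blast
   have "{x. EX k'<=i. (k', x):T} <= lspan (fst X) ?S"
   proof
    fix z assume "z:{x. EX k'<=i. (k', x):T}"
    then obtain k' where k': "k' <= i" "(k', z):T" by blast
    show "z:lspan (fst X) ?S"
    proof (cases "(k', z) = (k, x)")
    case True
    hence "lspan (fst X) {x. EX k'<=k. (k', x):?T'} <= lspan (fst X) ?S"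
    using k' by (intro lspan_mono) (blast intro: order_trans)
    thus ?thesis using xspan True by auto
    next
    case False
    hence "z:?S" using k' by blast
    thus ?thesis by (rule subsetD[OF lspan_incl])
    qed
   qed
   hence "lspan (fst X) {x. EX k'<=i. (k', x):T} <= lspan (fst X) ?S"
    by (rule lspan_least[OF submodule_lspan[OF F(1) S]])
   thus "snd X i <= lspan (fst X) ?S" using Tspan[OF i] by blast
  qed (use Tin in auto)
  hence "card T <= card ?T'" by (rule Tmin)
  moreover have "(k, x):T" using hT[OF kj] by (simp add: x_def)
  hence "card ?T' < card T" using Tfin by (intro card_Diff1_less)
  ultimately show False by simp
 qed
 let ?A = "std_flag n V e a"
 let ?C = "V<|sub (ixa a)|>"
 let ?ps = "restrict ps (sub (ixa a))"
 have psC: "?ps:lin ?C (fst X)"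
  by (rule lin_restrict_sub[OF V_vs submodule_sub ps])
 have "inj_on ?ps (car ?C)"
  by (rule lin_inj_iff[OF std_vspace F(1) linD[OF psC]]) (use ker in simp)
 moreover have "ixa a Int lev n = ixa a" by (auto simp: ixa_def lev_def)
 hence "?ps ` car ?C = car (fst X)"
  using img'[of n] F(4) by simp
 ultimately have bij: "bij_betw ?ps (car ?C) (car (fst X))"
  by (simp add: bij_betw_def)
 define ph where "ph = restrict (inv_into (car ?C) ?ps) (car (fst X))"
 have ph: "ph:lin (fst X) ?C"
  unfolding ph_def by (rule lin_inverse[OF std_vspace F(1) psC bij])
 have phps: "ph (ps v) = v" if v: "v:sub (ixa a)" for v
 proof -
  have "ps v:car (fst X)" using lin_closed[OF ps sub_in[OF v]] .
  moreover have "inv_into (car ?C) ?ps (?ps v) = v"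
   by (rule inv_into_f_f) (use bij v in "auto simp: bij_betw_def")
  ultimately show ?thesis using v by (simp add: ph_def)
 qed
 have psph: "ps (ph x) = x" if x: "x:car (fst X)" for x
 proof -
  obtain v where "v:sub (ixa a)" "x = ps v" using bij x by (auto simp: bij_betw_def)
  thus ?thesis using phps by simp
 qed
 have "ph:FL n X ?A"
 proof (rule flag_linI)
  show "ph:lin (fst X) (fst ?A)" using ph by (simp add: std_flag_eq)
  fix i x assume i: "i <= n" and x: "x:snd X i"
  then obtain v where v: "v:sub (ixa a Int lev i)" "x = ps v" using img'[OF i] by blast
  hence "v:sub (ixa a)" using sub_mono[of "ixa a Int lev i" "ixa a"] by blast
  thus "ph x:snd ?A i" using v phps i by (simp add: std_flag_eq)
 qed
 moreover have "?ps:FL n ?A X"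
 proof (rule flag_linI)
  show "?ps:lin (fst ?A) (fst X)" using psC by (simp add: std_flag_eq)
  fix i v assume i: "i <= n" and v: "v:snd ?A i"
  hence v': "v:sub (ixa a Int lev i)" by (simp add: std_flag_eq)
  hence "v:sub (ixa a)" using sub_mono[of "ixa a Int lev i" "ixa a"] by blast
  thus "?ps v:snd X i" using v' img'[OF i] by auto
 qed
 moreover have "cmp (fst X) ?ps ph = lin_id (fst X)"
  using lin_closed[OF ph] psph by (auto simp: compose_def lin_id_def intro!: restrict_ext)
 moreover have "cmp (fst ?A) ph ?ps = lin_id (fst ?A)"
  using phps by (auto simp: compose_def lin_id_def std_flag_eq intro!: restrict_ext)
 ultimately have "is_iso (Flag n) X ?A ph"
  unfolding is_iso_def is_inverse_def by auto
 moreover have "a:{1..n} \<rightarrow>\<^sub>E UNIV" by (simp add: a_def)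
 ultimately show ?thesis by blast
qed

abbreviation std :: "(nat => nat) => 'u flag" where
 "std a == std_flag n V e a"

abbreviation tp :: "'u flag => nat => nat" where
 "tp X == flag_type n V e X"

lemma iso_std_unique:
 assumes X: "X:Fl n" and a: "a:{1..n} \<rightarrow>\<^sub>E UNIV" and b: "b:{1..n} \<rightarrow>\<^sub>E UNIV"
  and ph: "is_iso (Flag n) X (std a) ph" and ps: "is_iso (Flag n) X (std b) ps"
 shows "a = b"
proof -
 have Xf: "is_flag n X" using X by simp
 obtain ph' where p: "ph:FL n X (std a)" "ph':FL n (std a) X"
  "cmp (fst X) ph' ph = lin_id (fst X)" "cmp (fst (std a)) ph ph' = lin_id (fst (std a))"
  using ph by (auto simp: is_iso_def is_inverse_def)
 obtain ps' where q: "ps:FL n X (std b)" "ps':FL n (std b) X"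
  "cmp (fst X) ps' ps = lin_id (fst X)" "cmp (fst (std b)) ps ps' = lin_id (fst (std b))"
  using ps by (auto simp: is_iso_def is_inverse_def)
 note pc = lin_closed[OF flag_linD(1)[OF p(2)]] and qc = lin_closed[OF flag_linD(1)[OF q(2)]]
 have inv: "ph' (ph x) = x" "ps' (ps x) = x" if "x:car (fst X)" for x
  using fun_cong[OF p(3), of x] fun_cong[OF q(3), of x] that by simp_all
 have inva: "ph (ph' v) = v" if "v:car (fst (std a))" for v
  using fun_cong[OF p(4), of v] that by simp
 have invb: "ps (ps' v) = v" if "v:car (fst (std b))" for v
  using fun_cong[OF q(4), of v] that by simp
 note f1 = flag_lin_compose[OF is_flag_std p(2) q(1)] and f2 = flag_lin_compose[OF is_flag_std q(2) p(1)]
 have "a k = b k" if k: "1 <= k" "k <= n" for k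
 proof (rule std_iso_type[OF f1 f2 _ _ k])
  show "cmp (fst (std b)) ph ps' (cmp (fst (std a)) ps ph' v) = v" if "v:sub (ixa a)" for v
  proof -
   have v: "v:car (fst (std a))" using that by (simp add: std_flag_eq)
   show ?thesis using v lin_closed[OF flag_linD(1)[OF q(1)] pc[OF v]] by (simp add: inv pc[OF v] inva[OF v])
  qed
  show "cmp (fst (std a)) ps ph' (cmp (fst (std b)) ph ps' v) = v" if "v:sub (ixa b)" for v
  proof -
   have v: "v:car (fst (std b))" using that by (simp add: std_flag_eq)
   show ?thesis using v lin_closed[OF flag_linD(1)[OF p(1)] qc[OF v]] by (simp add: inv qc[OF v] invb[OF v])
  qed
 qed
 thus ?thesis using a b by (intro PiE_ext[OF a b]) auto
qed

lemma flag_type_spec: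
 assumes X: "X:Fl n"
 shows "tp X:{1..n} \<rightarrow>\<^sub>E UNIV & (EX ph. is_iso (Flag n) X (std (tp X)) ph)"
proof -
 have "EX! a. a:{1..n} \<rightarrow>\<^sub>E UNIV & (EX ph. is_iso (Flag n) X (std a) ph)"
 proof (rule ex_ex1I)
  show "EX a. a:{1..n} \<rightarrow>\<^sub>E UNIV & (EX ph. is_iso (Flag n) X (std a) ph)"
   using std_iso_exists[of X] X by auto
  show "a = b" if "a:{1..n} \<rightarrow>\<^sub>E UNIV & (EX ph. is_iso (Flag n) X (std a) ph)"
   "b:{1..n} \<rightarrow>\<^sub>E UNIV & (EX ph. is_iso (Flag n) X (std b) ph)" for a b
   using iso_std_unique[OF X] that by blast
 qed
 from theI'[OF this] show ?thesis unfolding flag_type_def .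
qed

lemma is_iso_id: "is_flag n X ==> is_iso (Flag n) X X (lin_id (fst X))"
 unfolding is_iso_def is_inverse_def
 by (rule exI[of _ "lin_id (fst X)"]) (simp add: flag_lin_id compose_lin_id_left[OF lin_id_in] is_flagD(1))

lemma flag_type_std: "a:{1..n} \<rightarrow>\<^sub>E UNIV ==> tp (std a) = a"
 using flag_type_spec[OF std_Ob, of a] iso_std_unique[OF std_Ob _ _ _ is_iso_id[OF is_flag_std], of "tp (std a)" a] by blast

lemma std_iso_iso:
 assumes X: "X:Fl n"
 shows "is_iso (Flag n) X (std (tp X)) (std_iso n V e X)"
proof (cases "X = std (tp X)")
 case True
 hence "std_iso n V e X = lin_id (fst X)" by (simp add: std_iso_def)
 thus ?thesis using is_iso_id[of X] X True by simp
next
 case False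
 hence "std_iso n V e X = (SOME ph. is_iso (Flag n) X (std (tp X)) ph)" by (simp add: std_iso_def)
 thus ?thesis using someI_ex[OF conjunct2[OF flag_type_spec[OF X]]] by simp
qed

text \<open>Every flag is a retract of the big flag, through \<open>emb\<close> and \<open>ret\<close>; the two functors will be
 described by these maps alone.\<close>

definition emb :: "'u flag => 'u => 'u" where
 "emb X = std_iso n V e X"

definition ret :: "'u flag => 'u => 'u" where
 "ret X = (\<lambda>v\<in>car V. the_inverse (Flag n) X (std (tp X)) (std_iso n V e X) (proj (ixa (tp X)) v))"

abbreviation big :: "'u flag" where
 "big == big_flag V e"

lemma
 assumes X: "X:Fl n"
 shows emb_flag: "emb X:FL n X big"
  and emb_std: "x:car (fst X) ==> emb X x:sub (ixa (tp X))"
  and ret_flag: "ret X:FL n big X"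
  and ret_emb: "x:car (fst X) ==> ret X (emb X x) = x"
  and emb_ret: "v:car V ==> emb X (ret X v) = proj (ixa (tp X)) v"
proof -
 let ?A = "std (tp X)"
 define ps where "ps = the_inverse (Flag n) X ?A (std_iso n V e X)"
 have i: "is_inverse (Flag n) X ?A (std_iso n V e X) ps"
  unfolding ps_def by (rule the_inverse[OF category_Flag X std_Ob std_iso_iso[OF X]])
 have ph: "emb X:FL n X ?A" and ps: "ps:FL n ?A X"
  and c: "cmp (fst X) ps (emb X) = lin_id (fst X)" "cmp (fst ?A) (emb X) ps = lin_id (fst ?A)"
  using i by (auto simp: is_inverse_def emb_def)
 note phl = flag_linD(1)[OF ph] and psl = flag_linD(1)[OF ps]
 have inv: "ps (emb X x) = x" if "x:car (fst X)" for x
  using fun_cong[OF c(1), of x] that by simp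
 have inv': "emb X (ps v) = v" if "v:car (fst ?A)" for v
  using fun_cong[OF c(2), of v] that by simp
 have vX: "vsp (fst X)" using X is_flagD(1)[of n X] by simp
 show std: "emb X x:sub (ixa (tp X))" if "x:car (fst X)" for x
  using lin_closed[OF phl that] by (simp add: std_flag_eq)
 show "emb X:FL n X big"
 proof (rule flag_linI)
  show "emb X:lin (fst X) (fst big)"
   unfolding big_flag_eq by (rule lin_cowiden[OF phl[unfolded std_flag_eq]]) (auto simp: sub_in)
  fix i x assume i: "i <= n" "x:snd X i"
  hence "emb X x:sub (ixa (tp X) Int lev i)"
   using flag_linD(2)[OF ph i] by (simp add: std_flag_eq)
  thus "emb X x:snd big i"
   using i sub_mono[of "ixa (tp X) Int lev i" "lev i"] by (auto simp: big_flag_eq)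
 qed
 have rl: "linear_on V (fst X) (%v. ps (proj (ixa (tp X)) v))"
 proof (rule lin_comp[OF _ linD[OF psl]])
  show "linear_on V (fst ?A) (proj (ixa (tp X)))"
   unfolding std_flag_eq by (rule linD[OF lin_corestrict[OF proj_in proj_sub]])
 qed
 have r: "ret X v = ps (proj (ixa (tp X)) v)" if "v:car V" for v
  using that by (simp add: ret_def ps_def)
 show "ret X:FL n big X"
 proof (rule flag_linI)
  show "ret X:lin (fst big) (fst X)"
   using linI[OF V_vs rl] unfolding ret_def ps_def big_flag_eq .
  fix i v assume i: "i <= n" "v:snd big i"
  hence v: "v:sub (lev i)" by (simp add: big_flag_eq)
  have "proj (ixa (tp X)) v:sub (ixa (tp X) Int lev i)"
   by (rule map_sub[OF linD[OF proj_in] V_vs submodule_sub _ v])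
    (auto simp: proj_bas bas_sub submoduleD(2)[OF V_vs submodule_sub])
  hence "ps (proj (ixa (tp X)) v):snd X i"
   by (intro flag_linD(2)[OF ps i(1)]) (simp add: std_flag_eq i(1))
  thus "ret X v:snd X i" using r sub_in[OF v] by simp
 qed
 show "ret X (emb X x) = x" if x: "x:car (fst X)"
  using r[OF sub_in[OF std[OF x]]] proj_id[OF std[OF x]] inv[OF x] by simp
 show "emb X (ret X v) = proj (ixa (tp X)) v" if v: "v:car V"
  using inv'[of "proj (ixa (tp X)) v"] proj_sub[OF v] r[OF v] by (simp add: std_flag_eq)
qed

lemma emb_of_std: "a:{1..n} \<rightarrow>\<^sub>E UNIV ==> emb (std a) = lin_id (fst (std a))"
 by (simp add: emb_def std_iso_def flag_type_std)

lemma ret_of_std: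
 assumes a: "a:{1..n} \<rightarrow>\<^sub>E UNIV" and v: "v:car V"
 shows "ret (std a) v = proj (ixa a) v"
proof -
 have "ret (std a) v:car (fst (std a))"
  using lin_closed[OF flag_linD(1)[OF ret_flag[OF std_Ob]]] v by (simp add: big_flag_eq)
 thus ?thesis
  using emb_ret[OF std_Ob v, of a] by (simp add: emb_of_std[OF a] flag_type_std[OF a])
qed

lemma transport_eq:
 assumes X: "X:Fl n" and Y: "Y:Fl n" and f: "f:FL n X Y" and v: "v:sub (ixa (tp X))"
 shows "transport n V e X Y f v = emb Y (f (ret X v))"
proof -
 have "v:car (fst (std (tp X)))" using v by (simp add: std_flag_eq)
 thus ?thesis
  using sub_in[OF v] proj_id[OF v] by (simp add: transport_def Let_def emb_def ret_def)
qed

lemma transport_flag: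
 assumes X: "X:Fl n" and Y: "Y:Fl n" and f: "f:FL n X Y"
 shows "transport n V e X Y f:FL n (std (tp X)) (std (tp Y))"
proof -
 have i: "is_inverse (Flag n) X (std (tp X)) (std_iso n V e X) (the_inverse (Flag n) X (std (tp X)) (std_iso n V e X))"
  by (rule the_inverse[OF category_Flag X std_Ob std_iso_iso[OF X]])
 have j: "std_iso n V e Y:FL n Y (std (tp Y))"
  using std_iso_iso[OF Y] by (auto simp: is_iso_def is_inverse_def)
 have "cmp (fst (std (tp X))) f (the_inverse (Flag n) X (std (tp X)) (std_iso n V e X)):FL n (std (tp X)) Y"
  by (rule flag_lin_compose[OF is_flag_std _ f]) (use i in "simp add: is_inverse_def")
 from flag_lin_compose[OF is_flag_std this j] show ?thesis
  by (simp add: transport_def Let_def)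
qed

end

section \<open>The group inside the endomorphisms of the flag\<close>

context flagged_space
begin

abbreviation G :: "('u => 'u) monoid" where
 "G == GG n V e"

abbreviation eqv where "eqv == equivariant G"

abbreviation cst :: "nat => nat => nat" where
 "cst j == (\<lambda>i\<in>{1..n}. j)"

definition ixd :: "nat => (nat \<times> nat) set" where
 "ixd j = ixa (cst j)"

lemma ixd_iff: "(k, i):ixd j \<longleftrightarrow> 1 <= k & k <= n & 1 <= i & i <= j"
 by (auto simp: ixd_def ixa_def)

lemma ix_iff: "(k, i):ix \<longleftrightarrow> 1 <= k & k <= n & 1 <= i"
 by (auto simp: ix_def)

lemma ixd_ix: "ixd j <= ix" and finite_ixd [simp]: "finite (ixd j)"
 unfolding ixd_def by (rule ixa_ix, rule finite_ixa)

lemma ixdD: "x:ixd j ==> x:ix"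
 using ixd_ix by blast

lemma ixd_mono: "i <= j ==> ixd i <= ixd j"
 by (auto simp: ixd_iff subset_iff)

text \<open>The index sets of the \<open>\<complex>\<^sup>(\<^sup>j\<^sup>)\<close> are cofinal among the finite
 ones; hence all finiteness arguments.\<close>

lemma finite_sub_ixd: "finite A ==> A <= ix ==> EX j. A <= ixd j"
proof -
 assume A: "finite A" "A <= ix"
 have "A <= ixd (Max (insert 0 (snd ` A)))"
 proof
  fix x assume x: "x:A"
  hence "snd x <= Max (insert 0 (snd ` A))" using A by (intro Max_ge) auto
  thus "x:ixd (Max (insert 0 (snd ` A)))" using x A(2) by (cases x) (auto simp: ixd_iff ix_iff subset_iff)
 qed
 thus ?thesis ..
qed

lemma in_sub_ixd: "v:car V ==> EX j. v:sub (ixd j)"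
 using finite_sub_ixd[OF finite_supp supp_ix, of v] by (auto simp: sub_def)

lemma cst_PiE [simp]: "cst j:{1..n} \<rightarrow>\<^sub>E UNIV"
 by simp

lemma diag_flag_eq: "diag_flag n V e j = std (cst j)"
 by (simp add: diag_flag_def)

lemma EndV_eq: "EndV n V e = FL n big big"
 by (simp add: EndV_def)

lemma EndV_lin: "f:FL n big big ==> f:lin V V"
 using flag_linD(1)[of f n big big] by (simp add: big_flag_eq)

lemma EndV_I:
 assumes f: "f:lin V V" and b: "!!x. x:ix ==> f (bas x):sub (lev (fst x))"
 shows "f:FL n big big"
proof (rule flag_linI)
 fix i v assume i: "i <= n" and v: "v:snd big i"
 have v': "v:sub (lev i)" using v i by (simp add: big_flag_eq)
 have "f v:sub (lev i)"
 proof (rule map_sub[OF linD[OF f] V_vs submodule_sub _ v'])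
  fix x assume "x:lev i" "x:ix"
  thus "f (bas x):sub (lev i)" using b[of x] sub_mono[of "lev (fst x)" "lev i"] by (force simp: lev_def)
 qed
 thus "f v:snd big i" using i by (simp add: big_flag_eq)
qed (use f in "simp add: big_flag_eq")

lemma EndV_bas:
 assumes f: "f:FL n big big" and x: "x:ix"
 shows "f (bas x):sub (lev (fst x))"
proof -
 have i: "fst x <= n" using x by (cases x) (simp add: ix_iff)
 have "bas x:snd big (fst x)" using x i by (simp add: big_flag_eq bas_sub) (simp add: lev_def)
 thus ?thesis using flag_linD(2)[OF f i] i by (simp add: big_flag_eq)
qed

lemma EndV_compose: "f:FL n big big ==> g:FL n big big ==> cmp V g f:FL n big big"
 using flag_lin_compose[OF is_flag_big, of f big g big] by (simp add: big_flag_eq)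

lemma EndV_id: "lin_id V:FL n big big"
 using flag_lin_id[OF is_flag_big] by (simp add: big_flag_eq)

lemma EndV_proj: "proj J:FL n big big"
proof (rule EndV_I[OF proj_in])
 fix x assume x: "x:ix"
 hence "bas x:sub (lev (fst x))" using bas_sub[OF x] by (simp add: lev_def)
 thus "proj J (bas x):sub (lev (fst x))"
  using x submoduleD(2)[OF V_vs submodule_sub] by (simp add: proj_bas)
qed

lemma block_eq: "block n V e g i k p q = cd (g (bas (k, q))) (i, p)"
 by (simp add: block_def bas_def)

text \<open>Membership in \<open>G\<close> without matrices: an automorphism of the flag that together with its inverse
 preserves some \<open>\<complex>\<^sup>(\<^sup>j\<^sup>)\<close> and fixes the remaining basis vectors.\<close>

definition adm :: "nat => ('u => 'u) => bool" where
 "adm j g \<longleftrightarrow> g:FL n big big & (ALL x:ixd j. g (bas x):sub (ixd j)) \<and>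
   (ALL x:ix - ixd j. g (bas x) = bas x)"

definition adm_inv :: "nat => ('u => 'u) => ('u => 'u) => bool" where
 "adm_inv j g g' \<longleftrightarrow> adm j g & adm j g' & (ALL v:car V. g' (g v) = v & g (g' v) = v)"

lemma admD:
 assumes "adm j g"
 shows "g:FL n big big" "g:lin V V" "!!x. x:ixd j ==> g (bas x):sub (ixd j)"
  "!!x. x:ix ==> x \<notin> ixd j ==> g (bas x) = bas x" "!!v. v:sub (ixd j) ==> g v:sub (ixd j)"
proof -
 show "g:FL n big big" and l: "g:lin V V"
  and b: "!!x. x:ixd j ==> g (bas x):sub (ixd j)" and "!!x. x:ix ==> x \<notin> ixd j ==> g (bas x) = bas x"
  using assms EndV_lin by (auto simp: adm_def)
 show "!!v. v:sub (ixd j) ==> g v:sub (ixd j)"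
  by (rule map_sub[OF linD[OF l] V_vs submodule_sub _]) (use b in auto)
qed

lemma adm_compose:
 assumes g: "adm j g" and h: "adm j h"
 shows "adm j (cmp V g h)"
 unfolding adm_def
proof (intro conjI ballI)
 note D = admD[OF g] and E = admD[OF h]
 show "cmp V g h:FL n big big" by (rule EndV_compose[OF E(1) D(1)])
 show "cmp V g h (bas x):sub (ixd j)" if "x:ixd j" for x
  using bas_in[OF ixdD[OF that]] D(5)[OF E(3)[OF that]] by simp
 show "cmp V g h (bas x) = bas x" if "x:ix - ixd j" for x
  using that D(4) E(4) by simp
qed

lemma adm_coord:
 assumes g: "adm j g" and v: "v:car V" and y: "y \<notin> ixd j"
 shows "cd (g v) y = cd v y"
proof -
 note D = admD[OF g]
 have l: "g x:car V" if "x:car V" for x using lin_closed[OF D(2) that] .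
 have "submodule {v:car V. cd (g v) y = cd v y} CC V"
  by (rule submoduleI[OF V_vs])
   (auto simp: coord_zero coord_add coord_smult lin_zero[OF V_vs V_vs D(2)] lin_add[OF D(2)] lin_smult[OF D(2)] l)
 hence "v:{v:car V. cd (g v) y = cd v y}"
 proof (rule V_generated[OF _ _ v])
  fix x assume "x:supp v"
  hence x: "x:ix" using supp_ix[OF v] by blast
  show "bas x:{v:car V. cd (g v) y = cd v y}"
  proof (cases "x:ixd j")
   case True
   hence "y \<notin> supp (g (bas x))" using D(3)[OF True] y by (auto simp: sub_def)
   thus ?thesis using True x y by (auto simp: supp_def coord_bas)
  next
   case False
   thus ?thesis using D(4)[OF x] x by simp
  qed
 qed
 thus ?thesis by simp
qed

lemma restrict_std_flag:
 assumes f: "f:FL n big big" and m: "!!x. x:ixa a ==> f (bas x):sub (ixa b)"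
 shows "restrict f (car (fst (std a))):FL n (std a) (std b)"
proof (rule flag_linI)
 have C: "f v:sub (ixa b)" if "v:sub (ixa a)" for v
  by (rule map_sub[OF linD[OF EndV_lin[OF f]] V_vs submodule_sub _ that]) (use m in auto)
 show "restrict f (car (fst (std a))):lin (fst (std a)) (fst (std b))"
  unfolding std_flag_eq
  by (rule lin_corestrict) (use C in "auto intro!: lin_restrict_sub EndV_lin f")
 fix i v assume i: "i <= n" and v: "v:snd (std a) i"
 hence v1: "v:sub (ixa a)" and v2: "v:snd big i"
  by (auto simp: std_flag_eq big_flag_eq sub_def)
 have "f v:sub (ixa b) Int sub (lev i)"
  using C[OF v1] flag_linD(2)[OF f i v2] i by (simp add: big_flag_eq)
 thus "restrict f (car (fst (std a))) v:snd (std b) i"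
  using v1 i by (auto simp: std_flag_eq sub_def)
qed

lemma adm_inv_block:
 assumes gg: "adm_inv j g g'" and i: "1 <= i" "i <= n" and p: "1 <= p" "p <= j"
 shows "(\<Sum>r=1..j. block n V e g' i i r p * block n V e g i i q r) = (if p = q then 1 else 0)"
proof -
 have g: "adm j g" and g': "adm j g'" and inv: "!!v. v:car V ==> g (g' v) = v"
  using gg by (auto simp: adm_inv_def)
 have r: "restrict f (car (fst (std (cst j)))):FL n (std (cst j)) (std (cst j))" if "adm j f" for f
  by (rule restrict_std_flag[OF admD(1)[OF that]]) (use admD(3)[OF that] in "simp add: ixd_def")
 have m: "f v:sub (ixa (cst j))" if "adm j f" "v:sub (ixa (cst j))" for f v
  using admD(5)[OF that(1)] that(2) by (simp add: ixd_def)
 have b: "bas (i, r):sub (ixa (cst j))" if "1 <= r" "r <= j" for r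
  using bas_sub[of "(i, r)" "ixa (cst j)"] i that by (simp add: ix_iff) (simp add: ixa_def)
 have "(\<Sum>r=1..cst j i. cd (restrict g' (car (fst (std (cst j)))) (bas (i, p))) (i, r) *
   cd (restrict g (car (fst (std (cst j)))) (bas (i, r))) (i, q)) = (if p = q then 1 else 0)"
  by (rule std_iso_block[OF r[OF g'] r[OF g] _ i])
   (use m[OF g'] inv sub_in p i in "auto simp: std_flag_eq")
 moreover have "(\<Sum>r=1..j. block n V e g' i i r p * block n V e g i i q r) =
  (\<Sum>r=1..cst j i. cd (restrict g' (car (fst (std (cst j)))) (bas (i, p))) (i, r) *
   cd (restrict g (car (fst (std (cst j)))) (bas (i, r))) (i, q))"
  by (rule sum.cong) (use b p i in "auto simp: block_eq std_flag_eq")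
 ultimately show ?thesis by simp
qed

lemma GG_subI:
 assumes gg: "adm_inv j g g'"
 shows "g:GG_sub n V e (cst j)"
proof -
 have g: "adm j g" and g': "adm j g'" and inv: "!!v. v:car V ==> g' (g v) = v & g (g' v) = v"
  using gg by (auto simp: adm_inv_def)
 note D = admD[OF g] and D' = admD[OF g']
 have gg': "adm_inv j g' g" using gg by (auto simp: adm_inv_def)
 have bl: "block n V e g i k p q = (if i = k & p = q then 1 else 0)"
  if "1 <= i" "i <= n" "1 <= k" "k <= n" "1 <= p" "1 <= q" "p > j | q > j" for i k p q
 proof -
  have kq: "(k, q):ix" using that by (simp add: ix_iff)
  show ?thesis
  proof (cases "q > j")
   case True
   hence "g (bas (k, q)) = bas (k, q)" using D(4)[OF kq] by (simp add: ixd_iff)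
   thus ?thesis using kq by (simp add: block_eq coord_bas)
  next
   case False
   hence "(i, p) \<notin> ixd j" using that by (simp add: ixd_iff)
   hence "cd (g (bas (k, q))) (i, p) = cd (bas (k, q)) (i, p)"
    by (rule adm_coord[OF g bas_in[OF kq]])
   thus ?thesis using kq by (simp add: block_eq coord_bas)
  qed
 qed
 have low: "block n V e g i k p q = 0" if "1 <= k" "k <= n" "1 <= q" "k < i" for i k p q
 proof -
  have "g (bas (k, q)):sub (lev k)" using EndV_bas[OF D(1), of "(k, q)"] that by (simp add: ix_iff)
  hence "(i, p) \<notin> supp (g (bas (k, q)))" using that by (auto simp: sub_def lev_def)
  thus ?thesis by (simp add: block_eq supp_def)
 qed
 have GL: "in_GL_inf (block n V e g i i)" if i: "1 <= i" "i <= n" for i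
  unfolding in_GL_inf_def
 proof (intro exI[of _ j] conjI exI[of _ "block n V e g' i i"] allI impI ballI)
  show "block n V e g i i p q = (if p = q then 1 else 0)" if "1 <= p" "1 <= q" "p > j | q > j" for p q
   using bl[of i i p q] that i by simp
  fix p q assume "p:{1..j}" "q:{1..j}"
  thus "(\<Sum>r=1..j. block n V e g i i p r * block n V e g' i i r q) = (if p = q then 1 else 0)"
   "(\<Sum>r=1..j. block n V e g' i i p r * block n V e g i i r q) = (if p = q then 1 else 0)"
   using adm_inv_block[OF gg i, of q p] adm_inv_block[OF gg' i, of q p] by (simp_all add: mult.commute)
 qed
 have bij: "bij_betw g (car V) (car V)"
  by (rule lin_bijI[OF D(2) D'(2)]) (use inv in auto)
 have "g:car G"
  unfolding GG_def using D(2) bij low GL bl by (auto simp: in_End_inf_def intro!: exI[of _ j])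
 thus ?thesis
  unfolding GG_sub_def using bl by auto
qed

lemma GG_sub_adm:
 assumes "g:GG_sub n V e (cst j)"
 shows "adm j g"
proof -
 have gG: "g:car G" and b1: "!!i p q. i:{1..n} ==> p >= 1 ==> q >= 1 ==> p > j | q > j ==>
   block n V e g i i p q = (if p = q then 1 else 0)"
  and b2: "!!i k p q. i:{1..n} ==> k:{1..n} ==> i < k ==> p >= 1 ==> q >= 1 ==> p > j | q > j ==>
   block n V e g i k p q = 0"
  using assms by (auto simp: GG_sub_def)
 have gl: "g:lin V V" and low: "!!i k p q. i:{1..n} ==> k:{1..n} ==> k < i ==> p >= 1 ==> q >= 1 ==>
   block n V e g i k p q = 0"
  using gG by (auto simp: GG_def)
 have bV: "g (bas x):car V" if "x:ix" for x using lin_closed[OF gl bas_in[OF that]] .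
 have bl: "cd (g (bas x)) y = (if x = y then 1 else 0)"
  if "x:ix" "y:ix" "x \<notin> ixd j | y \<notin> ixd j" for x y
 proof -
  obtain k q i p where xy: "x = (k, q)" "y = (i, p)" by force
  show ?thesis
   using that b1[of i p q] b2[of i k p q] low[of i k p q] unfolding xy ix_iff ixd_iff
   by (cases "i = k"; cases "i < k") (auto simp: block_eq)
 qed
 show ?thesis
  unfolding adm_def
 proof (intro conjI ballI)
  show "g:FL n big big"
  proof (rule EndV_I[OF gl])
   fix x assume x: "x:ix"
   have "fst y <= fst x" if y: "y:supp (g (bas x))" for y
   proof (rule ccontr)
    assume "\<not> fst y <= fst x"
    moreover have "y:ix" using supp_ix[OF bV[OF x]] y by blast
    ultimately have "cd (g (bas x)) y = 0"
    using x low[of "fst y" "fst x" "snd y" "snd x"] by (cases x; cases y) (auto simp: ix_iff block_eq)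
    thus False using y by (simp add: supp_def)
   qed
   thus "g (bas x):sub (lev (fst x))" using bV[OF x] by (auto simp: sub_def lev_def)
  qed
  show "g (bas x):sub (ixd j)" if x: "x:ixd j" for x
  proof -
   have xi: "x:ix" using x ixd_ix by blast
   have "y:ixd j" if y: "y:supp (g (bas x))" for y
   proof -
    have "y:ix" using supp_ix[OF bV[OF xi]] y by blast
    thus ?thesis using bl[OF xi, of y] y x by (cases "y:ixd j"; cases "x = y") (simp_all add: supp_def)
   qed
   thus ?thesis using bV[OF xi] by (auto simp: sub_def)
  qed
  show "g (bas x) = bas x" if x: "x:ix - ixd j" for x
  proof (rule coord_eqI)
   show "cd (g (bas x)) y = cd (bas x) y" if "y:ix" for y
    using bl[of x y] x that coord_bas[of x y] by auto
  qed (use x bV in auto)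
 qed
qed

text \<open>The conditions defining the group bound the size of each of the finitely many blocks separately;
 take the largest bound.\<close>

lemma GG_sub_exists:
 assumes g: "g:car G"
 shows "EX j0. ALL j>=j0. g:GG_sub n V e (cst j)"
proof -
 have H: "EX N. ALL p>=1. ALL q>=1. p > N | q > N --> (i < k --> block n V e g i k p q = 0) \<and>
   (i = k --> block n V e g i k p q = (if p = q then 1 else 0))" if "i:{1..n}" "k:{1..n}" for i k
 proof -
  consider "i < k" | "i = k" | "k < i" by linarith
  thus ?thesis
  proof cases
   case 1
   hence "in_End_inf (block n V e g i k)" using g that by (simp add: GG_def)
   thus ?thesis using 1 unfolding in_End_inf_def by auto
  next
   case 2
   hence "in_GL_inf (block n V e g i k)" using g that by (simp add: GG_def)
   then obtain N where "ALL p>=1. ALL q>=1. p > N | q > N --> block n V e g i k p q = (if p = q then 1 else 0)"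
    unfolding in_GL_inf_def by blast
   thus ?thesis using 2 by (intro exI[of _ N]) simp
  qed simp
 qed
 have "ALL x:{1..n} \<times> {1..n}. EX N. ALL p>=1. ALL q>=1. p > N | q > N --> (fst x < snd x --> block n V e g (fst x) (snd x) p q = 0) \<and>
   (fst x = snd x --> block n V e g (fst x) (snd x) p q = (if p = q then 1 else 0))"
  by (intro ballI H) auto
 from bchoice[OF this] obtain N where N: "ALL x:{1..n} \<times> {1..n}. ALL p>=1. ALL q>=1. p > N x | q > N x --> (fst x < snd x --> block n V e g (fst x) (snd x) p q = 0) \<and>
   (fst x = snd x --> block n V e g (fst x) (snd x) p q = (if p = q then 1 else 0))" ..
 define j0 where "j0 = Max (N ` ({1..n} \<times> {1..n}))"
 have j0: "N (i, k) <= j0" if "i:{1..n}" "k:{1..n}" for i k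
  unfolding j0_def using that by (intro Max_ge) auto
 have "g:GG_sub n V e (cst j)" if j: "j >= j0" for j
  unfolding GG_sub_def
 proof (intro CollectI conjI ballI allI impI g)
  fix i k p q assume ik: "i:{1..n}" "k:{1..n}" and pq: "(1::nat) <= p" "(1::nat) <= q"
  have *: "p > N (i, k) | q > N (i, k)" if "p > j | q > j"
   using that j0[OF ik] j by linarith
  show "block n V e g i k p q = (if p = q then 1 else 0)" if "i = k & (p > cst j i | q > cst j i)"
  proof -
   have "p > j | q > j" using that ik by auto
   thus ?thesis using N[rule_format, of "(i, k)" p q] * that ik pq by auto
  qed
  show "block n V e g i k p q = 0" if "i < k & (p > cst j i | q > cst j k)"
  proof -
   have "p > j | q > j" using that ik by auto
   thus ?thesis using N[rule_format, of "(i, k)" p q] * that ik pq by auto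
  qed
 qed
 thus ?thesis by blast
qed

text \<open>The inverse of an element of \<open>G\<close> preserves the flag because the diagonal blocks are invertible:
 otherwise the top level component of a preimage would be killed by such a block.\<close>

lemma GG_inverse:
 assumes g: "g:GG_sub n V e (cst j)"
 shows "EX g'. adm_inv j g g'"
proof -
 have ad: "adm j g" by (rule GG_sub_adm[OF g])
 note D = admD[OF ad]
 have gG: "g:car G" using g by (simp add: GG_sub_def)
 have bij: "bij_betw g (car V) (car V)" using gG by (simp add: GG_def)
 define g' where "g' = restrict (inv_into (car V) g) (car V)"
 have g': "g':lin V V" unfolding g'_def by (rule lin_inverse[OF V_vs V_vs D(2) bij])
 have inv: "g' (g v) = v" "g (g' v) = v" if "v:car V" for v
  unfolding g'_def using bij that lin_closed[OF D(2)] by (auto simp: bij_betw_def f_inv_into_f)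
 have gc: "g' v:car V" if "v:car V" for v by (rule lin_closed[OF g' that])
 have lev: "g' v:sub (lev i)" if v: "v:sub (lev i)" for v i
 proof (rule ccontr)
  assume "g' v \<notin> sub (lev i)"
  define w where "w = g' v"
  have vV: "v:car V" and wV: "w:car V" using v gc by (auto simp: sub_def w_def)
  have gw: "g w = v" using inv(2)[OF vV] by (simp add: w_def)
  obtain y0 where y0: "y0:supp w" "fst y0 > i"
   using \<open>g' v \<notin> sub (lev i)\<close> wV by (auto simp: w_def[symmetric] sub_def lev_def subset_iff not_le)
  have fne: "finite (fst ` supp w)" "fst ` supp w ~= {}" using wV y0 by auto
  define k where "k = Max (fst ` supp w)"
  have kmax: "fst y <= k" if "y:supp w" for y unfolding k_def using fne that by simp
  have ki: "k > i" using kmax[OF y0(1)] y0(2) by simp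
  obtain q0 where q0: "(k, q0):supp w" using Max_in[OF fne] by (auto simp: k_def)
  hence k: "1 <= k" "k <= n" using supp_ix[OF wV] by (auto simp: ix_def)
  have exp: "(\<Sum>r=1..M. cd w (k, r) * block n V e g k k p r) = 0"
   if M: "!!r. r > M ==> cd w (k, r) * block n V e g k k p r = 0" for M p
  proof -
   let ?A = "supp w Un {k} \<times> {1..M}"
   have A: "finite ?A" "?A <= ix" using wV supp_ix[OF wV] k by (auto simp: ix_def)
   have bV: "g (bas x):car V" if "x:ix" for x using lin_closed[OF D(2) bas_in[OF that]] .
   have "cd (g w) (k, p) = (\<Sum>x\<in>?A. cd w x * cd (g (bas x)) (k, p))"
    by (rule functional_expand[OF _ _ wV A])
    (auto simp: lin_add[OF D(2)] lin_smult[OF D(2)] coord_add coord_smult lin_closed[OF D(2)])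
   also have "... = (\<Sum>x\<in>{k} \<times> {1..M}. cd w x * cd (g (bas x)) (k, p))"
   proof (rule sum.mono_neutral_right[OF A(1)])
    show "ALL x:?A - {k} \<times> {1..M}. cd w x * cd (g (bas x)) (k, p) = 0"
    proof
    fix x assume x: "x:?A - {k} \<times> {1..M}"
    hence xs: "x:supp w" by blast
    hence xi: "x:ix" using supp_ix[OF wV] by blast
    show "cd w x * cd (g (bas x)) (k, p) = 0"
    proof (cases "fst x = k")
    case True
    hence "snd x > M" using x xi by (cases x) (auto simp: ix_iff)
    thus ?thesis using M[of "snd x"] True by (cases x) (simp add: block_eq)
    next
    case False
    hence "fst x < k" using kmax[OF xs] by simp
    hence "(k, p) \<notin> supp (g (bas x))" using EndV_bas[OF D(1) xi] by (auto simp: sub_def lev_def)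
    thus ?thesis by (simp add: supp_def)
    qed
    qed
   qed auto
   also have "... = (\<Sum>r=1..M. cd w (k, r) * block n V e g k k p r)"
   proof -
    have eq: "{k} \<times> {1..M} = Pair k ` {1..M}" by auto
    show ?thesis unfolding eq by (subst sum.reindex) (auto simp: inj_on_def block_eq)
   qed
   also have "cd (g w) (k, p) = 0"
    unfolding gw using v ki by (auto simp: sub_def lev_def supp_def)
   finally show ?thesis by simp
  qed
  have "in_GL_inf (block n V e g k k)" using gG k by (simp add: GG_def)
  then obtain N B where NB: "ALL p>=1. ALL q>=1. p > N | q > N --> block n V e g k k p q = (if p = q then 1 else 0)"
   "ALL p:{1..N}. ALL q:{1..N}. (\<Sum>r=1..N. block n V e g k k p r * B r q) = (if p = q then 1 else 0) \<and>
    (\<Sum>r=1..N. B p r * block n V e g k k r q) = (if p = q then 1 else 0)"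
   unfolding in_GL_inf_def by blast
  note N = NB(1)[rule_format] and B = NB(2)[THEN bspec, THEN bspec, THEN conjunct2]
  have "cd w (k, q) = 0" if q: "1 <= q" for q
  proof (cases "q <= N")
   case True
   have row: "(\<Sum>r=1..N. cd w (k, r) * block n V e g k k p r) = 0" if "p:{1..N}" for p
    by (rule exp) (use N[of p] that in auto)
   have "cd w (k, q) = (\<Sum>r=1..N. cd w (k, r) * (if q = r then 1 else 0))"
    using True q by (subst sum.remove[of _ q]) (auto intro!: sum.neutral)
   also have "... = (\<Sum>r=1..N. cd w (k, r) * (\<Sum>p=1..N. B q p * block n V e g k k p r))"
    using B[of q] True q by (intro sum.cong) auto
   also have "... = (\<Sum>r=1..N. \<Sum>p=1..N. B q p * (cd w (k, r) * block n V e g k k p r))"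
    by (simp add: sum_distrib_left mult.left_commute)
   also have "... = (\<Sum>p=1..N. B q p * (\<Sum>r=1..N. cd w (k, r) * block n V e g k k p r))"
    by (subst sum.swap) (simp add: sum_distrib_left)
   also have "... = 0" using row by simp
   finally show ?thesis .
  next
   case False
   have "(\<Sum>r=1..q. cd w (k, r) * block n V e g k k q r) = 0"
    by (rule exp) (use N[of q] False q in auto)
   moreover have "(\<Sum>r=1..q. cd w (k, r) * block n V e g k k q r) = (\<Sum>r=1..q. if r = q then cd w (k, q) else 0)"
    by (rule sum.cong) (use N[of q] False q in auto)
   ultimately show ?thesis using q by (simp add: sum.delta)
  qed
  thus False using q0 supp_ix[OF wV] by (auto simp: supp_def ix_def)
 qed
 have "adm j g'"
  unfolding adm_def
 proof (intro conjI ballI)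
  show "g':FL n big big"
   by (rule EndV_I[OF g'], rule lev) (simp add: bas_sub lev_def)
  show "g' (bas x):sub (ixd j)" if x: "x:ixd j" for x
  proof -
   have xi: "x:ix" using x ixd_ix by blast
   note gx = gc[OF bas_in[OF xi]]
   have "y:ixd j" if y: "y:supp (g' (bas x))" for y
    using adm_coord[OF ad gx, of y] inv(2)[OF bas_in[OF xi]] y xi x by (cases "y:ixd j"; cases "x = y") (simp_all add: supp_def coord_bas)
   thus ?thesis using gx by (auto simp: sub_def)
  qed
  show "g' (bas x) = bas x" if x: "x:ix - ixd j" for x
   using inv(1)[of "bas x"] D(4)[of x] x by simp
 qed
 thus ?thesis unfolding adm_inv_def using ad inv by blast
qed

lemma GG_EndV: "g:car G ==> g:FL n big big"
 using GG_sub_exists[of g] GG_sub_adm[of g] admD(1) by blast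

lemma GG_sub_compose:
 assumes "g:GG_sub n V e (cst j)" "h:GG_sub n V e (cst j)"
 shows "cmp V g h:GG_sub n V e (cst j)"
proof -
 obtain g' h' where g: "adm_inv j g g'" and h: "adm_inv j h h'"
  using GG_inverse assms by blast
 hence a: "adm j g" "adm j g'" "adm j h" "adm j h'" by (auto simp: adm_inv_def)
 note l = lin_closed[OF admD(2)[OF a(1)]] lin_closed[OF admD(2)[OF a(2)]] lin_closed[OF admD(2)[OF a(3)]] lin_closed[OF admD(2)[OF a(4)]]
 have "adm_inv j (cmp V g h) (cmp V h' g')"
  unfolding adm_inv_def using adm_compose[OF a(1,3)] adm_compose[OF a(4,2)] g h l by (auto simp: adm_inv_def)
 thus ?thesis by (rule GG_subI)
qed

end

section \<open>Density of the group in the endomorphisms\<close>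

context flagged_space
begin

abbreviation pj :: "nat => 'u => 'u" where
 "pj N == proj (ixd N)"

definition swap_ix :: "nat => nat \<times> nat => nat \<times> nat" where
 "swap_ix K x = (fst x, if snd x <= K then snd x + K else snd x - K)"

lemma swap_ix: "x:ixd (2 * K) ==> swap_ix K x:ixd (2 * K)" "x:ixd (2 * K) ==> swap_ix K (swap_ix K x) = x"
 by (cases x, auto simp: swap_ix_def ixd_iff)+

definition shift :: "nat => 'u => 'u" where
 "shift K = extend V (%x. if x:ixd (2 * K) then bas (swap_ix K x) else 0[V])"

definition tail :: "nat => 'u => 'u" where
 "tail K = proj (- ixd (2 * K))"

lemma shift_in: "shift K:lin V V"
 unfolding shift_def by (rule extend_in) (auto dest: ixdD[OF swap_ix(1)])

lemma shift_bas: "x:ix ==> shift K (bas x) = (if x:ixd (2 * K) then bas (swap_ix K x) else 0[V])"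
 unfolding shift_def by (rule extend_bas) (auto dest: ixdD[OF swap_ix(1)])

lemma tail_in: "tail K:lin V V"
 by (simp add: tail_def)

lemma tail_bas: "x:ix ==> tail K (bas x) = (if x:ixd (2 * K) then 0[V] else bas x)"
 by (simp add: tail_def proj_bas)

lemma zero_in_sub: "0[V]:sub J"
 by (rule submoduleD(2)[OF V_vs submodule_sub])

lemma lin_zero_on_sub:
 assumes f: "f:lin V V" and J: "!!x. x:J ==> x:ix ==> f (bas x) = 0[V]" and v: "v:sub J"
 shows "f v = 0[V]"
 using map_sub[OF linD[OF f] V_vs submodule_singleton_zero[OF V_vs] _ v] J by auto

lemma lin_eq_V: "f:lin V V ==> g:lin V V ==> (!!x. x:ix ==> f (bas x) = g (bas x)) ==> v:car V ==> f v = g v"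
 by (rule V_eq[OF V_vs]) (auto dest: linD)

lemma lin_eq_V2: "f:lin V V ==> f':lin V V ==> g:lin V V ==> (!!x. x:ix ==> f (f' (bas x)) = g (bas x)) ==> v:car V ==> f (f' v) = g v"
 by (rule V_eq[OF V_vs lin_comp]) (auto dest: linD)

lemma zero_lin: "(\<lambda>v\<in>car V. 0[V]):lin V V"
 by (rule lin_space_closed(1)) simp_all

lemma shift_ids:
 assumes v: "v:car V" and NK: "N <= K"
 shows "shift K (shift K v) = pj (2 * K) v" "shift K (tail K v) = 0[V]" "tail K (shift K v) = 0[V]"
  "pj N (tail K v) = 0[V]" "tail K (tail K v) = tail K v" "tail K v +[V] pj (2 * K) v = v"
  "pj N (pj (2 * K) v) = pj N v"
proof -
 have z: "f 0[V] = 0[V]" if "f:lin V V" for f by (rule lin_zero[OF V_vs V_vs that])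
 note zs = z[OF shift_in] z[OF tail_in] z[OF proj_in]
 have i: "x:ixd (2 * K) ==> swap_ix K x:ix" for x using ixdD[OF swap_ix(1)] .
 have m: "x:ixd N ==> x:ixd (2 * K)" for x using ixd_mono[of N "2 * K"] NK by auto
 show "shift K (shift K v) = pj (2 * K) v"
  by (rule lin_eq_V2[OF shift_in shift_in proj_in _ v]) (simp add: shift_bas proj_bas zs i swap_ix)
 have "shift K (tail K v) = (\<lambda>v\<in>car V. 0[V]) v"
  by (rule lin_eq_V2[OF shift_in tail_in zero_lin _ v]) (simp add: shift_bas tail_bas zs)
 thus "shift K (tail K v) = 0[V]" using v by simp
 have "tail K (shift K v) = (\<lambda>v\<in>car V. 0[V]) v"
  by (rule lin_eq_V2[OF tail_in shift_in zero_lin _ v]) (simp add: shift_bas tail_bas zs i swap_ix)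
 thus "tail K (shift K v) = 0[V]" using v by simp
 have "pj N (tail K v) = (\<lambda>v\<in>car V. 0[V]) v"
  by (rule lin_eq_V2[OF proj_in tail_in zero_lin _ v]) (use m in "auto simp: proj_bas tail_bas zs")
 thus "pj N (tail K v) = 0[V]" using v by simp
 show "tail K (tail K v) = tail K v"
  by (rule lin_eq_V2[OF tail_in tail_in tail_in _ v]) (simp add: tail_bas zs)
 have "(\<lambda>v\<in>car V. tail K v +[V] pj (2 * K) v) v = lin_id V v"
  by (rule lin_eq_V[OF lin_space_closed(2)[OF V_vs V_vs tail_in proj_in] lin_id_in[OF V_vs] _ v]) (simp add: tail_bas proj_bas)
 thus "tail K v +[V] pj (2 * K) v = v" using v by simp
 show "pj N (pj (2 * K) v) = pj N v"
  by (rule lin_eq_V2[OF proj_in proj_in proj_in _ v]) (use m in "auto simp: proj_bas zs")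
qed

text \<open>The elements \<open>f \<circ> pj N + tail K + t shift K\<close>, \<open>t \<noteq> 0\<close>, lie in the group provided \<open>f\<close> maps
 \<open>\<complex>\<^sup>(\<^sup>N\<^sup>)\<close> into \<open>\<complex>\<^sup>(\<^sup>K\<^sup>)\<close>: the shift moves the image of \<open>f \<circ> pj N\<close> away from the support of this map.\<close>

lemma curve_in_G:
 assumes f: "f:FL n big big" and NK: "N <= K" and fK: "!!x. x:ixd N ==> f (bas x):sub (ixd K)" and t: "t ~= 0"
 shows "(\<lambda>v\<in>car V. (f (pj N v) +[V] tail K v) +[V] t *[V] shift K v):car G" (is "?g:_")
proof -
 note fl = EndV_lin[OF f]
 define g' where "g' = (\<lambda>v\<in>car V. (tail K v +[V] inverse t *[V] shift K v) +[V]
  (- (inverse t * inverse t)) *[V] shift K (f (pj N (shift K v))))"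
 note sl = lin_closed[OF shift_in] and tl = lin_closed[OF tail_in] and fc = lin_closed[OF fl]
 note L = lin_add[OF shift_in] lin_add[OF tail_in] lin_add[OF proj_in] lin_add[OF fl]
  lin_smult[OF shift_in] lin_smult[OF tail_in] lin_smult[OF proj_in] lin_smult[OF fl]
 note Z = lin_zero[OF V_vs V_vs shift_in] lin_zero[OF V_vs V_vs tail_in] lin_zero[OF V_vs V_vs proj_in] lin_zero[OF V_vs V_vs fl]
 note ids = shift_ids[OF _ NK]
 have fp: "f (pj N v):sub (ixd K)" if "v:car V" for v
  by (rule map_sub[OF linD[OF fl] V_vs submodule_sub _ proj_sub[OF that]]) (use fK in auto)
 have K2: "ixd K <= ixd (2 * K)" by (rule ixd_mono) simp
 have tf: "tail K w = 0[V]" "pj N (shift K w) = 0[V]" "pj (2 * K) w = w" if w: "w:sub (ixd K)" for w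
 proof -
  show "tail K w = 0[V]"
   by (rule lin_zero_on_sub[OF tail_in _ w]) (use K2 in "auto simp: tail_bas")
  have "cmp V (pj N) (shift K) w = 0[V]"
  proof (rule lin_zero_on_sub[OF lin_compose[OF V_vs shift_in proj_in] _ w])
   fix x assume x: "x:ixd K" "x:ix"
   hence x2: "x:ixd (2 * K)" using K2 by blast
   have "swap_ix K x \<notin> ixd N" using x NK by (cases x) (auto simp: swap_ix_def ixd_iff)
   thus "cmp V (pj N) (shift K) (bas x) = 0[V]"
    using x x2 by (simp add: shift_bas proj_bas ixdD[OF swap_ix(1)])
  qed
  thus "pj N (shift K w) = 0[V]" using sub_in[OF w] by simp
  show "pj (2 * K) w = w" using proj_id w sub_mono[OF K2] by blast
 qed
 have gl: "?g:lin V V" and gl': "g':lin V V"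
  unfolding g'_def
  by (rule linI[OF V_vs], rule linear_onI; simp add: L sl tl fc vs_ac vs_smult_radd vs_smult_smult mult.commute mult.left_commute)+
 have cds: "cd v y = cd (tail K v) y + cd (pj (2 * K) v) y" if "v:car V" for v y
 proof -
  have "cd v y = cd (tail K v +[V] pj (2 * K) v) y" using ids(6)[OF that] by simp
  also have "... = cd (tail K v) y + cd (pj (2 * K) v) y" by (rule coord_add[OF tl[OF that] proj_closed[OF that]])
  finally show ?thesis .
 qed
 note C = sl tl fc proj_closed
 have inv1: "g' (?g v) = v" if v: "v:car V" for v
 proof (rule coord_eqI)
  note w = fp[OF v]
  have wV: "f (pj N v):car V" using sub_in[OF w] .
  show "g' (?g v):car V" using lin_closed[OF gl' lin_closed[OF gl v]] .
  show "cd (g' (?g v)) y = cd v y" for y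
   using v wV t cds[OF v, of y]
   by (simp add: g'_def L Z C tf[OF w] ids[OF v] coord_add coord_smult coord_zero vs_smult_smult vs_smult_radd)
 qed (rule v)
 have inv2: "?g (g' v) = v" if v: "v:car V" for v
 proof (rule coord_eqI)
  note w = fp[OF sl[OF v]]
  have wV: "f (pj N (shift K v)):car V" using sub_in[OF w] .
  show "?g (g' v):car V" using lin_closed[OF gl lin_closed[OF gl' v]] .
  show "cd (?g (g' v)) y = cd v y" for y
   using v wV t cds[OF v, of y]
   by (simp add: g'_def L Z C tf[OF w] ids[OF v] ids[OF wV] coord_add coord_smult coord_zero vs_smult_smult vs_smult_radd)
 qed (rule v)
 have lv: "shift K v:sub (lev i)" "tail K v:sub (lev i)" "f (pj N v):sub (lev i)" if i: "i <= n" and v: "v:sub (lev i)" for v i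
 proof -
  show "shift K v:sub (lev i)"
   by (rule map_sub[OF linD[OF shift_in] V_vs submodule_sub _ v])
    (auto simp: shift_bas zero_in_sub bas_sub ixdD[OF swap_ix(1)], simp add: swap_ix_def lev_def)
  show "tail K v:sub (lev i)"
   by (rule map_sub[OF linD[OF tail_in] V_vs submodule_sub _ v]) (auto simp: tail_bas zero_in_sub bas_sub)
  have "pj N v:sub (lev i)"
   by (rule map_sub[OF linD[OF proj_in] V_vs submodule_sub _ v]) (auto simp: proj_bas zero_in_sub bas_sub)
  thus "f (pj N v):sub (lev i)"
   using flag_linD(2)[OF f i, of "pj N v"] i by (simp add: big_flag_eq)
 qed
 note SD = submoduleD[OF V_vs submodule_sub]
 have ends: "?g:FL n big big" "g':FL n big big"
 proof -
  have b: "bas x:sub (lev (fst x)) & fst x <= n" if "x:ix" for x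
   using that bas_sub[OF that, of "lev (fst x)"] by (cases x) (auto simp: lev_def ix_iff)
  show "?g:FL n big big"
   by (rule EndV_I[OF gl]) (use b in "simp add: SD lv")
  show "g':FL n big big"
   by (rule EndV_I[OF gl']) (use b in "simp add: g'_def SD lv")
 qed
 have fK2: "f (pj N v):sub (ixd (2 * K))" if "v:car V" for v
  using fp[OF that] sub_mono[OF K2] by blast
 have sK2: "shift K v:sub (ixd (2 * K))" if "v:car V" for v
  by (rule map_sub[OF linD[OF shift_in] V_vs submodule_sub, of UNIV])
   (use that in "auto simp: shift_bas zero_in_sub bas_sub ixdD[OF swap_ix(1)] swap_ix sub_def[of UNIV]")
 have "adm (2 * K) ?g"
  unfolding adm_def
 proof (intro conjI ballI ends)
  show "?g (bas x):sub (ixd (2 * K))" if "x:ixd (2 * K)" for x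
   using that ixdD[OF that] by (simp add: tail_bas SD fK2 sK2 zero_in_sub)
  show "?g (bas x) = bas x" if "x:ix - ixd (2 * K)" for x
  proof -
   have "x \<notin> ixd N" using that ixd_mono[of N "2 * K"] NK by auto
   thus ?thesis using that by (simp add: tail_bas shift_bas proj_bas Z)
  qed
 qed
 moreover have "adm (2 * K) g'"
  unfolding adm_def
 proof (intro conjI ballI ends)
  show "g' (bas x):sub (ixd (2 * K))" if "x:ixd (2 * K)" for x
   using that ixdD[OF that] by (simp add: g'_def tail_bas SD fK2 sK2 sl fc zero_in_sub)
  show "g' (bas x) = bas x" if "x:ix - ixd (2 * K)" for x
   using that by (simp add: g'_def tail_bas shift_bas Z)
 qed
 ultimately have "adm_inv (2 * K) ?g g'"
  unfolding adm_inv_def using inv1 inv2 by blast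
 thus ?thesis using GG_subI by (auto simp: GG_sub_def)
qed

definition target :: "('u => 'u) => nat => nat" where
 "target f N = (SOME K. N <= K & (ALL x:ixd N. f (bas x):sub (ixd K)))"

lemma target:
 assumes f: "f:lin V V"
 shows "N <= target f N" "x:ixd N ==> f (bas x):sub (ixd (target f N))"
proof -
 have fb: "f (bas x):car V" if "x:ixd N" for x
  using lin_closed[OF f bas_in[OF ixdD[OF that]]] .
 have "finite (\<Union>x\<in>ixd N. supp (f (bas x)))" "(\<Union>x\<in>ixd N. supp (f (bas x))) <= ix"
  using fb supp_ix by auto
 then obtain j where j: "(\<Union>x\<in>ixd N. supp (f (bas x))) <= ixd j"
  using finite_sub_ixd by blast
 have "N <= max N j & (ALL x:ixd N. f (bas x):sub (ixd (max N j)))"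
  using fb j ixd_mono[of j "max N j"] by (auto simp: sub_def)
 from someI[of "%K. N <= K & (ALL x:ixd N. f (bas x):sub (ixd K))", OF this]
 show "N <= target f N" "x:ixd N ==> f (bas x):sub (ixd (target f N))"
  by (simp_all add: target_def)
qed

definition curve :: "('u => 'u) => nat => complex => 'u => 'u" where
 "curve f N t = (\<lambda>v\<in>car V. (f (pj N v) +[V] tail (target f N) v) +[V] t *[V] shift (target f N) v)"

lemma curve_G: "f:FL n big big ==> t ~= 0 ==> curve f N t:car G"
 unfolding curve_def by (rule curve_in_G) (auto dest: EndV_lin target)

definition hcurve :: "(nat => nat) => nat => complex => 'u => 'u" where
 "hcurve a N t = (\<lambda>v\<in>car V. proj (- (ixd N - ixa a)) v +[V] t *[V] proj (ixd N - ixa a) v)"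

lemma hcurve_lin: "hcurve a N t:lin V V"
 unfolding hcurve_def
 by (rule linI[OF V_vs], rule linear_onI;
   simp add: lin_add[OF proj_in] lin_smult[OF proj_in] vs_ac vs_smult_radd vs_smult_smult mult.commute)

lemma hcurve_bas: "x:ix ==> hcurve a N t (bas x) = (if x:ixd N - ixa a then t else 1) *[V] bas x"
 by (auto simp: hcurve_def proj_bas)

lemma hcurve_H:
 assumes t: "t ~= 0"
 shows "hcurve a N t:HH n V e a"
proof -
 note SD = submoduleD[OF V_vs submodule_sub]
 have z: "hcurve a N s:FL n big big" for s
 proof (rule EndV_I[OF hcurve_lin])
  fix x assume x: "x:ix"
  hence "bas x:sub (lev (fst x))" using bas_sub[OF x] by (simp add: lev_def)
  thus "hcurve a N s (bas x):sub (lev (fst x))" using x by (simp add: hcurve_bas SD)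
 qed
 have ad: "adm N (hcurve a N s)" for s
  unfolding adm_def
 proof (intro conjI ballI z)
  show "hcurve a N s (bas x):sub (ixd N)" if "x:ixd N" for x
   using that ixdD[OF that] bas_sub[OF ixdD[OF that]] by (simp add: hcurve_bas SD)
  show "hcurve a N s (bas x) = bas x" if "x:ix - ixd N" for x
   using that by (simp add: hcurve_bas)
 qed
 have inv: "hcurve a N s (hcurve a N s' v) = lin_id V v" if "s * s' = 1" "v:car V" for s s' v
  by (rule lin_eq_V2[OF hcurve_lin hcurve_lin lin_id_in[OF V_vs] _ that(2)])
   (use that(1) in "simp add: hcurve_bas lin_smult[OF hcurve_lin] vs_smult_smult mult.commute")
 have "adm_inv N (hcurve a N t) (hcurve a N (inverse t))"
  unfolding adm_inv_def using ad inv[of t "inverse t"] inv[of "inverse t" t] t by simp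
 hence "hcurve a N t:car G" using GG_subI by (auto simp: GG_sub_def)
 thus ?thesis
  unfolding HH_def by (auto simp: block_eq hcurve_bas ix_iff coord_smult coord_bas ixa_def)
qed

section \<open>Polynomial representations\<close>

lemma tpow_finite_support:
 "y:car (tpow V b) ==> EX N0. ALL N>=N0. tpow_map V V b (pj N) y = y"
proof (induction b arbitrary: y)
 case (Suc b)
 let ?T = "tpow V (Suc b)"
 let ?U = "{y:car ?T. EX N0. ALL N>=N0. tpow_map V V (Suc b) (pj N) y = y}"
 have T: "vsp ?T" by simp
 note h = tpow_map_in[OF V_vs V_vs proj_in, of "Suc b"]
 have "submodule ?U CC ?T"
 proof (rule submoduleI[OF T])
  show "0[?T]:?U" using lin_zero[OF T T h] T by (simp del: tpow.simps tpow_map.simps)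
  show "x +[?T] y:?U" if xy: "x:?U" "y:?U" for x y
  proof -
   obtain N M where "!!K. K >= N ==> tpow_map V V (Suc b) (pj K) x = x" "!!K. K >= M ==> tpow_map V V (Suc b) (pj K) y = y"
    using xy by blast
   thus ?thesis
    using xy lin_add[OF h] T by (auto simp del: tpow.simps tpow_map.simps intro!: exI[of _ "max N M"])
  qed
  show "c *[?T] x:?U" if x: "x:?U" for c x
  proof -
   obtain N where "!!K. K >= N ==> tpow_map V V (Suc b) (pj K) x = x" using x by blast
   thus ?thesis
    using x lin_smult[OF h] T by (auto simp del: tpow.simps tpow_map.simps intro!: exI[of _ N])
  qed
 qed auto
 hence "car (tensor (tpow V b) V) <= ?U"
 proof (subst (asm) tpow.simps(2), intro tensor_generated)
  fix u v assume uv: "u:car (tpow V b)" "v:car V"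
  obtain N where N: "ALL K>=N. tpow_map V V b (pj K) u = u" using Suc.IH[OF uv(1)] by blast
  obtain j where j: "v:sub (ixd j)" using in_sub_ixd[OF uv(2)] by blast
  have fx: "tpow_map V V (Suc b) (pj K) (pure (tpow V b) V u v) = pure (tpow V b) V u v" if K: "K >= max N j" for K
  proof -
   have "pj K v = v" using proj_id[of v "ixd K"] j sub_mono[OF ixd_mono[of j K]] K by auto
   thus ?thesis using N K uv by simp
  qed
  have "pure (tpow V b) V u v:car ?T" using uv by simp
  thus "pure (tpow V b) V u v:?U"
   using fx by (intro CollectI conjI exI[of _ "max N j"] allI impI)
 qed simp_all
 thus ?case using Suc.prems by auto
qed simp

lemma tsum_finite_support:
 assumes y: "y:car (tsum V k a)"
 shows "EX N0. ALL N>=N0. tmap V V k a (pj N) y = y"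
proof -
 have "ALL i:{..<k}. EX N0. ALL N>=N0. tpow_map V V (a i) (pj N) (y i) = y i"
  using tpow_finite_support dsum_in[OF y] by blast
 from bchoice[OF this] obtain N0 where N0: "ALL i:{..<k}. ALL N>=N0 i. tpow_map V V (a i) (pj N) (y i) = y i" ..
 have "tmap V V k a (pj N) y = y" if N: "N >= Max (insert 0 (N0 ` {..<k}))" for N
 proof (rule dsum_eqI[OF tsum_map_closed[OF V_vs V_vs proj_in y] y])
  fix i assume i: "i < k"
  hence "N0 i <= N" using N by (intro order_trans[OF Max_ge N]) auto
  thus "tmap V V k a (pj N) y i = y i" using N0 i by (simp add: dsum_map_def)
 qed
 thus ?thesis by blast
qed

text \<open>On a given tensor the curve is affine in \<open>t\<close> and takes the value \<open>f\<close> at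
 \<open>0\<close>, since \<open>pj N\<close> fixes the tensor and \<open>tail K\<close> kills it for large
 \<open>N\<close>.\<close>

lemma extrapolate_curve:
 assumes f: "f:FL n big big" and y: "y:car (tsum V k a)"
 shows "EX N0. ALL N>=N0. extrapolate (tsum V k a) N (%t. tmap V V k a (curve f N t) y) = tmap V V k a f y"
proof -
 obtain N0 where N0: "!!N. N >= N0 ==> tmap V V k a (pj N) y = y" using tsum_finite_support[OF y] by blast
 note fl = EndV_lin[OF f]
 have "extrapolate (tsum V k a) N (%t. tmap V V k a (curve f N t) y) = tmap V V k a f y"
  if N: "N >= max N0 (Max (insert 0 (a ` {..<k})))" for N
 proof -
  let ?K = "target f N"
  define A where "A = (\<lambda>v\<in>car V. f (pj N v) +[V] tail ?K v)"
  have A: "A:lin V V"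
   unfolding A_def
   by (rule linI[OF V_vs], rule linear_onI;
    simp add: lin_add[OF fl] lin_smult[OF fl] lin_add[OF proj_in] lin_smult[OF proj_in] lin_closed[OF fl]
    lin_add[OF tail_in] lin_smult[OF tail_in] lin_closed[OF tail_in] vs_ac vs_smult_radd)
  have g: "curve f N t:lin V V" for t
   unfolding curve_def
   by (rule linI[OF V_vs], rule linear_onI;
    simp add: lin_add[OF fl] lin_smult[OF fl] lin_add[OF proj_in] lin_smult[OF proj_in] lin_closed[OF fl]
    lin_add[OF tail_in] lin_smult[OF tail_in] lin_closed[OF tail_in]
    lin_add[OF shift_in] lin_smult[OF shift_in] lin_closed[OF shift_in] vs_ac vs_smult_radd vs_smult_smult mult.commute)
  have d: "a i <= N" if "i < k" for i
   using N that by auto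
  have "extrapolate (tsum V k a) N (%t. tmap V V k a (curve f N t) y) = tmap V V k a A y"
   by (rule extrapolate_tsum[OF V_vs V_vs A shift_in[of ?K] g _ y d]) (simp add: curve_def A_def)
  also have "... = tmap V V k a A (tmap V V k a (pj N) y)"
   using N0 N by simp
  also have "... = tmap V V k a (cmp V A (pj N)) y"
   by (rule tsum_map_compose[OF V_vs V_vs V_vs proj_in A y, symmetric])
  also have "cmp V A (pj N) = cmp V f (pj N)"
  proof (rule lin_eqI[OF lin_compose[OF V_vs proj_in A] lin_compose[OF V_vs proj_in fl]])
   fix v assume v: "v:car V"
   have "tail ?K (pj N v) = 0[V]"
    by (rule lin_zero_on_sub[OF tail_in _ proj_sub[OF v]])
    (use ixd_mono[of N "2 * ?K"] target(1)[OF fl, of N] in "auto simp: tail_bas")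
   moreover have "pj N (pj N v) = pj N v" using proj_id[OF proj_sub[OF v]] .
   ultimately show "cmp V A (pj N) v = cmp V f (pj N) v"
    using v lin_closed[OF fl] by (simp add: A_def)
  qed
  also have "tmap V V k a (cmp V f (pj N)) y = tmap V V k a f (tmap V V k a (pj N) y)"
   by (rule tsum_map_compose[OF V_vs V_vs V_vs proj_in fl y])
  also have "... = tmap V V k a f y" using N0 N by simp
  finally show ?thesis .
 qed
 thus ?thesis by blast
qed

lemma extrapolate_hcurve:
 assumes y: "y:car (tsum V k a)"
 shows "EX N0. ALL N>=N0. extrapolate (tsum V k a) N (%t. tmap V V k a (hcurve b N t) y) = tmap V V k a (proj (ixa b)) y"
proof -
 obtain N0 where N0: "!!N. N >= N0 ==> tmap V V k a (pj N) y = y" using tsum_finite_support[OF y] by blast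
 have "extrapolate (tsum V k a) N (%t. tmap V V k a (hcurve b N t) y) = tmap V V k a (proj (ixa b)) y"
  if N: "N >= max N0 (Max (insert 0 (a ` {..<k})))" for N
 proof -
  let ?A = "proj (- (ixd N - ixa b))"
  have d: "a i <= N" if "i < k" for i
   using N that by auto
  have "extrapolate (tsum V k a) N (%t. tmap V V k a (hcurve b N t) y) = tmap V V k a ?A y"
   by (rule extrapolate_tsum[OF V_vs V_vs proj_in proj_in[of "ixd N - ixa b"] hcurve_lin _ y d]) (simp add: hcurve_def)
  also have "... = tmap V V k a ?A (tmap V V k a (pj N) y)"
   using N0 N by simp
  also have "... = tmap V V k a (cmp V ?A (pj N)) y"
   by (rule tsum_map_compose[OF V_vs V_vs V_vs proj_in proj_in y, symmetric])
  also have "cmp V ?A (pj N) = cmp V (proj (ixa b)) (pj N)"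
  proof -
   have "- (ixd N - ixa b) Int ixd N = ixa b Int ixd N" by blast
   thus ?thesis by (auto simp: compose_def proj_proj intro!: restrict_ext)
  qed
  also have "tmap V V k a (cmp V (proj (ixa b)) (pj N)) y = tmap V V k a (proj (ixa b)) (tmap V V k a (pj N) y)"
   by (rule tsum_map_compose[OF V_vs V_vs V_vs proj_in proj_in y])
  also have "... = tmap V V k a (proj (ixa b)) y" using N0 N by simp
  finally show ?thesis .
 qed
 thus ?thesis by blast
qed

subsection \<open>The action of the endomorphisms\<close>

abbreviation act :: "'u rep => ('u => 'u) => 'u => 'u" where
 "act R f == end_act n V e R f"

lemma presentation_pres: "presentation n V e R k a S p \<longleftrightarrow> pres V k a S p (fst R) \<and>
  (ALL g:car G. ALL x:S. tmap V V k a g x:S & p (tmap V V k a g x) = snd R g (p x))"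
 by (auto simp: presentation_def pres_def)

lemma presD:
 fixes A :: "'u vs"
 assumes "pres M k a S p A" "vsp M"
 shows "submodule S CC (tsum M k a)" "linear_on ((tsum M k a)<|S|>) A p" "p ` S = car A"
  "!!x. x:S ==> x:car (tsum M k a)" "!!x. x:S ==> p x:car A"
proof -
 show s: "submodule S CC (tsum M k a)" and "linear_on ((tsum M k a)<|S|>) A p" "p ` S = car A"
  using assms by (auto simp: pres_def)
 thus "!!x. x:S ==> p x:car A" by blast
 show "!!x. x:S ==> x:car (tsum M k a)" by (rule submoduleD(5)[OF tsum_vspace[OF assms(2)] s])
qed

lemma pres_extrapolate:
 assumes P: "presentation n V e R k a S p" and y: "y:S"
  and g: "!!t. t ~= 0 ==> g t:car G"
  and z: "extrapolate (tsum V k a) N (%t. tmap V V k a (g t) y) = z"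
 shows "z:S" "p z = extrapolate (fst R) N (%t. snd R (g t) (p y))"
proof -
 have pr: "pres V k a S p (fst R)" and eq: "!!g x. g:car G ==> x:S ==> tmap V V k a g x:S & p (tmap V V k a g x) = snd R g (p x)"
  using P by (auto simp: presentation_pres)
 note D = presD[OF pr V_vs]
 have gS: "tmap V V k a (g t) y:S" if "t ~= 0" for t using eq[OF g[OF that] y] by simp
 show "z:S" unfolding z[symmetric] by (rule extrapolate_closed[OF tsum_vspace[OF V_vs] D(1) gS])
 have "p z = extrapolate (fst R) N (%t. p (tmap V V k a (g t) y))"
  unfolding z[symmetric] by (rule extrapolate_linear[OF tsum_vspace[OF V_vs] D(1,2) gS])
 also have "... = extrapolate (fst R) N (%t. snd R (g t) (p y))"
  by (rule extrapolate_cong) (use eq[OF g y] in simp)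
 finally show "p z = extrapolate (fst R) N (%t. snd R (g t) (p y))" .
qed

lemma pres_curve:
 assumes P: "presentation n V e R k a S p" and y: "y:S" and f: "f:FL n big big"
 shows "tmap V V k a f y:S"
  "EX N0. ALL N>=N0. extrapolate (fst R) N (%t. snd R (curve f N t) (p y)) = p (tmap V V k a f y)"
proof -
 have yT: "y:car (tsum V k a)" using P y presD(4)[OF _ V_vs] by (auto simp: presentation_pres simp del: dsum_simps)
 obtain N0 where N0: "!!N. N >= N0 ==> extrapolate (tsum V k a) N (%t. tmap V V k a (curve f N t) y) = tmap V V k a f y"
  using extrapolate_curve[OF f yT] by blast
 note E = pres_extrapolate[OF P y curve_G[OF f] N0]
 show "tmap V V k a f y:S" using E(1)[of N0] by simp
 show "EX N0. ALL N>=N0. extrapolate (fst R) N (%t. snd R (curve f N t) (p y)) = p (tmap V V k a f y)"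
  using E(2) by (intro exI[of _ N0]) simp
qed

text \<open>Two presentations yield the same action of \<open>f\<close>, as both express it by the same elements of \<open>G\<close>.\<close>

lemma act_eq:
 assumes P: "presentation n V e R k a S p" and y: "y:S" and f: "f:FL n big big"
 shows "act R f (p y) = p (tmap V V k a f y)"
 unfolding end_act_def
proof (rule the_equality)
 show "EX k' a' S' p'. presentation n V e R k' a' S' p' \<and>
  (EX x:S'. p' x = p y & p (tmap V V k a f y) = p' (tmap V V k' a' f x))"
  using P y by blast
 fix m' assume "EX k' a' S' p'. presentation n V e R k' a' S' p' \<and>
  (EX x:S'. p' x = p y & m' = p' (tmap V V k' a' f x))"
 then obtain k' a' S' p' x where P': "presentation n V e R k' a' S' p'" and x: "x:S'" "p' x = p y" "m' = p' (tmap V V k' a' f x)"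
  by blast
 obtain N0 where N0: "!!N. N >= N0 ==> extrapolate (fst R) N (%t. snd R (curve f N t) (p y)) = p (tmap V V k a f y)"
  using pres_curve(2)[OF P y f] by blast
 obtain N1 where N1: "!!N. N >= N1 ==> extrapolate (fst R) N (%t. snd R (curve f N t) (p' x)) = p' (tmap V V k' a' f x)"
  using pres_curve(2)[OF P' x(1) f] by blast
 show "m' = p (tmap V V k a f y)"
  using N0[of "max N0 N1"] N1[of "max N0 N1"] x by simp
qed

abbreviation poly :: "'u rep => bool" where
 "poly R == polynomial_rep n V e R"

lemma polyD:
 assumes "poly R"
 shows "vsp (fst R)" "!!g. g:car G ==> snd R g:lin (fst R) (fst R)"
 using assms by (auto simp: polynomial_rep_def is_rep_def)

lemma polyE:
 assumes "poly R"
 obtains k a S p where "presentation n V e R k a S p" "pres V k a S p (fst R)"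
 using assms by (auto simp: polynomial_rep_def presentation_pres)

lemma act_in:
 assumes R: "poly R" and f: "f:FL n big big"
 shows "linear_on (fst R) (fst R) (act R f)"
proof -
 obtain k a S p where P: "presentation n V e R k a S p" and pr: "pres V k a S p (fst R)" using polyE[OF R] .
 note D = presD[OF pr V_vs] and pl = linear_onD[OF presD(2)[OF pr V_vs], simplified] and SD = submoduleD[OF tsum_vspace[OF V_vs] presD(1)[OF pr V_vs]]
 note A = act_eq[OF P _ f] and fS = pres_curve(1)[OF P _ f]
 note fl = linear_onD[OF linear_on_tsum_map[OF V_vs V_vs EndV_lin[OF f], of k a]]
 have surj: "EX y:S. m = p y" if "m:car (fst R)" for m using D(3) that by blast
 show ?thesis
 proof (rule linear_onI)
  fix x y c assume x: "x:car (fst R)"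
  obtain s where s: "s:S" "x = p s" using surj[OF x] by blast
  show "act R f x:car (fst R)" using A[OF s(1)] D(5)[OF fS[OF s(1)]] s(2) by simp
  have "p (c *[tsum V k a] s) = c *[fst R] x"
   using pl(3)[OF s(1)] s(2) by simp
  thus "act R f (c *[fst R] x) = c *[fst R] act R f x"
   using A[OF SD(4)[OF s(1), of c]] A[OF s(1)] fl(3)[OF D(4)[OF s(1)], of c] pl(3)[OF fS[OF s(1)], of c] s(2) by (simp del: dsum_simps add: dsum_simps(4))
  assume y: "y:car (fst R)"
  obtain s' where s': "s':S" "y = p s'" using surj[OF y] by blast
  have "p (s +[tsum V k a] s') = x +[fst R] y"
   using pl(2)[OF s(1) s'(1)] s(2) s'(2) by simp
  thus "act R f (x +[fst R] y) = act R f x +[fst R] act R f y"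
   using A[OF SD(3)[OF s(1) s'(1)]] A[OF s(1)] A[OF s'(1)] fl(2)[OF D(4)[OF s(1)] D(4)[OF s'(1)]]
    pl(2)[OF fS[OF s(1)] fS[OF s'(1)]] s(2) s'(2) by (simp del: dsum_simps add: dsum_simps(3))
 qed
qed

lemma act_closed: "poly R ==> f:FL n big big ==> m:car (fst R) ==> act R f m:car (fst R)"
 by (rule linear_onD(1)[OF act_in])

lemma act_compose:
 assumes R: "poly R" and f: "f:FL n big big" and g: "g:FL n big big" and m: "m:car (fst R)"
 shows "act R g (act R f m) = act R (cmp V g f) m"
proof -
 obtain k a S p where P: "presentation n V e R k a S p" and pr: "pres V k a S p (fst R)" using polyE[OF R] .
 obtain y where y: "y:S" "m = p y" using presD(3)[OF pr V_vs] m by blast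
 show ?thesis
  using act_eq[OF P y(1) f] act_eq[OF P pres_curve(1)[OF P y(1) f] g] act_eq[OF P y(1) EndV_compose[OF f g]]
   tsum_map_compose[OF V_vs V_vs V_vs EndV_lin[OF f] EndV_lin[OF g] presD(4)[OF pr V_vs y(1)]] y(2) by simp
qed

lemma act_cong:
 assumes R: "poly R" and f: "f:FL n big big" and g: "g:FL n big big"
  and "!!v. v:car V ==> f v = g v"
 shows "act R f = act R g"
 using lin_eqI[OF EndV_lin[OF f] EndV_lin[OF g]] assms(4) by metis

lemma act_G:
 assumes R: "poly R" and g: "g:car G" and m: "m:car (fst R)"
 shows "act R g m = snd R g m"
proof -
 obtain k a S p where P: "presentation n V e R k a S p" and pr: "pres V k a S p (fst R)" using polyE[OF R] .
 obtain y where y: "y:S" "m = p y" using presD(3)[OF pr V_vs] m by blast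
 show ?thesis
  using act_eq[OF P y(1) GG_EndV[OF g]] P g y by (simp add: presentation_pres)
qed

lemma act_curve:
 assumes R: "poly R" and f: "f:FL n big big" and m: "m:car (fst R)"
 shows "EX N0. ALL N>=N0. extrapolate (fst R) N (%t. snd R (curve f N t) m) = act R f m"
proof -
 obtain k a S p where P: "presentation n V e R k a S p" and pr: "pres V k a S p (fst R)" using polyE[OF R] .
 obtain y where y: "y:S" "m = p y" using presD(3)[OF pr V_vs] m by blast
 show ?thesis using pres_curve(2)[OF P y(1) f] act_eq[OF P y(1) f] y(2) by simp
qed

text \<open>An equivariant map commutes with the group, hence with the extrapolated actions of group elements
 that compute the action of \<open>f\<close>.\<close>

lemma act_equivariant:
 assumes R: "poly R" and Q: "poly Q" and ze: "ze:eqv R Q" and f: "f:FL n big big" and m: "m:car (fst R)"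
 shows "ze (act R f m) = act Q f (ze m)"
proof -
 have l: "ze:lin (fst R) (fst Q)" and eq: "!!g m. g:car G ==> m:car (fst R) ==> ze (snd R g m) = snd Q g (ze m)"
  using ze by (auto simp: equivariant_def)
 note v = polyD(1)[OF R]
 obtain N0 where N0: "!!N. N >= N0 ==> extrapolate (fst R) N (%t. snd R (curve f N t) m) = act R f m"
  using act_curve[OF R f m] by blast
 obtain N1 where N1: "!!N. N >= N1 ==> extrapolate (fst Q) N (%t. snd Q (curve f N t) (ze m)) = act Q f (ze m)"
  using act_curve[OF Q f lin_closed[OF l m]] by blast
 let ?N = "max N0 N1"
 have c: "snd R (curve f ?N t) m:car (fst R)" if "t ~= 0" for t
  by (rule lin_closed[OF polyD(2)[OF R curve_G[OF f that]] m])
 have "ze (act R f m) = ze (extrapolate (fst R) ?N (%t. snd R (curve f ?N t) m))" using N0[of ?N] by simp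
 also have "... = extrapolate (fst Q) ?N (%t. ze (snd R (curve f ?N t) m))"
  by (rule extrapolate_linear[OF v submodule_carrier[OF v] _ c]) (use linD[OF l] in simp)
 also have "... = extrapolate (fst Q) ?N (%t. snd Q (curve f ?N t) (ze m))"
  by (rule extrapolate_cong) (use eq[OF curve_G[OF f] m] in simp)
 also have "... = act Q f (ze m)" using N1[of ?N] by simp
 finally show ?thesis .
qed

text \<open>Invariants under \<open>H\<^sub>a\<close> are the fixed points of the projection onto \<open>\<complex>\<^sup>a\<close>: the latter is the limit, in the
 sense of extrapolation, of the diagonal matrices \<open>hcurve a N t\<close> in \<open>H\<^sub>a\<close>, and it absorbs \<open>H\<^sub>a\<close>.\<close>

lemma invariants_eq:
 assumes R: "poly R"
 shows "car (invariants n V e R a) = {m:car (fst R). act R (proj (ixa a)) m = m}"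
proof -
 have hG: "h:car G" if "h:HH n V e a" for h using that by (simp add: HH_def)
 obtain k b S p where P: "presentation n V e R k b S p" and pr: "pres V k b S p (fst R)" using polyE[OF R] .
 have "act R (proj (ixa a)) m = m" if m: "m:car (fst R)" and inv: "ALL h:HH n V e a. snd R h m = m" for m
 proof -
  obtain y where y: "y:S" "m = p y" using presD(3)[OF pr V_vs] m by blast
  obtain N0 where N0: "extrapolate (tsum V k b) N0 (%t. tmap V V k b (hcurve a N0 t) y) = tmap V V k b (proj (ixa a)) y"
   using extrapolate_hcurve[OF presD(4)[OF pr V_vs y(1)]] by blast
  have "p (tmap V V k b (proj (ixa a)) y) = extrapolate (fst R) N0 (%t. snd R (hcurve a N0 t) m)"
   using pres_extrapolate(2)[OF P y(1) hG[OF hcurve_H] N0] y(2) by simp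
  also have "... = extrapolate (fst R) N0 (%t. m)"
   by (rule extrapolate_cong) (use inv hcurve_H in blast)
  also have "... = m" by (rule extrapolate_const[OF polyD(1)[OF R] m])
  finally show ?thesis using act_eq[OF P y(1) EndV_proj] y(2) by simp
 qed
 moreover have "snd R h m = m" if m: "m:car (fst R)" and p: "act R (proj (ixa a)) m = m" and h: "h:HH n V e a" for m h
 proof -
  note hE = GG_EndV[OF hG[OF h]]
  have b: "h (bas x) = bas x" if x: "x:ixa a" for x
  proof (rule coord_eqI)
   have xi: "x:ix" using x ixa_ix by blast
   show "h (bas x):car V" using lin_closed[OF EndV_lin[OF hE] bas_in[OF xi]] .
   show "bas x:car V" using xi by simp
   fix y assume y: "y:ix"
   obtain k q i p where xy: "x = (k, q)" "y = (i, p)" by force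
   have "block n V e h i k p q = (if i = k & p = q then 1 else 0)"
    using h x y unfolding xy by (cases "i = k") (auto simp: HH_def ixa_def ix_iff)
   thus "cd (h (bas x)) y = cd (bas x) y"
    using coord_bas[OF xi, of y] by (auto simp: block_eq xy)
  qed
  have "h (proj (ixa a) v) = proj (ixa a) v" if v: "v:car V" for v
   by (rule lin_eq_V2[OF EndV_lin[OF hE] proj_in proj_in _ v])
    (use b lin_zero[OF V_vs V_vs EndV_lin[OF hE]] in "simp add: proj_bas")
  hence "cmp V h (proj (ixa a)) = proj (ixa a)"
   by (intro lin_eqI[OF lin_compose[OF V_vs proj_in EndV_lin[OF hE]] proj_in]) simp
  hence "act R h (act R (proj (ixa a)) m) = act R (proj (ixa a)) m"
   using act_compose[OF R EndV_proj hE m] by simp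
  thus ?thesis using p act_G[OF R hG[OF h] m] by simp
 qed
 ultimately show ?thesis unfolding invariants_def by auto
qed

text \<open>A tensor involves finitely many basis vectors.\<close>

lemma act_finite_support:
 assumes R: "poly R" and m: "m:car (fst R)"
 shows "EX N0. ALL N>=N0. act R (pj N) m = m"
proof -
 obtain k a S p where P: "presentation n V e R k a S p" and pr: "pres V k a S p (fst R)" using polyE[OF R] .
 obtain y where y: "y:S" "m = p y" using presD(3)[OF pr V_vs] m by blast
 obtain N0 where "!!N. N >= N0 ==> tmap V V k a (pj N) y = y"
  using tsum_finite_support[OF presD(4)[OF pr V_vs y(1)]] by blast
 thus ?thesis
  using act_eq[OF P y(1) EndV_proj] y(2) by (intro exI[of _ N0]) simp
qed

end

section \<open>Tensor categories with fibre functors\<close>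

locale fibred_tensor = vs_universe L l for L :: "'u vs" and l +
 fixes C :: "('o, 'm) tensor_cat" (structure) and I :: "'i set"
  and U :: "'i => 'o => 'u vs" and u :: "'i => 'm => 'u => 'u"
 assumes U_vs [simp]: "i:I ==> X:Ob C ==> vsp (U i X)"
  and u_in: "i:I ==> X:Ob C ==> Y:Ob C ==> f:Hom C X Y ==> u i f:lin (U i X) (U i Y)"
  and u_faithful: "X:Ob C ==> Y:Ob C ==> f:Hom C X Y ==> g:Hom C X Y ==> (!!i. i:I ==> u i f = u i g) ==> f = g"
  and cl_Idn: "X:Ob C ==> Idn C X:Hom C X X"
  and cl_Cmp: "X:Ob C ==> Y:Ob C ==> Z:Ob C ==> f:Hom C X Y ==> g:Hom C Y Z ==> Cmp C X Y Z g f:Hom C X Z"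
  and cl_Unt: "\<^bold>I:Ob C"
  and cl_Tob: "X:Ob C ==> Y:Ob C ==> X \<star> Y:Ob C"
  and cl_Tmor: "X:Ob C ==> X':Ob C ==> Y:Ob C ==> Y':Ob C ==> f:Hom C X X' ==> g:Hom C Y Y' ==>
   Tmor C X X' Y Y' f g:Hom C (X \<star> Y) (X' \<star> Y')"
  and cl_Asc: "X:Ob C ==> Y:Ob C ==> Z:Ob C ==> Asc C X Y Z:Hom C (X \<star> Y \<star> Z) (X \<star> (Y \<star> Z))"
  and cl_Lun: "X:Ob C ==> Lun C X:Hom C (\<^bold>I \<star> X) X"
  and cl_Run: "X:Ob C ==> Run C X:Hom C (X \<star> \<^bold>I) X"
  and cl_Swp: "X:Ob C ==> Y:Ob C ==> Swp C X Y:Hom C (X \<star> Y) (Y \<star> X)"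
  and u_Idn: "i:I ==> u i (Idn C X) = lin_id (U i X)"
  and u_Cmp: "i:I ==> u i (Cmp C X Y Z g f) = cmp (U i X) (u i g) (u i f)"
  and U_Unt: "i:I ==> U i \<^bold>I = unit_sp"
  and U_Tob: "i:I ==> U i (X \<star> Y) = tensor (U i X) (U i Y)"
  and u_Tmor: "i:I ==> u i (Tmor C X X' Y Y' f g) = tensor_map (U i X) (U i X') (U i Y) (U i Y') (u i f) (u i g)"
  and u_Asc: "i:I ==> u i (Asc C X Y Z) = tensor_assoc (U i X) (U i Y) (U i Z)"
  and u_Lun: "i:I ==> u i (Lun C X) = tensor_lunit (U i X)"
  and u_Run: "i:I ==> u i (Run C X) = tensor_runit (U i X)"
  and u_Swp: "i:I ==> u i (Swp C X Y) = tensor_swap (U i X) (U i Y)"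
  and u_iso: "X:Ob C ==> Y:Ob C ==> f:Hom C X Y ==>
   (!!i. i:I ==> bij_betw (u i f) (car (U i X)) (car (U i Y))) ==> is_iso C X Y f"
  and carrier_HomSp: "X:Ob C ==> Y:Ob C ==> car (HomSp C X Y) = Hom C X Y"
  and HomSp_vs: "X:Ob C ==> Y:Ob C ==> vsp (HomSp C X Y)"
  and u_linear: "i:I ==> X:Ob C ==> Y:Ob C ==> linear_on (HomSp C X Y) (lin_space (U i X) (U i Y)) (u i)"
begin

lemmas cl = cl_Idn cl_Cmp cl_Unt cl_Tob cl_Tmor cl_Asc cl_Lun cl_Run cl_Swp
lemmas us = u_Idn u_Cmp U_Unt U_Tob u_Tmor u_Asc u_Lun u_Run u_Swp

lemma u_closed: "i:I ==> X:Ob C ==> Y:Ob C ==> f:Hom C X Y ==> x:car (U i X) ==> u i f x:car (U i Y)"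
 by (rule lin_closed[OF u_in])

text \<open>The fibre functors are jointly faithful.\<close>

lemma hom_eqI:
 assumes "X:Ob C" "Y:Ob C" "f:Hom C X Y" "g:Hom C X Y"
  and "!!i x. i:I ==> x:car (U i X) ==> u i f x = u i g x"
 shows "f = g"
 by (rule u_faithful[OF assms(1-4)], rule lin_eqI[OF u_in u_in]) (use assms in auto)

lemma hom_eq2:
 assumes X: "X:Ob C" and Y: "Y:Ob C" and W: "W:Ob C" and f: "f:Hom C (X \<star> Y) W" and g: "g:Hom C (X \<star> Y) W"
  and e: "!!i x y. i:I ==> x:car (U i X) ==> y:car (U i Y) ==>
   u i f (pure (U i X) (U i Y) x y) = u i g (pure (U i X) (U i Y) x y)"
 shows "f = g"
proof (rule hom_eqI[OF cl_Tob[OF X Y] W f g])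
 fix i x assume i: "i:I" and x: "x:car (U i (X \<star> Y))"
 show "u i f x = u i g x"
  by (rule tensor_eq[OF U_vs[OF i X] U_vs[OF i Y] U_vs[OF i W]
    linD[OF u_in[OF i cl_Tob[OF X Y] W f, unfolded U_Tob[OF i]]] linD[OF u_in[OF i cl_Tob[OF X Y] W g, unfolded U_Tob[OF i]]]
    e[OF i] x[unfolded U_Tob[OF i]]])
qed

lemma hom_eq3:
 assumes X: "X:Ob C" and Y: "Y:Ob C" and Z: "Z:Ob C" and W: "W:Ob C"
  and f: "f:Hom C (X \<star> Y \<star> Z) W" and g: "g:Hom C (X \<star> Y \<star> Z) W"
  and e: "!!i x y z. i:I ==> x:car (U i X) ==> y:car (U i Y) ==> z:car (U i Z) ==>
   u i f (pure (tensor (U i X) (U i Y)) (U i Z) (pure (U i X) (U i Y) x y) z) =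
   u i g (pure (tensor (U i X) (U i Y)) (U i Z) (pure (U i X) (U i Y) x y) z)"
 shows "f = g"
proof (rule hom_eqI[OF cl_Tob[OF cl_Tob[OF X Y] Z] W f g])
 fix i x assume i: "i:I" and x: "x:car (U i (X \<star> Y \<star> Z))"
 note O = cl_Tob[OF cl_Tob[OF X Y] Z]
 show "u i f x = u i g x"
  by (rule tensor_eq_left[OF U_vs[OF i X] U_vs[OF i Y] U_vs[OF i Z] U_vs[OF i W]
    linD[OF u_in[OF i O W f, unfolded U_Tob[OF i]]] linD[OF u_in[OF i O W g, unfolded U_Tob[OF i]]]
    e[OF i] x[unfolded U_Tob[OF i]]])
qed

lemma hom_eq4:
 assumes X: "X:Ob C" and Y: "Y:Ob C" and Z: "Z:Ob C" and T: "T:Ob C" and W: "W:Ob C"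
  and f: "f:Hom C (X \<star> Y \<star> Z \<star> T) W" and g: "g:Hom C (X \<star> Y \<star> Z \<star> T) W"
  and e: "!!i x y z t. i:I ==> x:car (U i X) ==> y:car (U i Y) ==> z:car (U i Z) ==> t:car (U i T) ==>
   u i f (pure (tensor (tensor (U i X) (U i Y)) (U i Z)) (U i T) (pure (tensor (U i X) (U i Y)) (U i Z) (pure (U i X) (U i Y) x y) z) t) =
   u i g (pure (tensor (tensor (U i X) (U i Y)) (U i Z)) (U i T) (pure (tensor (U i X) (U i Y)) (U i Z) (pure (U i X) (U i Y) x y) z) t)"
 shows "f = g"
proof (rule hom_eqI[OF cl_Tob[OF cl_Tob[OF cl_Tob[OF X Y] Z] T] W f g])
 fix i x assume i: "i:I" and x: "x:car (U i (X \<star> Y \<star> Z \<star> T))"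
 note O = cl_Tob[OF cl_Tob[OF cl_Tob[OF X Y] Z] T]
 show "u i f x = u i g x"
  by (rule tensor_eq4[OF U_vs[OF i X] U_vs[OF i Y] U_vs[OF i Z] U_vs[OF i T] U_vs[OF i W]
    linD[OF u_in[OF i O W f, unfolded U_Tob[OF i]]] linD[OF u_in[OF i O W g, unfolded U_Tob[OF i]]]
    e[OF i] x[unfolded U_Tob[OF i]]])
qed

lemma hom_eq_lunit:
 assumes X: "X:Ob C" and W: "W:Ob C" and f: "f:Hom C (\<^bold>I \<star> X) W" and g: "g:Hom C (\<^bold>I \<star> X) W"
  and e: "!!i x. i:I ==> x:car (U i X) ==> u i f (pure unit_sp (U i X) unit_vec x) = u i g (pure unit_sp (U i X) unit_vec x)"
 shows "f = g"
proof (rule hom_eqI[OF cl_Tob[OF cl_Unt X] W f g])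
 fix i x assume i: "i:I" and x: "x:car (U i (\<^bold>I \<star> X))"
 note O = cl_Tob[OF cl_Unt X]
 show "u i f x = u i g x"
  by (rule tensor_unit_eq_left[OF U_vs[OF i X] U_vs[OF i W]
    linD[OF u_in[OF i O W f, unfolded U_Tob[OF i] U_Unt[OF i]]] linD[OF u_in[OF i O W g, unfolded U_Tob[OF i] U_Unt[OF i]]]
    e[OF i] x[unfolded U_Tob[OF i] U_Unt[OF i]]])
qed

lemma hom_eq_runit:
 assumes X: "X:Ob C" and W: "W:Ob C" and f: "f:Hom C (X \<star> \<^bold>I) W" and g: "g:Hom C (X \<star> \<^bold>I) W"
  and e: "!!i x. i:I ==> x:car (U i X) ==> u i f (pure (U i X) unit_sp x unit_vec) = u i g (pure (U i X) unit_sp x unit_vec)"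
 shows "f = g"
proof (rule hom_eqI[OF cl_Tob[OF X cl_Unt] W f g])
 fix i x assume i: "i:I" and x: "x:car (U i (X \<star> \<^bold>I))"
 note O = cl_Tob[OF X cl_Unt]
 show "u i f x = u i g x"
  by (rule tensor_unit_eq_right[OF U_vs[OF i X] U_vs[OF i W]
    linD[OF u_in[OF i O W f, unfolded U_Tob[OF i] U_Unt[OF i]]] linD[OF u_in[OF i O W g, unfolded U_Tob[OF i] U_Unt[OF i]]]
    e[OF i] x[unfolded U_Tob[OF i] U_Unt[OF i]]])
qed

lemma is_category: "category C"
proof
 fix W X Y Z f g h
 show "Cmp C X Y Y (Idn C Y) f = f" if "X:Ob C" "Y:Ob C" "f:Hom C X Y"
  by (rule u_faithful[OF that(1,2)]) (use that in "simp_all add: cl us compose_lin_id_left[OF u_in]")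
 show "Cmp C X X Y f (Idn C X) = f" if "X:Ob C" "Y:Ob C" "f:Hom C X Y"
  by (rule u_faithful[OF that(1,2)]) (use that in "simp_all add: cl us compose_lin_id_right[OF u_in]")
 show "Cmp C W X Z (Cmp C X Y Z h g) f = Cmp C W Y Z h (Cmp C W X Y g f)"
  if "W:Ob C" "X:Ob C" "Y:Ob C" "Z:Ob C" "f:Hom C W X" "g:Hom C X Y" "h:Hom C Y Z"
  by (rule u_faithful[OF that(1,4)]) (use that in "simp_all add: cl us compose_lin_assoc[OF u_in]")
qed (simp_all add: cl)

text \<open>Each axiom is an identity of linear maps in every fibre, and there it holds because it holds on pure
 tensors.\<close>

lemma is_tensor_category: "tensor_category C"
proof -
 interpret category C by (rule is_category)
 have c1: "linear_category C"
 proof (intro linear_category.intro linear_category_axioms.intro is_category)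
  fix X Y Z assume O: "X:Ob C" "Y:Ob C" "Z:Ob C"
  show "bilinear_on (HomSp C Y Z) (HomSp C X Y) (HomSp C X Z) (Cmp C X Y Z)"
  proof (rule bilinear_onI; simp only: carrier_HomSp O)
   fix f f' g g' c
   note H = HomSp_vs carrier_HomSp O cl
   have un: "u i (a +[HomSp C P Q] b) = (\<lambda>x\<in>car (U i P). u i a x +[U i Q] u i b x)"
    if "i:I" "P:Ob C" "Q:Ob C" "a:Hom C P Q" "b:Hom C P Q" for i P Q a b
    using linear_onD(2)[OF u_linear[OF that(1-3)], of a b] that by (simp add: carrier_HomSp)
   have us': "u i (c *[HomSp C P Q] a) = (\<lambda>x\<in>car (U i P). c *[U i Q] u i a x)"
    if "i:I" "P:Ob C" "Q:Ob C" "a:Hom C P Q" for i P Q a c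
    using linear_onD(3)[OF u_linear[OF that(1-3)], of a c] that by (simp add: carrier_HomSp)
   have ad: "a +[HomSp C P Q] b:Hom C P Q"
    if "P:Ob C" "Q:Ob C" "a:Hom C P Q" "b:Hom C P Q" for P Q a b
    using vs_add[OF HomSp_vs[OF that(1,2)], of a b] that by (simp add: carrier_HomSp)
   have sc: "c *[HomSp C P Q] a:Hom C P Q"
    if "P:Ob C" "Q:Ob C" "a:Hom C P Q" for P Q a c
    using vs_smult[OF HomSp_vs[OF that(1,2)], of a c] that by (simp add: carrier_HomSp)
   show "Cmp C X Y Z g f:Hom C X Z" if "g:Hom C Y Z" "f:Hom C X Y"
    using that O by (simp add: cl)
   show "Cmp C X Y Z (g +[HomSp C Y Z] g') f = Cmp C X Y Z g f +[HomSp C X Z] Cmp C X Y Z g' f"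
    if h: "g:Hom C Y Z" "g':Hom C Y Z" "f:Hom C X Y"
   proof (rule hom_eqI[OF O(1,3)])
    fix i x assume "i:I" "x:car (U i X)"
    thus "u i (Cmp C X Y Z (g +[HomSp C Y Z] g') f) x = u i (Cmp C X Y Z g f +[HomSp C X Z] Cmp C X Y Z g' f) x"
    using h O u_closed[of i X Y f x] by (simp add: us un cl)
   qed (use h O ad sc in "simp_all add: cl")
   show "Cmp C X Y Z g (f +[HomSp C X Y] f') = Cmp C X Y Z g f +[HomSp C X Z] Cmp C X Y Z g f'"
    if h: "g:Hom C Y Z" "f:Hom C X Y" "f':Hom C X Y"
   proof (rule hom_eqI[OF O(1,3)])
    fix i x assume "i:I" "x:car (U i X)"
    thus "u i (Cmp C X Y Z g (f +[HomSp C X Y] f')) x = u i (Cmp C X Y Z g f +[HomSp C X Z] Cmp C X Y Z g f') x"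
    using h O u_closed[of i X Y f x] u_closed[of i X Y f' x] lin_add[OF u_in[of i Y Z g]] by (simp add: us un cl)
   qed (use h O ad sc in "simp_all add: cl")
   show "Cmp C X Y Z (c *[HomSp C Y Z] g) f = c *[HomSp C X Z] Cmp C X Y Z g f"
    if h: "g:Hom C Y Z" "f:Hom C X Y"
   proof (rule hom_eqI[OF O(1,3)])
    fix i x assume "i:I" "x:car (U i X)"
    thus "u i (Cmp C X Y Z (c *[HomSp C Y Z] g) f) x = u i (c *[HomSp C X Z] Cmp C X Y Z g f) x"
    using h O u_closed[of i X Y f x] by (simp add: us us' cl)
   qed (use h O ad sc in "simp_all add: cl")
   show "Cmp C X Y Z g (c *[HomSp C X Y] f) = c *[HomSp C X Z] Cmp C X Y Z g f"
    if h: "g:Hom C Y Z" "f:Hom C X Y"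
   proof (rule hom_eqI[OF O(1,3)])
    fix i x assume "i:I" "x:car (U i X)"
    thus "u i (Cmp C X Y Z g (c *[HomSp C X Y] f)) x = u i (c *[HomSp C X Z] Cmp C X Y Z g f) x"
    using h O u_closed[of i X Y f x] lin_smult[OF u_in[of i Y Z g]] by (simp add: us us' cl)
   qed (use h O ad sc in "simp_all add: cl")
  qed
 qed (simp_all add: carrier_HomSp HomSp_vs)
 have c2: "symmetric_monoidal_category C"
 proof (intro symmetric_monoidal_category.intro symmetric_monoidal_category_axioms.intro is_category, goal_cases)
  case (4 X Y)
  thus ?case by (intro u_faithful[of "X \<star> Y" "X \<star> Y"]) (simp_all add: cl us tensor_map_id)
 next
  case (5 X X' X'' Y Y' Y'' f f' g g')
  thus ?case by (intro u_faithful[of "X \<star> Y" "X'' \<star> Y''"]) (simp_all add: cl us tensor_map_compose u_in)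
 next
  case (6 X Y Z)
  thus ?case by (intro u_iso) (simp_all add: cl us tensor_assoc_bij)
 next
  case (7 X X' Y Y' Z Z' f g h)
  thus ?case
   by (intro hom_eq3[of X Y Z "X' \<star> (Y' \<star> Z')"]) (simp_all add: cl us u_in u_closed[of _ X X' f] u_closed[of _ Y Y' g] u_closed[of _ Z Z' h])
 next
  case (8 X)
  thus ?case by (intro u_iso) (simp_all add: cl us tensor_lunit_bij)
 next
  case (9 X Y f)
  thus ?case by (intro hom_eq_lunit[of X Y]) (simp_all add: cl us u_in u_closed[of _ X Y f])
 next
  case (10 X)
  thus ?case by (intro u_iso) (simp_all add: cl us tensor_runit_bij)
 next
  case (11 X Y f)
  thus ?case by (intro hom_eq_runit[of X Y]) (simp_all add: cl us u_in u_closed[of _ X Y f])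
 next
  case (13 X X' Y Y' f g)
  thus ?case
   by (intro hom_eq2[of X Y "Y' \<star> X'"]) (simp_all add: cl us u_in u_closed[of _ X X' f] u_closed[of _ Y Y' g])
 next
  case (14 W X Y Z)
  thus ?case by (intro hom_eq4[of W X Y Z "W \<star> (X \<star> (Y \<star> Z))"]) (simp_all add: cl us)
 next
  case (15 X Y)
  note O = this
  show ?case (is "?f = ?g")
  proof (rule hom_eq2[of "X \<star> \<^bold>I" Y "X \<star> Y"])
   show f: "?f:Hom C (X \<star> \<^bold>I \<star> Y) (X \<star> Y)" and g: "?g:Hom C (X \<star> \<^bold>I \<star> Y) (X \<star> Y)"
    using O by (simp_all add: cl)
   fix i t y assume i: "i:I" and t: "t:car (U i (X \<star> \<^bold>I))" and y: "y:car (U i Y)"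
   have v: "vsp (U i X)" "vsp (U i Y)" "vsp (tensor (U i X) (U i Y))" using i O by simp_all
   have OO: "X \<star> \<^bold>I \<star> Y:Ob C" "X \<star> Y:Ob C" using O by (simp_all add: cl)
   note l = linear_on_pure1[OF tensor_vspace[OF v(1) unit_vspace] v(2) y]
   note fl = u_in[OF i OO f, unfolded U_Tob[OF i] U_Unt[OF i]] and gl = u_in[OF i OO g, unfolded U_Tob[OF i] U_Unt[OF i]]
   have "u i ?f (pure (tensor (U i X) unit_sp) (U i Y) t y) = u i ?g (pure (tensor (U i X) unit_sp) (U i Y) t y)"
    by (rule tensor_unit_eq_right[OF v(1,3) lin_comp[OF l linD[OF fl]] lin_comp[OF l linD[OF gl]]])
    (use t y v i in "simp_all add: us")
   thus "u i ?f (pure (U i (X \<star> \<^bold>I)) (U i Y) t y) = u i ?g (pure (U i (X \<star> \<^bold>I)) (U i Y) t y)"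
    by (simp add: U_Tob[OF i] U_Unt[OF i])
  qed (use O in "simp_all add: cl")
 next
  case (16 X Y Z)
  thus ?case by (intro hom_eq3[of X Y Z "Y \<star> (Z \<star> X)"]) (simp_all add: cl us)
 next
  case (17 X Y)
  thus ?case by (intro hom_eq2[of X Y "X \<star> Y"]) (simp_all add: cl us)
 qed (simp_all add: cl)
 have c3: "bilinear_on (HomSp C X X') (HomSp C Y Y') (HomSp C (X \<star> Y) (X' \<star> Y')) (Tmor C X X' Y Y')"
  if O: "X:Ob C" "X':Ob C" "Y:Ob C" "Y':Ob C" for X X' Y Y'
 proof -
  let ?O = "X \<star> Y" and ?O' = "X' \<star> Y'"
  have OO: "?O:Ob C" "?O':Ob C" using O by (simp_all add: cl)
  have b: "bilinear_on (lin_space (U i X) (U i X')) (lin_space (U i Y) (U i Y'))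
    (lin_space (U i ?O) (U i ?O')) (tensor_map (U i X) (U i X') (U i Y) (U i Y'))" if "i:I" for i
   using tensor_map_bilinear[of "U i X" "U i X'" "U i Y" "U i Y'"] that O by (simp only: U_Tob U_vs)
  note ul1 = linear_onD[OF u_linear[OF _ O(1,2)], unfolded carrier_HomSp[OF O(1,2)]]
  note ul2 = linear_onD[OF u_linear[OF _ O(3,4)], unfolded carrier_HomSp[OF O(3,4)]]
  note ul = linear_onD[OF u_linear[OF _ OO], unfolded carrier_HomSp[OF OO]]
  note B = bilinear_onD[OF b, unfolded lin_space_simps(1)]
  note ui1 = u_in[OF _ O(1,2)] and ui2 = u_in[OF _ O(3,4)]
  note A1 = vs_add[OF HomSp_vs[OF O(1,2)], unfolded carrier_HomSp[OF O(1,2)]] vs_smult[OF HomSp_vs[OF O(1,2)], unfolded carrier_HomSp[OF O(1,2)]]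
  note A2 = vs_add[OF HomSp_vs[OF O(3,4)], unfolded carrier_HomSp[OF O(3,4)]] vs_smult[OF HomSp_vs[OF O(3,4)], unfolded carrier_HomSp[OF O(3,4)]]
  note A = vs_add[OF HomSp_vs[OF OO], unfolded carrier_HomSp[OF OO]] vs_smult[OF HomSp_vs[OF OO], unfolded carrier_HomSp[OF OO]]
  note T = cl_Tmor[OF O]
  show ?thesis
  proof (rule bilinear_onI; simp only: carrier_HomSp O OO)
   fix f f' g g' c
   show "Tmor C X X' Y Y' f g:Hom C ?O ?O'" if "f:Hom C X X'" "g:Hom C Y Y'"
    by (rule T[OF that])
   show "Tmor C X X' Y Y' (f +[HomSp C X X'] f') g = Tmor C X X' Y Y' f g +[HomSp C ?O ?O'] Tmor C X X' Y Y' f' g"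
    if h: "f:Hom C X X'" "f':Hom C X X'" "g:Hom C Y Y'"
    by (rule u_faithful[OF OO T[OF A1(1)[OF h(1,2)] h(3)] A(1)[OF T[OF h(1,3)] T[OF h(2,3)]]])
    (simp only: ul(2)[OF _ T[OF h(1,3)] T[OF h(2,3)]] u_Tmor ul1(2)[OF _ h(1,2)] B(2)[OF _ ui1[OF _ h(1)] ui1[OF _ h(2)] ui2[OF _ h(3)]])
   show "Tmor C X X' Y Y' f (g +[HomSp C Y Y'] g') = Tmor C X X' Y Y' f g +[HomSp C ?O ?O'] Tmor C X X' Y Y' f g'"
    if h: "f:Hom C X X'" "g:Hom C Y Y'" "g':Hom C Y Y'"
    by (rule u_faithful[OF OO T[OF h(1) A2(1)[OF h(2,3)]] A(1)[OF T[OF h(1,2)] T[OF h(1,3)]]])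
    (simp only: ul(2)[OF _ T[OF h(1,2)] T[OF h(1,3)]] u_Tmor ul2(2)[OF _ h(2,3)] B(3)[OF _ ui1[OF _ h(1)] ui2[OF _ h(2)] ui2[OF _ h(3)]])
   show "Tmor C X X' Y Y' (c *[HomSp C X X'] f) g = c *[HomSp C ?O ?O'] Tmor C X X' Y Y' f g"
    if h: "f:Hom C X X'" "g:Hom C Y Y'"
    by (rule u_faithful[OF OO T[OF A1(2)[OF h(1)] h(2)] A(2)[OF T[OF h(1,2)]]])
    (simp only: ul(3)[OF _ T[OF h(1,2)]] u_Tmor ul1(3)[OF _ h(1)] B(4)[OF _ ui1[OF _ h(1)] ui2[OF _ h(2)]])
   show "Tmor C X X' Y Y' f (c *[HomSp C Y Y'] g) = c *[HomSp C ?O ?O'] Tmor C X X' Y Y' f g"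
    if h: "f:Hom C X X'" "g:Hom C Y Y'"
    by (rule u_faithful[OF OO T[OF h(1) A2(2)[OF h(2)]] A(2)[OF T[OF h(1,2)]]])
    (simp only: ul(3)[OF _ T[OF h(1,2)]] u_Tmor ul2(3)[OF _ h(2)] B(5)[OF _ ui1[OF _ h(1)] ui2[OF _ h(2)]])
  qed
 qed
 show ?thesis
  by (intro tensor_category.intro c1 c2 tensor_category_axioms.intro c3)
qed

end

section \<open>The two tensor categories\<close>

lemma bij_lin_inverse:
 assumes "vsp A" "vsp B" "f:lin A B" "bij_betw f (car A) (car B)"
 obtains g where "g:lin B A" "!!x. x:car A ==> g (f x) = x" "!!y. y:car B ==> f (g y) = y"
  "cmp A g f = lin_id A" "cmp B f g = lin_id B"
proof -
 define g where "g = restrict (inv_into (car A) f) (car B)"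
 have g: "g:lin B A" unfolding g_def by (rule lin_inverse[OF assms])
 have gf: "g (f x) = x" if "x:car A" for x
  using assms(4) that lin_closed[OF assms(3)] by (simp add: g_def bij_betw_def)
 have fg: "f (g y) = y" if "y:car B" for y
  using assms(4) that by (simp add: g_def bij_betw_def f_inv_into_f)
 have "cmp A g f = lin_id A" "cmp B f g = lin_id B"
  by (auto simp: compose_def lin_id_def gf fg intro!: restrict_ext)
 thus thesis using that[OF g gf fg] by blast
qed

lemma nat_transI:
 assumes "et:extensional (Fl n)"
  and "!!X. X:Fl n ==> et X:lin (FOb F X) (FOb G X)"
  and "!!X Y f x. X:Fl n ==> Y:Fl n ==> f:FL n X Y ==> x:car (FOb F X) ==>
   et Y (FMap F X Y f x) = FMap G X Y f (et X x)"
 shows "et:NT n F G"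
 unfolding nat_trans_def using assms by (auto simp: Vect_def compose_def simp del: Flag_simps(1) intro!: restrict_ext)

lemma nat_transD:
 assumes "et:NT n F G"
 shows "et:extensional (Fl n)"
  and "!!X. X:Fl n ==> et X:lin (FOb F X) (FOb G X)"
  and "!!X Y f x. X:Fl n ==> Y:Fl n ==> f:FL n X Y ==> x:car (FOb F X) ==>
   et Y (FMap F X Y f x) = FMap G X Y f (et X x)"
proof -
 show "et:extensional (Fl n)" "!!X. X:Fl n ==> et X:lin (FOb F X) (FOb G X)"
  using assms by (auto simp: nat_trans_def Vect_def simp del: Flag_simps(1))
 fix X Y f x assume "X:Fl n" "Y:Fl n" "f:FL n X Y" and x: "x:car (FOb F X)"
 hence "cmp (FOb F X) (et Y) (FMap F X Y f) = cmp (FOb F X) (FMap G X Y f) (et X)"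
  using assms by (simp add: nat_trans_def Vect_def del: Flag_simps(1))
 from fun_cong[OF this, of x] show "et Y (FMap F X Y f x) = FMap G X Y f (et X x)" using x by simp
qed

lemma category_Vect: "category Vect"
proof
 fix W X Y Z :: "'a vs" and f g h
 show "Cmp Vect X Y Y (Idn Vect Y) f = f" if "f:Hom Vect X Y"
  using that by (simp add: Vect_def compose_lin_id_left)
 show "Cmp Vect X X Y f (Idn Vect X) = f" if "f:Hom Vect X Y"
  using that by (simp add: Vect_def compose_lin_id_right)
 show "Cmp Vect W X Z (Cmp Vect X Y Z h g) f = Cmp Vect W Y Z h (Cmp Vect W X Y g f)" if "f:Hom Vect W X"
  using that by (simp add: Vect_def compose_lin_assoc)
 show "Cmp Vect X Y Z g f:Hom Vect X Z" if "X:Ob Vect" "f:Hom Vect X Y" "g:Hom Vect Y Z"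
  using that by (simp add: Vect_def lin_compose)
qed (simp add: Vect_def)

lemma cat_functor_VectI:
 assumes "!!X. X:Fl n ==> vsp (FOb F X) & fin_dim (FOb F X)"
  and "!!X Y f. X:Fl n ==> Y:Fl n ==> f:FL n X Y ==> FMap F X Y f:lin (FOb F X) (FOb F Y)"
  and "!!X. X:Fl n ==> FMap F X X (lin_id (fst X)) = lin_id (FOb F X)"
  and "!!X Y Z f g. X:Fl n ==> Y:Fl n ==> Z:Fl n ==> f:FL n X Y ==> g:FL n Y Z ==>
   FMap F X Z (cmp (fst X) g f) = cmp (FOb F X) (FMap F Y Z g) (FMap F X Y f)"
 shows "cat_functor (Flag n) Vect F"
 by (intro cat_functor.intro category_Flag category_Vect cat_functor_axioms.intro)
  (use assms in "simp_all add: Vect_def del: Flag_simps(1)")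

lemma cat_functor_VectD:
 assumes "cat_functor (Flag n) Vect F"
 shows "!!X. X:Fl n ==> vsp (FOb F X)" "!!X. X:Fl n ==> fin_dim (FOb F X)"
  and "!!X Y f. X:Fl n ==> Y:Fl n ==> f:FL n X Y ==> FMap F X Y f:lin (FOb F X) (FOb F Y)"
  and "!!X. X:Fl n ==> FMap F X X (lin_id (fst X)) = lin_id (FOb F X)"
  and "!!X Y Z f g. X:Fl n ==> Y:Fl n ==> Z:Fl n ==> f:FL n X Y ==> g:FL n Y Z ==>
   FMap F X Z (cmp (fst X) g f) = cmp (FOb F X) (FMap F Y Z g) (FMap F X Y f)"
 using cat_functor.FOb_in[OF assms] cat_functor.FMap_in[OF assms] cat_functor.FMap_Idn[OF assms] cat_functor.FMap_Cmp[OF assms]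
 by (simp_all add: Vect_def del: Flag_simps(1))

context vs_universe
begin

lemma tensor_assoc_natural:
 fixes A B C :: "'u vs"
 assumes v: "vsp A" "vsp B" "vsp C" "vsp A'" "vsp B'" "vsp C'"
  and m: "f:lin A A'" "g:lin B B'" "h:lin C C'" and x: "x:car (tensor (tensor A B) C)"
 shows "tensor_assoc A' B' C' (tensor_map (tensor A B) (tensor A' B') C C' (tensor_map A A' B B' f g) h x)
  = tensor_map A A' (tensor B C) (tensor B' C') f (tensor_map B B' C C' g h) (tensor_assoc A B C x)"
 using tensor_eq_left[OF v(1-3) tensor_vspace[OF v(4) tensor_vspace[OF v(5,6)]]
   lin_comp[OF linD[OF tensor_map_in[of "tensor A B" "tensor A' B'" C C' "tensor_map A A' B B' f g" h]] linD[OF tensor_assoc_in[OF v(4-6)]]]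
   lin_comp[OF linD[OF tensor_assoc_in[OF v(1-3)]] linD[OF tensor_map_in[of A A' "tensor B C" "tensor B' C'" f "tensor_map B B' C C' g h"]]] _ x]
 by (simp add: v m m[THEN lin_closed])

lemma tensor_lunit_natural:
 fixes A A' :: "'u vs"
 assumes v: "vsp A" "vsp A'" and m: "f:lin A A'" and x: "x:car (tensor unit_sp A)"
 shows "tensor_lunit A' (tensor_map unit_sp unit_sp A A' (lin_id unit_sp) f x) = f (tensor_lunit A x)"
 using tensor_unit_eq_left[OF v lin_comp[OF linD[OF tensor_map_in[of unit_sp unit_sp A A' "lin_id unit_sp" f]] linD[OF tensor_lunit_in[OF v(2)]]]
   lin_comp[OF linD[OF tensor_lunit_in[OF v(1)]] linD[OF m]] _ x]
 by (simp add: v m m[THEN lin_closed])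

lemma tensor_runit_natural:
 fixes A A' :: "'u vs"
 assumes v: "vsp A" "vsp A'" and m: "f:lin A A'" and x: "x:car (tensor A unit_sp)"
 shows "tensor_runit A' (tensor_map A A' unit_sp unit_sp f (lin_id unit_sp) x) = f (tensor_runit A x)"
 using tensor_unit_eq_right[OF v lin_comp[OF linD[OF tensor_map_in[of A A' unit_sp unit_sp f "lin_id unit_sp"]] linD[OF tensor_runit_in[OF v(2)]]]
   lin_comp[OF linD[OF tensor_runit_in[OF v(1)]] linD[OF m]] _ x]
 by (simp add: v m m[THEN lin_closed])

lemma tensor_swap_natural:
 fixes A B :: "'u vs"
 assumes v: "vsp A" "vsp B" "vsp A'" "vsp B'"
  and m: "f:lin A A'" "g:lin B B'" and x: "x:car (tensor A B)"
 shows "tensor_swap A' B' (tensor_map A A' B B' f g x) = tensor_map B B' A A' g f (tensor_swap A B x)"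
 using tensor_eq[OF v(1,2) tensor_vspace[OF v(4,3)]
   lin_comp[OF linD[OF tensor_map_in[of A A' B B' f g]] linD[OF tensor_swap_in[OF v(3,4)]]]
   lin_comp[OF linD[OF tensor_swap_in[OF v(1,2)]] linD[OF tensor_map_in[of B B' A A' g f]]] _ x]
 by (simp add: v m m[THEN lin_closed])

end

definition fpres :: "nat => 'u flagfun => nat => (nat => nat) => ('u flag => (nat => 'u) set) =>
  ('u flag => (nat => 'u) => 'u) => bool" where
 "fpres n F k a S p \<longleftrightarrow> (ALL X:Fl n. vs_universe.pres (fst X) k a (S X) (p X) (FOb F X)) \<and>
  (ALL X:Fl n. ALL Y:Fl n. ALL f:FL n X Y. ALL x:S X.
    tmap (fst X) (fst Y) k a f x:S Y & p Y (tmap (fst X) (fst Y) k a f x) = FMap F X Y f (p X x))"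

context vs_universe
begin

lemma polynomial_functor_iff:
 fixes F :: "'u flagfun"
 shows "pfn n F \<longleftrightarrow> cat_functor (Flag n) Vect F & (EX k a S p. fpres n F k a S p)"
 unfolding polynomial_functor_def fpres_def pres_def by (simp only: Flag_simps(2))

lemma nat_trans_space_simps [simp]:
 "car (nat_trans_space n F H) = NT n F H"
 "0[nat_trans_space n F H] = (\<lambda>X\<in>Fl n. 0[lin_space (FOb F X) (FOb H X)])"
 "et +[nat_trans_space n F H] ze = (\<lambda>X\<in>Fl n. et X +[lin_space (FOb F X) (FOb H X)] ze X)"
 "c *[nat_trans_space n F H] et = (\<lambda>X\<in>Fl n. c *[lin_space (FOb F X) (FOb H X)] et X)"
 by (simp_all add: nat_trans_space_def)

lemma nat_trans_space_vspace:
 fixes F H :: "'u flagfun"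
 assumes F: "cat_functor (Flag n) Vect F" and H: "cat_functor (Flag n) Vect H"
 shows "vsp (nat_trans_space n F H)"
proof -
 note FD = cat_functor_VectD[OF F] and HD = cat_functor_VectD[OF H]
 have v: "vsp (lin_space (FOb F X) (FOb H X))" if "X:Fl n" for X
  by (rule lin_space_vspace[OF FD(1)[OF that] HD(1)[OF that]])
 have m: "et X:car (lin_space (FOb F X) (FOb H X))" if "et:NT n F H" "X:Fl n" for et X
  using nat_transD(2)[OF that] by simp
 have e: "(\<lambda>X\<in>Fl n. et X) = et" if "et:NT n F H" for et
  using nat_transD(1)[OF that] by (simp add: extensional_restrict)
 note c = lin_closed[OF FD(3)] lin_closed[OF HD(3)]
 show ?thesis
 proof (rule vsI, goal_cases)
  case (1 et ze)
  hence a: "et:NT n F H" "ze:NT n F H" by simp_all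
  show ?case unfolding nat_trans_space_simps(1,3)
  proof (rule nat_transI)
   show "(\<lambda>X\<in>Fl n. et X +[lin_space (FOb F X) (FOb H X)] ze X) X:lin (FOb F X) (FOb H X)" if "X:Fl n" for X
    using vs_add[OF v[OF that] m[OF a(1) that] m[OF a(2) that]] that by (simp del: Flag_simps(1))
  qed (use nat_transD(3)[OF a(1)] nat_transD(3)[OF a(2)] lin_closed[OF nat_transD(2)[OF a(1)]] lin_closed[OF nat_transD(2)[OF a(2)]] c lin_add[OF HD(3)] in "simp_all del: Flag_simps(1)")
 next
  case 2
  show ?case unfolding nat_trans_space_simps(1,2)
  proof (rule nat_transI)
   show "(\<lambda>X\<in>Fl n. 0[lin_space (FOb F X) (FOb H X)]) X:lin (FOb F X) (FOb H X)" if "X:Fl n" for X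
    using vs_zero[OF v[OF that]] that by (simp del: Flag_simps(1))
  qed (use c lin_zero[OF HD(1) HD(1) HD(3)] in "simp_all del: Flag_simps(1)")
 next
  case (3 c' et)
  hence a: "et:NT n F H" by simp
  show ?case unfolding nat_trans_space_simps(1,4)
  proof (rule nat_transI)
   show "(\<lambda>X\<in>Fl n. c' *[lin_space (FOb F X) (FOb H X)] et X) X:lin (FOb F X) (FOb H X)" if "X:Fl n" for X
    using vs_smult[OF v[OF that] m[OF a that]] that by (simp del: Flag_simps(1))
  qed (use nat_transD(3)[OF a] lin_closed[OF nat_transD(2)[OF a]] c lin_smult[OF HD(3)] in "simp_all del: Flag_simps(1)")
 next
  case (4 x y z)
  thus ?case unfolding nat_trans_space_simps by (intro restrict_ext) (simp only: restrict_apply' vs_add_assoc[OF v m m m])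
 next
  case (5 x y)
  thus ?case unfolding nat_trans_space_simps by (intro restrict_ext) (simp only: restrict_apply' vs_add_commute[OF v m m])
 next
  case (6 x)
  hence "(\<lambda>X\<in>Fl n. (\<lambda>X\<in>Fl n. 0[lin_space (FOb F X) (FOb H X)]) X +[lin_space (FOb F X) (FOb H X)] x X) = (\<lambda>X\<in>Fl n. x X)"
   unfolding nat_trans_space_simps by (intro restrict_ext) (simp only: restrict_apply' vs_add_zero(1)[OF v m])
  with 6 e show ?case unfolding nat_trans_space_simps by (simp only:)
 next
  case (7 x)
  thus ?case unfolding nat_trans_space_simps by (intro restrict_ext) (simp only: restrict_apply' vs_smult_zero[OF v m])
 next
  case (8 a b x)
  thus ?case unfolding nat_trans_space_simps by (intro restrict_ext) (simp only: restrict_apply' vs_smult_ladd[OF v m])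
 next
  case (9 a x y)
  thus ?case unfolding nat_trans_space_simps by (intro restrict_ext) (simp only: restrict_apply' vs_smult_radd[OF v m m])
 next
  case (10 a b x)
  thus ?case unfolding nat_trans_space_simps by (intro restrict_ext) (simp only: restrict_apply' vs_smult_smult[OF v m])
 next
  case (11 x)
  hence "(\<lambda>X\<in>Fl n. 1 *[lin_space (FOb F X) (FOb H X)] x X) = (\<lambda>X\<in>Fl n. x X)"
   unfolding nat_trans_space_simps by (intro restrict_ext) (simp only: restrict_apply' vs_smult_one[OF v m])
  with 11 e show ?case unfolding nat_trans_space_simps by (simp only:)
 qed
qed

lemma dsum1_pres:
 fixes M :: "'u vs"
 assumes M: "vsp M"
 shows "pres M 1 (%_. 0) (car (tsum M 1 (%_. 0))) (%y. y 0) unit_sp"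
 unfolding pres_def
proof (intro conjI)
 have U: "vsp (tpow M 0)" by simp
 show "linear_on (tsum M 1 (%_. 0)<|car (tsum M 1 (%_. 0))|>) unit_sp (%y. y 0)"
  by (rule linear_onI) (auto simp: PiE_iff)
 show "(%y. y 0) ` car (tsum M 1 (%_. 0)) = car unit_sp"
 proof
  show "car unit_sp <= (%y. y 0) ` car (tsum M 1 (%_. 0))"
  proof
   fix x assume "x:car (unit_sp :: 'u vs)"
   thus "x:(%y. y 0) ` car (tsum M 1 (%_. 0))"
    by (intro image_eqI[of _ _ "\<lambda>i\<in>{..<1}. x"]) auto
  qed
 qed (auto simp: PiE_iff)
qed (rule submodule_carrier[OF tsum_vspace[OF M]])

lemma CatA_Unt: "pfn n ((|FOb = (%X. unit_sp), FMap = (%X Y f. lin_id unit_sp)|) :: 'u flagfun)" (is "pfn n ?F")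
 unfolding polynomial_functor_iff
proof (intro conjI exI)
 show "cat_functor (Flag n) Vect ?F"
  by (rule cat_functor_VectI) (auto simp: fin_dim_unit compose_lin_id_left[OF lin_id_in])
 show "fpres n ?F 1 (%_. 0) (%X. car (tsum (fst X) 1 (%_. 0))) (%X y. y 0)"
  unfolding fpres_def
 proof (intro conjI ballI)
  fix X :: "'u flag" assume X: "X:Fl n"
  hence vX: "vsp (fst X)" using is_flagD(1)[of n X] by simp
  show "pres (fst X) 1 (%_. 0) (car (tsum (fst X) 1 (%_. 0))) (%y. y 0) (FOb ?F X)"
   using dsum1_pres[OF vX] by simp
  fix Y :: "'u flag" and f x assume Y: "Y:Fl n" and f: "f:FL n X Y" and x: "x:car (tsum (fst X) 1 (%_. 0))"
  hence vY: "vsp (fst Y)" using is_flagD(1)[of n Y] by simp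
  show "tmap (fst X) (fst Y) 1 (%_. 0) f x:car (tsum (fst Y) 1 (%_. 0))"
   by (rule tsum_map_closed[OF vX vY flag_linD(1)[OF f] x])
  show "tmap (fst X) (fst Y) 1 (%_. 0) f x 0 = FMap ?F X Y f (x 0)"
   using x by (simp add: dsum_map_def)
 qed
qed

lemma CatA_Tob:
 fixes F H :: "'u flagfun"
 assumes F: "pfn n F" and H: "pfn n H"
 shows "pfn n (|FOb = (%X. tensor (FOb F X) (FOb H X)),
    FMap = (%X Y f. tensor_map (FOb F X) (FOb F Y) (FOb H X) (FOb H Y) (FMap F X Y f) (FMap H X Y f))|)" (is "pfn n ?T")
proof -
 obtain k a S p where F1: "cat_functor (Flag n) Vect F" and F2: "fpres n F k a S p"
  using F by (auto simp: polynomial_functor_iff)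
 obtain k' a' S' p' where H1: "cat_functor (Flag n) Vect H" and H2: "fpres n H k' a' S' p'"
  using H by (auto simp: polynomial_functor_iff)
 note FD = cat_functor_VectD[OF F1] and HD = cat_functor_VectD[OF H1]
 have vX: "vsp (fst X)" if "X:Fl n" for X :: "'u flag" using that is_flagD(1)[of n X] by simp
 have Fp: "pres (fst X) k a (S X) (p X) (FOb F X)" and Hp: "pres (fst X) k' a' (S' X) (p' X) (FOb H X)" if "X:Fl n" for X
  using F2 H2 that by (simp_all add: fpres_def del: Flag_simps(1))
 have "ALL X:Fl n. EX P. pres (fst X) (k * k') (tprod_exp a k' a') (tprod_span (fst X) k a (S X) k' a' (S' X)) P (tensor (FOb F X) (FOb H X)) \<and>
  linear_on (tsum (fst X) (k * k') (tprod_exp a k' a')) (tensor (FOb F X) (FOb H X)) P \<and>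
  (ALL s:S X. ALL s':S' X. P (tprod (fst X) k a k' a' s s') = pure (FOb F X) (FOb H X) (p X s) (p' X s'))"
  using pres_tensor[OF vX FD(1) HD(1) Fp Hp] by blast
 from bchoice[OF this] obtain P where P: "!!X. X:Fl n ==> pres (fst X) (k * k') (tprod_exp a k' a') (tprod_span (fst X) k a (S X) k' a' (S' X)) (P X) (tensor (FOb F X) (FOb H X))"
  "!!X. X:Fl n ==> linear_on (tsum (fst X) (k * k') (tprod_exp a k' a')) (tensor (FOb F X) (FOb H X)) (P X)"
  "!!X. X:Fl n ==> ALL s:S X. ALL s':S' X. P X (tprod (fst X) k a k' a' s s') = pure (FOb F X) (FOb H X) (p X s) (p' X s')"
  by (auto simp del: Flag_simps(1))
 have "fpres n ?T (k * k') (tprod_exp a k' a') (%X. tprod_span (fst X) k a (S X) k' a' (S' X)) P"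
  unfolding fpres_def
 proof (intro conjI ballI)
  fix X :: "'u flag" assume X: "X:Fl n"
  show "pres (fst X) (k * k') (tprod_exp a k' a') (tprod_span (fst X) k a (S X) k' a' (S' X)) (P X) (FOb ?T X)"
   using P(1)[OF X] by simp
  fix Y :: "'u flag" and f x assume Y: "Y:Fl n" and f: "f:FL n X Y" and x: "x:tprod_span (fst X) k a (S X) k' a' (S' X)"
  have c: "tmap (fst X) (fst Y) k a f s:S Y & p Y (tmap (fst X) (fst Y) k a f s) = FMap F X Y f (p X s)" if "s:S X" for s
   using F2 X Y f that by (simp add: fpres_def del: Flag_simps(1))
  have c': "tmap (fst X) (fst Y) k' a' f s:S' Y & p' Y (tmap (fst X) (fst Y) k' a' f s) = FMap H X Y f (p' X s)" if "s:S' X" for s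
   using H2 X Y f that by (simp add: fpres_def del: Flag_simps(1))
  note R = pres_tensor_natural[OF vX[OF X] vX[OF Y] flag_linD(1)[OF f] FD(1)[OF X] HD(1)[OF X] FD(1)[OF Y] HD(1)[OF Y]
   FD(3)[OF X Y f] HD(3)[OF X Y f] Fp[OF X] Hp[OF X] Fp[OF Y] Hp[OF Y] c c' P(2,3)[OF X] P(2,3)[OF Y] x]
  show "tmap (fst X) (fst Y) (k * k') (tprod_exp a k' a') f x:tprod_span (fst Y) k a (S Y) k' a' (S' Y)"
   using R by blast
  show "P Y (tmap (fst X) (fst Y) (k * k') (tprod_exp a k' a') f x) = FMap ?T X Y f (P X x)"
   using R by simp
 qed
 moreover have "cat_functor (Flag n) Vect ?T"
  by (rule cat_functor_VectI)
   (simp_all add: FD HD fin_dim_tensor tensor_map_id tensor_map_compose del: Flag_simps(1))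
 ultimately show ?thesis unfolding polynomial_functor_iff by blast
qed

lemma CatA_simps [simp]:
 "Ob (CatA n) = {F. pfn n F}" "Hom (CatA n) = NT n"
 "Idn (CatA n) F = (\<lambda>X\<in>Fl n. lin_id (FOb F X))"
 "Cmp (CatA n) F G H ze et = (\<lambda>X\<in>Fl n. cmp (FOb F X) (ze X) (et X))"
 "HomSp (CatA n) = nat_trans_space n"
 "Unt (CatA n) = (|FOb = (%X. unit_sp), FMap = (%X Y f. lin_id unit_sp)|)"
 "Tob (CatA n) F G = (|FOb = (%X. tensor (FOb F X) (FOb G X)),
    FMap = (%X Y f. tensor_map (FOb F X) (FOb F Y) (FOb G X) (FOb G Y) (FMap F X Y f) (FMap G X Y f))|)"
 "Tmor (CatA n) F F' G G' et ze = (\<lambda>X\<in>Fl n. tensor_map (FOb F X) (FOb F' X) (FOb G X) (FOb G' X) (et X) (ze X))"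
 "Asc (CatA n) F G H = (\<lambda>X\<in>Fl n. tensor_assoc (FOb F X) (FOb G X) (FOb H X))"
 "Lun (CatA n) F = (\<lambda>X\<in>Fl n. tensor_lunit (FOb F X))"
 "Run (CatA n) F = (\<lambda>X\<in>Fl n. tensor_runit (FOb F X))"
 "Swp (CatA n) F G = (\<lambda>X\<in>Fl n. tensor_swap (FOb F X) (FOb G X))"
 for F G H F' G' :: "'u flagfun"
 by (simp_all add: CatA_def)

lemma polyfunD:
 fixes F :: "'u flagfun"
 assumes "pfn n F"
 shows "!!X. X:Fl n ==> vsp (FOb F X)" "!!X. X:Fl n ==> fin_dim (FOb F X)"
  and "!!X Y f. X:Fl n ==> Y:Fl n ==> f:FL n X Y ==> FMap F X Y f:lin (FOb F X) (FOb F Y)"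
  and "!!X. X:Fl n ==> FMap F X X (lin_id (fst X)) = lin_id (FOb F X)"
  and "!!X Y Z f g. X:Fl n ==> Y:Fl n ==> Z:Fl n ==> f:FL n X Y ==> g:FL n Y Z ==>
   FMap F X Z (cmp (fst X) g f) = cmp (FOb F X) (FMap F Y Z g) (FMap F X Y f)"
 using cat_functor_VectD[of n F] assms by (simp_all add: polynomial_functor_iff)

text \<open>Evaluation at the flags is a faithful family of fibre functors.\<close>

lemma fibred_CatA: "fibred_tensor L l (CatA n) (Fl n) (%X F. FOb F X) (%X et. et X)"
proof (rule fibred_tensor.intro[OF vs_universe_axioms], rule fibred_tensor_axioms.intro; (simp only: CatA_simps mem_Collect_eq restrict_apply')?)
 fix X Y Z :: "'u flag" and A B C A' B' :: "'u flagfun" and et ze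
 note fl = Flag_simps(1)
 note D = polyfunD
 have cv: "vsp (FOb P X)" if "pfn n P" "X:Fl n" for P :: "'u flagfun" and X using polyfunD(1)[OF that] .
 note ND = nat_transD
 have ml: "FMap P X Y f:lin (FOb P X) (FOb P Y)"
  if "pfn n P" "X:Fl n" "Y:Fl n" "f:FL n X Y" for P :: "'u flagfun" and X Y f
  using polyfunD(3)[OF that] .
 show "vsp (FOb A X)" if "X:Fl n" "pfn n A" using cv that by simp
 show "et X:lin (FOb A X) (FOb B X)" if "X:Fl n" "et:NT n A B" using ND(2)[OF that(2,1)] .
 show "et = ze" if "et:NT n A B" "ze:NT n A B" "!!X. X:Fl n ==> et X = ze X"
  using extensionalityI[OF ND(1)[OF that(1)] ND(1)[OF that(2)] that(3)] .
 show "(\<lambda>X\<in>Fl n. lin_id (FOb A X)):NT n A A" if "pfn n A"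
  by (rule nat_transI) (use that cv ml[THEN lin_closed] in "simp_all del: fl")
 show "(\<lambda>X\<in>Fl n. cmp (FOb A X) (ze X) (et X)):NT n A C"
  if "pfn n A" "pfn n B" "pfn n C" "et:NT n A B" "ze:NT n B C"
 proof (rule nat_transI)
  show "(\<lambda>X\<in>Fl n. cmp (FOb A X) (ze X) (et X)) X:lin (FOb A X) (FOb C X)" if X: "X:Fl n" for X
   using lin_compose[OF cv[OF \<open>pfn n A\<close> X] ND(2)[OF \<open>et:NT n A B\<close> X] ND(2)[OF \<open>ze:NT n B C\<close> X]] X by (simp del: fl)
 qed (use that ml[THEN lin_closed, OF that(1)] ND(3)[OF that(4)] ND(3)[OF that(5)] lin_closed[OF ND(2)[OF that(4)]] in "simp_all del: fl")
 show "pfn n ((|FOb = (%X. unit_sp), FMap = (%X Y f. lin_id unit_sp)|) :: 'u flagfun)" by (rule CatA_Unt)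
 show "pfn n (|FOb = (%X. tensor (FOb A X) (FOb B X)),
    FMap = (%X Y f. tensor_map (FOb A X) (FOb A Y) (FOb B X) (FOb B Y) (FMap A X Y f) (FMap B X Y f))|)"
  if "pfn n A" "pfn n B" using CatA_Tob that by simp
 let ?T = "%A B :: 'u flagfun. (|FOb = (%X. tensor (FOb A X) (FOb B X)),
    FMap = (%X Y f. tensor_map (FOb A X) (FOb A Y) (FOb B X) (FOb B Y) (FMap A X Y f) (FMap B X Y f))|) :: 'u flagfun"
 let ?I = "(|FOb = (%X. unit_sp), FMap = (%X Y f. lin_id unit_sp)|) :: 'u flagfun"
 show "(\<lambda>X\<in>Fl n. tensor_map (FOb A X) (FOb A' X) (FOb B X) (FOb B' X) (et X) (ze X)):NT n (?T A B) (?T A' B')"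
  if p: "pfn n A" "pfn n A'" "pfn n B" "pfn n B'"
   and h: "et:NT n A A'" "ze:NT n B B'"
 proof (rule nat_transI)
  fix X Y f x assume O: "X:Fl n" "Y:Fl n" and f: "f:FL n X Y" and x: "x:car (FOb (?T A B) X)"
  note v = cv[OF p(1)] cv[OF p(2)] cv[OF p(3)] cv[OF p(4)]
  note mm = ml[OF p(1) O f] ml[OF p(2) O f] ml[OF p(3) O f] ml[OF p(4) O f]
  have c1: "cmp (FOb A X) (et Y) (FMap A X Y f) = cmp (FOb A X) (FMap A' X Y f) (et X)"
   using ND(3)[OF h(1) O f] by (auto simp: compose_def intro!: restrict_ext)
  have c2: "cmp (FOb B X) (ze Y) (FMap B X Y f) = cmp (FOb B X) (FMap B' X Y f) (ze X)"
   using ND(3)[OF h(2) O f] by (auto simp: compose_def intro!: restrict_ext)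
  show "(\<lambda>X\<in>Fl n. tensor_map (FOb A X) (FOb A' X) (FOb B X) (FOb B' X) (et X) (ze X)) Y (FMap (?T A B) X Y f x) =
   FMap (?T A' B') X Y f ((\<lambda>X\<in>Fl n. tensor_map (FOb A X) (FOb A' X) (FOb B X) (FOb B' X) (et X) (ze X)) X x)"
   using O x tensor_map_compose_apply[OF v(1)[OF O(1)] v(1)[OF O(2)] v(2)[OF O(2)] v(3)[OF O(1)] v(3)[OF O(2)] v(4)[OF O(2)] mm(1) ND(2)[OF h(1) O(2)] mm(3) ND(2)[OF h(2) O(2)]]
    tensor_map_compose_apply[OF v(1)[OF O(1)] v(2)[OF O(1)] v(2)[OF O(2)] v(3)[OF O(1)] v(4)[OF O(1)] v(4)[OF O(2)] ND(2)[OF h(1) O(1)] mm(2) ND(2)[OF h(2) O(1)] mm(4)]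
   by (simp add: c1 c2 del: fl)
 qed (use cv p ND(2)[OF h(1)] ND(2)[OF h(2)] in "simp_all del: fl")
 show "(\<lambda>X\<in>Fl n. tensor_assoc (FOb A X) (FOb B X) (FOb C X)):NT n (?T (?T A B) C) (?T A (?T B C))"
  if "pfn n A" "pfn n B" "pfn n C"
  by (rule nat_transI) (simp_all add: that cv ml tensor_assoc_natural del: fl)
 show "(\<lambda>X\<in>Fl n. tensor_lunit (FOb A X)):NT n (?T ?I A) A"
  if "pfn n A"
  by (rule nat_transI) (simp_all add: that cv ml tensor_lunit_natural del: fl)
 show "(\<lambda>X\<in>Fl n. tensor_runit (FOb A X)):NT n (?T A ?I) A"
  if "pfn n A"
  by (rule nat_transI) (simp_all add: that cv ml tensor_runit_natural del: fl)
 show "(\<lambda>X\<in>Fl n. tensor_swap (FOb A X) (FOb B X)):NT n (?T A B) (?T B A)"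
  if "pfn n A" "pfn n B"
  by (rule nat_transI) (simp_all add: that cv ml tensor_swap_natural del: fl)
 show "is_iso (CatA n) A B et"
  if p: "pfn n A" "pfn n B" and h: "et:NT n A B"
   and b: "!!X. X:Fl n ==> bij_betw (et X) (car (FOb A X)) (car (FOb B X))"
 proof -
  define ze where "ze = (\<lambda>X\<in>Fl n. SOME g. g:lin (FOb B X) (FOb A X) & (ALL x:car (FOb A X). g (et X x) = x) & (ALL y:car (FOb B X). et X (g y) = y))"
  have ze: "ze X:lin (FOb B X) (FOb A X) & (ALL x:car (FOb A X). ze X (et X x) = x) & (ALL y:car (FOb B X). et X (ze X y) = y)"
   if X: "X:Fl n" for X
  proof -
   obtain g where "g:lin (FOb B X) (FOb A X)" "!!x. x:car (FOb A X) ==> g (et X x) = x" "!!y. y:car (FOb B X) ==> et X (g y) = y"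
    using bij_lin_inverse[OF cv[OF p(1) X] cv[OF p(2) X] ND(2)[OF h X] b[OF X]] by blast
   hence "EX g. g:lin (FOb B X) (FOb A X) & (ALL x:car (FOb A X). g (et X x) = x) & (ALL y:car (FOb B X). et X (g y) = y)" by blast
   from someI_ex[OF this] show ?thesis using X by (simp add: ze_def del: fl)
  qed
  have t: "ze:NT n B A"
  proof (rule nat_transI)
   show "ze:extensional (Fl n)" by (simp add: ze_def del: fl)
   show "ze X:lin (FOb B X) (FOb A X)" if "X:Fl n" for X using ze[OF that] by blast
   fix X Y f y assume O: "X:Fl n" "Y:Fl n" and f: "f:FL n X Y" and y: "y:car (FOb B X)"
   have ty: "ze X y:car (FOb A X)" using lin_closed[OF conjunct1[OF ze[OF O(1)]] y] .
   have "FMap B X Y f y = et Y (FMap A X Y f (ze X y))"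
    using ND(3)[OF h O f ty] ze[OF O(1)] y by simp
   thus "ze Y (FMap B X Y f y) = FMap A X Y f (ze X y)"
    using ze[OF O(2)] lin_closed[OF ml[OF p(1) O f] ty] by simp
  qed
  have "is_inverse (CatA n) A B et ze"
   unfolding is_inverse_def CatA_simps using h t ze
   by (auto simp: compose_def lin_id_def simp del: fl intro!: restrict_ext)
  thus ?thesis unfolding is_iso_def by blast
 qed
 show "vsp (nat_trans_space n A B)" if "pfn n A" "pfn n B"
  by (rule nat_trans_space_vspace) (use that in "simp_all add: polynomial_functor_iff")
 show "linear_on (nat_trans_space n A B) (lin_space (FOb A X) (FOb B X)) (%et. et X)"
  if X: "X:Fl n"
  by (rule linear_onI) (use X ND(2)[OF _ X] in "simp_all del: fl")
qed simp_all

end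

section \<open>The tensor category of polynomial representations\<close>

lemma equivariantI:
 assumes "ze:lin (fst R) (fst Q)"
  and "!!g m. g:car K ==> m:car (fst R) ==> ze (snd R g m) = snd Q g (ze m)"
 shows "ze:equivariant K R Q"
 using assms by (simp add: equivariant_def)

lemma equivariantD:
 assumes "ze:equivariant K R Q"
 shows "ze:lin (fst R) (fst Q)"
  and "!!g m. g:car K ==> m:car (fst R) ==> ze (snd R g m) = snd Q g (ze m)"
 using assms by (simp_all add: equivariant_def)

context flagged_space
begin

abbreviation RG where "RG == RepG n V e"
abbreviation PH where "PH == Phi n V e"
abbreviation Pm where "Pm == Phi_map n V e"
abbreviation Pa where "Pa == Phi_act n V e"
abbreviation PS where "PS == Psi n V e"

abbreviation rtensor :: "'u rep => 'u rep => 'u rep" where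
 "rtensor R Q == (tensor (fst R) (fst Q), %g. tensor_map (fst R) (fst R) (fst Q) (fst Q) (snd R g) (snd Q g))"

abbreviation runit :: "'u rep" where
 "runit == (unit_sp, %g. lin_id unit_sp)"

lemma RepG_simps [simp]:
 "Ob RG = {R. poly R}" "Hom RG = eqv"
 "Idn RG R = lin_id (fst R)"
 "Cmp RG R R' R'' ze et = cmp (fst R) ze et"
 "HomSp RG R R' = (lin_space (fst R) (fst R'))<|eqv R R'|>"
 "Unt RG = runit"
 "Tob RG R Q = rtensor R Q"
 "Tmor RG R R' Q Q' et ze = tensor_map (fst R) (fst R') (fst Q) (fst Q') et ze"
 "Asc RG R Q P = tensor_assoc (fst R) (fst Q) (fst P)"
 "Lun RG R = tensor_lunit (fst R)"
 "Run RG R = tensor_runit (fst R)"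
 "Swp RG R Q = tensor_swap (fst R) (fst Q)"
 by (simp_all add: RepG_def)

lemma rep_id: "poly R ==> snd R \<one>\<^bsub>G\<^esub> = lin_id (fst R)"
 and rep_mult: "poly R ==> g:car G ==> h:car G ==>
  snd R (g \<otimes>\<^bsub>G\<^esub> h) = cmp (fst R) (snd R g) (snd R h)"
 by (simp_all add: polynomial_rep_def is_rep_def)

lemma G_lin: "g:car G ==> g:lin V V"
 by (rule EndV_lin[OF GG_EndV])

lemma
 shows poly_unit: "poly runit"
  and act_unit: "f:FL n big big ==> x:car unit_sp ==> act runit f x = x"
proof -
 let ?S = "car (tsum V 1 (%_. 0))"
 have P: "presentation n V e runit 1 (%_. 0) ?S (%y. y 0)"
  unfolding presentation_pres
 proof (intro conjI ballI)
  show "pres V 1 (%_. 0) ?S (%y. y 0) (fst runit)" using dsum1_pres[OF V_vs] by simp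
  fix g y assume g: "g:car G" and y: "y:?S"
  show "tmap V V 1 (%_. 0) g y:?S" by (rule tsum_map_closed[OF V_vs V_vs G_lin[OF g] y])
  show "tmap V V 1 (%_. 0) g y 0 = snd runit g (y 0)" by (simp add: dsum_map_def)
 qed
 have "is_rep G runit" by (simp add: is_rep_def compose_lin_id_left[OF lin_id_in])
 thus "poly runit" using P unfolding polynomial_rep_def by blast
 assume f: "f:FL n big big" and x: "x:car (unit_sp :: 'u vs)"
 define y where "y = (\<lambda>i\<in>{..<1::nat}. x)"
 have y: "y:?S" "y 0 = x" using x by (auto simp: y_def)
 show "act runit f x = x"
  using act_eq[OF P y(1) f] y x by (simp add: dsum_map_def)
qed

lemma
 assumes R: "poly R" and Q: "poly Q"
 shows poly_tensor: "poly (rtensor R Q)"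
  and act_tensor: "f:FL n big big ==> r:car (fst R) ==> q:car (fst Q) ==>
   act (rtensor R Q) f (pure (fst R) (fst Q) r q) = pure (fst R) (fst Q) (act R f r) (act Q f q)"
proof -
 note vR = polyD(1)[OF R] and vQ = polyD(1)[OF Q]
 obtain k a S p where P: "presentation n V e R k a S p" and pr: "pres V k a S p (fst R)" using polyE[OF R] .
 obtain k' a' S' p' where P': "presentation n V e Q k' a' S' p'" and pr': "pres V k' a' S' p' (fst Q)" using polyE[OF Q] .
 let ?k = "k * k'" and ?a = "tprod_exp a k' a'" and ?S = "tprod_span V k a S k' a' S'"
 obtain T where T: "pres V ?k ?a ?S T (tensor (fst R) (fst Q))" "linear_on (tsum V ?k ?a) (tensor (fst R) (fst Q)) T"
   "ALL s:S. ALL s':S'. T (tprod V k a k' a' s s') = pure (fst R) (fst Q) (p s) (p' s')"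
  using pres_tensor[OF V_vs vR vQ pr pr'] by blast
 have nat: "tmap V V ?k ?a f y:?S & T (tmap V V ?k ?a f y) =
   tensor_map (fst R) (fst R) (fst Q) (fst Q) ph ph' (T y)"
  if "f:lin V V" "ph:lin (fst R) (fst R)" "ph':lin (fst Q) (fst Q)" "y:?S"
   "!!s. s:S ==> tmap V V k a f s:S & p (tmap V V k a f s) = ph (p s)"
   "!!s. s:S' ==> tmap V V k' a' f s:S' & p' (tmap V V k' a' f s) = ph' (p' s)"
  for f ph ph' y
  by (rule pres_tensor_natural[OF V_vs V_vs that(1) vR vQ vR vQ that(2,3) pr pr' pr pr' that(5,6) T(2,3) T(2,3) that(4)])
 have TP: "presentation n V e (rtensor R Q) ?k ?a ?S T"
  unfolding presentation_pres
 proof (intro conjI ballI)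
  show "pres V ?k ?a ?S T (fst (rtensor R Q))" using T(1) by simp
  fix g y assume g: "g:car G" and y: "y:?S"
  have "!!s. s:S ==> tmap V V k a g s:S & p (tmap V V k a g s) = snd R g (p s)"
   "!!s. s:S' ==> tmap V V k' a' g s:S' & p' (tmap V V k' a' g s) = snd Q g (p' s)"
   using P P' g by (simp_all add: presentation_pres)
  note N = nat[OF G_lin[OF g] polyD(2)[OF R g] polyD(2)[OF Q g] y this]
  show "tmap V V ?k ?a g y:?S" using N by blast
  show "T (tmap V V ?k ?a g y) = snd (rtensor R Q) g (T y)" using N by simp
 qed
 have "is_rep G (rtensor R Q)"
  unfolding is_rep_def
  by (simp add: vR vQ polyD(2)[OF R] polyD(2)[OF Q] rep_mult[OF R] rep_mult[OF Q] tensor_map_compose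
   rep_id[OF R] rep_id[OF Q] tensor_map_id)
 thus p: "poly (rtensor R Q)" using TP unfolding polynomial_rep_def by blast
 assume f: "f:FL n big big" and r: "r:car (fst R)" and q: "q:car (fst Q)"
 define ph ph' where "ph = restrict (act R f) (car (fst R))" and "ph' = restrict (act Q f) (car (fst Q))"
 have l: "ph:lin (fst R) (fst R)" "ph':lin (fst Q) (fst Q)"
  unfolding ph_def ph'_def by (rule linI[OF vR act_in[OF R f]], rule linI[OF vQ act_in[OF Q f]])
 obtain y where y: "y:?S" "T y = pure (fst R) (fst Q) r q"
  using presD(3)[OF T(1) V_vs] pure_in[OF vR vQ r q] by (metis imageE)
 have c1: "tmap V V k a f s:S & p (tmap V V k a f s) = ph (p s)" if "s:S" for s
  using pres_curve(1)[OF P that f] act_eq[OF P that f] presD(5)[OF pr V_vs that] by (simp add: ph_def)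
 have c2: "tmap V V k' a' f s:S' & p' (tmap V V k' a' f s) = ph' (p' s)" if "s:S'" for s
  using pres_curve(1)[OF P' that f] act_eq[OF P' that f] presD(5)[OF pr' V_vs that] by (simp add: ph'_def)
 have "act (rtensor R Q) f (T y) = tensor_map (fst R) (fst R) (fst Q) (fst Q) ph ph' (T y)"
  using act_eq[OF TP y(1) f] nat[OF EndV_lin[OF f] l y(1) c1 c2] by simp
 thus "act (rtensor R Q) f (pure (fst R) (fst Q) r q) = pure (fst R) (fst Q) (act R f r) (act Q f q)"
  using tensor_map_pure[OF vR vR vQ vQ l r q] r q by (simp add: y(2) ph_def ph'_def)
qed

lemma HomSp_submodule:
 assumes R: "poly R" and Q: "poly Q"
 shows "submodule (eqv R Q) CC (lin_space (fst R) (fst Q))"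
proof (rule submoduleI[OF lin_space_vspace[OF polyD(1)[OF R] polyD(1)[OF Q]]])
 note c = lin_space_closed[OF polyD(1)[OF R] polyD(1)[OF Q]]
 note D = polyD[OF R] polyD[OF Q]
 have cl: "snd R g m:car (fst R)" if "g:car G" "m:car (fst R)" for g m
  using lin_closed[OF D(2)] that by blast
 show "eqv R Q <= car (lin_space (fst R) (fst Q))" by (auto simp: equivariant_def)
 show "0[lin_space (fst R) (fst Q)]:eqv R Q"
  by (rule equivariantI) (simp_all add: c cl lin_zero[OF D(3,3,4)])
 show "x +[lin_space (fst R) (fst Q)] y:eqv R Q" if "x:eqv R Q" "y:eqv R Q" for x y
  by (rule equivariantI)
   (use equivariantD[OF that(1)] equivariantD[OF that(2)] lin_closed[OF equivariantD(1)[OF that(1)]] lin_closed[OF equivariantD(1)[OF that(2)]] in "simp_all add: c cl lin_add[OF D(4)]")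
 show "t *[lin_space (fst R) (fst Q)] x:eqv R Q" if "x:eqv R Q" for t x
  by (rule equivariantI)
   (use equivariantD[OF that] lin_closed[OF equivariantD(1)[OF that]] in "simp_all add: c cl lin_smult[OF D(4)]")
qed

text \<open>The forgetful functor is faithful and preserves all the structure.\<close>

lemma fibred_RepG: "fibred_tensor V (e 1 1) RG (UNIV :: unit set) (%_ R. fst R) (%_ ze. ze)"
proof (rule fibred_tensor.intro[OF vs_universe_axioms], rule fibred_tensor_axioms.intro; (simp only: RepG_simps mem_Collect_eq)?)
 fix R Q P R' Q' :: "'u rep" and et ze :: "'u => 'u"
 note D = polyD
 note E = equivariantD
 have cl: "snd R g m:car (fst R)" if "poly R" "g:car G" "m:car (fst R)" for R g m
  using lin_closed[OF D(2)[OF that(1,2)] that(3)] .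
 have cm: "cmp (fst R) ze (snd R g) = cmp (fst R) (snd Q g) ze"
  if "ze:eqv R Q" "g:car G" for R Q :: "'u rep" and ze g
  unfolding compose_def by (rule restrict_ext) (rule E(2)[OF that])
 show "vsp (fst R)" if "poly R" using D(1)[OF that] .
 show "ze:lin (fst R) (fst Q)" if "ze:eqv R Q" using E(1)[OF that] .
 show "lin_id (fst R):eqv R R" if "poly R"
  by (rule equivariantI) (use D[OF that] cl[OF that] in simp_all)
 show "cmp (fst R) ze et:eqv R P" if "poly R" "et:eqv R Q" "ze:eqv Q P"
  by (rule equivariantI) (use lin_compose[OF D(1)[OF that(1)] E(1)[OF that(2)] E(1)[OF that(3)]]
   cl[OF that(1)] E(2)[OF that(2)] E(2)[OF that(3)] lin_closed[OF E(1)[OF that(2)]] in simp_all)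
 show "poly runit" by (rule poly_unit)
 show "poly (rtensor R Q)" if "poly R" "poly Q" by (rule poly_tensor[OF that])
 show "tensor_map (fst R) (fst R') (fst Q) (fst Q') et ze:eqv (rtensor R Q) (rtensor R' Q')"
  if p: "poly R" "poly R'" "poly Q" "poly Q'" and h: "et:eqv R R'" "ze:eqv Q Q'"
 proof (rule equivariantI)
  note v = D(1)[OF p(1)] D(1)[OF p(2)] D(1)[OF p(3)] D(1)[OF p(4)] and m = E(1)[OF h(1)] E(1)[OF h(2)]
  show "tensor_map (fst R) (fst R') (fst Q) (fst Q') et ze:lin (fst (rtensor R Q)) (fst (rtensor R' Q'))"
   using v m by simp
  fix g x assume g: "g:car G" and x: "x:car (fst (rtensor R Q))"
  note s = D(2)[OF p(1) g] D(2)[OF p(2) g] D(2)[OF p(3) g] D(2)[OF p(4) g]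
  show "tensor_map (fst R) (fst R') (fst Q) (fst Q') et ze (snd (rtensor R Q) g x)
   = snd (rtensor R' Q') g (tensor_map (fst R) (fst R') (fst Q) (fst Q') et ze x)"
   using x tensor_map_compose_apply[OF v(1,1,2,3,3,4) s(1) m(1) s(3) m(2)] tensor_map_compose_apply[OF v(1,2,2,3,4,4) m(1) s(2) m(2) s(4)]
    cm[OF h(1) g] cm[OF h(2) g] by simp
 qed
 show "tensor_assoc (fst R) (fst Q) (fst P):eqv (rtensor (rtensor R Q) P) (rtensor R (rtensor Q P))"
  if p: "poly R" "poly Q" "poly P"
  by (rule equivariantI) (use D(1)[OF p(1)] D(1)[OF p(2)] D(1)[OF p(3)] D(2)[OF p(1)] D(2)[OF p(2)] D(2)[OF p(3)] in "simp_all add: tensor_assoc_natural")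
 show "tensor_lunit (fst R):eqv (rtensor runit R) R" if p: "poly R"
  by (rule equivariantI) (use D[OF p] in "simp_all add: tensor_lunit_natural")
 show "tensor_runit (fst R):eqv (rtensor R runit) R" if p: "poly R"
  by (rule equivariantI) (use D[OF p] in "simp_all add: tensor_runit_natural")
 show "tensor_swap (fst R) (fst Q):eqv (rtensor R Q) (rtensor Q R)" if p: "poly R" "poly Q"
  by (rule equivariantI) (use D[OF p(1)] D[OF p(2)] in "simp_all add: tensor_swap_natural")
 show "is_iso RG R Q ze"
  if p: "poly R" "poly Q" and h: "ze:eqv R Q"
   and b: "!!i :: unit. i:UNIV ==> bij_betw ze (car (fst R)) (car (fst Q))"
 proof -
  obtain g where g: "g:lin (fst Q) (fst R)" "!!x. x:car (fst R) ==> g (ze x) = x" "!!y. y:car (fst Q) ==> ze (g y) = y"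
   "cmp (fst R) g ze = lin_id (fst R)" "cmp (fst Q) ze g = lin_id (fst Q)"
   using bij_lin_inverse[OF D(1)[OF p(1)] D(1)[OF p(2)] E(1)[OF h] b[OF UNIV_I]] by blast
  have "g:eqv Q R"
  proof (rule equivariantI[OF g(1)])
   fix s m assume s: "s:car G" and m: "m:car (fst Q)"
   have "snd Q s m = ze (snd R s (g m))"
    using E(2)[OF h s lin_closed[OF g(1) m]] g(3)[OF m] by simp
   thus "g (snd Q s m) = snd R s (g m)"
    using g(2)[OF cl[OF p(1) s lin_closed[OF g(1) m]]] by simp
  qed
  thus ?thesis using h g(4,5) unfolding is_iso_def is_inverse_def RepG_simps by blast
 qed
 show "vsp (lin_space (fst R) (fst Q)<|eqv R Q|>)" if p: "poly R" "poly Q"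
  by (rule submodule_vspace[OF lin_space_vspace[OF D(1)[OF p(1)] D(1)[OF p(2)]] HomSp_submodule[OF p]])
 show "linear_on (lin_space (fst R) (fst Q)<|eqv R Q|>) (lin_space (fst R) (fst Q)) (%ze. ze)" if p: "poly R" "poly Q"
  by (rule linear_on_sub[OF lin_space_vspace[OF D(1)[OF p(1)] D(1)[OF p(2)]] HomSp_submodule[OF p] linear_on_ident])
qed simp_all

lemma tensor_category_RepG: "tensor_category RG"
 by (rule fibred_tensor.is_tensor_category[OF fibred_RepG])

lemma tensor_category_CatA: "tensor_category (CatA n :: ('u flagfun, 'u flag => 'u => 'u) tensor_cat)"
 by (rule fibred_tensor.is_tensor_category[OF fibred_CatA])

end

section \<open>From functors to representations\<close>

context flagged_space
begin

abbreviation pf :: "'u flagfun => bool" where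
 "pf F == pfn n F"

definition dg :: "nat => 'u flag" where
 "dg j = diag_flag n V e j"

lemma dg_std: "dg j = std (cst j)"
 by (simp add: dg_def diag_flag_eq)

lemma dg_Ob [simp]: "dg j:Fl n"
 by (simp add: dg_std del: Flag_simps(1))

lemma is_flag_dg: "is_flag n (dg j)"
 by (simp add: dg_std is_flag_std)

abbreviation PF :: "'u flagfun => 'u vs" where
 "PF F == fst (Phi_colim n V e F)"

abbreviation lF :: "'u flagfun => nat => 'u => 'u" where
 "lF F j == snd (Phi_colim n V e F) j"

lemma fst_dg: "fst (dg j) = V<|sub (ixd j)|>"
 by (simp add: dg_std std_flag_eq ixd_def)

lemma carrier_dg [simp]: "car (fst (dg j)) = sub (ixd j)"
 by (simp add: fst_dg)

lemma flag_std_iff: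
 assumes X: "is_flag n X"
 shows "f:FL n X (std a) \<longleftrightarrow> f:FL n X big & (ALL x:car (fst X). f x:sub (ixa a))"
proof
 assume f: "f:FL n X (std a)"
 note l = flag_linD(1)[OF f, unfolded std_flag_eq(1)]
 have "f:FL n X big"
 proof (rule flag_linI)
  show "f:lin (fst X) (fst big)" unfolding big_flag_eq(1) by (rule lin_cowiden[OF l]) (auto simp: sub_in)
  show "f x:snd big i" if "i <= n" "x:snd X i" for i x
   using flag_linD(2)[OF f that] that(1) sub_mono[of "ixa a Int lev i" "lev i"] by (auto simp: big_flag_eq std_flag_eq)
 qed
 thus "f:FL n X big & (ALL x:car (fst X). f x:sub (ixa a))"
  using lin_closed[OF l] by simp
next
 assume f: "f:FL n X big & (ALL x:car (fst X). f x:sub (ixa a))"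
 show "f:FL n X (std a)"
 proof (rule flag_linI)
  show "f:lin (fst X) (fst (std a))" unfolding std_flag_eq(1)
   by (rule lin_corestrict) (use f flag_linD(1)[of f n X big] in "auto simp: big_flag_eq")
  show "f x:snd (std a) i" if "i <= n" "x:snd X i" for i x
   using flag_linD(2)[of f n X big, OF _ that] f is_flagD(5)[OF X that] that(1) by (auto simp: big_flag_eq std_flag_eq sub_def)
 qed
qed

lemma ObD: "X:Fl n ==> is_flag n X" "X:Fl n ==> vsp (fst X)"
 by (simp_all add: is_flagD(1)[of n X])

lemma flag_dg_iff: "is_flag n X ==> f:FL n X (dg j) \<longleftrightarrow> f:FL n X big & (ALL x:car (fst X). f x:sub (ixd j))"
 unfolding dg_std ixd_def by (rule flag_std_iff)

lemma flag_dg_exists: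
 assumes X: "X:Fl n" and f: "f:FL n X big"
 shows "EX j. f:FL n X (dg j)"
proof -
 obtain S where S: "finite S" "S <= car (fst X)" "lspan (fst X) S = car (fst X)"
  using X by (auto simp: fin_dim_def)
 have fl: "f:lin (fst X) V" using flag_linD(1)[OF f] by (simp add: big_flag_eq)
 have "finite (\<Union>s\<in>S. supp (f s))" "(\<Union>s\<in>S. supp (f s)) <= ix"
  using S(1,2) lin_closed[OF fl] finite_supp supp_ix by (blast, blast)
 then obtain j where j: "(\<Union>s\<in>S. supp (f s)) <= ixd j" using finite_sub_ixd by blast
 have "lspan (fst X) S <= {x:car (fst X). f x:sub (ixd j)}"
  by (rule lspan_least[OF submodule_preimage[OF ObD(2)[OF X] V_vs linD[OF fl] submodule_sub]])
   (use S(2) j lin_closed[OF fl] in "auto simp: sub_def")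
 hence "f:FL n X (dg j)"
  using flag_dg_iff[OF ObD(1)[OF X]] f S(3) by auto
 thus ?thesis ..
qed

lemma flag_dg_mono: "X:Fl n ==> f:FL n X (dg i) ==> i <= j ==> f:FL n X (dg j)"
 using flag_dg_iff[OF ObD(1), of X f] sub_mono[OF ixd_mono[of i j]] by (auto simp del: Flag_simps(1))

lemma incl_flag: "i <= j ==> lin_id (fst (dg i)):FL n (dg i) (dg j)"
 by (rule flag_dg_mono[OF dg_Ob flag_lin_id[OF is_flag_dg]])

lemma restrict_flag:
 assumes g: "g:FL n big X"
 shows "restrict g (sub (ixa a)):FL n (std a) X"
proof (rule flag_linI)
 show "restrict g (sub (ixa a)):lin (fst (std a)) (fst X)"
  unfolding std_flag_eq(1) by (rule lin_restrict_sub[OF V_vs submodule_sub]) (use flag_linD(1)[OF g] in "simp add: big_flag_eq")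
 show "restrict g (sub (ixa a)) x:snd X i" if "i <= n" "x:snd (std a) i" for i x
  using that flag_linD(2)[OF g that(1), of x] by (auto simp: big_flag_eq std_flag_eq sub_def)
qed

lemma restrict_flag_dg: "g:FL n big X ==> restrict g (sub (ixd j)):FL n (dg j) X"
 unfolding dg_std ixd_def by (rule restrict_flag)

lemma restrict_incl: "i <= j ==> compose (sub (ixd i)) (restrict g (sub (ixd j))) (lin_id (fst (dg i))) = restrict g (sub (ixd i))"
 using sub_mono[OF ixd_mono[of i j]] lin_id_apply[of _ "fst (dg i)"] by (auto simp: compose_def intro!: restrict_ext)

subsection \<open>The colimit\<close>

lemma Phi_is_colim:
 assumes F: "pf F"
 shows "is_colim (%j. FOb F (dg j)) (%j. FMap F (dg j) (dg (Suc j)) (lin_id (fst (dg j)))) (PF F) (%j. lF F j)"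
 using is_colim_choice[of "%j. FOb F (dg j)" "%j. FMap F (dg j) (dg (Suc j)) (lin_id (fst (dg j)))"]
  polyfunD(1)[OF F dg_Ob] polyfunD(3)[OF F dg_Ob dg_Ob incl_flag[of _ "Suc _"]]
 by (simp add: Phi_colim_def dg_def[symmetric])

lemma PF_vs [simp]: "pf F ==> vsp (PF F)"
 and lF_in: "pf F ==> lF F j:lin (FOb F (dg j)) (PF F)"
 using is_colimD(1,2)[OF Phi_is_colim] by blast+

lemma lF_closed: "pf F ==> x:car (FOb F (dg j)) ==> lF F j x:car (PF F)"
 by (rule lin_closed[OF lF_in])

lemma PF_elem:
 assumes "pf F" "z:car (PF F)"
 obtains j x where "j0 <= j" "x:car (FOb F (dg j))" "z = lF F j x"
 using colim_elem[OF Phi_is_colim[OF assms(1)] polyfunD(1)[OF assms(1) dg_Ob]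
   polyfunD(3)[OF assms(1) dg_Ob dg_Ob incl_flag[of _ "Suc _"]] assms(2)] by (metis lessI less_imp_le)

text \<open>The class of \<open>F f x\<close> does not depend on the stage in which \<open>f\<close> takes its
 values.\<close>

lemma lF_later:
 assumes F: "pf F" and X: "X:Fl n" and f: "f:FL n X (dg i)" and ij: "i <= j" and x: "x:car (FOb F X)"
 shows "lF F j (FMap F X (dg j) f x) = lF F i (FMap F X (dg i) f x)"
 using ij
proof (induction rule: dec_induct)
 case (step k)
 have fk: "f:FL n X (dg k)" by (rule flag_dg_mono[OF X f step(1)])
 have "FMap F X (dg (Suc k)) f x = FMap F (dg k) (dg (Suc k)) (lin_id (fst (dg k))) (FMap F X (dg k) f x)"
  using polyfunD(5)[OF F X dg_Ob dg_Ob fk incl_flag[of k "Suc k"]] x compose_lin_id_left[OF flag_linD(1)[OF fk]] by simp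
 thus ?case
  using is_colimD(3)[OF Phi_is_colim[OF F], of "FMap F X (dg k) f x" k] lin_closed[OF polyfunD(3)[OF F X dg_Ob fk] x] step by simp
qed simp

lemma lF_move:
 assumes F: "pf F" and ij: "i <= j" and x: "x:car (FOb F (dg i))"
 shows "lF F j (FMap F (dg i) (dg j) (lin_id (fst (dg i))) x) = lF F i x"
 using lF_later[OF F dg_Ob incl_flag[OF order_refl] ij x] polyfunD(4)[OF F dg_Ob] x by simp

lemma PF_elem_at:
 assumes F: "pf F" and z: "z:car (PF F)"
 shows "EX j0. ALL j>=j0. EX x:car (FOb F (dg j)). z = lF F j x"
proof -
 obtain i x where x: "x:car (FOb F (dg i))" "z = lF F i x" using PF_elem[OF assms, of 0] by blast
 have "EX y:car (FOb F (dg j)). z = lF F j y" if "i <= j" for j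
  using lF_move[OF F that x(1)] lin_closed[OF polyfunD(3)[OF F dg_Ob dg_Ob incl_flag[OF that]] x(1)] x(2) by force
 thus ?thesis by blast
qed

lemma PF_eqI:
 assumes F: "pf F" and z: "z:car (PF F)" and e: "!!j x. x:car (FOb F (dg j)) ==> j0 <= j ==> f (lF F j x) = g (lF F j x)"
 shows "f z = g z"
 using PF_elem[OF F z, of j0] e by metis

lemma Phi_lift:
 fixes P :: "'u vs"
 assumes F: "pf F" and P: "vsp P" and m: "!!j. m j:lin (FOb F (dg j)) P"
  and c: "!!j x. x:car (FOb F (dg j)) ==> m (Suc j) (FMap F (dg j) (dg (Suc j)) (lin_id (fst (dg j))) x) = m j x"
 shows "EX! h. h:lin (PF F) P & (ALL j. ALL x:car (FOb F (dg j)). h (lF F j x) = m j x)"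
 using is_colimD(4)[OF Phi_is_colim[OF F], of P m] by (simp add: is_cocone_def P m c)

subsection \<open>Maps into and out of the colimit\<close>

text \<open>The functor is defined on finite dimensional flags only; its colimit behaves like its value on the infinite
 dimensional flag \<open>V\<close>. The maps induced by flag maps into, out of and inside \<open>V\<close> are as follows.\<close>

definition inF :: "'u flagfun => 'u flag => ('u => 'u) => 'u => 'u" where
 "inF F X f = (let j = SOME j. f:FL n X (dg j) in cmp (FOb F X) (lF F j) (FMap F X (dg j) f))"

lemma inF_eq:
 assumes F: "pf F" and X: "X:Fl n" and f: "f:FL n X (dg j)" and x: "x:car (FOb F X)"
 shows "inF F X f x = lF F j (FMap F X (dg j) f x)"
proof -
 define i where "i = (SOME j. f:FL n X (dg j))"
 have i: "f:FL n X (dg i)" unfolding i_def using f by (rule someI)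
 have "inF F X f x = lF F i (FMap F X (dg i) f x)" using x by (simp add: inF_def Let_def i_def)
 thus ?thesis
  using lF_later[OF F X i _ x, of "max i j"] lF_later[OF F X f _ x, of "max i j"] by simp
qed

lemma inF_in:
 assumes F: "pf F" and X: "X:Fl n" and f: "f:FL n X big"
 shows "inF F X f:lin (FOb F X) (PF F)"
proof -
 obtain j where "f:FL n X (dg j)" using flag_dg_exists[OF X f] ..
 hence j: "f:FL n X (dg (SOME j. f:FL n X (dg j)))" by (rule someI)
 show ?thesis unfolding inF_def Let_def
  by (rule lin_compose[OF polyfunD(1)[OF F X] polyfunD(3)[OF F X dg_Ob j] lF_in[OF F]])
qed

lemma inF_FMap:
 assumes F: "pf F" and X: "X:Fl n" and Y: "Y:Fl n" and g: "g:FL n X Y" and f: "f:FL n Y big"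
  and x: "x:car (FOb F X)"
 shows "inF F Y f (FMap F X Y g x) = inF F X (cmp (fst X) f g) x"
proof -
 obtain j where j: "f:FL n Y (dg j)" using flag_dg_exists[OF Y f] ..
 show ?thesis
  using inF_eq[OF F Y j lin_closed[OF polyfunD(3)[OF F X Y g] x]] inF_eq[OF F X flag_lin_compose[OF ObD(1)[OF X] g j] x]
   polyfunD(5)[OF F X Y dg_Ob g j] x by simp
qed

lemma inF_dg:
 assumes F: "pf F" and ij: "i <= j" and x: "x:car (FOb F (dg i))"
 shows "inF F (dg i) (lin_id (fst (dg i))) x = lF F i x"
 using inF_eq[OF F dg_Ob incl_flag[OF order_refl] x] polyfunD(4)[OF F dg_Ob] x by simp

lemma actF_ex1:
 assumes F: "pf F" and f: "f:FL n big big"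
 shows "EX! h. h:lin (PF F) (PF F) & (ALL j. ALL x:car (FOb F (dg j)). h (lF F j x) = inF F (dg j) (restrict f (sub (ixd j))) x)"
proof (rule Phi_lift[OF F PF_vs[OF F] inF_in[OF F dg_Ob restrict_flag_dg[OF f]]])
 show "inF F (dg (Suc j)) (restrict f (sub (ixd (Suc j)))) (FMap F (dg j) (dg (Suc j)) (lin_id (fst (dg j))) x) =
   inF F (dg j) (restrict f (sub (ixd j))) x" if "x:car (FOb F (dg j))" for j x
  using inF_FMap[OF F dg_Ob dg_Ob incl_flag[of j "Suc j"] restrict_flag_dg[OF f] that] restrict_incl[of j "Suc j" f] by simp
qed

definition actF :: "'u flagfun => ('u => 'u) => 'u => 'u" where
 "actF F f = (THE h. h:lin (PF F) (PF F) & (ALL j. ALL x:car (FOb F (dg j)). h (lF F j x) = inF F (dg j) (restrict f (sub (ixd j))) x))"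

lemma actF_in: "pf F ==> f:FL n big big ==> actF F f:lin (PF F) (PF F)"
 and actF_l: "pf F ==> f:FL n big big ==> x:car (FOb F (dg j)) ==>
  actF F f (lF F j x) = inF F (dg j) (restrict f (sub (ixd j))) x"
 using theI'[OF actF_ex1] unfolding actF_def by blast+

lemma outF_ex1:
 assumes F: "pf F" and X: "X:Fl n" and g: "g:FL n big X"
 shows "EX! h. h:lin (PF F) (FOb F X) & (ALL j. ALL x:car (FOb F (dg j)). h (lF F j x) = FMap F (dg j) X (restrict g (sub (ixd j))) x)"
proof (rule Phi_lift[OF F polyfunD(1)[OF F X] polyfunD(3)[OF F dg_Ob X restrict_flag_dg[OF g]]])
 show "FMap F (dg (Suc j)) X (restrict g (sub (ixd (Suc j)))) (FMap F (dg j) (dg (Suc j)) (lin_id (fst (dg j))) x) =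
   FMap F (dg j) X (restrict g (sub (ixd j))) x" if "x:car (FOb F (dg j))" for j x
  using polyfunD(5)[OF F dg_Ob dg_Ob X incl_flag[of j "Suc j"] restrict_flag_dg[OF g]] that restrict_incl[of j "Suc j" g] by simp
qed

definition outF :: "'u flagfun => 'u flag => ('u => 'u) => 'u => 'u" where
 "outF F X g = (THE h. h:lin (PF F) (FOb F X) & (ALL j. ALL x:car (FOb F (dg j)). h (lF F j x) = FMap F (dg j) X (restrict g (sub (ixd j))) x))"

lemma outF_in: "pf F ==> X:Fl n ==> g:FL n big X ==> outF F X g:lin (PF F) (FOb F X)"
 and outF_l: "pf F ==> X:Fl n ==> g:FL n big X ==> x:car (FOb F (dg j)) ==>
  outF F X g (lF F j x) = FMap F (dg j) X (restrict g (sub (ixd j))) x"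
 using theI'[OF outF_ex1] unfolding outF_def by blast+

lemma outF_inF:
 assumes F: "pf F" and X: "X:Fl n" and Y: "Y:Fl n" and f: "f:FL n Y big" and g: "g:FL n big X"
  and y: "y:car (FOb F Y)"
 shows "outF F X g (inF F Y f y) = FMap F Y X (cmp (fst Y) g f) y"
proof -
 obtain j where j: "f:FL n Y (dg j)" using flag_dg_exists[OF Y f] ..
 have "cmp (fst Y) (restrict g (sub (ixd j))) f = cmp (fst Y) g f"
  unfolding compose_def by (rule restrict_ext) (use lin_closed[OF flag_linD(1)[OF j]] in simp)
 thus ?thesis
  using inF_eq[OF F Y j y] outF_l[OF F X g lin_closed[OF polyfunD(3)[OF F Y dg_Ob j] y]]
   polyfunD(5)[OF F Y dg_Ob X j restrict_flag_dg[OF g]] y by simp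
qed

lemma actF_inF:
 assumes F: "pf F" and X: "X:Fl n" and f: "f:FL n X big" and g: "g:FL n big big"
  and x: "x:car (FOb F X)"
 shows "actF F g (inF F X f x) = inF F X (cmp (fst X) g f) x"
proof -
 obtain j where j: "f:FL n X (dg j)" using flag_dg_exists[OF X f] ..
 have "cmp (fst X) (restrict g (sub (ixd j))) f = cmp (fst X) g f"
  unfolding compose_def by (rule restrict_ext) (use lin_closed[OF flag_linD(1)[OF j]] in simp)
 thus ?thesis
  using inF_eq[OF F X j x] actF_l[OF F g lin_closed[OF polyfunD(3)[OF F X dg_Ob j] x]]
   inF_FMap[OF F X dg_Ob j restrict_flag_dg[OF g] x] by simp
qed

lemma inF_outF:
 assumes F: "pf F" and X: "X:Fl n" and f: "f:FL n X big" and g: "g:FL n big X"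
  and z: "z:car (PF F)"
 shows "inF F X f (outF F X g z) = actF F (cmp V f g) z"
proof (rule PF_eqI[OF F z, of 0 "%z. inF F X f (outF F X g z)"])
 fix j x assume x: "x:car (FOb F (dg j))"
 have fg: "cmp V f g:FL n big big"
  using flag_lin_compose[OF is_flag_big g f] by (simp add: big_flag_eq)
 have "compose (sub (ixd j)) f (restrict g (sub (ixd j))) = restrict (cmp V f g) (sub (ixd j))"
  by (auto simp: compose_def sub_in intro!: restrict_ext)
 thus "inF F X f (outF F X g (lF F j x)) = actF F (cmp V f g) (lF F j x)"
  using outF_l[OF F X g x] inF_FMap[OF F dg_Ob X restrict_flag_dg[OF g] f x] actF_l[OF F fg x] by simp
qed

lemma actF_compose:
 assumes F: "pf F" and f: "f:FL n big big" and g: "g:FL n big big" and z: "z:car (PF F)"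
 shows "actF F g (actF F f z) = actF F (cmp V g f) z"
proof (rule PF_eqI[OF F z, of 0 "%z. actF F g (actF F f z)"])
 fix j x assume x: "x:car (FOb F (dg j))"
 have "compose (sub (ixd j)) g (restrict f (sub (ixd j))) = restrict (cmp V g f) (sub (ixd j))"
  by (auto simp: compose_def sub_in intro!: restrict_ext)
 thus "actF F g (actF F f (lF F j x)) = actF F (cmp V g f) (lF F j x)"
  using actF_l[OF F f x] actF_inF[OF F dg_Ob restrict_flag_dg[OF f] g x] actF_l[OF F EndV_compose[OF f g] x] by simp
qed

lemma actF_id:
 assumes F: "pf F" and z: "z:car (PF F)"
 shows "actF F (lin_id V) z = z"
proof (rule PF_eqI[OF F z, of 0 "actF F (lin_id V)"])
 fix j x assume x: "x:car (FOb F (dg j))"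
 have "restrict (lin_id V) (sub (ixd j)) = lin_id (fst (dg j))"
  by (auto simp: lin_id_def sub_in intro!: restrict_ext)
 thus "actF F (lin_id V) (lF F j x) = lF F j x"
  using actF_l[OF F EndV_id x] inF_dg[OF F order_refl x] by simp
qed

lemma lF_inj:
 assumes F: "pf F" and x: "x:car (FOb F (dg j))"
 shows "outF F (dg j) (ret (dg j)) (lF F j x) = x"
proof -
 have "restrict (ret (dg j)) (sub (ixd j)) = lin_id (fst (dg j))"
  unfolding lin_id_def carrier_dg
  by (rule restrict_ext) (simp add: dg_std ret_of_std[OF cst_PiE] sub_in proj_id ixd_def del: restrict_apply One_nat_def)
 thus ?thesis
  using outF_l[OF F dg_Ob ret_flag[OF dg_Ob] x] polyfunD(4)[OF F dg_Ob] x by simp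
qed

lemma adm_restrict_dg:
 assumes "adm j g"
 shows "restrict g (sub (ixd j)):FL n (dg j) (dg j)"
 using restrict_flag_dg[OF admD(1)[OF assms], of j] admD(5)[OF assms] flag_dg_iff[OF is_flag_dg] by simp

lemma actF_l_sub:
 assumes F: "pf F" and g: "g:GG_sub n V e (cst j)" and x: "x:car (FOb F (dg j))"
 shows "actF F g (lF F j x) = lF F j (FMap F (dg j) (dg j) (restrict g (sub (ixd j))) x)"
 using actF_l[OF F admD(1)[OF GG_sub_adm[OF g]] x] inF_eq[OF F dg_Ob adm_restrict_dg[OF GG_sub_adm[OF g]] x] by simp

text \<open>An element of the group lies in \<open>G\<^sub>(\<^sub>j\<^sub>)\<close> for all large
 \<open>j\<close>, and the colimit is exhausted by these stages; this determines the action.\<close>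

lemma Phi_act_eq:
 assumes F: "pf F" and g: "g:car G"
 shows "Pa F g = actF F g"
 unfolding Phi_act_def
proof (rule the_equality)
 have l: "actF F g (lF F j x) = lF F j (FMap F (dg j) (dg j) (restrict g (sub (ixd j))) x)"
  if "g:GG_sub n V e (cst j)" "x:car (FOb F (dg j))" for j x
  by (rule actF_l_sub[OF F that])
 show A: "actF F g:lin (PF F) (PF F) & (ALL j. g:GG_sub n V e (cst j) -->
   (ALL x:car (FOb F (diag_flag n V e j)). actF F g (lF F j x) = lF F j
    (FMap F (diag_flag n V e j) (diag_flag n V e j) (restrict g (car (fst (diag_flag n V e j)))) x)))"
  using l actF_in[OF F GG_EndV[OF g]] by (simp add: dg_def[symmetric])
 fix h assume h: "h:lin (PF F) (PF F) & (ALL j. g:GG_sub n V e (cst j) -->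
   (ALL x:car (FOb F (diag_flag n V e j)). h (lF F j x) = lF F j
    (FMap F (diag_flag n V e j) (diag_flag n V e j) (restrict g (car (fst (diag_flag n V e j)))) x)))"
 obtain j0 where j0: "!!j. j >= j0 ==> g:GG_sub n V e (cst j)" using GG_sub_exists[OF g] by blast
 show "h = actF F g"
 proof (rule lin_eqI)
  fix z assume z: "z:car (PF F)"
  show "h z = actF F g z"
   by (rule PF_eqI[OF F z, of j0 h]) (use h l j0 in "simp add: dg_def[symmetric]")
 qed (use h actF_in[OF F GG_EndV[OF g]] in auto)
qed

end

declare Flag_simps(1) [simp del]

context flagged_space
begin

subsection \<open>Polynomiality of the colimit\<close>

lemma G_one: "\<one>\<^bsub>G\<^esub> = lin_id V" and G_mult: "g \<otimes>\<^bsub>G\<^esub> h = cmp V g h"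
 by (simp_all add: GG_def)

lemma G_one_in: "lin_id V:car G"
proof -
 have "adm_inv 0 (lin_id V) (lin_id V)"
  by (auto simp: adm_inv_def adm_def EndV_id bas_sub ixdD)
 from GG_subI[OF this] show ?thesis by (simp add: GG_sub_def)
qed

lemma G_mult_in: "g:car G ==> h:car G ==> cmp V g h:car G"
proof -
 assume "g:car G" "h:car G"
 then obtain i j where "!!m. m >= i ==> g:GG_sub n V e (cst m)" "!!m. m >= j ==> h:GG_sub n V e (cst m)"
  using GG_sub_exists by metis
 hence "cmp V g h:GG_sub n V e (cst (max i j))" by (intro GG_sub_compose) auto
 thus ?thesis by (simp add: GG_sub_def)
qed

abbreviation phr :: "'u flagfun => 'u rep" where
 "phr F == (PF F, Pa F)"

lemma is_rep_Phi:
 assumes F: "pf F"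
 shows "is_rep G (phr F)"
 unfolding is_rep_def
proof (intro conjI ballI)
 note a = actF_in[OF F GG_EndV]
 show "vsp (fst (phr F))" using F by simp
 show "snd (phr F) g:lin (fst (phr F)) (fst (phr F))" if "g:car G" for g
  using a[OF that] Phi_act_eq[OF F that] by simp
 show "snd (phr F) \<one>\<^bsub>G\<^esub> = lin_id (fst (phr F))"
  using lin_eqI[OF a[OF G_one_in] lin_id_in[OF PF_vs[OF F]]] actF_id[OF F] Phi_act_eq[OF F G_one_in] by (simp add: G_one)
 fix g h assume g: "g:car G" and h: "h:car G"
 note gh = G_mult_in[OF g h]
 have "actF F (cmp V g h) = cmp (PF F) (actF F g) (actF F h)"
  by (rule lin_eqI[OF a[OF gh] lin_compose[OF PF_vs[OF F] a[OF h] a[OF g]]])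
   (simp add: actF_compose[OF F GG_EndV[OF h] GG_EndV[OF g]])
 thus "snd (phr F) (g \<otimes>\<^bsub>G\<^esub> h) = cmp (fst (phr F)) (snd (phr F) g) (snd (phr F) h)"
  using Phi_act_eq[OF F g] Phi_act_eq[OF F h] Phi_act_eq[OF F gh] by (simp add: G_mult)
qed

text \<open>A presentation of \<open>F\<close> induces one of the colimit: an element of \<open>\<Oplus>V\<^sup>\<otimes>\<^sup>a\<close> comes from some
 \<open>\<Oplus>(\<complex>\<^sup>(\<^sup>j\<^sup>))\<^sup>\<otimes>\<^sup>a\<close>, where the presentation of \<open>F\<close> can be used.\<close>

lemma Phi_presentation:
 assumes F: "pf F"
 obtains k a S P where "presentation n V e (phr F) k a S P"
  "!!f y. f:FL n big big ==> y:S ==> P (tmap V V k a f y) = actF F f (P y)"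
proof -
 obtain k a S p where P: "fpres n F k a S p"
  using F by (auto simp: polynomial_functor_iff)
 have vd [simp]: "vsp (fst (dg j))" for j by (rule ObD(2)[OF dg_Ob])
 have pr: "pres (fst (dg j)) k a (S (dg j)) (p (dg j)) (FOb F (dg j))" for j
  using P unfolding fpres_def by simp
 have pn: "tmap (fst X) (fst Y) k a f x:S Y & p Y (tmap (fst X) (fst Y) k a f x) = FMap F X Y f (p X x)"
  if "X:Fl n" "Y:Fl n" "f:FL n X Y" "x:S X" for X Y f x
  using P that unfolding fpres_def by simp
 note prD = presD[OF pr vd]
 define W where "W = tsum V k a"
 define D where "D j = tsum (fst (dg j)) k a" for j
 have vW [simp]: "vsp W" and vD [simp]: "vsp (D j)" for j by (simp_all add: W_def D_def)
 define R where "R j = tmap V (fst (dg j)) k a (ret (dg j))" for j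
 define p' where "p' j = p (dg j)" for j
 define S' where "S' j = S (dg j)" for j
 define \<Theta> where "\<Theta> = tmap V V k a"
 have rl: "ret (dg j):lin V (fst (dg j))" for j using flag_linD(1)[OF ret_flag[OF dg_Ob]] by (simp add: big_flag_eq)
 have rp: "ret (dg j) v = pj j v" if "v:car V" for j v
  using ret_of_std[OF cst_PiE that] by (simp add: dg_std ixd_def)
 have Rl: "linear_on W (D j) (R j)" for j
  unfolding W_def D_def R_def by (rule linear_on_tsum_map[OF V_vs vd rl])
 have Tl: "linear_on W W (\<Theta> f)" if "f:lin V V" for f
  unfolding W_def \<Theta>_def by (rule linear_on_tsum_map[OF V_vs V_vs that])
 have pl: "linear_on (D j<|S' j|>) (FOb F (dg j)) (p' j)" for j
  unfolding D_def S'_def p'_def by (rule prD(2))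
 have Sm: "submodule (S' j) CC (D j)" for j unfolding D_def S'_def by (rule prD(1))
 have pin: "p' j s:car (FOb F (dg j))" if "s:S' j" for j s
  using prD(5)[of s j] that by (simp add: S'_def p'_def)
 define T where "T j y \<longleftrightarrow> y:car W & \<Theta> (pj j) y = y & R j y:S' j" for j y
 have step: "T m (\<Theta> f y) & R m (\<Theta> f y) = tmap (fst (dg i)) (fst (dg m)) k a (restrict f (sub (ixd i))) (R i y)"
  if y: "T i y" and f: "f:FL n big big" and fm: "restrict f (sub (ixd i)):FL n (dg i) (dg m)" for i m f y
 proof -
  note fl = EndV_lin[OF f]
  have yW: "y:car (tsum V k a)" and yp: "tmap V V k a (pj i) y = y" and yS: "R i y:S (dg i)"
   using y by (simp_all add: T_def W_def \<Theta>_def S'_def)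
  have fs: "f v:sub (ixd m)" if "v:sub (ixd i)" for v
   using lin_closed[OF flag_linD(1)[OF fm], of v] that by simp
  have pjs: "pj j v:sub (ixd j)" if "v:car V" for j v by (rule proj_sub[OF that])
  have fp: "cmp V f (pj i):lin V V" by (rule lin_compose[OF V_vs proj_in fl])
  have fy: "tmap V V k a f y = tmap V V k a (cmp V f (pj i)) y"
   using tsum_map_compose[OF V_vs V_vs V_vs proj_in[of "ixd i"] fl yW] yp by simp
  have c1: "cmp V (pj m) (cmp V f (pj i)) = cmp V f (pj i)"
   unfolding compose_def by (rule restrict_ext) (simp add: proj_id fs pjs)
  have c2: "cmp V (ret (dg m)) (cmp V f (pj i)) = cmp V (restrict f (sub (ixd i))) (ret (dg i))"
   unfolding compose_def by (rule restrict_ext) (simp add: proj_id fs pjs rp sub_in[OF fs])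
  have a: "\<Theta> (pj m) (\<Theta> f y) = \<Theta> f y"
   using tsum_map_compose[OF V_vs V_vs V_vs fp proj_in[of "ixd m"] yW] by (simp add: \<Theta>_def c1 fy)
  have b: "R m (\<Theta> f y) = tmap (fst (dg i)) (fst (dg m)) k a (restrict f (sub (ixd i))) (R i y)"
   using tsum_map_compose[OF V_vs V_vs vd fp rl[of m] yW] tsum_map_compose[OF V_vs vd vd rl flag_linD(1)[OF fm] yW]
   by (simp add: \<Theta>_def R_def c2 fy)
  have "\<Theta> f y:car W" using linear_onD(1)[OF Tl[OF fl]] y by (simp add: T_def)
  thus ?thesis using a b pn[OF dg_Ob dg_Ob fm yS] by (simp add: T_def S'_def)
 qed
 have later: "T m y & lF F m (p' m (R m y)) = lF F i (p' i (R i y))" if y: "T i y" and im: "i <= m" for i m y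
 proof -
  have r: "restrict (lin_id V) (sub (ixd i)) = lin_id (fst (dg i))"
   by (auto simp: lin_id_def sub_in intro!: restrict_ext)
  have i: "\<Theta> (lin_id V) y = y" using y by (simp add: \<Theta>_def T_def W_def tsum_map_id)
  have t: "T m y" "R m y = tmap (fst (dg i)) (fst (dg m)) k a (lin_id (fst (dg i))) (R i y)"
   using step[OF y EndV_id, of m] incl_flag[OF im] by (simp_all add: r i)
  have "p' m (R m y) = FMap F (dg i) (dg m) (lin_id (fst (dg i))) (p' i (R i y))"
   using pn[OF dg_Ob dg_Ob incl_flag[OF im], of "R i y"] y t(2) by (simp add: T_def S'_def p'_def)
  thus ?thesis using t(1) lF_move[OF F im pin] y by (simp add: T_def)
 qed
 define SV where "SV = {y. EX j. T j y}"
 define Q where "Q y = (let j = SOME j. T j y in lF F j (p' j (R j y)))" for y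
 have Qe: "Q y = lF F j (p' j (R j y))" if y: "T j y" for j y
 proof -
  define i where "i = (SOME j. T j y)"
  have i: "T i y" unfolding i_def using y by (rule someI)
  have "Q y = lF F i (p' i (R i y))" by (simp add: Q_def Let_def i_def)
  thus ?thesis using later[OF i, of "max i j"] later[OF y, of "max i j"] by simp
 qed
 have two: "EX j. T j y & T j z" if yz: "y:SV" "z:SV" for y z
 proof -
  obtain i j where ij: "T i y" "T j z" using yz unfolding SV_def by blast
  have "T (max i j) y" "T (max i j) z" using later[OF ij(1), of "max i j"] later[OF ij(2), of "max i j"] by simp_all
  thus ?thesis by blast
 qed
 note SD = submoduleD[OF vD Sm]
 note RD = linear_onD[OF Rl] and TD = linear_onD[OF Tl[OF proj_in]]
 have Tadd: "T j (y +[W] z)" if "T j y" "T j z" for j y z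
  using that by (simp add: T_def RD TD SD)
 have Tsm: "T j (c *[W] y)" if "T j y" for j y c
  using that by (simp add: T_def RD TD SD)
 have T0: "T j 0[W]" for j
  using linear_on_zero[OF vW vD Rl] linear_on_zero[OF vW vW Tl[OF proj_in]] by (simp add: T_def SD)
 have SVm: "submodule SV CC W"
 proof (rule submoduleI[OF vW])
  show "SV <= car W" by (auto simp: SV_def T_def)
  show "0[W]:SV" using T0 by (auto simp: SV_def)
  show "y +[W] z:SV" if "y:SV" "z:SV" for y z using two[OF that] Tadd by (auto simp: SV_def)
  show "c *[W] y:SV" if "y:SV" for y c using that Tsm by (auto simp: SV_def)
 qed
 note plD = linear_onD[OF pl, simplified]
 have Ql: "linear_on (W<|SV|>) (PF F) Q"
 proof (rule linear_onI; simp)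
  show "Q y:car (PF F)" if y: "y:SV" for y
  proof -
   obtain j where "T j y" using y by (auto simp: SV_def)
   thus ?thesis using Qe[of j y] lF_closed[OF F pin] by (simp add: T_def)
  qed
  show "Q (y +[W] z) = Q y +[PF F] Q z" if yz: "y:SV" "z:SV" for y z
  proof -
   obtain j where j: "T j y" "T j z" using two[OF yz] by blast
   thus ?thesis
    using lin_add[OF lF_in[OF F] pin pin, of "R j y" j "R j z"] by (simp add: Qe[OF Tadd[OF j]] Qe[OF j(1)] Qe[OF j(2)] T_def RD plD)
  qed
  show "Q (c *[W] y) = c *[PF F] Q y" if y: "y:SV" for y c
  proof -
   obtain j where j: "T j y" using y by (auto simp: SV_def)
   thus ?thesis
    using lin_smult[OF lF_in[OF F] pin, of "R j y" j] by (simp add: Qe[OF Tsm[OF j]] Qe[OF j] T_def RD plD)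
  qed
 qed
 have Qs: "car (PF F) <= Q ` SV"
 proof
  fix z assume z: "z:car (PF F)"
  obtain j x where x: "x:car (FOb F (dg j))" "z = lF F j x" using PF_elem[OF F z, of 0] by blast
  obtain s where s: "s:S (dg j)" "x = p (dg j) s" using prD(3)[of j] x(1) by blast
  have sD: "s:car (tsum (fst (dg j)) k a)" by (rule prD(4)[OF s(1)])
  have el: "emb (dg j):lin (fst (dg j)) V" using flag_linD(1)[OF emb_flag[OF dg_Ob]] by (simp add: big_flag_eq)
  define y where "y = tmap (fst (dg j)) V k a (emb (dg j)) s"
  have "y:car W" unfolding y_def W_def by (rule tsum_map_closed[OF vd V_vs el sD])
  moreover have "R j y = s"
  proof -
   have "cmp (fst (dg j)) (ret (dg j)) (emb (dg j)) = lin_id (fst (dg j))"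
    unfolding compose_def lin_id_def by (rule restrict_ext) (simp only: ret_emb[OF dg_Ob])
   thus ?thesis
    using tsum_map_compose[OF vd V_vs vd el rl[of j] sD] tsum_map_id[OF vd sD] by (simp add: R_def y_def)
  qed
  moreover have "\<Theta> (pj j) y = y"
  proof -
   have em: "emb (dg j) = lin_id (fst (dg j))" unfolding dg_std by (rule emb_of_std[OF cst_PiE])
   have "cmp (fst (dg j)) (pj j) (emb (dg j)) = emb (dg j)"
    unfolding em by (auto simp: compose_def lin_id_def proj_id intro!: restrict_ext)
   thus ?thesis
    using tsum_map_compose[OF vd V_vs V_vs el proj_in[of "ixd j"] sD] by (simp add: \<Theta>_def y_def)
  qed
  ultimately have "T j y" using s(1) by (simp add: T_def S'_def)
  hence "y:SV" "Q y = z" using Qe[of j y] \<open>R j y = s\<close> x(2) s(2) by (auto simp: SV_def p'_def)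
  thus "z:Q ` SV" by blast
 qed
 have eq: "\<Theta> f y:SV & Q (\<Theta> f y) = actF F f (Q y)" if f: "f:FL n big big" and y: "y:SV" for f y
 proof -
  obtain i where i: "T i y" using y by (auto simp: SV_def)
  obtain m where m: "restrict f (sub (ixd i)):FL n (dg i) (dg m)"
   using flag_dg_exists[OF dg_Ob restrict_flag_dg[OF f]] by blast
  note s = step[OF i f m]
  have Ri: "R i y:S' i" using i by (simp add: T_def)
  have "Q (\<Theta> f y) = lF F m (FMap F (dg i) (dg m) (restrict f (sub (ixd i))) (p' i (R i y)))"
   using Qe[of m "\<Theta> f y"] s pn[OF dg_Ob dg_Ob m, of "R i y"] Ri by (simp add: S'_def p'_def)
  also have "... = actF F f (Q y)"
   using actF_l[OF F f pin[OF Ri]] inF_eq[OF F dg_Ob m pin[OF Ri]] Qe[OF i] by simp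
  finally show ?thesis using s by (auto simp: SV_def)
 qed
 have "presentation n V e (phr F) k a SV Q"
  unfolding presentation_pres pres_def
 proof (intro conjI ballI)
  show "submodule SV CC (tsum V k a)" "linear_on (tsum V k a<|SV|>) (fst (phr F)) Q"
   using SVm Ql by (simp_all add: W_def)
  show "Q ` SV = car (fst (phr F))" using Qs linear_onD(1)[OF Ql] by auto
  fix g y assume g: "g:car G" and y: "y:SV"
  show "tmap V V k a g y:SV" "Q (tmap V V k a g y) = snd (phr F) g (Q y)"
   using eq[OF GG_EndV[OF g] y] Phi_act_eq[OF F g] by (simp_all add: \<Theta>_def)
 qed
 thus thesis by (rule that) (use eq in \<open>simp add: \<Theta>_def\<close>)
qed

lemma poly_Phi: "pf F ==> poly (phr F)"
 using is_rep_Phi Phi_presentation unfolding polynomial_rep_def by metis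

text \<open>The action of \<open>End V\<close> defined through presentations is the one that comes from
 functoriality.\<close>

lemma act_Phi:
 assumes F: "pf F" and f: "f:FL n big big" and z: "z:car (PF F)"
 shows "act (phr F) f z = actF F f z"
proof -
 obtain k a S P where P: "presentation n V e (phr F) k a S P"
  "!!f y. f:FL n big big ==> y:S ==> P (tmap V V k a f y) = actF F f (P y)"
  by (rule Phi_presentation[OF F]) blast
 have "P ` S = car (PF F)" using P(1) by (simp add: presentation_pres pres_def)
 then obtain y where "y:S" "z = P y" using z by blast
 thus ?thesis using act_eq[OF P(1) _ f] P(2)[OF f] by simp
qed

subsection \<open>Functoriality\<close>

lemma Phi_map_ex1:
 assumes F: "pf F" and H: "pf H" and et: "et:NT n F H"
 shows "EX! h. h:lin (PF F) (PF H) & (ALL j. ALL x:car (FOb F (dg j)). h (lF F j x) = lF H j (et (dg j) x))"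
proof -
 note N = nat_transD(2)[OF et dg_Ob]
 define m where "m j = cmp (FOb F (dg j)) (lF H j) (et (dg j))" for j
 have "EX! h. h:lin (PF F) (PF H) & (ALL j. ALL x:car (FOb F (dg j)). h (lF F j x) = m j x)"
 proof (rule Phi_lift[OF F PF_vs[OF H]])
  show "m j:lin (FOb F (dg j)) (PF H)" for j
   unfolding m_def by (rule lin_compose[OF polyfunD(1)[OF F dg_Ob] N lF_in[OF H]])
  fix j x assume x: "x:car (FOb F (dg j))"
  note i = incl_flag[of j "Suc j", simplified]
  show "m (Suc j) (FMap F (dg j) (dg (Suc j)) (lin_id (fst (dg j))) x) = m j x"
   using lF_move[OF H _ lin_closed[OF N x], of "Suc j"] nat_transD(3)[OF et dg_Ob dg_Ob i x]
    lin_closed[OF polyfunD(3)[OF F dg_Ob dg_Ob i] x] x by (simp add: m_def)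
 qed
 thus ?thesis by (simp add: m_def cong: conj_cong)
qed

lemma Phi_map_in: "pf F ==> pf H ==> et:NT n F H ==> Pm F H et:lin (PF F) (PF H)"
 and Phi_map_l: "pf F ==> pf H ==> et:NT n F H ==> x:car (FOb F (dg j)) ==>
  Pm F H et (lF F j x) = lF H j (et (dg j) x)"
 using theI'[OF Phi_map_ex1] unfolding Phi_map_def dg_def[symmetric] by blast+

lemma Phi_map_eqI:
 assumes F: "pf F" and H: "pf H" and et: "et:NT n F H" and h: "h:lin (PF F) (PF H)"
  and e: "!!j x. x:car (FOb F (dg j)) ==> h (lF F j x) = lF H j (et (dg j) x)"
 shows "Pm F H et = h"
proof (rule lin_eqI[OF Phi_map_in[OF F H et] h])
 fix z assume z: "z:car (PF F)"
 show "Pm F H et z = h z"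
  by (rule PF_eqI[OF F z, of 0 "Pm F H et" h]) (simp add: Phi_map_l[OF F H et] e)
qed

lemma Phi_map_inF:
 assumes F: "pf F" and H: "pf H" and et: "et:NT n F H" and X: "X:Fl n"
  and f: "f:FL n X big" and x: "x:car (FOb F X)"
 shows "Pm F H et (inF F X f x) = inF H X f (et X x)"
proof -
 obtain j where j: "f:FL n X (dg j)" using flag_dg_exists[OF X f] ..
 show ?thesis
  using inF_eq[OF F X j x] inF_eq[OF H X j lin_closed[OF nat_transD(2)[OF et X] x]]
   Phi_map_l[OF F H et lin_closed[OF polyfunD(3)[OF F X dg_Ob j] x]] nat_transD(3)[OF et X dg_Ob j x] by simp
qed

lemma Phi_map_equivariant:
 assumes F: "pf F" and H: "pf H" and et: "et:NT n F H"
 shows "Pm F H et:eqv (phr F) (phr H)"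
proof (rule equivariantI; simp only: fst_conv snd_conv)
 show "Pm F H et:lin (PF F) (PF H)" by (rule Phi_map_in[OF assms])
 fix g z assume g: "g:car G" and z: "z:car (PF F)"
 have "Pm F H et (actF F g z) = actF H g (Pm F H et z)"
 proof (rule PF_eqI[OF F z, of 0 "%z. Pm F H et (actF F g z)"])
  fix j x assume x: "x:car (FOb F (dg j))"
  note g' = GG_EndV[OF g]
  show "Pm F H et (actF F g (lF F j x)) = actF H g (Pm F H et (lF F j x))"
   using actF_l[OF F g' x] Phi_map_inF[OF assms dg_Ob restrict_flag_dg[OF g'] x] Phi_map_l[OF assms x]
    actF_l[OF H g' lin_closed[OF nat_transD(2)[OF et dg_Ob] x]] by simp
 qed
 thus "Pm F H et (Pa F g z) = Pa H g (Pm F H et z)"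
  using Phi_act_eq[OF F g] Phi_act_eq[OF H g] by simp
qed

lemma Phi_simps [simp]: "FOb PH F = phr F" "FMap PH = Pm"
 by (simp_all add: Phi_def)

lemma functor_Phi: "cat_functor (CatA n) RG PH"
proof (intro cat_functor.intro cat_functor_axioms.intro; (simp only: CatA_simps RepG_simps Phi_simps mem_Collect_eq fst_conv snd_conv)?)
 show "category (CatA n :: ('u flagfun, 'u flag => 'u => 'u) tensor_cat)" by (rule fibred_tensor.is_category[OF fibred_CatA])
 show "category RG" by (rule fibred_tensor.is_category[OF fibred_RepG])
 fix X Y Z :: "'u flagfun" and f g
 show "poly (phr X)" if "pf X" by (rule poly_Phi[OF that])
 show "Pm X Y f:eqv (phr X) (phr Y)" if "pf X" "pf Y" "f:NT n X Y"
  by (rule Phi_map_equivariant[OF that])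
 show "Pm X X (\<lambda>Y\<in>Fl n. lin_id (FOb X Y)) = lin_id (PF X)" if X: "pf X"
 proof -
  have i: "(\<lambda>Y\<in>Fl n. lin_id (FOb X Y)):NT n X X"
   using fibred_tensor.cl_Idn[OF fibred_CatA, of X] X by simp
  show ?thesis
   by (rule Phi_map_eqI[OF X X i lin_id_in[OF PF_vs[OF X]]]) (simp add: lF_closed[OF X])
 qed
 show "Pm X Z (\<lambda>W\<in>Fl n. cmp (FOb X W) (g W) (f W)) = cmp (PF X) (Pm Y Z g) (Pm X Y f)"
  if X: "pf X" and Y: "pf Y" and Z: "pf Z" and f: "f:NT n X Y" and g: "g:NT n Y Z"
 proof -
  have i: "(\<lambda>W\<in>Fl n. cmp (FOb X W) (g W) (f W)):NT n X Z"
   using fibred_tensor.cl_Cmp[OF fibred_CatA[of n], of X Y Z f g] X Y Z f g by simp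
  show ?thesis
   by (rule Phi_map_eqI[OF X Z i lin_compose[OF PF_vs[OF X] Phi_map_in[OF X Y f] Phi_map_in[OF Y Z g]]])
    (simp add: Phi_map_l[OF X Y f] Phi_map_l[OF Y Z g] lF_closed[OF X] lin_closed[OF nat_transD(2)[OF f dg_Ob]])
 qed
qed

end

context flagged_space
begin

subsection \<open>The colimit of a tensor product\<close>

abbreviation ften :: "'u flagfun => 'u flagfun => 'u flagfun" where
 "ften F H == (|FOb = (%X. tensor (FOb F X) (FOb H X)),
    FMap = (%X Y f. tensor_map (FOb F X) (FOb F Y) (FOb H X) (FOb H Y) (FMap F X Y f) (FMap H X Y f))|)"

abbreviation funit :: "'u flagfun" where
 "funit == (|FOb = (%X. unit_sp), FMap = (%X Y f. lin_id unit_sp)|)"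

lemma common_stage3:
 assumes "pf F" "pf H" "pf K" "x:car (PF F)" "y:car (PF H)" "z:car (PF K)"
 obtains j u w t where "u:car (FOb F (dg j))" "x = lF F j u" "w:car (FOb H (dg j))" "y = lF H j w"
  "t:car (FOb K (dg j))" "z = lF K j t"
proof -
 obtain j0 where a: "ALL j>=j0. EX u:car (FOb F (dg j)). x = lF F j u" using PF_elem_at[OF assms(1,4)] ..
 obtain j1 where b: "ALL j>=j1. EX u:car (FOb H (dg j)). y = lF H j u" using PF_elem_at[OF assms(2,5)] ..
 obtain j2 where c: "ALL j>=j2. EX u:car (FOb K (dg j)). z = lF K j u" using PF_elem_at[OF assms(3,6)] ..
 define j where "j = max j0 (max j1 j2)"
 have "j0 <= j" "j1 <= j" "j2 <= j" by (simp_all add: j_def)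
 with a b c obtain u w t where "u:car (FOb F (dg j))" "x = lF F j u" "w:car (FOb H (dg j))" "y = lF H j w"
  "t:car (FOb K (dg j))" "z = lF K j t" by blast
 thus thesis by (rule that)
qed

lemma common_stage2:
 assumes "pf F" "pf H" "x:car (PF F)" "y:car (PF H)"
 obtains j u w where "u:car (FOb F (dg j))" "x = lF F j u" "w:car (FOb H (dg j))" "y = lF H j w"
 by (rule common_stage3[OF assms(1,2,1,3,4,3)]) (rule that)

lemma Phi_tensor_ex1:
 assumes F: "pf F" and H: "pf H"
 shows "EX! h. h:lin (PF (ften F H)) (tensor (PF F) (PF H)) \<and>
  (ALL j. ALL t:car (FOb (ften F H) (dg j)). h (lF (ften F H) j t) = tensor_map (FOb F (dg j)) (PF F) (FOb H (dg j)) (PF H) (lF F j) (lF H j) t)"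
proof (rule Phi_lift[OF CatA_Tob[OF F H]])
 note v = polyfunD(1)[OF F dg_Ob] polyfunD(1)[OF H dg_Ob]
 show "vsp (tensor (PF F) (PF H))" using F H by simp
 show "tensor_map (FOb F (dg j)) (PF F) (FOb H (dg j)) (PF H) (lF F j) (lF H j):lin (FOb (ften F H) (dg j)) (tensor (PF F) (PF H))" for j
  using F H v lF_in by simp
 fix j t assume t: "t:car (FOb (ften F H) (dg j))"
 have i: "lin_id (fst (dg j)):FL n (dg j) (dg (Suc j))" by (rule incl_flag) simp
 have c: "cmp (FOb K (dg j)) (lF K (Suc j)) (FMap K (dg j) (dg (Suc j)) (lin_id (fst (dg j)))) = lF K j" if K: "pf K" for K
  by (rule lin_eqI[OF lin_compose[OF polyfunD(1)[OF K dg_Ob] polyfunD(3)[OF K dg_Ob dg_Ob i] lF_in[OF K]] lF_in[OF K]])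
   (simp add: lF_move[OF K])
 show "tensor_map (FOb F (dg (Suc j))) (PF F) (FOb H (dg (Suc j))) (PF H) (lF F (Suc j)) (lF H (Suc j)) (FMap (ften F H) (dg j) (dg (Suc j)) (lin_id (fst (dg j))) t)
  = tensor_map (FOb F (dg j)) (PF F) (FOb H (dg j)) (PF H) (lF F j) (lF H j) t"
  using t tensor_map_compose_apply[OF v(1) v(1) PF_vs[OF F] v(2) v(2) PF_vs[OF H] polyfunD(3)[OF F dg_Ob dg_Ob i] lF_in[OF F]
   polyfunD(3)[OF H dg_Ob dg_Ob i] lF_in[OF H], of t] c[OF F] c[OF H] by simp
qed

definition nu :: "'u flagfun => 'u flagfun => 'u => 'u" where
 "nu F H = (THE h. h:lin (PF (ften F H)) (tensor (PF F) (PF H)) \<and>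
  (ALL j. ALL t:car (FOb (ften F H) (dg j)). h (lF (ften F H) j t) = tensor_map (FOb F (dg j)) (PF F) (FOb H (dg j)) (PF H) (lF F j) (lF H j) t))"

lemma nu_in: "pf F ==> pf H ==> nu F H:lin (PF (ften F H)) (tensor (PF F) (PF H))"
 and nu_l: "pf F ==> pf H ==> t:car (tensor (FOb F (dg j)) (FOb H (dg j))) ==>
  nu F H (lF (ften F H) j t) = tensor_map (FOb F (dg j)) (PF F) (FOb H (dg j)) (PF H) (lF F j) (lF H j) t"
 using theI'[OF Phi_tensor_ex1] unfolding nu_def by auto

lemma nu_pure:
 assumes F: "pf F" and H: "pf H" and x: "x:car (FOb F (dg j))" and y: "y:car (FOb H (dg j))"
 shows "nu F H (lF (ften F H) j (pure (FOb F (dg j)) (FOb H (dg j)) x y)) = pure (PF F) (PF H) (lF F j x) (lF H j y)"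
 using nu_l[OF F H pure_in[OF polyfunD(1)[OF F dg_Ob] polyfunD(1)[OF H dg_Ob] x y]]
  tensor_map_pure[OF polyfunD(1)[OF F dg_Ob] PF_vs[OF F] polyfunD(1)[OF H dg_Ob] PF_vs[OF H] lF_in[OF F] lF_in[OF H] x y] by simp

lemma nu_equivariant:
 assumes F: "pf F" and H: "pf H"
 shows "nu F H:eqv (phr (ften F H)) (rtensor (phr F) (phr H))"
proof (rule equivariantI; simp only: fst_conv snd_conv)
 note T = CatA_Tob[OF F H]
 show "nu F H:lin (PF (ften F H)) (tensor (PF F) (PF H))" by (rule nu_in[OF F H])
 fix g z assume g: "g:car G" and z: "z:car (PF (ften F H))"
 note g' = GG_EndV[OF g]
 let ?A = "tensor_map (PF F) (PF F) (PF H) (PF H) (actF F g) (actF H g)"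
 obtain j0 where j0: "!!j. j >= j0 ==> g:GG_sub n V e (cst j)" using GG_sub_exists[OF g] by blast
 have "nu F H (actF (ften F H) g z) = ?A (nu F H z)"
 proof (rule PF_eqI[OF T z, of j0 "%z. nu F H (actF (ften F H) g z)" "%z. ?A (nu F H z)"])
  fix j t assume t': "t:car (FOb (ften F H) (dg j))" and j: "j0 <= j"
  define r where "r = restrict g (sub (ixd j))"
  have r: "r:FL n (dg j) (dg j)" unfolding r_def by (rule adm_restrict_dg[OF GG_sub_adm[OF j0[OF j]]])
  have t: "t:car (tensor (FOb F (dg j)) (FOb H (dg j)))" using t' by simp
  note v = polyfunD(1)[OF F dg_Ob, of j] polyfunD(1)[OF H dg_Ob, of j] PF_vs[OF F] PF_vs[OF H]
  note m = polyfunD(3)[OF F dg_Ob dg_Ob r] polyfunD(3)[OF H dg_Ob dg_Ob r] lF_in[OF F, of j] lF_in[OF H, of j]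
  note A = actF_in[OF F g'] actF_in[OF H g']
  let ?r = "tensor_map (FOb F (dg j)) (FOb F (dg j)) (FOb H (dg j)) (FOb H (dg j)) (FMap F (dg j) (dg j) r) (FMap H (dg j) (dg j) r)"
  let ?l = "tensor_map (FOb F (dg j)) (PF F) (FOb H (dg j)) (PF H) (lF F j) (lF H j)"
  have c: "cmp (FOb K (dg j)) (lF K j) (FMap K (dg j) (dg j) r) = cmp (FOb K (dg j)) (actF K g) (lF K j)"
   if K: "pf K" for K
   unfolding compose_def r_def by (rule restrict_ext) (rule actF_l_sub[OF K j0[OF j], symmetric])
  have rt: "?r t:car (tensor (FOb F (dg j)) (FOb H (dg j)))"
   by (rule lin_closed[OF tensor_map_in[OF v(1,1,2,2) m(1,2)] t])
  have "actF (ften F H) g (lF (ften F H) j t) = lF (ften F H) j (?r t)"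
   using actF_l_sub[OF T j0[OF j] t'] by (simp add: r_def)
  hence "nu F H (actF (ften F H) g (lF (ften F H) j t)) = ?l (?r t)"
   using nu_l[OF F H rt] by simp
  also have "... = ?A (?l t)"
   using tensor_map_compose_apply[OF v(1,1,3,2,2,4) m(1,3,2,4) t] tensor_map_compose_apply[OF v(1,3,3,2,4,4) m(3) A(1) m(4) A(2) t]
    c[OF F] c[OF H] by simp
  finally show "nu F H (actF (ften F H) g (lF (ften F H) j t)) = ?A (nu F H (lF (ften F H) j t))"
   using nu_l[OF F H t] by simp
 qed
 thus "nu F H (Pa (ften F H) g z) = tensor_map (PF F) (PF F) (PF H) (PF H) (Pa F g) (Pa H g) (nu F H z)"
  using Phi_act_eq[OF F g] Phi_act_eq[OF H g] Phi_act_eq[OF T g] by simp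
qed

text \<open>Injectivity holds because the maps \<open>l_j\<close> have retractions; surjectivity because two elements of the
 colimits come from a common stage.\<close>

lemma nu_bij:
 assumes F: "pf F" and H: "pf H"
 shows "bij_betw (nu F H) (car (PF (ften F H))) (car (tensor (PF F) (PF H)))"
 unfolding bij_betw_def
proof
 note T = CatA_Tob[OF F H]
 note TP = tensor_vspace[OF PF_vs[OF F] PF_vs[OF H]]
 show "inj_on (nu F H) (car (PF (ften F H)))"
 proof (rule inj_onI)
  fix z z' assume z: "z:car (PF (ften F H))" and z': "z':car (PF (ften F H))" and e: "nu F H z = nu F H z'"
  obtain j t t' where t: "t:car (FOb (ften F H) (dg j))" "z = lF (ften F H) j t"
   and t': "t':car (FOb (ften F H) (dg j))" "z' = lF (ften F H) j t'"
   by (rule common_stage2[OF T T z z'])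
  note t = t[simplified] and t' = t'[simplified]
  note v = polyfunD(1)[OF F dg_Ob, of j] polyfunD(1)[OF H dg_Ob, of j] PF_vs[OF F] PF_vs[OF H]
  let ?l = "tensor_map (FOb F (dg j)) (PF F) (FOb H (dg j)) (PF H) (lF F j) (lF H j)"
  let ?o = "tensor_map (PF F) (FOb F (dg j)) (PF H) (FOb H (dg j)) (outF F (dg j) (ret (dg j))) (outF H (dg j) (ret (dg j)))"
  have c: "cmp (FOb K (dg j)) (outF K (dg j) (ret (dg j))) (lF K j) = lin_id (FOb K (dg j))" if "pf K" for K
   unfolding compose_def lin_id_def by (rule restrict_ext) (rule lF_inj[OF that])
  have o: "?o (?l s) = s" if s: "s:car (tensor (FOb F (dg j)) (FOb H (dg j)))" for s
   using tensor_map_compose_apply[OF v(1,3,1,2,4,2) lF_in[OF F] outF_in[OF F dg_Ob ret_flag[OF dg_Ob]] lF_in[OF H] outF_in[OF H dg_Ob ret_flag[OF dg_Ob]] s]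
    c[OF F] c[OF H] tensor_map_id[OF v(1,2)] s by simp
  have "?l t = ?l t'" using e nu_l[OF F H t(1)] nu_l[OF F H t'(1)] t(2) t'(2) by simp
  from arg_cong[OF this, of ?o] have "t = t'" unfolding o[OF t(1)] o[OF t'(1)] .
  thus "z = z'" unfolding t(2) t'(2) by (rule arg_cong)
 qed
 have "car (tensor (PF F) (PF H)) <= nu F H ` car (PF (ften F H))"
 proof (rule tensor_generated[OF PF_vs[OF F] PF_vs[OF H]])
  show "submodule (nu F H ` car (PF (ften F H))) CC (tensor (PF F) (PF H))"
   by (rule submodule_image[OF PF_vs[OF T] TP linD[OF nu_in[OF F H]] submodule_carrier[OF PF_vs[OF T]]])
  fix x y assume x: "x:car (PF F)" and y: "y:car (PF H)"
  obtain j u w where u: "u:car (FOb F (dg j))" "x = lF F j u" and w: "w:car (FOb H (dg j))" "y = lF H j w"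
   by (rule common_stage2[OF F H x y])
  have "lF (ften F H) j (pure (FOb F (dg j)) (FOb H (dg j)) u w):car (PF (ften F H))"
   by (rule lF_closed[OF T]) (simp add: pure_in[OF polyfunD(1)[OF F dg_Ob] polyfunD(1)[OF H dg_Ob] u(1) w(1)])
  thus "pure (PF F) (PF H) x y:nu F H ` car (PF (ften F H))"
   unfolding u(2) w(2) nu_pure[OF F H u(1) w(1), symmetric] by (rule imageI)
 qed
 thus "nu F H ` car (PF (ften F H)) = car (tensor (PF F) (PF H))"
  using lin_closed[OF nu_in[OF F H]] by (intro equalityI image_subsetI)
qed

definition muP :: "'u flagfun => 'u flagfun => 'u => 'u" where
 "muP F H = the_inverse RG (phr (ften F H)) (rtensor (phr F) (phr H)) (nu F H)"

lemma muP_inverse: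
 assumes F: "pf F" and H: "pf H"
 shows "is_inverse RG (phr (ften F H)) (rtensor (phr F) (phr H)) (nu F H) (muP F H)"
 unfolding muP_def
proof (rule the_inverse[OF fibred_tensor.is_category[OF fibred_RepG]])
 note p = poly_Phi[OF CatA_Tob[OF F H]] poly_tensor[OF poly_Phi[OF F] poly_Phi[OF H]]
 show "phr (ften F H):Ob RG" "rtensor (phr F) (phr H):Ob RG" using p by simp_all
 show "is_iso RG (phr (ften F H)) (rtensor (phr F) (phr H)) (nu F H)"
  by (rule fibred_tensor.u_iso[OF fibred_RepG]) (use p nu_equivariant[OF F H] nu_bij[OF F H] in simp_all)
qed

lemma is_inverse_sym: "is_inverse C X Y f g ==> is_inverse C Y X g f"
 by (simp add: is_inverse_def)

lemma muP_iso: "pf F ==> pf H ==> is_iso RG (rtensor (phr F) (phr H)) (phr (ften F H)) (muP F H)"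
 unfolding is_iso_def by (rule exI, rule is_inverse_sym, rule muP_inverse)

lemma muP_hom: "pf F ==> pf H ==> muP F H:eqv (rtensor (phr F) (phr H)) (phr (ften F H))"
 using muP_inverse[of F H] unfolding is_inverse_def RepG_simps by simp

lemma muP_pure:
 assumes F: "pf F" and H: "pf H" and x: "x:car (FOb F (dg j))" and y: "y:car (FOb H (dg j))"
 shows "muP F H (pure (PF F) (PF H) (lF F j x) (lF H j y)) = lF (ften F H) j (pure (FOb F (dg j)) (FOb H (dg j)) x y)" (is "_ = ?z")
proof -
 have z: "?z:car (PF (ften F H))"
  by (rule lF_closed[OF CatA_Tob[OF F H]]) (simp add: pure_in[OF polyfunD(1)[OF F dg_Ob] polyfunD(1)[OF H dg_Ob] x y])
 have "cmp (PF (ften F H)) (muP F H) (nu F H) = lin_id (PF (ften F H))"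
  using muP_inverse[OF F H] unfolding is_inverse_def RepG_simps fst_conv by blast
 from fun_cong[OF this, of ?z] show ?thesis using z nu_pure[OF F H x y] by simp
qed

abbreviation iotaP :: "'u => 'u" where
 "iotaP == lF funit 0"

lemma lF_unit:
 assumes "x:car unit_sp"
 shows "lF funit j x = iotaP x"
 using lF_move[OF CatA_Unt, of 0 j x] assms by simp

lemma iotaP_hom: "iotaP:eqv runit (phr funit)"
proof (rule equivariantI; simp only: fst_conv snd_conv)
 show "iotaP:lin unit_sp (PF funit)" using lF_in[OF CatA_Unt, of 0] by simp
 fix g x assume g: "g:car G" and x: "x:car (unit_sp :: 'u vs)"
 obtain j where j: "g:GG_sub n V e (cst j)" using GG_sub_exists[OF g] by blast
 have "actF funit g (lF funit j x) = lF funit j x"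
  using actF_l_sub[OF CatA_Unt j, of x] x by simp
 thus "iotaP (lin_id unit_sp x) = Pa funit g (iotaP x)"
  using Phi_act_eq[OF CatA_Unt g] lF_unit[OF x, of j] x by simp
qed

lemma iotaP_iso: "is_iso RG runit (phr funit) iotaP"
proof (rule fibred_tensor.u_iso[OF fibred_RepG])
 show "bij_betw iotaP (car (fst runit)) (car (fst (phr funit)))"
  unfolding bij_betw_def fst_conv
 proof
  show "inj_on iotaP (car unit_sp)"
   by (rule inj_on_inverseI[where g = "outF funit (dg 0) (ret (dg 0))"]) (simp add: lF_inj[OF CatA_Unt])
  have "car (PF funit) <= iotaP ` car unit_sp"
  proof
   fix z assume z: "z:car (PF funit)"
   obtain j x where x: "x:car (FOb funit (dg j))" "z = lF funit j x" by (rule PF_elem[OF CatA_Unt z, of 0])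
   have "x:car unit_sp" using x(1) by simp
   thus "z:iotaP ` car unit_sp" unfolding x(2) lF_unit[OF \<open>x:car unit_sp\<close>, of j] by (rule imageI)
  qed
  thus "iotaP ` car unit_sp = car (PF funit)"
   using lF_closed[OF CatA_Unt, of _ 0] by auto
 qed
qed (use poly_unit poly_Phi[OF CatA_Unt] iotaP_hom in simp_all)

lemma Phi_map_linear:
 assumes F: "pf F" and H: "pf H"
 shows "linear_on (nat_trans_space n F H) ((lin_space (PF F) (PF H))<|eqv (phr F) (phr H)|>) (Pm F H)"
proof -
 have v: "vsp (nat_trans_space n F H)"
  by (rule nat_trans_space_vspace) (use F H in "simp_all add: polynomial_functor_iff")
 note lc = lin_space_closed[OF PF_vs[OF F] PF_vs[OF H]]
 note N = lin_closed[OF nat_transD(2)[OF _ dg_Ob]]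
 show ?thesis
 proof (rule linear_onI; simp only: nat_trans_space_simps(1))
  fix et ze c assume et: "et:NT n F H"
  note Pet = Phi_map_in[OF F H et]
  show "Pm F H et:car (lin_space (PF F) (PF H)<|eqv (phr F) (phr H)|>)"
   using Phi_map_equivariant[OF F H et] by simp
  have s: "c *[nat_trans_space n F H] et:NT n F H" using vs_smult[OF v, of et c] et by simp
  show "Pm F H (c *[nat_trans_space n F H] et)
   = c *[lin_space (PF F) (PF H)<|eqv (phr F) (phr H)|>] Pm F H et"
   by (rule Phi_map_eqI[OF F H s])
    (simp_all add: lc Pet lF_closed[OF F] Phi_map_l[OF F H et] lin_smult[OF lF_in[OF H]] N[OF et])
  assume ze: "ze:NT n F H"
  have a: "et +[nat_trans_space n F H] ze:NT n F H" using vs_add[OF v, of et ze] et ze by simp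
  show "Pm F H (et +[nat_trans_space n F H] ze)
   = Pm F H et +[lin_space (PF F) (PF H)<|eqv (phr F) (phr H)|>] Pm F H ze"
   by (rule Phi_map_eqI[OF F H a])
    (simp_all add: lc Pet Phi_map_in[OF F H ze] lF_closed[OF F] Phi_map_l[OF F H et] Phi_map_l[OF F H ze] lin_add[OF lF_in[OF H]] N[OF et] N[OF ze])
 qed
qed

end

lemma is_iso_hom: "is_iso C X Y f ==> f:Hom C X Y"
 by (auto simp: is_iso_def is_inverse_def)

context fibred_tensor
begin

text \<open>For a functor into a category with fibre functors the coherence conditions can be checked on pure tensors.\<close>

lemma tensor_functorI:
 fixes A :: "('p, 'k) tensor_cat" and F :: "('p, 'k, 'o, 'm) cfunctor"
 assumes A: "tensor_category A" and F: "cat_functor A C F"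
  and lin: "!!X Y. X:Ob A ==> Y:Ob A ==> linear_on (HomSp A X Y) (HomSp C (FOb F X) (FOb F Y)) (FMap F X Y)"
  and mu: "!!X Y. X:Ob A ==> Y:Ob A ==> is_iso C (FOb F X \<star> FOb F Y) (FOb F (Tob A X Y)) (\<mu> X Y)"
  and io: "is_iso C \<^bold>I (FOb F (Unt A)) \<iota>"
  and nat: "!!i X X' Y Y' f g x y. i:I ==> X:Ob A ==> X':Ob A ==> Y:Ob A ==> Y':Ob A ==>
   f:Hom A X X' ==> g:Hom A Y Y' ==> x:car (U i (FOb F X)) ==> y:car (U i (FOb F Y)) ==>
   u i (\<mu> X' Y') (pure (U i (FOb F X')) (U i (FOb F Y')) (u i (FMap F X X' f) x) (u i (FMap F Y Y' g) y))
   = u i (FMap F (Tob A X Y) (Tob A X' Y') (Tmor A X X' Y Y' f g)) (u i (\<mu> X Y) (pure (U i (FOb F X)) (U i (FOb F Y)) x y))"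
  and asc: "!!i X Y Z x y z. i:I ==> X:Ob A ==> Y:Ob A ==> Z:Ob A ==>
   x:car (U i (FOb F X)) ==> y:car (U i (FOb F Y)) ==> z:car (U i (FOb F Z)) ==>
   u i (FMap F (Tob A (Tob A X Y) Z) (Tob A X (Tob A Y Z)) (Asc A X Y Z))
    (u i (\<mu> (Tob A X Y) Z) (pure (U i (FOb F (Tob A X Y))) (U i (FOb F Z)) (u i (\<mu> X Y) (pure (U i (FOb F X)) (U i (FOb F Y)) x y)) z))
   = u i (\<mu> X (Tob A Y Z)) (pure (U i (FOb F X)) (U i (FOb F (Tob A Y Z))) x (u i (\<mu> Y Z) (pure (U i (FOb F Y)) (U i (FOb F Z)) y z)))"
  and lun: "!!i X x. i:I ==> X:Ob A ==> x:car (U i (FOb F X)) ==>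
   u i (FMap F (Tob A (Unt A) X) X (Lun A X)) (u i (\<mu> (Unt A) X) (pure (U i (FOb F (Unt A))) (U i (FOb F X)) (u i \<iota> unit_vec) x)) = x"
  and run: "!!i X x. i:I ==> X:Ob A ==> x:car (U i (FOb F X)) ==>
   u i (FMap F (Tob A X (Unt A)) X (Run A X)) (u i (\<mu> X (Unt A)) (pure (U i (FOb F X)) (U i (FOb F (Unt A))) x (u i \<iota> unit_vec))) = x"
  and swp: "!!i X Y x y. i:I ==> X:Ob A ==> Y:Ob A ==> x:car (U i (FOb F X)) ==> y:car (U i (FOb F Y)) ==>
   u i (FMap F (Tob A X Y) (Tob A Y X) (Swp A X Y)) (u i (\<mu> X Y) (pure (U i (FOb F X)) (U i (FOb F Y)) x y))
   = u i (\<mu> Y X) (pure (U i (FOb F Y)) (U i (FOb F X)) y x)"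
 shows "tensor_functor A C F \<mu> \<iota>"
proof (intro tensor_functor.intro tensor_functor_axioms.intro A F is_tensor_category lin mu io, goal_cases)
 interpret A: tensor_category A by (rule A)
 interpret F: cat_functor A C F by (rule F)
 note O = F.FOb_in and M = F.FMap_in
 note mh = is_iso_hom[OF mu] and ih = is_iso_hom[OF io]
 have ml: "u i (\<mu> X Y):lin (tensor (U i (FOb F X)) (U i (FOb F Y))) (U i (FOb F (Tob A X Y)))"
  if "i:I" "X:Ob A" "Y:Ob A" for i X Y
  using u_in[OF that(1) cl_Tob[OF O O] O mh, of X Y] that by (simp add: U_Tob A.Tob_in)
 have il: "u i \<iota>:lin unit_sp (U i (FOb F (Unt A)))" if "i:I" for i
  using u_in[OF that cl_Unt O ih] that by (simp add: U_Unt A.Unt_in)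
 note ss = cl us O M mh ih ml il u_in[OF _ O O M] A.Tob_in A.Unt_in A.Tmor_in A.Swp_in is_iso_hom[OF A.Asc_iso]
  is_iso_hom[OF A.Lun_iso] is_iso_hom[OF A.Run_iso]
 {
  case (5 X X' Y Y' f g)
  thus ?case
   by (intro hom_eq2[of "FOb F X" "FOb F Y" "FOb F (Tob A X' Y')"]) (simp_all add: ss nat)
 next
  case (6 X Y Z)
  thus ?case
   by (intro hom_eq3[of "FOb F X" "FOb F Y" "FOb F Z" "FOb F (Tob A X (Tob A Y Z))"]) (simp_all add: ss asc)
 next
  case (7 X)
  thus ?case by (intro hom_eq_lunit[of "FOb F X" "FOb F X"]) (simp_all add: ss lun)
 next
  case (8 X)
  thus ?case by (intro hom_eq_runit[of "FOb F X" "FOb F X"]) (simp_all add: ss run)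
 next
  case (9 X Y)
  thus ?case by (intro hom_eq2[of "FOb F X" "FOb F Y" "FOb F (Tob A Y X)"]) (simp_all add: ss swp)
 }
qed

end

context flagged_space
begin

lemma tensor_functor_Phi: "tensor_functor (CatA n) RG PH muP iotaP"
proof ((rule fibred_tensor.tensor_functorI[OF fibred_RepG tensor_category_CatA functor_Phi];
  (simp only: CatA_simps(1,2,5-7) RepG_simps Phi_simps mem_Collect_eq fst_conv)?), goal_cases)
 note D = polyfunD(1)[OF _ dg_Ob]
 note cA = fibred_tensor.cl[OF fibred_CatA[of n]]
 {
  case (1 X Y)
  thus ?case by (rule Phi_map_linear)
 next
  case (2 X Y)
  thus ?case using muP_iso[of X Y] by simp
 next
  case 3
  show ?case by (rule iotaP_iso)
 next
  case (4 i X X' Y Y' f g x y)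
  note p = 4(2-5) and h = 4(6,7) and x = 4(8) and y = 4(9)
  obtain j v w where v: "v:car (FOb X (dg j))" "x = lF X j v" and w: "w:car (FOb Y (dg j))" "y = lF Y j w"
   by (rule common_stage2[OF p(1,3) x y])
  have t: "Tmor (CatA n) X X' Y Y' f g:NT n (ften X Y) (ften X' Y')"
   using cA(5)[of X X' Y Y' f g] p h by simp
  note N = nat_transD(2)[OF h(1) dg_Ob] nat_transD(2)[OF h(2) dg_Ob]
  show ?case
   unfolding v(2) w(2) Phi_map_l[OF p(1,2) h(1) v(1)] Phi_map_l[OF p(3,4) h(2) w(1)] muP_pure[OF p(1,3) v(1) w(1)]
    muP_pure[OF p(2,4) lin_closed[OF N(1) v(1)] lin_closed[OF N(2) w(1)]]
   using Phi_map_l[OF CatA_Tob[OF p(1,3)] CatA_Tob[OF p(2,4)] t, of "pure (FOb X (dg j)) (FOb Y (dg j)) v w" j] D p v(1) w(1) N by simp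
 next
  case (5 i X Y Z x y z)
  note p = 5(2-4) and x = 5(5) and y = 5(6) and z = 5(7)
  obtain j v w t where v: "v:car (FOb X (dg j))" "x = lF X j v" and w: "w:car (FOb Y (dg j))" "y = lF Y j w"
   and t: "t:car (FOb Z (dg j))" "z = lF Z j t"
   by (rule common_stage3[OF p x y z])
  note T = CatA_Tob[OF p(1,2)] CatA_Tob[OF p(2,3)]
  have a: "Asc (CatA n) X Y Z:NT n (ften (ften X Y) Z) (ften X (ften Y Z))"
   using cA(6)[of X Y Z] p by simp
  have vw: "pure (FOb X (dg j)) (FOb Y (dg j)) v w:car (FOb (ften X Y) (dg j))"
   and wt: "pure (FOb Y (dg j)) (FOb Z (dg j)) w t:car (FOb (ften Y Z) (dg j))"
   using D p v w t by simp_all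
  show ?case
   unfolding v(2) w(2) t(2) muP_pure[OF p(1,2) v(1) w(1)] muP_pure[OF p(2,3) w(1) t(1)] muP_pure[OF T(1) p(3) vw t(1)] muP_pure[OF p(1) T(2) v(1) wt]
   using Phi_map_l[OF CatA_Tob[OF T(1) p(3)] CatA_Tob[OF p(1) T(2)] a, of "pure (tensor (FOb X (dg j)) (FOb Y (dg j))) (FOb Z (dg j)) (pure (FOb X (dg j)) (FOb Y (dg j)) v w) t" j]
    D p v(1) w(1) t(1) by simp
 next
  case (6 i X x)
  note p = 6(2) and x = 6(3)
  obtain j v where v: "v:car (FOb X (dg j))" "x = lF X j v" by (rule PF_elem[OF p x, of 0])
  have a: "Lun (CatA n) X:NT n (ften funit X) X" using cA(7)[of X] p by simp
  have uv: "unit_vec:car (FOb funit (dg j))" by simp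
  show ?case
   unfolding v(2) lF_unit[OF unit_vec_in, of j, symmetric] muP_pure[OF CatA_Unt p uv v(1)]
   using Phi_map_l[OF CatA_Tob[OF CatA_Unt p] p a, of "pure unit_sp (FOb X (dg j)) unit_vec v" j] D p v(1) by simp
 next
  case (7 i X x)
  note p = 7(2) and x = 7(3)
  obtain j v where v: "v:car (FOb X (dg j))" "x = lF X j v" by (rule PF_elem[OF p x, of 0])
  have a: "Run (CatA n) X:NT n (ften X funit) X" using cA(8)[of X] p by simp
  have uv: "unit_vec:car (FOb funit (dg j))" by simp
  show ?case
   unfolding v(2) lF_unit[OF unit_vec_in, of j, symmetric] muP_pure[OF p CatA_Unt v(1) uv]
   using Phi_map_l[OF CatA_Tob[OF p CatA_Unt] p a, of "pure (FOb X (dg j)) unit_sp v unit_vec" j] D p v(1) by simp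
 next
  case (8 i X Y x y)
  note p = 8(2,3) and x = 8(4) and y = 8(5)
  obtain j v w where v: "v:car (FOb X (dg j))" "x = lF X j v" and w: "w:car (FOb Y (dg j))" "y = lF Y j w"
   by (rule common_stage2[OF p x y])
  have a: "Swp (CatA n) X Y:NT n (ften X Y) (ften Y X)" using cA(9)[of X Y] p by simp
  show ?case
   unfolding v(2) w(2) muP_pure[OF p v(1) w(1)] muP_pure[OF p(2,1) w(1) v(1)]
   using Phi_map_l[OF CatA_Tob[OF p] CatA_Tob[OF p(2,1)] a, of "pure (FOb X (dg j)) (FOb Y (dg j)) v w" j] D p v(1) w(1) by simp
 }
qed

end

section \<open>From representations to functors\<close>

context flagged_space
begin

abbreviation pX :: "'u flag => 'u => 'u" where
 "pX X == proj (ixa (tp X))"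

abbreviation IV :: "'u rep => 'u flag => 'u vs" where
 "IV R X == invariants n V e R (tp X)"

text \<open>The endomorphism of \<open>V\<close> by which a flag map \<open>X \<rightarrow> Y\<close> acts on invariants.\<close>

definition via :: "'u flag => 'u flag => ('u => 'u) => 'u => 'u" where
 "via X Y f = (\<lambda>v\<in>car V. emb Y (f (ret X v)))"

lemma emb_lin: "X:Fl n ==> emb X:lin (fst X) V"
 and ret_lin: "X:Fl n ==> ret X:lin V (fst X)"
 using flag_linD(1)[OF emb_flag] flag_linD(1)[OF ret_flag] by (simp_all add: big_flag_eq)

lemma via_flag:
 assumes X: "X:Fl n" and Y: "Y:Fl n" and f: "f:FL n X Y"
 shows "via X Y f:FL n big big"
proof -
 have "cmp V (emb Y) (cmp V f (ret X)):FL n big big"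
  using flag_lin_compose[OF is_flag_big flag_lin_compose[OF is_flag_big ret_flag[OF X] f] emb_flag[OF Y]]
  by (simp add: big_flag_eq)
 moreover have "cmp V (emb Y) (cmp V f (ret X)) = via X Y f"
  by (auto simp: compose_def via_def intro!: restrict_ext)
 ultimately show ?thesis by simp
qed

lemma emb_proj: "X:Fl n ==> x:car (fst X) ==> pX X (emb X x) = emb X x"
 by (rule proj_id[OF emb_std])

lemma ret_proj: "X:Fl n ==> v:car V ==> ret X (pX X v) = ret X v"
 using emb_ret[of X v] ret_emb[of X "ret X v"] lin_closed[OF ret_lin, of X v] by simp

lemma via_id: "X:Fl n ==> v:car V ==> via X X (lin_id (fst X)) v = pX X v"
 using lin_closed[OF ret_lin, of X v] emb_ret[of X v] by (simp add: via_def)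

lemma via_closed: "X:Fl n ==> Y:Fl n ==> f:FL n X Y ==> v:car V ==> via X Y f v:sub (ixa (tp Y))"
 using emb_std[of Y] lin_closed[OF flag_linD(1), of f n X Y "ret X v"] lin_closed[OF ret_lin, of X v] by (simp add: via_def)

lemma via_compose:
 assumes X: "X:Fl n" and Y: "Y:Fl n" and Z: "Z:Fl n" and f: "f:FL n X Y" and g: "g:FL n Y Z"
 shows "cmp V (via Y Z g) (via X Y f) = via X Z (cmp (fst X) g f)"
proof -
 have "via Y Z g (via X Y f v) = via X Z (cmp (fst X) g f) v" if v: "v:car V" for v
  using v lin_closed[OF ret_lin[OF X] v] lin_closed[OF flag_linD(1)[OF f] lin_closed[OF ret_lin[OF X] v]] lin_closed[OF emb_lin[OF Y]]
  by (simp add: via_def ret_emb[OF Y])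
 thus ?thesis
  by (intro lin_eqI[OF lin_compose[OF V_vs EndV_lin[OF via_flag[OF X Y f]] EndV_lin[OF via_flag[OF Y Z g]]]
    EndV_lin[OF via_flag[OF X Z flag_lin_compose[OF ObD(1)[OF X] f g]]]]) simp
qed

text \<open>The blocks of \<open>h\<close> are the identity on the first \<open>b i\<close> coordinates.\<close>

lemma HH_fix:
 assumes h: "h:HH n V e b" and v: "v:sub (ixa b)"
 shows "h v = v"
proof -
 have hl: "h:lin V V" using h by (simp add: HH_def GG_def)
 have hb: "h (bas x) = bas x" if x: "x:ixa b" for x
 proof -
  obtain k q where kq: "x = (k, q)" by (cases x)
  have b: "1 <= k" "k <= n" "1 <= q" "q <= b k" using x by (auto simp: kq ixa_def)
  have xi: "x:ix" using x ixa_ix by blast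
  show ?thesis
  proof (rule coord_eqI)
   show "h (bas x):car V" "bas x:car V" using xi lin_closed[OF hl] by auto
   fix y assume y: "y:ix"
   obtain i p where ip: "y = (i, p)" by (cases y)
   have i: "1 <= i" "i <= n" "1 <= p" using y by (simp_all add: ip ix_iff)
   have "ALL i:{1..n}. ALL k:{1..n}. ALL p>=1. ALL q>=1. (i ~= k --> block n V e h i k p q = 0) \<and>
    (i = k & (p <= b i | q <= b i) --> block n V e h i k p q = (if p = q then 1 else 0))"
    using h unfolding HH_def by blast
   moreover have "i:{1..n}" "k:{1..n}" using b i by simp_all
   ultimately have "(i ~= k --> block n V e h i k p q = 0) \<and>
    (i = k & (p <= b i | q <= b i) --> block n V e h i k p q = (if p = q then 1 else 0))"
    using b(3) i(3) by blast
   hence "block n V e h i k p q = (if i = k & p = q then 1 else 0)"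
    using b(4) by auto
   moreover have "cd (bas x) y = (if i = k & p = q then 1 else 0)"
    using coord_bas[OF xi] by (auto simp: kq ip)
   ultimately show "cd (h (bas x)) y = cd (bas x) y" by (simp add: block_eq kq ip)
  qed
 qed
 have "h (proj (ixa b) v) = proj (ixa b) v"
 proof (rule lin_eq_V2[OF hl proj_in proj_in])
  show "h (proj (ixa b) (bas x)) = proj (ixa b) (bas x)" if "x:ix" for x
   using that hb lin_zero[OF V_vs V_vs hl] by (simp add: proj_bas)
 qed (use v sub_in in blast)
 thus ?thesis using proj_id[OF v] by simp
qed

text \<open>The extension by zero is a lift, since \<open>H\<^sub>b\<close> fixes \<open>\<complex>\<^sup>b\<close> pointwise.\<close>

lemma lift_exists:
 assumes f: "f:FL n (std a) (std b)"
 shows "is_lift n V e a b f (\<lambda>v\<in>car V. f (proj (ixa a) v))" (is "is_lift n V e a b f ?g")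
 unfolding is_lift_def
proof (intro conjI ballI)
 have fl: "f v:sub (ixa b)" if "v:sub (ixa a)" for v
  using lin_closed[OF flag_linD(1)[OF f], of v] that by (simp add: std_flag_eq)
 have pr: "proj (ixa a):FL n big (std a)"
  using flag_std_iff[OF is_flag_big] EndV_proj proj_sub by (simp add: big_flag_eq)
 have "cmp V f (proj (ixa a)):FL n big (std b)"
  using flag_lin_compose[OF is_flag_big pr f] by (simp add: big_flag_eq)
 thus "?g:EndV n V e" using flag_std_iff[OF is_flag_big] by (simp add: EndV_eq compose_def)
 show "?g x = f x" if "x:car (fst (std a))" for x
  using that by (simp add: std_flag_eq proj_id sub_in)
 fix h assume h: "h:HH n V e b"
 have id: "hcurve a 0 1 v = v" if "v:car V" for v
  using lin_eq_V[OF hcurve_lin lin_id_in[OF V_vs] _ that, of a 0 1] that by (simp add: hcurve_bas)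
 show "EX h':HH n V e a. ALL v:car V. h (?g v) = ?g (h' v)"
  using HH_fix[OF h fl] proj_sub by (intro bexI[OF _ hcurve_H[of 1 a 0]]) (simp_all add: id)
qed

lemma IV_iff: "poly R ==> m:car (IV R X) \<longleftrightarrow> m:car (fst R) & act R (pX X) m = m"
 by (simp add: invariants_eq)

lemma IV_ops [simp]:
 "x +[invariants n V e R a] y = x +[fst R] y" "c *[invariants n V e R a] x = c *[fst R] x" "0[invariants n V e R a] = 0[fst R]"
 by (simp_all add: invariants_def)

lemma IV_eq: "IV R X = fst R<|car (IV R X)|>"
 by (simp add: invariants_def)

lemma IV_sub:
 assumes R: "poly R"
 shows "submodule (car (IV R X)) CC (fst R)"
 using submodule_eqset[OF polyD(1)[OF R] polyD(1)[OF R] act_in[OF R EndV_proj] linear_on_ident]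
 by (simp add: invariants_eq[OF R])

lemma IV_vs [simp]: "poly R ==> vsp (IV R X)"
 using submodule_vspace[OF polyD(1) IV_sub] by (simp add: IV_eq[symmetric])

lemma IV_in: "poly R ==> m:car (IV R X) ==> m:car (fst R)"
 by (simp add: IV_iff)

lemma IV_incl: "poly R ==> lin_id (IV R X):lin (IV R X) (fst R)"
 using lin_id_sub[OF polyD(1) IV_sub] by (simp add: IV_eq[symmetric])

lemma act_via_IV:
 assumes R: "poly R" and X: "X:Fl n" and Y: "Y:Fl n" and f: "f:FL n X Y" and m: "m:car (fst R)"
 shows "act R (via X Y f) m:car (IV R Y)"
proof -
 note v = via_flag[OF X Y f]
 have "act R (pX Y) (act R (via X Y f) m) = act R (cmp V (pX Y) (via X Y f)) m"
  by (rule act_compose[OF R v EndV_proj m])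
 also have "cmp V (pX Y) (via X Y f) = via X Y f"
  using via_closed[OF X Y f] by (auto simp: compose_def via_def proj_id intro!: restrict_ext)
 finally show ?thesis using act_closed[OF R v m] by (simp add: IV_iff[OF R])
qed

lemma Psi_simps [simp]:
 "FOb PS = Psi_ob n V e" "FOb (Psi_ob n V e R) X = IV R X"
 "FMap PS R R' ze = (\<lambda>X\<in>Fl n. restrict ze (car (IV R X)))"
 by (simp_all add: Psi_def Psi_ob_def)

text \<open>Any lift \<open>g\<close> gives the same map: an invariant vector is fixed by
 \<open>\<pi>\<^sub>a\<close>, and \<open>g \<circ> \<pi>\<^sub>a\<close> depends only on the restriction of
 \<open>g\<close> to \<open>\<complex>\<^sup>a\<close>.\<close>

lemma Psi_FMap:
 assumes R: "poly R" and X: "X:Fl n" and Y: "Y:Fl n" and f: "f:FL n X Y"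
 shows "FMap (Psi_ob n V e R) X Y f = restrict (act R (via X Y f)) (car (IV R X))"
proof -
 let ?t = "transport n V e X Y f"
 define g where "g = (SOME g. is_lift n V e (tp X) (tp Y) ?t g)"
 have g: "is_lift n V e (tp X) (tp Y) ?t g"
  unfolding g_def by (rule someI[where P = "is_lift n V e (tp X) (tp Y) ?t"], rule lift_exists[OF transport_flag[OF X Y f]])
 hence gE: "g:FL n big big" and gf: "!!x. x:sub (ixa (tp X)) ==> g x = ?t x"
  by (simp_all add: is_lift_def EndV_eq std_flag_eq)
 have "act R g m = act R (via X Y f) m" if m: "m:car (IV R X)" for m
 proof -
  have m': "m:car (fst R)" "act R (pX X) m = m" using m by (simp_all add: IV_iff[OF R])
  have "act R g m = act R g (act R (pX X) m)" using m' by simp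
  also have "... = act R (cmp V g (pX X)) m" by (rule act_compose[OF R EndV_proj gE m'(1)])
  also have "cmp V g (pX X) = via X Y f"
   unfolding compose_def via_def by (rule restrict_ext)
    (simp add: gf proj_sub transport_eq[OF X Y f] ret_proj[OF X])
  finally show ?thesis .
 qed
 thus ?thesis unfolding Psi_ob_def Psi_std_def g_def[symmetric] cfunctor.simps by (rule restrict_ext)
qed

lemma Psi_FMap_apply:
 assumes "poly R" "X:Fl n" "Y:Fl n" "f:FL n X Y" "m:car (IV R X)"
 shows "FMap (Psi_ob n V e R) X Y f m = act R (via X Y f) m"
 using Psi_FMap[OF assms(1-4)] assms(5) by simp

text \<open>If \<open>R\<close> is presented by \<open>p\<close> on \<open>S\<close>, then \<open>\<Psi>
 R\<close> is presented at \<open>X\<close> by \<open>p\<close> on the preimage of \<open>S\<close> under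
 \<open>emb X\<close>; \<open>ret X\<close> provides preimages of invariant vectors. As \<open>X\<close> is
 finite dimensional, so are the invariants.\<close>

lemma Psi_poly:
 assumes R: "poly R"
 shows "pf (Psi_ob n V e R)"
proof -
 obtain k a S p where P: "presentation n V e R k a S p" and pr: "pres V k a S p (fst R)" using polyE[OF R] .
 note vR = polyD(1)[OF R]
 note pd = presD[OF pr V_vs]
 define T where "T X = {y:car (tsum (fst X) k a). tmap (fst X) V k a (emb X) y:S}" for X
 define q where "q X y = p (tmap (fst X) V k a (emb X) y)" for X y
 have pX: "pres (fst X) k a (T X) (q X) (IV R X)" if X: "X:Fl n" for X
  unfolding pres_def
 proof (intro conjI)
  note vX = ObD(2)[OF X]
  note el = linear_on_tsum_map[OF vX V_vs emb_lin[OF X], of k a]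
  show sT: "submodule (T X) CC (tsum (fst X) k a)"
   unfolding T_def by (rule submodule_preimage[OF tsum_vspace[OF vX] tsum_vspace[OF V_vs] el pd(1)])
  have TS: "tmap (fst X) V k a (emb X) y:S" "y:car (tsum (fst X) k a)" if "y:T X" for y using that by (simp_all add: T_def)
  have inv: "q X y:car (IV R X)" if y: "y:T X" for y
  proof -
   have "act R (pX X) (q X y) = p (tmap V V k a (pX X) (tmap (fst X) V k a (emb X) y))"
    unfolding q_def by (rule act_eq[OF P TS(1)[OF y] EndV_proj])
   also have "tmap V V k a (pX X) (tmap (fst X) V k a (emb X) y) = tmap (fst X) V k a (cmp (fst X) (pX X) (emb X)) y"
    using tsum_map_compose[OF vX V_vs V_vs emb_lin[OF X] proj_in[of "ixa (tp X)"] TS(2)[OF y]] by simp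
   also have "cmp (fst X) (pX X) (emb X) = emb X"
    by (rule lin_eqI[OF lin_compose[OF vX emb_lin[OF X] proj_in] emb_lin[OF X]]) (simp add: emb_proj[OF X])
   finally show ?thesis using pd(5)[OF TS(1)[OF y]] by (simp add: IV_iff[OF R] q_def)
  qed
  have eT: "linear_on (tsum (fst X) k a<|T X|>) (tsum V k a<|S|>) (tmap (fst X) V k a (emb X))"
   using linear_on_sub[OF tsum_vspace[OF vX] sT el] TS(1) by (simp add: linear_on_def Pi_iff)
  have l: "linear_on (tsum (fst X) k a<|T X|>) (fst R) (q X)"
   unfolding q_def by (rule lin_comp[OF eT pd(2)])
  show "linear_on (tsum (fst X) k a<|T X|>) (IV R X) (q X)"
   using l inv by (simp add: linear_on_def Pi_iff)
  show "q X ` T X = car (IV R X)"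
  proof (intro equalityI image_subsetI subsetI)
   fix m assume m: "m:car (IV R X)"
   have m': "m:car (fst R)" "act R (pX X) m = m" using m by (simp_all add: IV_iff[OF R])
   obtain s where s: "s:S" "m = p s" using m'(1) pd(3) by blast
   define y where "y = tmap V (fst X) k a (ret X) s"
   note sc = pd(4)[OF s(1)]
   have yc: "y:car (tsum (fst X) k a)" unfolding y_def by (rule tsum_map_closed[OF V_vs vX ret_lin[OF X] sc])
   have "cmp V (emb X) (ret X) = pX X"
    by (rule lin_eqI[OF lin_compose[OF V_vs ret_lin[OF X] emb_lin[OF X]] proj_in]) (simp add: emb_ret[OF X])
   hence e: "tmap (fst X) V k a (emb X) y = tmap V V k a (pX X) s"
    using tsum_map_compose[OF V_vs vX V_vs ret_lin[OF X] emb_lin[OF X] sc] by (simp add: y_def)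
   have "y:T X" using yc e pres_curve(1)[OF P s(1) EndV_proj] by (simp add: T_def)
   moreover have "q X y = m" using e act_eq[OF P s(1) EndV_proj, of "ixa (tp X)"] s(2) m'(2) by (simp add: q_def)
   ultimately show "m:q X ` T X" by (intro image_eqI[where x = y]) simp_all
  qed (rule inv)
 qed
 have fp: "fpres n (Psi_ob n V e R) k a T q"
  unfolding fpres_def
 proof (intro conjI ballI)
  show "pres (fst X) k a (T X) (q X) (FOb (Psi_ob n V e R) X)" if "X:Fl n" for X using pX[OF that] by simp
  fix X Y :: "'u flag" and f y assume X: "X:Fl n" and Y: "Y:Fl n" and f: "f:FL n X Y" and y: "y:T X"
  note vX = ObD(2)[OF X] and vY = ObD(2)[OF Y] and v = via_flag[OF X Y f] and fl = flag_linD(1)[OF f]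
  have yc: "y:car (tsum (fst X) k a)" and yS: "tmap (fst X) V k a (emb X) y:S" using y by (simp_all add: T_def)
  have c: "cmp (fst X) (emb Y) f = cmp (fst X) (via X Y f) (emb X)"
   unfolding compose_def by (rule restrict_ext) (use lin_closed[OF emb_lin[OF X]] ret_emb[OF X] in "simp add: via_def")
  have e: "tmap (fst Y) V k a (emb Y) (tmap (fst X) (fst Y) k a f y) = tmap V V k a (via X Y f) (tmap (fst X) V k a (emb X) y)"
   using tsum_map_compose[OF vX vY V_vs fl emb_lin[OF Y] yc] tsum_map_compose[OF vX V_vs V_vs emb_lin[OF X] EndV_lin[OF v] yc] c by simp
  have "tmap (fst X) (fst Y) k a f y:car (tsum (fst Y) k a)" by (rule tsum_map_closed[OF vX vY fl yc])
  thus "tmap (fst X) (fst Y) k a f y:T Y"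
   using e pres_curve(1)[OF P yS v] by (simp add: T_def)
  have "q X y:car (IV R X)" using pX[OF X] y by (auto simp: pres_def)
  thus "q Y (tmap (fst X) (fst Y) k a f y) = FMap (Psi_ob n V e R) X Y f (q X y)"
   using e act_eq[OF P yS v] Psi_FMap_apply[OF R X Y f] by (simp add: q_def)
 qed
 have "cat_functor (Flag n) Vect (Psi_ob n V e R)"
 proof (rule cat_functor_VectI)
  fix X Y Z :: "'u flag" and f g assume X: "X:Fl n"
  note vX = ObD(2)[OF X]
  have fd: "fin_dim (tsum (fst X) k a)" by (rule fin_dim_tsum[OF vX]) (use X in "simp add: Flag_def")
  note pp = pX[OF X, unfolded pres_def]
  have "fin_dim (IV R X)"
   by (rule fin_dim_image[OF submodule_vspace[OF tsum_vspace[OF vX] conjunct1[OF pp]] IV_vs[OF R] conjunct1[OF conjunct2[OF pp]] _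
    fin_dim_submodule[OF tsum_vspace[OF vX] conjunct1[OF pp] fd]]) (use pp in simp)
  thus "vsp (FOb (Psi_ob n V e R) X) & fin_dim (FOb (Psi_ob n V e R) X)" using R by simp
  show "FMap (Psi_ob n V e R) X X (lin_id (fst X)) = lin_id (FOb (Psi_ob n V e R) X)"
  proof -
   have i: "lin_id (fst X):FL n X X" by (rule flag_lin_id[OF ObD(1)[OF X]])
   have "act R (via X X (lin_id (fst X))) = act R (pX X)"
    by (rule act_cong[OF R via_flag[OF X X i] EndV_proj via_id[OF X]])
   thus ?thesis unfolding Psi_FMap[OF R X X i] by (auto simp: lin_id_def IV_iff[OF R] intro!: restrict_ext)
  qed
  assume Y: "Y:Fl n" and f: "f:FL n X Y"
  show "FMap (Psi_ob n V e R) X Y f:lin (FOb (Psi_ob n V e R) X) (FOb (Psi_ob n V e R) Y)"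
   unfolding Psi_FMap[OF R X Y f] Psi_simps
  proof (rule linI[OF IV_vs[OF R]])
   show "linear_on (IV R X) (IV R Y) (act R (via X Y f))"
    by (rule linear_onI) (simp_all add: act_via_IV[OF R X Y f] IV_in[OF R] linear_onD[OF act_in[OF R via_flag[OF X Y f]]])
  qed
  assume Z: "Z:Fl n" and g: "g:FL n Y Z"
  have gf: "cmp (fst X) g f:FL n X Z" by (rule flag_lin_compose[OF ObD(1)[OF X] f g])
  show "FMap (Psi_ob n V e R) X Z (cmp (fst X) g f) = cmp (FOb (Psi_ob n V e R) X) (FMap (Psi_ob n V e R) Y Z g) (FMap (Psi_ob n V e R) X Y f)"
   unfolding Psi_FMap[OF R X Z gf] Psi_FMap[OF R X Y f] Psi_FMap[OF R Y Z g] Psi_simps compose_def[of "car (IV R X)"]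
  proof (rule restrict_ext)
   fix m assume m: "m:car (IV R X)"
   show "act R (via X Z (cmp (fst X) g f)) m = restrict (act R (via Y Z g)) (car (IV R Y)) (restrict (act R (via X Y f)) (car (IV R X)) m)"
    using m act_via_IV[OF R X Y f IV_in[OF R m]] act_compose[OF R via_flag[OF X Y f] via_flag[OF Y Z g] IV_in[OF R m]] via_compose[OF X Y Z f g] by simp
  qed
 qed
 thus ?thesis using fp unfolding polynomial_functor_iff by blast
qed

lemma Psi_nat_trans:
 assumes R: "poly R" and Q: "poly Q" and ze: "ze:eqv R Q"
 shows "(\<lambda>X\<in>Fl n. restrict ze (car (IV R X))):NT n (Psi_ob n V e R) (Psi_ob n V e Q)"
proof (rule nat_transI)
 note l = equivariantD(1)[OF ze]
 have inv: "ze m:car (IV Q X)" if "m:car (IV R X)" for m X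
  using that act_equivariant[OF R Q ze EndV_proj, of m "ixa (tp X)"] lin_closed[OF l] by (simp add: IV_iff[OF R] IV_iff[OF Q])
 show "(\<lambda>X\<in>Fl n. restrict ze (car (IV R X))) X:lin (FOb (Psi_ob n V e R) X) (FOb (Psi_ob n V e Q) X)" if "X:Fl n" for X
 proof -
  have "linear_on (IV R X) (IV Q X) ze"
   by (rule linear_onI) (simp_all add: inv IV_in[OF R] lin_add[OF l] lin_smult[OF l])
  thus ?thesis using that linI[OF IV_vs[OF R]] by simp
 qed
 fix X Y f m assume X: "X:Fl n" and Y: "Y:Fl n" and f: "f:FL n X Y" and m': "m:car (FOb (Psi_ob n V e R) X)"
 have m: "m:car (IV R X)" using m' by simp
 show "(\<lambda>X\<in>Fl n. restrict ze (car (IV R X))) Y (FMap (Psi_ob n V e R) X Y f m) = FMap (Psi_ob n V e Q) X Y f ((\<lambda>X\<in>Fl n. restrict ze (car (IV R X))) X m)"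
  using X Y m inv[OF m] Psi_FMap_apply[OF R X Y f m] Psi_FMap_apply[OF Q X Y f inv[OF m]] act_via_IV[OF R X Y f IV_in[OF R m]]
   act_equivariant[OF R Q ze via_flag[OF X Y f] IV_in[OF R m]] by simp
qed simp

lemma functor_Psi: "cat_functor RG (CatA n) PS"
proof (intro cat_functor.intro cat_functor_axioms.intro; (simp only: CatA_simps RepG_simps Psi_simps mem_Collect_eq)?)
 show "category (CatA n :: ('u flagfun, 'u flag => 'u => 'u) tensor_cat)" by (rule fibred_tensor.is_category[OF fibred_CatA])
 show "category RG" by (rule fibred_tensor.is_category[OF fibred_RepG])
 fix R Q P :: "'u rep" and f g
 show "pf (Psi_ob n V e R)" if "poly R" by (rule Psi_poly[OF that])
 show "(\<lambda>X\<in>Fl n. restrict f (car (IV R X))):NT n (Psi_ob n V e R) (Psi_ob n V e Q)"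
  if "poly R" "poly Q" "f:eqv R Q" by (rule Psi_nat_trans[OF that])
 show "(\<lambda>X\<in>Fl n. restrict (lin_id (fst R)) (car (IV R X))) = (\<lambda>X\<in>Fl n. lin_id (IV R X))" if R: "poly R"
  by (intro restrict_ext) (auto simp: lin_id_def IV_in[OF R] intro!: restrict_ext)
 show "(\<lambda>X\<in>Fl n. restrict (cmp (fst R) g f) (car (IV R X)))
  = (\<lambda>X\<in>Fl n. cmp (IV R X) ((\<lambda>X\<in>Fl n. restrict g (car (IV Q X))) X) ((\<lambda>X\<in>Fl n. restrict f (car (IV R X))) X))"
  if R: "poly R" and Q: "poly Q" and f: "f:eqv R Q"
 proof (intro restrict_ext)
  fix X :: "'u flag" assume X: "X:Fl n"
  have "f m:car (IV Q X)" if "m:car (IV R X)" for m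
   using lin_closed[OF nat_transD(2)[OF Psi_nat_trans[OF R Q f] X], of m] that X by simp
  thus "restrict (cmp (fst R) g f) (car (IV R X)) = cmp (IV R X) ((\<lambda>X\<in>Fl n. restrict g (car (IV Q X))) X) ((\<lambda>X\<in>Fl n. restrict f (car (IV R X))) X)"
   using X by (auto simp: compose_def IV_in[OF R] intro!: restrict_ext)
 qed
qed

end

context flagged_space
begin

subsection \<open>Invariants of a tensor product\<close>

abbreviation pso :: "'u rep => 'u flagfun" where
 "pso R == Psi_ob n V e R"

definition muI :: "'u rep => 'u rep => 'u flag => 'u => 'u" where
 "muI R Q X = tensor_map (IV R X) (fst R) (IV Q X) (fst Q) (lin_id (IV R X)) (lin_id (IV Q X))"

lemma muI_pure:
 assumes R: "poly R" and Q: "poly Q" and r: "r:car (IV R X)" and q: "q:car (IV Q X)"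
 shows "muI R Q X (pure (IV R X) (IV Q X) r q) = pure (fst R) (fst Q) r q"
 using tensor_map_pure[OF IV_vs[OF R] polyD(1)[OF R] IV_vs[OF Q] polyD(1)[OF Q] IV_incl[OF R] IV_incl[OF Q] r q] r q
 by (simp add: muI_def)

lemma muI_lin0:
 assumes R: "poly R" and Q: "poly Q"
 shows "muI R Q X:lin (tensor (IV R X) (IV Q X)) (tensor (fst R) (fst Q))"
 unfolding muI_def by (rule tensor_map_in[OF IV_vs[OF R] polyD(1)[OF R] IV_vs[OF Q] polyD(1)[OF Q] IV_incl[OF R] IV_incl[OF Q]])

lemma pure_IV:
 assumes R: "poly R" and Q: "poly Q" and r: "r:car (IV R X)" and q: "q:car (IV Q X)"
 shows "pure (fst R) (fst Q) r q:car (IV (rtensor R Q) X)"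
 using act_tensor[OF R Q EndV_proj, of r q "ixa (tp X)"] r q pure_in[OF polyD(1)[OF R] polyD(1)[OF Q]]
 by (simp add: IV_iff[OF R] IV_iff[OF Q] IV_iff[OF poly_tensor[OF R Q]])

lemma muI_in:
 assumes R: "poly R" and Q: "poly Q"
 shows "muI R Q X:lin (tensor (IV R X) (IV Q X)) (IV (rtensor R Q) X)"
proof -
 note T = poly_tensor[OF R Q]
 note v = tensor_vspace[OF IV_vs[OF R] IV_vs[OF Q]]
 have "car (tensor (IV R X) (IV Q X)) <= {t:car (tensor (IV R X) (IV Q X)). muI R Q X t:car (IV (rtensor R Q) X)}"
 proof (rule tensor_generated[OF IV_vs[OF R] IV_vs[OF Q]])
  show "submodule {t:car (tensor (IV R X) (IV Q X)). muI R Q X t:car (IV (rtensor R Q) X)} CC (tensor (IV R X) (IV Q X))"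
   using submodule_preimage[OF v polyD(1)[OF T] _ IV_sub[OF T]] linD[OF muI_lin0[OF R Q]] by simp
 qed (simp add: muI_pure[OF R Q] pure_IV[OF R Q] IV_vs[OF R] IV_vs[OF Q])
 hence "muI R Q X:lin (tensor (IV R X) (IV Q X)) (tensor (fst R) (fst Q)<|car (IV (rtensor R Q) X)|>)"
  by (intro lin_corestrict[OF muI_lin0[OF R Q]]) blast
 thus ?thesis using IV_eq[of "rtensor R Q" X] by simp
qed

text \<open>The inverse is induced by the projections onto the invariants, that is by the action of \<open>\<pi>\<^sub>a\<close>.\<close>

lemma muI_bij:
 assumes R: "poly R" and Q: "poly Q"
 shows "bij_betw (muI R Q X) (car (tensor (IV R X) (IV Q X))) (car (IV (rtensor R Q) X))"
proof -
 note T = poly_tensor[OF R Q]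
 note v = IV_vs[OF R, of X] IV_vs[OF Q, of X] polyD(1)[OF R] polyD(1)[OF Q]
 define pp where "pp P = restrict (act P (pX X)) (car (fst P))" for P :: "'u rep"
 have ppa: "pp P r = act P (pX X) r" if "r:car (fst P)" for P r using that by (simp add: pp_def)
 have pl: "pp P:lin (fst P) (IV P X)" if P: "poly P" for P
  unfolding pp_def
 proof (rule linI[OF polyD(1)[OF P]], rule linear_onI)
  note a = linear_onD[OF act_in[OF P EndV_proj[of "ixa (tp X)"]]]
  show "act P (pX X) x:car (IV P X)" if x: "x:car (fst P)" for x
  proof -
   have "cmp V (pX X) (pX X) = pX X"
    by (rule lin_eqI[OF lin_compose[OF V_vs proj_in proj_in] proj_in]) (simp add: proj_proj)
   thus ?thesis
    using act_compose[OF P EndV_proj EndV_proj x, of "ixa (tp X)" "ixa (tp X)"] a(1)[OF x] by (simp add: IV_iff[OF P])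
  qed
 qed (simp_all add: linear_onD[OF act_in[OF P EndV_proj]])
 let ?g = "tensor_map (fst R) (IV R X) (fst Q) (IV Q X) (pp R) (pp Q)"
 have gl: "?g:lin (tensor (fst R) (fst Q)) (tensor (IV R X) (IV Q X))" by (rule tensor_map_in[OF v(3,1,4,2) pl[OF R] pl[OF Q]])
 have gp: "?g (pure (fst R) (fst Q) r q) = pure (IV R X) (IV Q X) (act R (pX X) r) (act Q (pX X) q)"
  if "r:car (fst R)" "q:car (fst Q)" for r q
  using tensor_map_pure[OF v(3,1,4,2) pl[OF R] pl[OF Q] that] that by (simp add: ppa)
 have ai: "act P (pX X) r:car (IV P X)" if "poly P" "r:car (fst P)" for P r
  using lin_closed[OF pl[OF that(1)] that(2)] ppa[OF that(2)] by simp
 have gm: "?g (muI R Q X t) = t" if t: "t:car (tensor (IV R X) (IV Q X))" for t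
  by (rule tensor_eq[OF v(1,2) tensor_vspace[OF v(1,2)] lin_comp[OF linD[OF muI_lin0[OF R Q]] linD[OF gl]] linear_on_ident _ t])
   (simp add: muI_pure[OF R Q] gp IV_iff[OF R] IV_iff[OF Q])
 have mg: "muI R Q X (?g t) = t" if t: "t:car (IV (rtensor R Q) X)" for t
 proof -
  have tc: "t:car (tensor (fst R) (fst Q))" "act (rtensor R Q) (pX X) t = t" using t by (simp_all add: IV_iff[OF T])
  have "muI R Q X (?g t) = act (rtensor R Q) (pX X) t"
   by (rule tensor_eq[OF v(3,4) tensor_vspace[OF v(3,4)] lin_comp[OF linD[OF gl] linD[OF muI_lin0[OF R Q]]] _ _ tc(1)])
    (use act_in[OF T EndV_proj] in "simp_all add: gp muI_pure[OF R Q] ai R Q act_tensor[OF R Q EndV_proj]")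
  thus ?thesis using tc(2) by simp
 qed
 have gI: "restrict ?g (car (IV (rtensor R Q) X)):lin (IV (rtensor R Q) X) (tensor (IV R X) (IV Q X))"
  using lin_restrict_sub[OF polyD(1)[OF T] IV_sub[OF T, of X], of ?g, unfolded fst_conv, OF gl]
  by (simp only: IV_eq[of "rtensor R Q" X, unfolded fst_conv, symmetric])
 show ?thesis
  by (rule lin_bijI[OF muI_in[OF R Q] gI]) (use gm mg lin_closed[OF muI_in[OF R Q]] in simp_all)
qed

definition muS :: "'u rep => 'u rep => 'u flag => 'u => 'u" where
 "muS R Q = (\<lambda>X\<in>Fl n. muI R Q X)"

definition iotaS :: "'u flag => 'u => 'u" where
 "iotaS = (\<lambda>X\<in>Fl n. lin_id unit_sp)"

lemma muS_pure:
 assumes "poly R" "poly Q" "X:Fl n" "r:car (IV R X)" "q:car (IV Q X)"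
 shows "muS R Q X (pure (IV R X) (IV Q X) r q) = pure (fst R) (fst Q) r q"
 using muI_pure[OF assms(1,2,4,5)] assms(3) by (simp add: muS_def)

lemma muS_hom:
 assumes R: "poly R" and Q: "poly Q"
 shows "muS R Q:NT n (ften (pso R) (pso Q)) (pso (rtensor R Q))"
proof (rule nat_transI)
 note T = poly_tensor[OF R Q]
 show "muS R Q:extensional (Fl n)" by (simp add: muS_def)
 show "muS R Q X:lin (FOb (ften (pso R) (pso Q)) X) (FOb (pso (rtensor R Q)) X)" if "X:Fl n" for X
  using muI_in[OF R Q] that by (simp add: muS_def)
 fix X Y f t assume X: "X:Fl n" and Y: "Y:Fl n" and f: "f:FL n X Y" and t: "t:car (FOb (ften (pso R) (pso Q)) X)"
 note m = polyfunD(3)[OF Psi_poly[OF R] X Y f, unfolded Psi_simps] polyfunD(3)[OF Psi_poly[OF Q] X Y f, unfolded Psi_simps]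
  polyfunD(3)[OF Psi_poly[OF T] X Y f, unfolded Psi_simps]
 note v = IV_vs[OF R] IV_vs[OF Q]
 let ?F = "tensor_map (IV R X) (IV R Y) (IV Q X) (IV Q Y) (FMap (pso R) X Y f) (FMap (pso Q) X Y f)"
 have "muI R Q Y (?F t) = FMap (pso (rtensor R Q)) X Y f (muI R Q X t)"
 proof (rule tensor_eq[OF v(1)[of X] v(2)[of X] IV_vs[OF T, of Y] lin_comp[OF linD[OF tensor_map_in[OF v(1) v(1) v(2) v(2) m(1,2)]] linD[OF muI_in[OF R Q]]]
    lin_comp[OF linD[OF muI_in[OF R Q]] linD[OF m(3)]]])
  fix r q assume r: "r:car (IV R X)" and q: "q:car (IV Q X)"
  have c: "act R (via X Y f) r:car (IV R Y)" "act Q (via X Y f) q:car (IV Q Y)"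
   using act_via_IV[OF R X Y f IV_in[OF R r]] act_via_IV[OF Q X Y f IV_in[OF Q q]] .
  have p: "?F (pure (IV R X) (IV Q X) r q) = pure (IV R Y) (IV Q Y) (act R (via X Y f) r) (act Q (via X Y f) q)"
   using tensor_map_pure[OF v(1) v(1) v(2) v(2) m(1,2) r q] Psi_FMap_apply[OF R X Y f r] Psi_FMap_apply[OF Q X Y f q] by simp
  show "muI R Q Y (?F (pure (IV R X) (IV Q X) r q)) = FMap (pso (rtensor R Q)) X Y f (muI R Q X (pure (IV R X) (IV Q X) r q))"
   unfolding p muI_pure[OF R Q r q] muI_pure[OF R Q c] Psi_FMap_apply[OF T X Y f pure_IV[OF R Q r q]]
   by (rule act_tensor[OF R Q via_flag[OF X Y f] IV_in[OF R r] IV_in[OF Q q], symmetric])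
 qed (use t in simp)
 thus "muS R Q Y (FMap (ften (pso R) (pso Q)) X Y f t) = FMap (pso (rtensor R Q)) X Y f (muS R Q X t)"
  using X Y by (simp add: muS_def)
qed

lemma IV_unit: "car (IV runit X) = car unit_sp"
 using IV_iff[OF poly_unit, of _ X] act_unit[OF EndV_proj] by auto

lemma iotaS_hom: "iotaS:NT n funit (pso runit)"
proof (rule nat_transI)
 show "iotaS:extensional (Fl n)" by (simp add: iotaS_def)
 show "iotaS X:lin (FOb funit X) (FOb (pso runit) X)" if "X:Fl n" for X
  using that lin_corestrict[OF lin_id_in[OF unit_vspace], of "car (IV runit X)"] IV_eq[of runit X]
  by (simp add: iotaS_def IV_unit)
 show "iotaS Y (FMap funit X Y f x) = FMap (pso runit) X Y f (iotaS X x)"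
  if X: "X:Fl n" and Y: "Y:Fl n" and f: "f:FL n X Y" and x: "x:car (FOb funit X)" for X Y f x
  using X Y x Psi_FMap_apply[OF poly_unit X Y f, of x] act_unit[OF via_flag[OF X Y f], of x] by (simp add: iotaS_def IV_unit)
qed

lemma muS_iso:
 assumes p: "poly R" "poly Q"
 shows "is_iso (CatA n) (ften (pso R) (pso Q)) (pso (rtensor R Q)) (muS R Q)"
proof (rule fibred_tensor.u_iso[OF fibred_CatA]; (simp only: CatA_simps mem_Collect_eq)?)
 show "pf (ften (pso R) (pso Q))" by (rule CatA_Tob[OF Psi_poly[OF p(1)] Psi_poly[OF p(2)]])
 show "pf (pso (rtensor R Q))" by (rule Psi_poly[OF poly_tensor[OF p]])
 show "muS R Q:NT n (ften (pso R) (pso Q)) (pso (rtensor R Q))" by (rule muS_hom[OF p])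
 show "bij_betw (muS R Q X) (car (FOb (ften (pso R) (pso Q)) X)) (car (FOb (pso (rtensor R Q)) X))" if "X:Fl n" for X
  using muI_bij[OF p, of X] that by (simp add: muS_def)
qed

lemma iotaS_iso: "is_iso (CatA n) funit (pso runit) iotaS"
proof (rule fibred_tensor.u_iso[OF fibred_CatA]; (simp only: CatA_simps mem_Collect_eq)?)
 show "pf funit" by (rule CatA_Unt)
 show "pf (pso runit)" by (rule Psi_poly[OF poly_unit])
 show "iotaS:NT n funit (pso runit)" by (rule iotaS_hom)
 show "bij_betw (iotaS X) (car (FOb funit X)) (car (FOb (pso runit) X))" if "X:Fl n" for X
  using that by (simp add: iotaS_def IV_unit) (auto simp: bij_betw_def inj_on_def)
qed

lemma Psi_map_linear:
 assumes R: "poly R" and Q: "poly Q"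
 shows "linear_on ((lin_space (fst R) (fst Q))<|eqv R Q|>) (nat_trans_space n (pso R) (pso Q))
  (%ze. \<lambda>X\<in>Fl n. restrict ze (car (IV R X)))"
proof (rule linear_onI)
 fix et ze c
 show "(\<lambda>X\<in>Fl n. restrict ze (car (IV R X))):car (nat_trans_space n (pso R) (pso Q))"
  if "ze:car ((lin_space (fst R) (fst Q))<|eqv R Q|>)"
  using Psi_nat_trans[OF R Q, of ze] that by simp
 show "(\<lambda>X\<in>Fl n. restrict (et +[(lin_space (fst R) (fst Q))<|eqv R Q|>] ze) (car (IV R X)))
  = (\<lambda>X\<in>Fl n. restrict et (car (IV R X))) +[nat_trans_space n (pso R) (pso Q)] (\<lambda>X\<in>Fl n. restrict ze (car (IV R X)))"
  unfolding nat_trans_space_simps by (rule restrict_ext) (auto simp: IV_in[OF R] intro!: restrict_ext)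
 show "(\<lambda>X\<in>Fl n. restrict (c *[(lin_space (fst R) (fst Q))<|eqv R Q|>] ze) (car (IV R X)))
  = c *[nat_trans_space n (pso R) (pso Q)] (\<lambda>X\<in>Fl n. restrict ze (car (IV R X)))"
  unfolding nat_trans_space_simps by (rule restrict_ext) (auto simp: IV_in[OF R] intro!: restrict_ext)
qed

lemma tensor_functor_Psi: "tensor_functor RG (CatA n) PS muS iotaS"
proof ((rule fibred_tensor.tensor_functorI[OF fibred_CatA tensor_category_RepG functor_Psi];
  (simp only: CatA_simps(1,2,5-7) RepG_simps Psi_simps mem_Collect_eq)?), goal_cases)
 have Pm: "ze m:car (IV Q X)"
  if "X:Fl n" "poly R" "poly Q" "ze:eqv R Q" "m:car (IV R X)" for R Q ze m X
  using lin_closed[OF nat_transD(2)[OF Psi_nat_trans[OF that(2-4)] that(1)], of m] that(1,5) by simp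
 have uv: "unit_vec:car (IV runit X)" for X by (simp add: IV_unit)
 have iu: "iotaS X unit_vec = unit_vec" if "X:Fl n" for X using that by (simp add: iotaS_def)
 {
  case (1 R Q)
  have "FMap PS R Q = (%ze. \<lambda>X\<in>Fl n. restrict ze (car (IV R X)))" by (rule ext) (rule Psi_simps)
  thus ?case using Psi_map_linear[OF 1] by (simp only:)
 next
  case (2 R Q)
  thus ?case using muS_iso[of R Q] by simp
 next
  case 3
  show ?case by (rule iotaS_iso)
 next
  case (4 X R R' Q Q' f g r q)
  note X = 4(1) and p = 4(2-5) and f = 4(6) and g = 4(7) and r = 4(8) and q = 4(9)
  show ?case
  using X r q muS_pure[OF p(1,3) X r q] muS_pure[OF p(2,4) X Pm[OF X p(1,2) f r] Pm[OF X p(3,4) g q]] pure_IV[OF p(1,3) r q]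
   tensor_map_pure[OF polyD(1)[OF p(1)] polyD(1)[OF p(2)] polyD(1)[OF p(3)] polyD(1)[OF p(4)] equivariantD(1)[OF f] equivariantD(1)[OF g] IV_in[OF p(1) r] IV_in[OF p(3) q]]
  by simp
 next
  case (5 X R Q P r q p)
  note X = 5(1) and h = 5(2-4) and r = 5(5) and q = 5(6) and p = 5(7)
  note T = poly_tensor[OF h(1,2)] poly_tensor[OF h(2,3)]
  note a = pure_IV[OF h(1,2) r q] pure_IV[OF h(2,3) q p]
  show ?case
   unfolding muS_pure[OF h(1,2) X r q] muS_pure[OF h(2,3) X q p] muS_pure[OF T(1) h(3) X a(1) p] muS_pure[OF h(1) T(2) X r a(2)]
   using X pure_IV[OF T(1) h(3) a(1) p] tensor_assoc_pure[OF polyD(1)[OF h(1)] polyD(1)[OF h(2)] polyD(1)[OF h(3)] IV_in[OF h(1) r] IV_in[OF h(2) q] IV_in[OF h(3) p]]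
   by simp
 next
  case (6 X R r)
  note X = 6(1) and h = 6(2) and r = 6(3)
  show ?case
  unfolding iu[OF X] muS_pure[OF poly_unit h X uv r]
  using X pure_IV[OF poly_unit h uv r] tensor_lunit_pure[OF polyD(1)[OF h] IV_in[OF h r]] by simp
 next
  case (7 X R r)
  note X = 7(1) and h = 7(2) and r = 7(3)
  show ?case
  unfolding iu[OF X] muS_pure[OF h poly_unit X r uv]
  using X pure_IV[OF h poly_unit r uv] tensor_runit_pure[OF polyD(1)[OF h] IV_in[OF h r]] by simp
 next
  case (8 X R Q r q)
  note X = 8(1) and h = 8(2,3) and r = 8(4) and q = 8(5)
  show ?case
  unfolding muS_pure[OF h X r q] muS_pure[OF h(2,1) X q r]
  using X pure_IV[OF h r q] tensor_swap_pure[OF polyD(1)[OF h(1)] polyD(1)[OF h(2)] IV_in[OF h(1) r] IV_in[OF h(2) q]] by simp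
 }
qed

end

section \<open>The equivalence\<close>

context fibred_tensor
begin

text \<open>As for functors, the conditions on a natural isomorphism are checked on elements and pure tensors.\<close>

lemma monoidal_nat_isoI:
 fixes A :: "('p, 'k) tensor_cat" and F H :: "('p, 'k, 'o, 'm) cfunctor"
 assumes A: "tensor_category A" and F: "cat_functor A C F" and H: "cat_functor A C H"
  and iso: "!!X. X:Ob A ==> is_iso C (FOb F X) (FOb H X) (et X)"
  and mF: "!!X Y. X:Ob A ==> Y:Ob A ==> mF X Y:Hom C (FOb F X \<star> FOb F Y) (FOb F (Tob A X Y))"
  and mH: "!!X Y. X:Ob A ==> Y:Ob A ==> mH X Y:Hom C (FOb H X \<star> FOb H Y) (FOb H (Tob A X Y))"
  and iF: "iF:Hom C \<^bold>I (FOb F (Unt A))" and iH: "iH:Hom C \<^bold>I (FOb H (Unt A))"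
  and nat: "!!i X Y f x. i:I ==> X:Ob A ==> Y:Ob A ==> f:Hom A X Y ==> x:car (U i (FOb F X)) ==>
   u i (et Y) (u i (FMap F X Y f) x) = u i (FMap H X Y f) (u i (et X) x)"
  and mon: "!!i X Y x y. i:I ==> X:Ob A ==> Y:Ob A ==> x:car (U i (FOb F X)) ==> y:car (U i (FOb F Y)) ==>
   u i (et (Tob A X Y)) (u i (mF X Y) (pure (U i (FOb F X)) (U i (FOb F Y)) x y))
   = u i (mH X Y) (pure (U i (FOb H X)) (U i (FOb H Y)) (u i (et X) x) (u i (et Y) y))"
  and un: "!!i. i:I ==> u i (et (Unt A)) (u i iF unit_vec) = u i iH unit_vec"
 shows "monoidal_nat_iso A C F mF iF H mH iH et"
 unfolding monoidal_nat_iso_def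
proof (intro conjI ballI iso, goal_cases)
 interpret A: tensor_category A by (rule A)
 interpret F: cat_functor A C F by (rule F)
 interpret H: cat_functor A C H by (rule H)
 note O = F.FOb_in H.FOb_in and M = F.FMap_in H.FMap_in and eh = is_iso_hom[OF iso]
 note ss = cl us O M eh mF mH A.Tob_in A.Unt_in u_in[OF _ O(1) O(2) eh]
 {
  case (2 X Y f)
  thus ?case by (intro hom_eqI[of "FOb F X" "FOb H Y"]) (simp_all add: ss nat)
 next
  case (3 X Y)
  thus ?case by (intro hom_eq2[of "FOb F X" "FOb F Y" "FOb H (Tob A X Y)"]) (simp_all add: ss mon)
 next
  case 4
  note l = cl_Cmp[OF cl_Unt O[OF A.Unt_in] iF eh[OF A.Unt_in]] and O2 = O(2)[OF A.Unt_in]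
  show ?case
  proof (rule hom_eqI[OF cl_Unt O2 l iH])
   fix i x assume i: "i:I" and x: "x:car (U i \<^bold>I)"
   show "u i (Cmp C \<^bold>I (FOb F (Unt A)) (FOb H (Unt A)) (et (Unt A)) iF) x = u i iH x"
    by (rule unit_eq[OF linD[OF u_in[OF i cl_Unt O2 l, unfolded U_Unt[OF i]]] linD[OF u_in[OF i cl_Unt O2 iH, unfolded U_Unt[OF i]]] _ x[unfolded U_Unt[OF i]]])
    (simp add: u_Cmp[OF i] U_Unt[OF i] un[OF i])
  qed
 }
qed

end

context flagged_space
begin

subsection \<open>The unit\<close>

definition eta :: "'u flagfun => 'u flag => 'u => 'u" where
 "eta F = (\<lambda>X\<in>Fl n. inF F X (emb X))"

lemma inF_emb_IV:
 assumes F: "pf F" and X: "X:Fl n" and x: "x:car (FOb F X)"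
 shows "inF F X (emb X) x:car (IV (phr F) X)"
proof -
 have c: "inF F X (emb X) x:car (PF F)" by (rule lin_closed[OF inF_in[OF F X emb_flag[OF X]] x])
 have "cmp (fst X) (pX X) (emb X) = emb X"
  by (rule lin_eqI[OF lin_compose[OF ObD(2)[OF X] emb_lin[OF X] proj_in] emb_lin[OF X]]) (simp add: emb_proj[OF X])
 hence "actF F (pX X) (inF F X (emb X) x) = inF F X (emb X) x"
  using actF_inF[OF F X emb_flag[OF X] EndV_proj x] by simp
 thus ?thesis using c act_Phi[OF F EndV_proj c] by (simp add: IV_iff[OF poly_Phi[OF F]])
qed

lemma inF_emb_lin:
 assumes F: "pf F" and X: "X:Fl n"
 shows "inF F X (emb X):lin (FOb F X) (IV (phr F) X)"
 using lin_corestrict[OF inF_in[OF F X emb_flag[OF X]] inF_emb_IV[OF F X]]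
 by (simp only: IV_eq[of "phr F" X, unfolded fst_conv, symmetric])

text \<open>The composites with \<open>outF F X (ret X)\<close> are induced by \<open>ret X \<circ> emb X =
 id\<close> and by \<open>emb X \<circ> ret X = \<pi>\<^sub>a\<close>, which is the identity on invariants.\<close>

lemma inF_emb_bij:
 assumes F: "pf F" and X: "X:Fl n"
 shows "bij_betw (inF F X (emb X)) (car (FOb F X)) (car (IV (phr F) X))"
proof (rule bij_betw_byWitness[where f' = "outF F X (ret X)"])
 note ef = emb_flag[OF X] and rf = ret_flag[OF X] and R = poly_Phi[OF F]
 have re: "cmp (fst X) (ret X) (emb X) = lin_id (fst X)"
  by (rule lin_eqI[OF lin_compose[OF ObD(2)[OF X] emb_lin[OF X] ret_lin[OF X]] lin_id_in[OF ObD(2)[OF X]]]) (simp add: ret_emb[OF X])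
 have er: "cmp V (emb X) (ret X) = pX X"
  by (rule lin_eqI[OF lin_compose[OF V_vs ret_lin[OF X] emb_lin[OF X]] proj_in]) (simp add: emb_ret[OF X])
 show "ALL x:car (FOb F X). outF F X (ret X) (inF F X (emb X) x) = x"
  using outF_inF[OF F X X ef rf] re polyfunD(4)[OF F X] by simp
 have z: "z:car (PF F) & actF F (pX X) z = z" if "z:car (IV (phr F) X)" for z
  using that act_Phi[OF F EndV_proj, of z "ixa (tp X)"] by (simp add: IV_iff[OF R])
 show "ALL z:car (IV (phr F) X). inF F X (emb X) (outF F X (ret X) z) = z"
  using inF_outF[OF F X ef rf] er z by simp
 show "inF F X (emb X) ` car (FOb F X) <= car (IV (phr F) X)" using inF_emb_IV[OF F X] by blast
 show "outF F X (ret X) ` car (IV (phr F) X) <= car (FOb F X)"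
  using lin_closed[OF outF_in[OF F X rf]] z by blast
qed

lemma eta_hom:
 assumes F: "pf F"
 shows "eta F:NT n F (pso (phr F))"
proof (rule nat_transI)
 note R = poly_Phi[OF F]
 show "eta F:extensional (Fl n)" by (simp add: eta_def)
 show "eta F X:lin (FOb F X) (FOb (pso (phr F)) X)" if "X:Fl n" for X
  using inF_emb_lin[OF F that] that by (simp add: eta_def)
 fix X Y f x assume X: "X:Fl n" and Y: "Y:Fl n" and f: "f:FL n X Y" and x: "x:car (FOb F X)"
 note v = via_flag[OF X Y f] and i = inF_emb_IV[OF F X x]
 have "cmp (fst X) (emb Y) f = cmp (fst X) (via X Y f) (emb X)"
  unfolding compose_def by (rule restrict_ext) (use lin_closed[OF emb_lin[OF X]] ret_emb[OF X] in "simp add: via_def")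
 hence "inF F Y (emb Y) (FMap F X Y f x) = actF F (via X Y f) (inF F X (emb X) x)"
  using inF_FMap[OF F X Y f emb_flag[OF Y] x] actF_inF[OF F X emb_flag[OF X] v x] by simp
 also have "... = FMap (pso (phr F)) X Y f (inF F X (emb X) x)"
  using Psi_FMap_apply[OF R X Y f i] act_Phi[OF F v] IV_in[OF R i] by simp
 finally show "eta F Y (FMap F X Y f x) = FMap (pso (phr F)) X Y f (eta F X x)" using X Y by (simp add: eta_def)
qed

lemma eta_iso:
 assumes F: "pf F"
 shows "is_iso (CatA n) F (pso (phr F)) (eta F)"
 by (rule fibred_tensor.u_iso[OF fibred_CatA])
  (use F Psi_poly[OF poly_Phi[OF F]] eta_hom[OF F] inF_emb_bij[OF F] in "simp_all add: eta_def")

text \<open>Both sides are computed at a stage that contains the image of \<open>emb X\<close>.\<close>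

lemma eta_tensor:
 assumes F: "pf F" and H: "pf H" and X: "X:Fl n" and x: "x:car (FOb F X)" and y: "y:car (FOb H X)"
 shows "muP F H (pure (PF F) (PF H) (inF F X (emb X) x) (inF H X (emb X) y)) = inF (ften F H) X (emb X) (pure (FOb F X) (FOb H X) x y)"
proof -
 obtain j where j: "emb X:FL n X (dg j)" using flag_dg_exists[OF X emb_flag[OF X]] ..
 note m = polyfunD(3)[OF F X dg_Ob j] polyfunD(3)[OF H X dg_Ob j]
 note v = polyfunD(1)[OF F X] polyfunD(1)[OF F dg_Ob] polyfunD(1)[OF H X] polyfunD(1)[OF H dg_Ob]
 show ?thesis
  unfolding inF_eq[OF F X j x] inF_eq[OF H X j y] muP_pure[OF F H lin_closed[OF m(1) x] lin_closed[OF m(2) y]]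
  using inF_eq[OF CatA_Tob[OF F H] X j, of "pure (FOb F X) (FOb H X) x y"] pure_in[OF v(1,3) x y] tensor_map_pure[OF v m x y] by simp
qed

lemma comp_functor_eta: "cat_functor (CatA n) (CatA n) (comp_functor PS PH)"
 and comp_functor_eps: "cat_functor RG RG (comp_functor PH PS)"
proof -
 have c: "cat_functor A B (comp_functor K J)" if "cat_functor A D J" "cat_functor D B K"
  for A :: "('a, 'b, 'c) category_scheme" and D :: "('d, 'e, 'f) category_scheme" and B :: "('g, 'h, 'i) category_scheme" and J K
 proof -
  interpret J: cat_functor A D J by (rule that(1))
  interpret K: cat_functor D B K by (rule that(2))
  show ?thesis
   by unfold_locales (simp_all add: comp_functor_def J.FOb_in K.FOb_in J.FMap_in K.FMap_in J.FMap_Idn K.FMap_Idn J.FMap_Cmp K.FMap_Cmp)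
 qed
 show "cat_functor (CatA n) (CatA n) (comp_functor PS PH)" by (rule c[OF functor_Phi functor_Psi])
 show "cat_functor RG RG (comp_functor PH PS)" by (rule c[OF functor_Psi functor_Phi])
qed

lemma id_functor: "category C ==> cat_functor C C id_functor"
proof -
 assume "category C"
 then interpret category C .
 show ?thesis by unfold_locales (simp_all add: id_functor_def)
qed

lemma monoidal_eta: "monoidal_nat_iso (CatA n) (CatA n)
  id_functor (%X Y. Idn (CatA n) (X \<star>\<^bsub>CatA n\<^esub> Y)) (Idn (CatA n) \<^bold>I\<^bsub>CatA n\<^esub>)
  (comp_functor PS PH) (comp_mu (CatA n) (CatA n) PS muS RG PH muP)
  (comp_iota (CatA n) (CatA n) PS iotaS RG PH iotaP) eta"
proof (rule fibred_tensor.monoidal_nat_isoI[OF fibred_CatA tensor_category_CatA id_functor[OF fibred_tensor.is_category[OF fibred_CatA]] comp_functor_eta], goal_cases)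
 have fs: "FOb (comp_functor PS PH) F = pso (phr F)"
  "FMap (comp_functor PS PH) F H f = (\<lambda>X\<in>Fl n. restrict (Pm F H f) (car (IV (phr F) X)))" for F H f
  by (simp_all add: comp_functor_def)
 have ids: "FOb id_functor F = F" "FMap id_functor F H f = f" for F H :: "'u flagfun" and f :: "'u flag => 'u => 'u"
  by (simp_all add: id_functor_def)
 have ms: "comp_mu (CatA n) (CatA n) PS muS RG PH muP F H =
   Cmp (CatA n) (ften (pso (phr F)) (pso (phr H))) (pso (rtensor (phr F) (phr H))) (pso (phr (ften F H)))
    (\<lambda>X\<in>Fl n. restrict (muP F H) (car (IV (rtensor (phr F) (phr H)) X))) (muS (phr F) (phr H))" for F H
  unfolding comp_mu_def Phi_simps Psi_simps(1,3) RepG_simps(7) CatA_simps(7) ..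
 have us: "comp_iota (CatA n) (CatA n) PS iotaS RG PH iotaP =
   Cmp (CatA n) funit (pso runit) (pso (phr funit)) (\<lambda>X\<in>Fl n. restrict iotaP (car (IV runit X))) iotaS"
  unfolding comp_iota_def Phi_simps Psi_simps(1,3) RepG_simps(6) CatA_simps(6) ..
 note cC = fibred_tensor.cl_Cmp[OF fibred_CatA[of n], unfolded CatA_simps(1,2) mem_Collect_eq]
 {
  case (1 F)
  thus ?case using eta_iso[of F] unfolding fs ids by simp
 next
  case (2 F H)
  thus ?case unfolding ids by (intro fibred_tensor.cl_Idn[OF fibred_CatA] fibred_tensor.cl_Tob[OF fibred_CatA])
 next
  case (3 F H)
  note h = this
  have F: "pf F" and H: "pf H" using h by simp_all
  note R = poly_Phi[OF F] poly_Phi[OF H]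
  note T = poly_tensor[OF R] poly_Phi[OF CatA_Tob[OF F H]]
  show ?case unfolding fs ms CatA_simps(2,7)
   by (rule cC[OF CatA_Tob[OF Psi_poly[OF R(1)] Psi_poly[OF R(2)]] Psi_poly[OF T(1)] Psi_poly[OF T(2)] muS_hom[OF R] Psi_nat_trans[OF T muP_hom[OF F H]]])
 next
  case 4
  show ?case unfolding ids by (rule fibred_tensor.cl_Idn[OF fibred_CatA fibred_tensor.cl_Unt[OF fibred_CatA]])
 next
  case 5
  show ?case
  unfolding fs us CatA_simps(2,6)
  by (rule cC[OF CatA_Unt Psi_poly[OF poly_unit] Psi_poly[OF poly_Phi[OF CatA_Unt]] iotaS_hom Psi_nat_trans[OF poly_unit poly_Phi[OF CatA_Unt] iotaP_hom]])
 next
  case (6 X F H f x)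
  note X = 6(1) and that = 6(2-)
  have F: "pf F" and H: "pf H" and f: "f:NT n F H" and x: "x:car (FOb F X)" using that by (simp_all add: ids)
  show ?case unfolding fs ids
   using X Phi_map_inF[OF F H f X emb_flag[OF X] x] inF_emb_IV[OF F X x] by (simp add: eta_def)
 next
  case (7 X F H x y)
  note X = 7(1) and that = 7(2-)
  have F: "pf F" and H: "pf H" and x: "x:car (FOb F X)" and y: "y:car (FOb H X)" using that by (simp_all add: ids)
  note R = poly_Phi[OF F] poly_Phi[OF H]
  note i = inF_emb_IV[OF F X x] inF_emb_IV[OF H X y]
  have p: "pure (FOb F X) (FOb H X) x y:car (tensor (FOb F X) (FOb H X))" by (rule pure_in[OF polyfunD(1)[OF F X] polyfunD(1)[OF H X] x y])
  show ?case unfolding fs ids ms CatA_simps(3,4,7)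
   using X p eta_tensor[OF F H X x y] muS_pure[OF R X i] pure_IV[OF R i] pure_in[OF IV_vs[OF R(1)] IV_vs[OF R(2)] i] by (simp add: eta_def)
 next
  case (8 X)
  note X = this
  obtain j where j: "emb X:FL n X (dg j)" using flag_dg_exists[OF X emb_flag[OF X]] ..
  have "inF funit X (emb X) unit_vec = iotaP unit_vec"
   using inF_eq[OF CatA_Unt X j, of unit_vec] lF_unit[OF unit_vec_in, of j] by simp
  thus ?case unfolding us CatA_simps(3,4,6) using X by (simp add: eta_def iotaS_def IV_unit)
 }
qed

end

context flagged_space
begin

subsection \<open>The counit\<close>

lemma tp_dg: "tp (dg j) = cst j"
 unfolding dg_std by (rule flag_type_std[OF cst_PiE])

lemma emb_dg: "emb (dg j) = lin_id (fst (dg j))"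
 unfolding dg_std by (rule emb_of_std[OF cst_PiE])

lemma ret_dg: "v:car V ==> ret (dg j) v = pj j v"
 unfolding dg_std ixd_def by (rule ret_of_std[OF cst_PiE])

lemma IV_dg_iff: "poly R ==> m:car (IV R (dg j)) \<longleftrightarrow> m:car (fst R) & act R (pj j) m = m"
 unfolding ixd_def by (subst IV_iff) (simp_all only: tp_dg)

lemma eps_ex1:
 assumes R: "poly R"
 shows "EX! h. h:lin (PF (pso R)) (fst R) & (ALL j. ALL x:car (FOb (pso R) (dg j)). h (lF (pso R) j x) = lin_id (IV R (dg j)) x)"
proof (rule Phi_lift[OF Psi_poly[OF R] polyD(1)[OF R]])
 show "lin_id (IV R (dg j)):lin (FOb (pso R) (dg j)) (fst R)" for j using IV_incl[OF R] by simp
 fix j x assume "x:car (FOb (pso R) (dg j))"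
 hence x: "x:car (IV R (dg j))" by simp
 have i: "lin_id (fst (dg j)):FL n (dg j) (dg (Suc j))" by (rule incl_flag) simp
 have s: "pj j v:sub (ixd (Suc j))" if "v:car V" for v
  using proj_sub[OF that] sub_mono[OF ixd_mono[of j "Suc j"]] by auto
 have "act R (via (dg j) (dg (Suc j)) (lin_id (fst (dg j)))) = act R (pj j)"
 proof (rule act_cong[OF R via_flag[OF dg_Ob dg_Ob i] EndV_proj])
  show "via (dg j) (dg (Suc j)) (lin_id (fst (dg j))) v = pj j v" if v: "v:car V" for v
   using v s[OF v] proj_sub[OF v, of "ixd j"] by (simp add: via_def emb_dg ret_dg)
 qed
 hence "FMap (pso R) (dg j) (dg (Suc j)) (lin_id (fst (dg j))) x = x"
  using Psi_FMap_apply[OF R dg_Ob dg_Ob i x] x by (simp add: IV_dg_iff[OF R])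
 moreover have "x:car (IV R (dg (Suc j)))"
  using lin_closed[OF polyfunD(3)[OF Psi_poly[OF R] dg_Ob dg_Ob i], of x] x calculation by simp
 ultimately show "lin_id (IV R (dg (Suc j))) (FMap (pso R) (dg j) (dg (Suc j)) (lin_id (fst (dg j))) x) = lin_id (IV R (dg j)) x"
  using x by simp
qed

definition eps :: "'u rep => 'u => 'u" where
 "eps R = (THE h. h:lin (PF (pso R)) (fst R) & (ALL j. ALL x:car (FOb (pso R) (dg j)). h (lF (pso R) j x) = lin_id (IV R (dg j)) x))"

lemma eps_in: "poly R ==> eps R:lin (PF (pso R)) (fst R)"
 and eps_l: "poly R ==> m:car (IV R (dg j)) ==> eps R (lF (pso R) j m) = m"
 using theI'[OF eps_ex1] unfolding eps_def by auto

lemma eps_hom: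
 assumes R: "poly R"
 shows "eps R:eqv (phr (pso R)) R"
proof (rule equivariantI; simp only: fst_conv snd_conv)
 note F = Psi_poly[OF R]
 show "eps R:lin (PF (pso R)) (fst R)" by (rule eps_in[OF R])
 fix g z assume g: "g:car G" and z: "z:car (PF (pso R))"
 note g' = GG_EndV[OF g]
 obtain j0 where j0: "!!j. j >= j0 ==> g:GG_sub n V e (cst j)" using GG_sub_exists[OF g] by blast
 have "eps R (actF (pso R) g z) = snd R g (eps R z)"
 proof (rule PF_eqI[OF F z, of j0 "%z. eps R (actF (pso R) g z)" "%z. snd R g (eps R z)"])
  fix j m assume m': "m:car (FOb (pso R) (dg j))" and j: "j0 <= j"
  hence m: "m:car (IV R (dg j))" by simp
  have mm: "m:car (fst R)" "act R (pj j) m = m" using m by (simp_all add: IV_dg_iff[OF R])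
  define r where "r = restrict g (sub (ixd j))"
  have r: "r:FL n (dg j) (dg j)" unfolding r_def by (rule adm_restrict_dg[OF GG_sub_adm[OF j0[OF j]]])
  have rc: "r v:sub (ixd j)" if "v:sub (ixd j)" for v using lin_closed[OF flag_linD(1)[OF r], of v] that by simp
  have "act R (via (dg j) (dg j) r) = act R (cmp V g (pj j))"
  proof (rule act_cong[OF R via_flag[OF dg_Ob dg_Ob r] EndV_compose[OF EndV_proj g']])
   show "via (dg j) (dg j) r v = cmp V g (pj j) v" if v: "v:car V" for v
    using v rc[OF proj_sub[OF v]] proj_sub[OF v, of "ixd j"] by (simp add: via_def emb_dg ret_dg r_def)
  qed
  hence a: "act R (via (dg j) (dg j) r) m = snd R g m"
   using act_compose[OF R EndV_proj g' mm(1), of "ixd j"] mm(2) act_G[OF R g mm(1)] by simp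
  have c: "snd R g m:car (IV R (dg j))" using act_via_IV[OF R dg_Ob dg_Ob r mm(1)] by (simp only: a)
  have "actF (pso R) g (lF (pso R) j m) = lF (pso R) j (snd R g m)"
   using actF_l_sub[OF F j0[OF j] m'] Psi_FMap_apply[OF R dg_Ob dg_Ob r m] a by (simp add: r_def)
  thus "eps R (actF (pso R) g (lF (pso R) j m)) = snd R g (eps R (lF (pso R) j m))"
   using eps_l[OF R m] eps_l[OF R c] by simp
 qed
 thus "eps R (Pa (pso R) g z) = snd R g (eps R z)" using Phi_act_eq[OF F g] by simp
qed

text \<open>Injective because the stages consist of vectors of \<open>R\<close> and the transition maps are
 inclusions; surjective because every vector is fixed by some \<open>pj N\<close>.\<close>

lemma eps_bij:
 assumes R: "poly R"
 shows "bij_betw (eps R) (car (PF (pso R))) (car (fst R))"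
 unfolding bij_betw_def
proof
 note F = Psi_poly[OF R]
 show "inj_on (eps R) (car (PF (pso R)))"
 proof (rule inj_onI)
  fix z z' assume z: "z:car (PF (pso R))" "z':car (PF (pso R))" and eq: "eps R z = eps R z'"
  obtain j m m' where m: "m:car (FOb (pso R) (dg j))" "z = lF (pso R) j m" "m':car (FOb (pso R) (dg j))" "z' = lF (pso R) j m'"
   by (rule common_stage2[OF F F z])
  hence "m = m'" using eq eps_l[OF R, of m j] eps_l[OF R, of m' j] by simp
  thus "z = z'" using m by simp
 qed
 show "eps R ` car (PF (pso R)) = car (fst R)"
 proof (intro equalityI image_subsetI subsetI)
  show "eps R z:car (fst R)" if "z:car (PF (pso R))" for z by (rule lin_closed[OF eps_in[OF R] that])
  fix m assume m: "m:car (fst R)"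
  obtain N where "act R (pj N) m = m" using act_finite_support[OF R m] by blast
  hence mN: "m:car (IV R (dg N))" using m by (simp add: IV_dg_iff[OF R])
  show "m:eps R ` car (PF (pso R))"
   by (rule image_eqI[where x = "lF (pso R) N m"]) (use eps_l[OF R mN] lF_closed[OF F, of m N] mN in simp_all)
 qed
qed

lemma eps_iso: "poly R ==> is_iso RG (phr (pso R)) R (eps R)"
 by (rule fibred_tensor.u_iso[OF fibred_RepG]) (simp_all add: poly_Phi Psi_poly eps_hom eps_bij)

lemma monoidal_eps: "monoidal_nat_iso RG RG
  (comp_functor PH PS) (comp_mu RG RG PH muP (CatA n) PS muS)
  (comp_iota RG RG PH iotaP (CatA n) PS iotaS)
  id_functor (%X Y. Idn RG (X \<star>\<^bsub>RG\<^esub> Y)) (Idn RG \<^bold>I\<^bsub>RG\<^esub>) eps"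
proof (rule fibred_tensor.monoidal_nat_isoI[OF fibred_RepG tensor_category_RepG comp_functor_eps id_functor[OF fibred_tensor.is_category[OF fibred_RepG]]], goal_cases)
 have fs: "FOb (comp_functor PH PS) R = phr (pso R)"
  "FMap (comp_functor PH PS) R Q f = Pm (pso R) (pso Q) (\<lambda>X\<in>Fl n. restrict f (car (IV R X)))" for R Q f
  by (simp_all add: comp_functor_def)
 have ids: "FOb id_functor R = R" "FMap id_functor R Q f = f" for R Q :: "'u rep" and f :: "'u => 'u"
  by (simp_all add: id_functor_def)
 have ms: "comp_mu RG RG PH muP (CatA n) PS muS R Q =
   cmp (tensor (PF (pso R)) (PF (pso Q))) (Pm (ften (pso R) (pso Q)) (pso (rtensor R Q)) (muS R Q)) (muP (pso R) (pso Q))" for R Q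
  unfolding comp_mu_def Phi_simps Psi_simps(1) RepG_simps(4,7) CatA_simps(7) fst_conv ..
 have us: "comp_iota RG RG PH iotaP (CatA n) PS iotaS =
   cmp unit_sp (Pm funit (pso runit) iotaS) iotaP"
  unfolding comp_iota_def Phi_simps Psi_simps(1) RepG_simps(4,6) CatA_simps(6) fst_conv ..
 note cC = fibred_tensor.cl_Cmp[OF fibred_RepG, unfolded RepG_simps(1,2,4) mem_Collect_eq]
 {
  case (1 R)
  thus ?case using eps_iso[of R] unfolding fs ids by simp
 next
  case (3 R Q)
  thus ?case unfolding ids by (intro fibred_tensor.cl_Idn[OF fibred_RepG] fibred_tensor.cl_Tob[OF fibred_RepG])
 next
  case 5
  show ?case unfolding ids by (rule fibred_tensor.cl_Idn[OF fibred_RepG fibred_tensor.cl_Unt[OF fibred_RepG]])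
 next
  case (2 R Q)
  note h = this
  have R: "poly R" and Q: "poly Q" using h by simp_all
  note F = Psi_poly[OF R] Psi_poly[OF Q]
  note T = CatA_Tob[OF F] Psi_poly[OF poly_tensor[OF R Q]]
  show ?case unfolding fs ms RepG_simps(2,7)
   using cC[OF poly_tensor[OF poly_Phi[OF F(1)] poly_Phi[OF F(2)]] poly_Phi[OF T(1)] poly_Phi[OF T(2)] muP_hom[OF F] Phi_map_equivariant[OF T muS_hom[OF R Q]]]
   by (simp only: fst_conv)
 next
  case 4
  show ?case
  unfolding fs us RepG_simps(2,6)
  by (rule cC[OF poly_unit poly_Phi[OF CatA_Unt] poly_Phi[OF Psi_poly[OF poly_unit]] iotaP_hom Phi_map_equivariant[OF CatA_Unt Psi_poly[OF poly_unit] iotaS_hom], unfolded fst_conv])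
 next
  case (6 i R Q f x)
  note that = 6(2-)
  have R: "poly R" and Q: "poly Q" and f: "f:eqv R Q" and x: "x:car (PF (pso R))" using that by (simp_all add: fs)
  obtain j m where m: "m:car (FOb (pso R) (dg j))" "x = lF (pso R) j m" by (rule PF_elem[OF Psi_poly[OF R] x, of 0])
  note N = Psi_nat_trans[OF R Q f]
  have mi: "m:car (IV R (dg j))" using m(1) by simp
  have fm: "f m:car (IV Q (dg j))" using lin_closed[OF nat_transD(2)[OF N dg_Ob] m(1)] mi by simp
  show ?case unfolding fs ids m(2) Phi_map_l[OF Psi_poly[OF R] Psi_poly[OF Q] N m(1)]
   using mi eps_l[OF R mi] eps_l[OF Q fm] by simp
 next
  case (7 i R Q x y)
  note that = 7(2-)
  have R: "poly R" and Q: "poly Q" and x: "x:car (PF (pso R))" and y: "y:car (PF (pso Q))" using that by (simp_all add: fs)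
  note F = Psi_poly[OF R] Psi_poly[OF Q] and T = poly_tensor[OF R Q]
  obtain j r q where r: "r:car (FOb (pso R) (dg j))" "x = lF (pso R) j r" and q: "q:car (FOb (pso Q) (dg j))" "y = lF (pso Q) j q"
   by (rule common_stage2[OF F x y])
  have ri: "r:car (IV R (dg j))" and qi: "q:car (IV Q (dg j))" using r q by simp_all
  note pc = pure_in[OF PF_vs[OF F(1)] PF_vs[OF F(2)] x y]
  have p: "pure (FOb (pso R) (dg j)) (FOb (pso Q) (dg j)) r q:car (FOb (ften (pso R) (pso Q)) (dg j))"
   using pure_in[OF IV_vs[OF R] IV_vs[OF Q] ri qi] by simp
  have "comp_mu RG RG PH muP (CatA n) PS muS R Q (pure (PF (pso R)) (PF (pso Q)) x y)
   = lF (pso (rtensor R Q)) j (muS R Q (dg j) (pure (FOb (pso R) (dg j)) (FOb (pso Q) (dg j)) r q))"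
   unfolding ms compose_apply[OF pc] unfolding r(2) q(2) muP_pure[OF F r(1) q(1)]
   by (rule Phi_map_l[OF CatA_Tob[OF F] Psi_poly[OF T] muS_hom[OF R Q] p])
  also have "muS R Q (dg j) (pure (FOb (pso R) (dg j)) (FOb (pso Q) (dg j)) r q) = pure (fst R) (fst Q) r q"
   using muS_pure[OF R Q dg_Ob ri qi] by simp
  finally show ?case unfolding fs ids fst_conv RepG_simps(3,7)
   using eps_l[OF T pure_IV[OF R Q ri qi]] eps_l[OF R ri] eps_l[OF Q qi] r(2) q(2)
    pure_in[OF polyD(1)[OF R] polyD(1)[OF Q] IV_in[OF R ri] IV_in[OF Q qi]] by simp
 next
  case (8 i)
  have uv: "unit_vec:car (FOb funit (dg 0))" "unit_vec:car (IV runit (dg 0))" by (simp_all add: IV_unit)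
  show ?case unfolding us RepG_simps(3,6)
   using Phi_map_l[OF CatA_Unt Psi_poly[OF poly_unit] iotaS_hom uv(1)] eps_l[OF poly_unit uv(2)] by (simp add: iotaS_def)
 }
qed

lemma tensor_equivalence_Phi_Psi: "tensor_equivalence (CatA n) RG PH PS"
 unfolding tensor_equivalence_def
 using tensor_category_CatA tensor_category_RepG tensor_functor_Phi tensor_functor_Psi monoidal_eta monoidal_eps by blast

end

theorem proposition4p6:
  fixes n :: nat and V :: "(complex, 'u) module" and e :: "nat \<Rightarrow> nat \<Rightarrow> 'u"
  assumes "n \<ge> 1" and "flag_basis n V e"
  shows "tensor_equivalence (CatA n) (RepG n V e) (Phi n V e) (Psi n V e)"
  by (rule flagged_space.tensor_equivalence_Phi_Psi[OF flagged_space.intro[OF assms]])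

end
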